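(* Let $p$ be a prime with $p\ge 5$ and $k$ an odd positive integer. For $F\in M_k(\Gamma_2)_{\mathbb{Z}_{(p)}}$, assume that $$m_p(F)\succ\left(\left[\tfrac{k-35}{10}\right]+2,\ \left[\tfrac{k-35}{10}\right]+3,\ r_0-1\right),$$ where $r_0\in\mathbb{Z}$ is the maximum number such that $\left(\left[\frac{k-35}{10}\right],\left[\frac{k-35}{10}\right],r_0\right)\in L_2$. Then $m_p(F)=(\infty)$, namely $F\equiv 0\pmod p$.
   Context: $\Gamma_2=Sp_2(\mathbb{Z})$ is the Siegel modular group of degree $2$ (consisting of $4\times 4$ integral symplectic matrices), acting on the Siegel upper half-space $\mathbb{H}_2$ of degree $2$. $M_k(\Gamma_2)$ is the $\mathbb{C}$-vector space of Siegel modular forms of weight $k$ for $\Gamma_2$. $[x]$ denotes the greatest integer not exceeding $x$. Let $\Lambda_2=\{T=(t_{ij})\in Sym_2(\mathbb{Q}) : t_{ii}\in\mathbb{Z},\ 2t_{ij}\in\mathbb{Z}\}$ and $L_2=\{T\in\Lambda_2 : T \text{ is positive semi-definite}\}$. Write $T=(m,n,r)$ for $T=\begin{pmatrix} m & r/2\\ r/2 & n\end{pmatrix}$. Every $F\in M_k(\Gamma_2)$ has a Fourier expansion $F(Z)=\sum_{T\in L_2}a(T;F)q^T$, where $q^T=e^{2\pi i\,\mathrm{tr}(TZ)}$ and $Z\in\mathbb{H}_2$. For a subring $R\subset\mathbb{C}$, $M_k(\Gamma_2)_R$ is the set of $F\in M_k(\Gamma_2)$ all of whose Fourier coefficients lie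 in $R$. $\mathbb{Z}_{(p)}$ is the ring of $p$-integral rational numbers. $F\equiv 0\pmod p$ means that all Fourier coefficients of $F$ lie in $p\mathbb{Z}_{(p)}$. Order: for distinct $T=(m,n,r)$ and $T'=(m',n',r')$ in $\Lambda_2$, $T\succ T'$ means that (1) $\mathrm{tr}(T)>\mathrm{tr}(T')$; or (2) $\mathrm{tr}(T)=\mathrm{tr}(T')$ and $m>m'$; or (3) $\mathrm{tr}(T)=\mathrm{tr}(T')$, $m=m'$ and $r>r'$. Here $\mathrm{tr}(T)=m+n$. $p$-minimum matrix: for $F\in M_k(\Gamma_2)_{\mathbb{Z}_{(p)}}$ with $F\not\equiv 0\pmod p$, $m_p(F):=\min\{T\in L_2 : a(T;F)\not\equiv 0\pmod p\}$, the minimum being with respect to the order $\succ$. If $F\equiv 0\pmod p$, then $m_p(F):=(\infty)$, where $(\infty)$ is regarded as $\succ T$ for every $T\in\Lambda_2$. *)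

theory Defs
  imports "HOL-Analysis.Analysis" "HOL-Computational_Algebra.Primes"
begin

section \<open>The Siegel modular group and the Siegel upper half-space of degree 2\<close>

text \<open>
  A \<open>4 \<times> 4\<close> matrix is indexed by the four-element sum type \<open>2 + 2\<close>, so that its
  \<open>2 \<times> 2\<close> blocks are obtained by restricting the indices to \<open>Inl\<close> and \<open>Inr\<close>.
\<close>

definition blockA :: "'a ^ (2 + 2) ^ (2 + 2) \<Rightarrow> 'a ^ 2 ^ 2" where
  "blockA M = (\<chi> i j. M $ Inl i $ Inl j)"

definition blockB :: "'a ^ (2 + 2) ^ (2 + 2) \<Rightarrow> 'a ^ 2 ^ 2" where
  "blockB M = (\<chi> i j. M $ Inl i $ Inr j)"

definition blockC :: "'a ^ (2 + 2) ^ (2 + 2) \<Rightarrow> 'a ^ 2 ^ 2" where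
  "blockC M = (\<chi> i j. M $ Inr i $ Inl j)"

definition blockD :: "'a ^ (2 + 2) ^ (2 + 2) \<Rightarrow> 'a ^ 2 ^ 2" where
  "blockD M = (\<chi> i j. M $ Inr i $ Inr j)"

text \<open>The standard symplectic form, with blocks \<open>0, 1, -1, 0\<close>.\<close>

definition symplectic_J :: "int ^ (2 + 2) ^ (2 + 2)" where
  "symplectic_J = (\<chi> i j.
     case (i, j) of
       (Inl a, Inr b) \<Rightarrow> (if a = b then 1 else 0)
     | (Inr a, Inl b) \<Rightarrow> (if a = b then - 1 else 0)
     | _ \<Rightarrow> 0)"

definition Gamma2 :: "(int ^ (2 + 2) ^ (2 + 2)) set" where
  "Gamma2 = {M. transpose M ** symplectic_J ** M = symplectic_J}"

definition positive_definite :: "real ^ 'n ^ 'n \<Rightarrow> bool" where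
  "positive_definite Y \<longleftrightarrow> transpose Y = Y \<and> (\<forall>x. x \<noteq> 0 \<longrightarrow> x \<bullet> (Y *v x) > 0)"

definition positive_semidefinite :: "real ^ 'n ^ 'n \<Rightarrow> bool" where
  "positive_semidefinite Y \<longleftrightarrow> transpose Y = Y \<and> (\<forall>x. x \<bullet> (Y *v x) \<ge> 0)"

definition siegel_H2 :: "(complex ^ 2 ^ 2) set" where
  "siegel_H2 = {Z. transpose Z = Z \<and> positive_definite (map_matrix Im Z)}"

definition automorphy_matrix :: "int ^ (2 + 2) ^ (2 + 2) \<Rightarrow> complex ^ 2 ^ 2 \<Rightarrow> complex ^ 2 ^ 2" where
  "automorphy_matrix M Z = map_matrix of_int (blockC M) ** Z + map_matrix of_int (blockD M)"

definition siegel_action :: "int ^ (2 + 2) ^ (2 + 2) \<Rightarrow> complex ^ 2 ^ 2 \<Rightarrow> complex ^ 2 ^ 2" where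
  "siegel_action M Z =
     (map_matrix of_int (blockA M) ** Z + map_matrix of_int (blockB M))
       ** matrix_inv (automorphy_matrix M Z)"


section \<open>Siegel modular forms of degree 2\<close>

text \<open>
  \<open>siegel_H2\<close> is open in the three-dimensional space of symmetric complex matrices.
  Holomorphy in the three variables is complex differentiability at every point: the
  derivative relative to \<open>siegel_H2\<close> exists and is complex linear. (Only its values on
  symmetric matrices are determined, and every complex linear functional there extends
  to all matrices.)
\<close>

definition holomorphic_on_H2 :: "(complex ^ 2 ^ 2 \<Rightarrow> complex) \<Rightarrow> bool" where
  "holomorphic_on_H2 F \<longleftrightarrow>
     (\<forall>Z \<in> siegel_H2. \<exists>L. (F has_derivative L) (at Z within siegel_H2) \<and>
        (\<forall>c X. L (\<chi> i j. c * X $ i $ j) = c * L X))"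

text \<open>
  Holomorphy at the cusps is automatic in degree 2, by the Koecher principle. The values
  of \<open>F\<close> outside \<open>siegel_H2\<close> are irrelevant in this and all later definitions.
\<close>

definition siegel_modular_forms :: "nat \<Rightarrow> (complex ^ 2 ^ 2 \<Rightarrow> complex) set" where
  "siegel_modular_forms k = {F. holomorphic_on_H2 F \<and>
     (\<forall>M \<in> Gamma2. \<forall>Z \<in> siegel_H2.
        F (siegel_action M Z) = det (automorphy_matrix M Z) ^ k * F Z)}"


section \<open>Fourier expansions\<close>

text \<open>Rationality of the entries follows from the integrality conditions.\<close>

definition Lambda2 :: "(real ^ 2 ^ 2) set" where
  "Lambda2 = {T. transpose T = T \<and> (\<forall>i. T $ i $ i \<in> \<int>) \<and> (\<forall>i j. 2 * T $ i $ j \<in> \<int>)}"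

definition L2 :: "(real ^ 2 ^ 2) set" where
  "L2 = {T \<in> Lambda2. positive_semidefinite T}"

text \<open>The matrix abbreviated \<open>(m, n, r)\<close>.\<close>

definition half_int :: "int \<Rightarrow> int \<Rightarrow> int \<Rightarrow> real ^ 2 ^ 2" where
  "half_int m n r = vector [vector [of_int m, of_int r / 2], vector [of_int r / 2, of_int n]]"

definition q_pow :: "real ^ 2 ^ 2 \<Rightarrow> complex ^ 2 ^ 2 \<Rightarrow> complex" where
  "q_pow T Z = exp (2 * of_real pi * \<i> * trace (map_matrix of_real T ** Z))"

text \<open>
  The coefficient family of the expansion over \<open>L2\<close>, extended by \<open>0\<close> to all matrices so
  that it is determined uniquely.
\<close>

definition fourier_coeff :: "(complex ^ 2 ^ 2 \<Rightarrow> complex) \<Rightarrow> real ^ 2 ^ 2 \<Rightarrow> complex" where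
  "fourier_coeff F = (THE a. (\<forall>T. T \<notin> L2 \<longrightarrow> a T = 0) \<and>
     (\<forall>Z \<in> siegel_H2. ((\<lambda>T. a T * q_pow T Z) has_sum F Z) L2))"

definition siegel_modular_forms_over :: "nat \<Rightarrow> complex set \<Rightarrow> (complex ^ 2 ^ 2 \<Rightarrow> complex) set" where
  "siegel_modular_forms_over k R =
     {F \<in> siegel_modular_forms k. \<forall>T \<in> L2. fourier_coeff F T \<in> R}"

text \<open>The \<open>p\<close>-integral rational numbers, as a subring of the complex numbers, and its ideal
  generated by \<open>p\<close>.\<close>

definition p_integral :: "nat \<Rightarrow> complex set" where
  "p_integral p = {of_int a / of_int b | a b. \<not> int p dvd b}"

definition p_ideal :: "nat \<Rightarrow> complex set" where
  "p_ideal p = {of_nat p * x | x. x \<in> p_integral p}"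

definition zero_mod :: "nat \<Rightarrow> (complex ^ 2 ^ 2 \<Rightarrow> complex) \<Rightarrow> bool" where
  "zero_mod p F \<longleftrightarrow> (\<forall>T \<in> L2. fourier_coeff F T \<in> p_ideal p)"


section \<open>The order and the \<open>p\<close>-minimum matrix\<close>

text \<open>For \<open>T = (m, n, r)\<close> one has \<open>m = T $ 1 $ 1\<close> and \<open>r = 2 * T $ 1 $ 2\<close>.\<close>

definition mat_succ :: "real ^ 2 ^ 2 \<Rightarrow> real ^ 2 ^ 2 \<Rightarrow> bool" where
  "mat_succ T T' \<longleftrightarrow>
     trace T > trace T' \<or>
     trace T = trace T' \<and> T $ 1 $ 1 > T' $ 1 $ 1 \<or>
     trace T = trace T' \<and> T $ 1 $ 1 = T' $ 1 $ 1 \<and> 2 * T $ 1 $ 2 > 2 * T' $ 1 $ 2"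

datatype mat_ext = Fin "real ^ 2 ^ 2" | Infty

fun ext_succ :: "mat_ext \<Rightarrow> mat_ext \<Rightarrow> bool" where
  "ext_succ (Fin T) (Fin T') = mat_succ T T'"
| "ext_succ Infty (Fin T') = True"
| "ext_succ _ Infty = False"

definition min_matrix :: "nat \<Rightarrow> (complex ^ 2 ^ 2 \<Rightarrow> complex) \<Rightarrow> mat_ext" where
  "min_matrix p F =
     (if zero_mod p F then Infty
      else Fin (THE T. T \<in> L2 \<and> fourier_coeff F T \<notin> p_ideal p \<and>
        (\<forall>T' \<in> L2. fourier_coeff F T' \<notin> p_ideal p \<longrightarrow> T' = T \<or> mat_succ T' T)))"

end

(*
  Let a(m,r,n) be the Fourier coefficients and b_v(m,n) = sum_r a(m,r,n) binomial(r,v) the Taylor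
  coefficients at zeta = 1 of the Fourier-Jacobi coefficient phi_n.  For odd k both families are
  antisymmetric in m and n, and one shows by induction on v that every b_v lies in the ideal (p).
  If b_0, ..., b_(v-1) vanish mod p in the row n and v <= 2n, then the leading Taylor coefficient
  b_v(.,n)^2 of phi_n^2 is congruent to an elliptic modular form of weight 2(k+v): the germs
  theta(Nz)^2 for N = 1, 2, 3 have integral coefficients, and suitable monomials in them remove the
  lower Taylor coefficients of phi_n^2 one at a time, at the cost of inverting 6.  Sturm's bound mod p
  then reduces the row to its first (k+v)/12 entries, which are covered either by the hypothesis or,
  for large v, by the following fact: the row n vanishes mod p as soon as b_0, ..., b_(2n-2) do,
  because the unipotent action on r and antisymmetry leave only the indices |r| < n, and their
  coefficients are determined by the first 2n - 1 binomial sums.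
*)

theory Submission
  imports Defs "HOL-Complex_Analysis.Complex_Analysis"
begin

section \<open>Fourier series of periodic holomorphic functions\<close>

text \<open>Congruences between Taylor coefficients do not survive t -> -1/t: the transformation law
  mixes all of them with complex factors, and only a coefficient below which everything vanishes
  exactly is modular. So the lower coefficients, which merely lie in the ideal, must be cleared
  exactly by germs of the same weight and index. These come from an exchange:
  \<open>theta_germ 2 ^ 3\<close> and \<open>theta_germ 1 ^ 3 * theta_germ 3\<close> both have index
  12, but orders 6 and 8 and weights -6 and -8. Each exchange raises the order by 2 at constant
  index, and the modular form being cleared supplies the missing weight. The leading coefficients
  are products of 4 and 9, hence the factor 6.

  The slope 10 is 12 - 2: Sturm's bound grows like v / 12, while a row is settled once v reaches 2n
  - 1. The hypothesis serves as long as k + v < 12 (c + 4), where c = [(k - 35) / 10]. Beyond that v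
  >= 2c + 5, which settles the rows up to c + 3 outright. The ranges meet for k <= 10c + 43, and 10c
  + 43 is the largest odd k with this c.\<close>

definition ee :: "complex \<Rightarrow> complex" where "ee z = exp (2 * of_real pi * \<i> * z)"

lemma ee_0 [simp]: "ee 0 = 1" by (simp add: ee_def)
lemma ee_nonzero [simp]: "ee z \<noteq> 0" by (simp add: ee_def)
lemma ee_add: "ee (a + b) = ee a * ee b" by (simp add: ee_def ring_distribs exp_add)
lemma ee_minus: "ee (- a) = inverse (ee a)" by (simp add: ee_def exp_minus)
lemma ee_diff: "ee (a - b) = ee a / ee b" by (simp add: ee_def ring_distribs exp_diff)
lemma norm_ee: "norm (ee z) = exp (- 2 * pi * Im z)" by (simp add: ee_def)
lemma ee_eq_1_iff: "ee z = 1 \<longleftrightarrow> (\<exists>n::int. z = of_int n)"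
proof -
  have "(2 * of_real pi * \<i> * z = complex_of_real (of_int (2 * n) * pi) * \<i>) \<longleftrightarrow> z = of_int n" for n
    by (simp add: field_simps)
  moreover have "ee z = 1 \<longleftrightarrow> (\<exists>n::int. 2 * of_real pi * \<i> * z = complex_of_real (of_int (2 * n) * pi) * \<i>)"
    unfolding ee_def exp_eq_1 by (auto simp: complex_eq_iff)
  ultimately show ?thesis by auto
qed
lemma ee_of_int [simp]: "ee (of_int n) = 1" using ee_eq_1_iff by auto
lemma ee_1 [simp]: "ee 1 = 1" using ee_of_int[of 1] by simp
lemma ee_add_of_int [simp]: "ee (z + of_int n) = ee z" "ee (of_int n + z) = ee z" by (simp_all add: ee_add)
lemma ee_add_1 [simp]: "ee (z + 1) = ee z" by (simp add: ee_add)
lemma ee_power: "ee (of_nat n * z) = ee z ^ n" "ee (z * of_nat n) = ee z ^ n"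
  by (simp_all add: ee_def exp_of_nat_mult[symmetric] mult_ac)
lemma holomorphic_on_ee [holomorphic_intros]: "f holomorphic_on S \<Longrightarrow> (\<lambda>z. ee (f z)) holomorphic_on S"
  unfolding ee_def by (intro holomorphic_intros)
lemma continuous_on_ee [continuous_intros]: "continuous_on S f \<Longrightarrow> continuous_on S (\<lambda>z. ee (f z))"
  unfolding ee_def by (intro continuous_intros)

section \<open>Integrals of periodic functions along horizontal segments\<close>

definition line_integral :: "(complex \<Rightarrow> complex) \<Rightarrow> real \<Rightarrow> complex" where
  "line_integral f y = integral {0..1} (\<lambda>x. f (Complex x y))"

text \<open>One notion for half planes and for the whole plane: the outer variables of the Siegel
  domain range over the former, the middle one over the latter. Convexity supplies
  primitives.\<close>

definition line_domain :: "complex set \<Rightarrow> bool" where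
  "line_domain S \<longleftrightarrow> open S \<and> convex S \<and> (\<forall>z\<in>S. \<forall>x::real. z + of_real x \<in> S)"

lemma line_domain_halfplane: "line_domain {z. c < Im z}"
  by (auto simp: line_domain_def open_halfspace_Im_gt convex_halfspace_Im_gt)
lemma line_domain_UNIV: "line_domain UNIV"
  by (auto simp: line_domain_def)

lemma line_domain_Complex:
  assumes "line_domain S" "Complex x0 y \<in> S" shows "Complex x y \<in> S"
proof -
  have "Complex x0 y + of_real (x - x0) \<in> S" using assms unfolding line_domain_def by blast
  also have "Complex x0 y + of_real (x - x0) = Complex x y" by (simp add: complex_eq_iff)
  finally show ?thesis .
qed

lemma continuous_on_Complex_line [continuous_intros]: "continuous_on A (\<lambda>x. Complex x y)"
  unfolding Complex_eq by (intro continuous_intros)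

lemma has_vector_derivative_hline:
  assumes "(G has_field_derivative g) (at (Complex x y))"
  shows "((\<lambda>x. G (Complex x y)) has_vector_derivative g) (at x within A)"
proof -
  have 1: "((\<lambda>x. Complex x y) has_vector_derivative 1) (at x within A)"
    unfolding Complex_eq by (auto intro!: derivative_eq_intros)
  have "((G \<circ> (\<lambda>x. Complex x y)) has_vector_derivative 1 * g) (at x within A)"
    by (rule field_vector_diff_chain_within[OF 1]) (rule has_field_derivative_at_within, rule assms)
  then show ?thesis by (simp add: o_def)
qed

lemma continuous_on_unit_interval_bounded:
  fixes f :: "real \<Rightarrow> complex"
  assumes "continuous_on {0..1} f"
  obtains B where "\<And>x. x \<in> {0..1} \<Longrightarrow> norm (f x) \<le> B"
proof -
  have "bounded (f ` {0..1})" using compact_continuous_image[OF assms] by (intro compact_imp_bounded) auto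
  then show ?thesis unfolding bounded_iff using that by blast
qed

lemma continuous_on_hline:
  assumes "line_domain S" "Complex 0 y \<in> S" "continuous_on S f"
  shows "continuous_on A (\<lambda>x. f (Complex x y))"
  by (rule continuous_on_compose2[OF assms(3)]) (use assms line_domain_Complex in \<open>auto intro!: continuous_intros\<close>)

text \<open>A primitive changes by a constant under z -> z + 1, because f(z + 1) - f(z) vanishes;
  the integral over a period is this constant at every height.\<close>

lemma line_integral_const:
  assumes S: "line_domain S" and f: "f holomorphic_on S" and per: "\<And>z. z \<in> S \<Longrightarrow> f (z + 1) = f z"
    and y: "Complex 0 y1 \<in> S" "Complex 0 y2 \<in> S"
  shows "line_integral f y1 = line_integral f y2"
proof -
  have S': "open S" "convex S" using S by (auto simp: line_domain_def)
  obtain G where G: "\<And>x. x \<in> S \<Longrightarrow> (G has_field_derivative f x) (at x within S)"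
    using holomorphic_convex_primitive'[OF S'(2,1) f] by blast
  have G': "(G has_field_derivative f x) (at x)" if "x \<in> S" for x
    using G[OF that] at_within_open[OF that S'(1)] by metis
  have sh: "z + 1 \<in> S" if "z \<in> S" for z
    using S that unfolding line_domain_def by (auto dest!: bspec[of _ _ z] spec[of _ "1::real"])
  have "((\<lambda>w. G (w + 1) - G w) has_field_derivative 0) (at w within S)" if "w \<in> S" for w
  proof -
    have "((\<lambda>w. G (w + 1)) has_field_derivative f (w + 1)) (at w)"
      using DERIV_shift[of G "f (w+1)" w 1] G'[OF sh[OF that]] by blast
    then have "((\<lambda>w. G (w + 1) - G w) has_field_derivative f (w + 1) - f w) (at w)"
      by (rule DERIV_diff) (rule G'[OF that])
    then show ?thesis using per[OF that] by (simp add: has_field_derivative_at_within)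
  qed
  then have "\<exists>c. \<forall>w\<in>S. G (w + 1) - G w = c"
    by (rule has_field_derivative_zero_constant[OF S'(2)])
  then obtain c where c: "\<And>w. w \<in> S \<Longrightarrow> G (w + 1) - G w = c" by auto
  have "line_integral f y = c" if "Complex 0 y \<in> S" for y
  proof -
    have "((\<lambda>x. f (Complex x y)) has_integral G (Complex 1 y) - G (Complex 0 y)) {0..1}"
    proof (rule fundamental_theorem_of_calculus)
      fix x :: real
      show "((\<lambda>x. G (Complex x y)) has_vector_derivative f (Complex x y)) (at x within {0..1})"
        by (rule has_vector_derivative_hline, rule G', rule line_domain_Complex[OF S that])
    qed simp
    moreover have "G (Complex 1 y) - G (Complex 0 y) = c"
    proof -
      have "Complex 0 y + 1 = Complex 1 y" by (simp add: complex_eq_iff)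
      then show ?thesis using c[OF that] by simp
    qed
    ultimately show ?thesis by (simp add: line_integral_def integral_unique)
  qed
  then show ?thesis using y by simp
qed

text \<open>The N-th partial sum misses the integral of the quotient by an integral carrying
  \<open>E x ^ N\<close>, which is O(\<open>\<rho> ^ N\<close>), so no interchange of limit and
  integral is involved.\<close>

lemma integral_geometric_sums:
  fixes \<phi> E :: "real \<Rightarrow> complex"
  assumes c: "continuous_on {0..1} \<phi>" "continuous_on {0..1} E"
    and \<rho>: "\<And>x. x \<in> {0..1} \<Longrightarrow> norm (E x) \<le> \<rho>" "\<rho> < 1"
  shows "(\<lambda>k. integral {0..1} (\<lambda>x. \<phi> x * E x ^ k)) sums integral {0..1} (\<lambda>x. \<phi> x / (1 - E x))"
    and "summable (\<lambda>k. norm (integral {0..1} (\<lambda>x. \<phi> x * E x ^ k)))"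
proof -
  have \<rho>0: "0 \<le> \<rho>" using order_trans[OF norm_ge_zero \<rho>(1)[of 0]] by simp
  obtain M where M: "\<And>x. x \<in> {0..1} \<Longrightarrow> norm (\<phi> x) \<le> M"
    using continuous_on_unit_interval_bounded[OF c(1)] by blast
  have expm1_fps: "1 - E x \<noteq> 0" if "x \<in> {0..1}" for x using \<rho>(1)[OF that] \<rho>(2) by auto
  have bnd: "norm (integral {0..1} (\<lambda>x. h x * E x ^ k)) \<le> B * \<rho> ^ k"
    if "continuous_on {0..1} h" "\<And>x. x \<in> {0..1} \<Longrightarrow> norm (h x) \<le> B" for h k B
  proof -
    have "norm (integral {0..1} (\<lambda>x. h x * E x ^ k)) \<le> (B * \<rho> ^ k) * (1 - 0)"
    proof (rule integral_bound)
      show "continuous_on {0..1} (\<lambda>x. h x * E x ^ k)" by (intro continuous_intros that c)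
      fix x :: real assume x: "x \<in> {0..1}"
      show "norm (h x * E x ^ k) \<le> B * \<rho> ^ k"
        unfolding norm_mult norm_power
        by (intro mult_mono power_mono \<rho> x that(2)) (use order_trans[OF norm_ge_zero that(2)[OF x]] in auto)
    qed simp
    then show ?thesis by simp
  qed
  show "summable (\<lambda>k. norm (integral {0..1} (\<lambda>x. \<phi> x * E x ^ k)))"
    by (rule summable_comparison_test'[of "\<lambda>k. M * \<rho> ^ k" 0])
       (use \<rho>0 \<rho> bnd[OF c(1) M] in \<open>auto intro!: summable_mult summable_geometric\<close>)
  have cq: "continuous_on {0..1} (\<lambda>x. \<phi> x / (1 - E x))" using expm1_fps by (auto intro!: continuous_intros c)
  have part: "(\<Sum>k<N. integral {0..1} (\<lambda>x. \<phi> x * E x ^ k)) = integral {0..1} (\<lambda>x. \<phi> x / (1 - E x))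
      - integral {0..1} (\<lambda>x. \<phi> x / (1 - E x) * E x ^ N)" for N
  proof -
    have "(\<Sum>k<N. integral {0..1} (\<lambda>x. \<phi> x * E x ^ k)) = integral {0..1} (\<lambda>x. \<Sum>k<N. \<phi> x * E x ^ k)"
      by (subst integral_sum) (auto intro!: integrable_continuous_real continuous_intros c)
    also have "\<dots> = integral {0..1} (\<lambda>x. \<phi> x / (1 - E x) - \<phi> x / (1 - E x) * E x ^ N)"
    proof (rule integral_cong)
      fix x :: real assume x: "x \<in> {0..1}"
      have "(\<Sum>k<N. \<phi> x * E x ^ k) = \<phi> x * ((1 - E x ^ N) / (1 - E x))"
        using expm1_fps[OF x] by (simp add: sum_distrib_left[symmetric] sum_gp_strict)
      then show "(\<Sum>k<N. \<phi> x * E x ^ k) = \<phi> x / (1 - E x) - \<phi> x / (1 - E x) * E x ^ N"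
        by (simp add: diff_divide_distrib right_diff_distrib)
    qed
    also have "\<dots> = integral {0..1} (\<lambda>x. \<phi> x / (1 - E x)) - integral {0..1} (\<lambda>x. \<phi> x / (1 - E x) * E x ^ N)"
      by (rule integral_diff) (intro integrable_continuous_real continuous_intros cq c)+
    finally show ?thesis .
  qed
  obtain B where B: "\<And>x. x \<in> {0..1} \<Longrightarrow> norm (\<phi> x / (1 - E x)) \<le> B"
    using continuous_on_unit_interval_bounded[OF cq] by blast
  have "(\<lambda>N. integral {0..1} (\<lambda>x. \<phi> x / (1 - E x) * E x ^ N)) \<longlonglongrightarrow> 0"
  proof (rule Lim_null_comparison)
    show "(\<lambda>N. B * \<rho> ^ N) \<longlonglongrightarrow> 0"
      using \<rho>0 \<rho>(2) by (auto intro!: tendsto_eq_intros LIMSEQ_realpow_zero)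
  qed (use bnd[OF cq B] in auto)
  then show "(\<lambda>k. integral {0..1} (\<lambda>x. \<phi> x * E x ^ k)) sums integral {0..1} (\<lambda>x. \<phi> x / (1 - E x))"
    unfolding sums_def part by (auto intro!: tendsto_eq_intros)
qed

lemma has_sum_int_split:
  fixes h :: "int \<Rightarrow> complex"
  assumes "((\<lambda>k::nat. h (int k)) has_sum A) UNIV" "((\<lambda>k::nat. h (- int k - 1)) has_sum B) UNIV"
  shows "(h has_sum (A + B)) UNIV"
proof -
  have "(h has_sum A) (range int)"
    using assms(1) by (subst has_sum_reindex) (auto simp: o_def inj_on_def)
  moreover have "(h has_sum B) (range (\<lambda>k::nat. - int k - 1))"
    using assms(2) by (subst has_sum_reindex) (auto simp: o_def inj_on_def)
  ultimately have "(h has_sum (A + B)) (range int \<union> range (\<lambda>k::nat. - int k - 1))"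
    by (rule has_sum_Un_disjoint) auto
  moreover have "range int \<union> range (\<lambda>k::nat. - int k - 1) = UNIV"
  proof -
    have "n \<in> range int \<union> range (\<lambda>k::nat. - int k - 1)" for n
      proof (cases "n \<ge> 0")
        case True then have "n = int (nat n)" by simp
        then show ?thesis by blast
      next
        case False then have "n = - int (nat (- n - 1)) - 1" by simp
        then show ?thesis by blast
      qed
    then show ?thesis by auto
  qed
  ultimately show ?thesis by simp
qed

definition line_coeff :: "(complex \<Rightarrow> complex) \<Rightarrow> int \<Rightarrow> real \<Rightarrow> complex" where
  "line_coeff f n y = line_integral (\<lambda>z. f z * ee (- (of_int n * z))) y"

lemma line_coeff_const:
  assumes S: "line_domain S" and f: "f holomorphic_on S" and per: "\<And>z. z \<in> S \<Longrightarrow> f (z + 1) = f z"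
    and y: "Complex 0 y1 \<in> S" "Complex 0 y2 \<in> S"
  shows "line_coeff f n y1 = line_coeff f n y2"
  unfolding line_coeff_def
proof (rule line_integral_const[OF S])
  show "(\<lambda>z. f z * ee (- (of_int n * z))) holomorphic_on S" by (intro holomorphic_intros f)
  fix z assume z: "z \<in> S"
  have "ee (- (of_int n * (z + 1))) = ee (- (of_int n * z) + of_int (- n))" by (simp add: ring_distribs)
  then show "f (z + 1) * ee (- (of_int n * (z + 1))) = f z * ee (- (of_int n * z))"
    using per[OF z] by (simp only: ee_add_of_int)
qed (use y in auto)

text \<open>The quotient (f(\<xi>) - f(w)) / (1 - ee(w - \<xi>)) is holomorphic and periodic, so its
  integrals below and above w agree. Below w the geometric series in ee(w - \<xi>) yields the
  indices n >= 0, above w the one in ee(\<xi> - w) yields n < 0. Their difference expands f - f(w)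
  at w and has sum 0.\<close>

theorem fourier_has_sum:
  assumes S: "line_domain S" and f: "f holomorphic_on S" and per: "\<And>z. z \<in> S \<Longrightarrow> f (z + 1) = f z"
    and y: "Complex 0 y \<in> S" and w: "w \<in> S"
  shows "((\<lambda>n. line_coeff f n y * ee (of_int n * w)) has_sum f w) UNIV"
proof -
  have S': "open S" using S by (auto simp: line_domain_def)
  have perZ: "f (z + of_int n) = f z" if "z \<in> S" for z n
  proof -
    have sh: "z + of_int k \<in> S" if "z \<in> S" for z k
      using S that unfolding line_domain_def by (metis of_real_of_int_eq)
    have nn: "f (z + of_nat k) = f z" if "z \<in> S" for z k
    proof (induction k)
      case (Suc k)
      have "f (z + of_nat (Suc k)) = f ((z + of_int (int k)) + 1)" by (simp add: algebra_simps)
      also have "\<dots> = f z" using per[OF sh[OF that, of "int k"]] Suc by simp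
      finally show ?case .
    qed simp
    show ?thesis
    proof (cases "n \<ge> 0")
      case True then show ?thesis using nn[OF that, of "nat n"] by simp
    next
      case False then show ?thesis using nn[OF sh[OF that, of n], of "nat (- n)"] by simp
    qed
  qed
  obtain d where d: "d > 0" "cball w d \<subseteq> S" using S' w open_contains_cball by blast
  define y1 y2 where "y1 = Im w - d" and "y2 = Im w + d"
  have inS: "Complex (Re w) y1 \<in> S" "Complex (Re w) y2 \<in> S"
    using d by (auto simp: y1_def y2_def dist_norm cmod_def intro!: subsetD[OF d(2)])
  have yS: "Complex 0 y1 \<in> S" "Complex 0 y2 \<in> S" using line_domain_Complex[OF S] inS by blast+
  define D where "D = (\<lambda>\<xi>. 1 - ee (w - \<xi>))"
  \<comment> \<open>At the zeros of \<open>D\<close> the value is the limit of the quotient: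
    \<open>D\<close> has derivative 2 pi i there.\<close>
  define g where "g = (\<lambda>\<xi>. if D \<xi> = 0 then deriv f w / (2 * of_real pi * \<i>) else (f \<xi> - f w) / D \<xi>)"
  have Dder: "(D has_field_derivative 2 * of_real pi * \<i> * ee (w - \<xi>)) (at \<xi>)" for \<xi>
    unfolding D_def ee_def by (auto intro!: derivative_eq_intros)
  have D0: "D \<xi> = 0 \<longleftrightarrow> (\<exists>n::int. \<xi> = w + of_int n)" for \<xi>
  proof -
    have "D \<xi> = 0 \<longleftrightarrow> ee (\<xi> - w) = 1"
      unfolding D_def by (simp add: ee_diff) (auto simp: field_simps)
    also have "\<dots> \<longleftrightarrow> (\<exists>n::int. \<xi> - w = of_int n)" by (rule ee_eq_1_iff)
    also have "\<dots> \<longleftrightarrow> (\<exists>n::int. \<xi> = w + of_int n)" by (auto simp: algebra_simps)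
    finally show ?thesis .
  qed
  have Dhol: "D holomorphic_on A" for A unfolding D_def by (intro holomorphic_intros)
  have gper: "g (\<xi> + of_int n) = g \<xi>" if "\<xi> \<in> S" for \<xi> n
  proof -
    have "D (\<xi> + of_int n) = D \<xi>" unfolding D_def using ee_add_of_int(1)[of "w - \<xi>" "- n"]
      by (simp add: algebra_simps)
    then show ?thesis using perZ[OF that] by (simp add: g_def)
  qed
  \<comment> \<open>Near w, \<open>g\<close> is the quotient of the difference quotients of
    \<open>f\<close> and \<open>D\<close> at w. Periodicity later carries this to the other zeros w
    + n of \<open>D\<close>.\<close>
  have g_loc: "g holomorphic_on S \<inter> ball w 1"
  proof -
    define p where "p = (\<lambda>\<xi>. if \<xi> = w then deriv f w else (f \<xi> - f w) / (\<xi> - w))"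
    define e where "e = (\<lambda>\<xi>. if \<xi> = w then deriv D w else (D \<xi> - D w) / (\<xi> - w))"
    have p: "p holomorphic_on S" unfolding p_def by (rule pole_lemma_open[OF f S'])
    have e: "e holomorphic_on S" unfolding e_def by (rule pole_lemma_open[OF Dhol S'])
    have Dw: "D w = 0" by (simp add: D_def)
    have dDw: "deriv D w = 2 * of_real pi * \<i>" using DERIV_imp_deriv[OF Dder[of w]] by simp
    have only: "D \<xi> \<noteq> 0" if "\<xi> \<in> ball w 1" "\<xi> \<noteq> w" for \<xi>
    proof
      assume "D \<xi> = 0"
      then obtain n :: int where n: "\<xi> = w + of_int n" using D0 by auto
      with that have "n \<noteq> 0" by auto
      then have "\<bar>n\<bar> \<ge> 1" by auto
      then have "norm (of_int n :: complex) \<ge> 1" by simp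
      then show False using that n by (simp add: dist_norm)
    qed
    have e0: "e \<xi> \<noteq> 0" if "\<xi> \<in> ball w 1" for \<xi>
      using only[OF that] by (auto simp: e_def dDw Dw)
    have "(\<lambda>\<xi>. p \<xi> / e \<xi>) holomorphic_on S \<inter> ball w 1"
      by (intro holomorphic_on_divide holomorphic_on_subset[OF p] holomorphic_on_subset[OF e]) (use e0 in auto)
    then show ?thesis
      by (rule holomorphic_transform) (use only in \<open>auto simp: p_def e_def g_def dDw Dw\<close>)
  qed
  have ghol: "g holomorphic_on S"
  proof (rule holomorphic_onI)
    fix \<xi> assume \<xi>: "\<xi> \<in> S"
    show "g field_differentiable at \<xi> within S"
    proof (cases "D \<xi> = 0")
      case True
      then obtain n where n: "\<xi> = w + of_int n" using D0 by auto
      have shS: "z - of_int n \<in> S" if "z \<in> S" for z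
        using S that unfolding line_domain_def by (metis of_real_of_int_eq diff_conv_add_uminus of_int_minus)
      have "(g \<circ> (\<lambda>z. z - of_int n)) holomorphic_on S \<inter> ball \<xi> 1"
        by (rule holomorphic_on_compose_gen[OF _ g_loc])
           (use shS in \<open>auto intro!: holomorphic_intros simp: n dist_norm algebra_simps\<close>)
      then have "g holomorphic_on S \<inter> ball \<xi> 1"
      proof (rule holomorphic_transform)
        fix z assume "z \<in> S \<inter> ball \<xi> 1"
        then show "(g \<circ> (\<lambda>z. z - of_int n)) z = g z" using gper[OF shS[of z], of n] by simp
      qed
      then have "g field_differentiable at \<xi>"
        by (rule holomorphic_on_imp_differentiable_at) (use \<xi> S' in auto)
      then show ?thesis by (rule field_differentiable_at_within)
    next
      case False
      have op: "open (S \<inter> (D -` (- {0})))"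
        by (rule continuous_open_preimage[OF holomorphic_on_imp_continuous_on[OF Dhol] S']) auto
      have "(\<lambda>\<xi>. (f \<xi> - f w) / D \<xi>) holomorphic_on (S \<inter> (D -` (- {0})))"
        by (intro holomorphic_intros Dhol holomorphic_on_subset[OF f]) auto
      then have "g holomorphic_on (S \<inter> (D -` (- {0})))"
        by (rule holomorphic_transform) (auto simp: g_def)
      then have "g field_differentiable at \<xi>"
        by (rule holomorphic_on_imp_differentiable_at[OF _ op]) (use \<xi> False in auto)
      then show ?thesis by (rule field_differentiable_at_within)
    qed
  qed
  have g12: "line_integral g y1 = line_integral g y2"
    using line_integral_const[OF S ghol _ yS] gper[of _ 1] by simp
  define \<phi> where "\<phi> = (\<lambda>y x. f (Complex x y) - f w)"
  have fc: "continuous_on S f" using f by (rule holomorphic_on_imp_continuous_on)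
  have \<phi>c: "continuous_on {0..1} (\<phi> y1)" "continuous_on {0..1} (\<phi> y2)"
    unfolding \<phi>_def by (intro continuous_intros continuous_on_hline[OF S _ fc] yS)+
  have fcoefS: "line_coeff f n y1 = line_coeff f n y" "line_coeff f n y2 = line_coeff f n y" for n
    using line_coeff_const[OF S f per] y yS by blast+
  have int_ee: "integral {0..1} (\<lambda>x. ee (- (of_int n * Complex x y'))) = (if n = 0 then 1 else 0)" for n y'
  proof (cases "n = 0")
    case False
    have "((\<lambda>x. ee (- (of_int n * Complex x y'))) has_integral
      (ee (- (of_int n * Complex 1 y')) / (- 2 * of_real pi * \<i> * of_int n) - ee (- (of_int n * Complex 0 y')) / (- 2 * of_real pi * \<i> * of_int n))) {0..1}"
    proof (rule fundamental_theorem_of_calculus)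
      fix x :: real
      show "((\<lambda>x. ee (- (of_int n * Complex x y')) / (- 2 * of_real pi * \<i> * of_int n)) has_vector_derivative
          ee (- (of_int n * Complex x y'))) (at x within {0..1})"
        unfolding ee_def using False
        by (intro has_vector_derivative_hline) (auto intro!: derivative_eq_intros simp: field_simps)
    qed simp
    moreover have "ee (- (of_int n * Complex 1 y')) = ee (- (of_int n * Complex 0 y'))"
    proof -
      have "- (of_int n * Complex 1 y') = - (of_int n * Complex 0 y') + of_int (- n)"
        by (simp add: complex_eq_iff)
      then show ?thesis by (metis ee_add_of_int(1))
    qed
    ultimately have "((\<lambda>x. ee (- (of_int n * Complex x y'))) has_integral 0) {0..1}" by simp
    then show ?thesis using False by (simp add: integral_unique)
  qed simp
  have coefint: "integral {0..1} (\<lambda>x. \<phi> y' x * ee (of_int n * (w - Complex x y')))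
       = (line_coeff f n y - (if n = 0 then f w else 0)) * ee (of_int n * w)"
    if y': "y' = y1 \<or> y' = y2" for n y'
  proof -
    have yS': "Complex 0 y' \<in> S" using y' yS by auto
    have "integral {0..1} (\<lambda>x. \<phi> y' x * ee (of_int n * (w - Complex x y')))
      = integral {0..1} (\<lambda>x. (f (Complex x y') * ee (- (of_int n * Complex x y')) - f w * ee (- (of_int n * Complex x y'))) * ee (of_int n * w))"
      by (intro integral_cong) (simp add: \<phi>_def ring_distribs ee_diff ee_minus field_simps)
    also have "\<dots> = (integral {0..1} (\<lambda>x. f (Complex x y') * ee (- (of_int n * Complex x y'))) -
       integral {0..1} (\<lambda>x. f w * ee (- (of_int n * Complex x y')))) * ee (of_int n * w)"
      by (subst integral_mult_left, subst integral_diff)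
         (auto intro!: integrable_continuous_real continuous_intros continuous_on_hline[OF S yS' fc])
    also have "integral {0..1} (\<lambda>x. f (Complex x y') * ee (- (of_int n * Complex x y'))) = line_coeff f n y"
      using fcoefS y' unfolding line_coeff_def line_integral_def by auto
    also have "integral {0..1} (\<lambda>x. f w * ee (- (of_int n * Complex x y'))) = (if n = 0 then f w else 0)"
      using int_ee[of n y'] by simp
    finally show ?thesis .
  qed
  have n1: "norm (ee (w - Complex x y1)) = exp (- 2 * pi * d)" for x by (simp add: norm_ee y1_def)
  have n2: "norm (ee (Complex x y2 - w)) = exp (- 2 * pi * d)" for x by (simp add: norm_ee y2_def)
  have lt1: "exp (- 2 * pi * d) < 1" using d by simp
  have eeI: "ee (of_int (int k) * u) = ee u ^ k" for k u using ee_power(1)[of k u] by simp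
  have eeI': "ee (of_int (- int k - 1) * (w - u)) = ee (u - w) * ee (u - w) ^ k" for k u
  proof -
    have "of_int (- int k - 1) * (w - u) = (u - w) + of_nat k * (u - w)" by (simp add: algebra_simps)
    then show ?thesis by (simp only: ee_add ee_power)
  qed
  have c1: "continuous_on {0..1} (\<lambda>x. ee (w - Complex x y1))" by (intro continuous_intros)
  have c2: "continuous_on {0..1} (\<lambda>x. ee (Complex x y2 - w))" by (intro continuous_intros)
  have A1: "(\<lambda>k. (line_coeff f (int k) y - (if int k = 0 then f w else 0)) * ee (of_int (int k) * w)) sums line_integral g y1"
    and A2: "summable (\<lambda>k. norm ((line_coeff f (int k) y - (if int k = 0 then f w else 0)) * ee (of_int (int k) * w)))"
  proof -
    have *: "integral {0..1} (\<lambda>x. \<phi> y1 x * ee (w - Complex x y1) ^ k) =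
      (line_coeff f (int k) y - (if int k = 0 then f w else 0)) * ee (of_int (int k) * w)" for k
      unfolding eeI[symmetric] by (rule coefint) simp
    have **: "integral {0..1} (\<lambda>x. \<phi> y1 x / (1 - ee (w - Complex x y1))) = line_integral g y1"
      unfolding line_integral_def
    proof (rule integral_cong)
      fix x :: real
      have "D (Complex x y1) \<noteq> 0" using n1[of x] lt1 unfolding D_def
        by (metis eq_iff_diff_eq_0 norm_one order_less_irrefl)
      then show "\<phi> y1 x / (1 - ee (w - Complex x y1)) = g (Complex x y1)" by (simp add: g_def \<phi>_def D_def)
    qed
    show "(\<lambda>k. (line_coeff f (int k) y - (if int k = 0 then f w else 0)) * ee (of_int (int k) * w)) sums line_integral g y1"
      using integral_geometric_sums(1)[OF \<phi>c(1) c1 _ lt1] n1 unfolding * ** by auto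
    show "summable (\<lambda>k. norm ((line_coeff f (int k) y - (if int k = 0 then f w else 0)) * ee (of_int (int k) * w)))"
      using integral_geometric_sums(2)[OF \<phi>c(1) c1 _ lt1] n1 unfolding * by auto
  qed
  have B1: "(\<lambda>k. line_coeff f (- int k - 1) y * ee (of_int (- int k - 1) * w)) sums (- line_integral g y2)"
    and B2: "summable (\<lambda>k. norm (line_coeff f (- int k - 1) y * ee (of_int (- int k - 1) * w)))"
  proof -
    have *: "integral {0..1} (\<lambda>x. \<phi> y2 x * ee (Complex x y2 - w) * ee (Complex x y2 - w) ^ k) =
      line_coeff f (- int k - 1) y * ee (of_int (- int k - 1) * w)" for k
      using coefint[of y2 "- int k - 1"] unfolding eeI' mult.assoc by simp
    have **: "integral {0..1} (\<lambda>x. \<phi> y2 x * ee (Complex x y2 - w) / (1 - ee (Complex x y2 - w))) = - line_integral g y2"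
      unfolding line_integral_def integral_neg[symmetric]
    proof (rule integral_cong)
      fix x :: real
      define u where "u = ee (Complex x y2 - w)"
      have u1: "u \<noteq> 1" using n2[of x] lt1 unfolding u_def by (metis norm_one order_less_irrefl)
      have u0: "u \<noteq> 0" by (simp add: u_def)
      have "ee (w - Complex x y2) = inverse u" unfolding u_def ee_minus[symmetric] by simp
      then have "D (Complex x y2) = (u - 1) / u" using u0 by (simp add: D_def diff_divide_distrib inverse_eq_divide)
      then have "g (Complex x y2) = (f (Complex x y2) - f w) * u / (u - 1)" using u0 u1 by (simp add: g_def)
      moreover have "a / (1 - u) = - (a / (u - 1))" for a by (metis minus_diff_eq minus_divide_right)
      ultimately show "\<phi> y2 x * ee (Complex x y2 - w) / (1 - ee (Complex x y2 - w)) = - g (Complex x y2)"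
        unfolding u_def[symmetric] by (simp add: \<phi>_def)
    qed
    have \<phi>c2: "continuous_on {0..1} (\<lambda>x. \<phi> y2 x * ee (Complex x y2 - w))" by (intro continuous_intros \<phi>c)
    show "(\<lambda>k. line_coeff f (- int k - 1) y * ee (of_int (- int k - 1) * w)) sums (- line_integral g y2)"
      using integral_geometric_sums(1)[OF \<phi>c2 c2 _ lt1] n2 unfolding * ** by auto
    show "summable (\<lambda>k. norm (line_coeff f (- int k - 1) y * ee (of_int (- int k - 1) * w)))"
      using integral_geometric_sums(2)[OF \<phi>c2 c2 _ lt1] n2 unfolding * by auto
  qed
  \<comment> \<open>The two one-sided series add up to 0 by \<open>g12\<close>; the term n = 0 is
    short of f(w), which \<open>h0\<close> restores.\<close>
  have hs: "((\<lambda>n. (line_coeff f n y - (if n = 0 then f w else 0)) * ee (of_int n * w)) has_sum (line_integral g y1 + - line_integral g y2)) UNIV"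
    by (rule has_sum_int_split) (use A1 A2 B1 B2 in \<open>auto intro!: norm_summable_imp_has_sum\<close>)
  have h0: "((\<lambda>n. if n = 0 then f w else 0) has_sum f w) (UNIV :: int set)"
    by (rule has_sum_finite_neutralI[where B = "{0}"]) auto
  have "((\<lambda>n. (line_coeff f n y - (if n = 0 then f w else 0)) * ee (of_int n * w) + (if n = 0 then f w else 0)) has_sum (0 + f w)) UNIV"
    by (rule has_sum_add) (use hs g12 h0 in auto)
  moreover have "(\<lambda>n. (line_coeff f n y - (if n = 0 then f w else 0)) * ee (of_int n * w) + (if n = 0 then f w else 0))
     = (\<lambda>n. line_coeff f n y * ee (of_int n * w))" by (auto simp: fun_eq_iff)
  ultimately show ?thesis by simp
qed

section \<open>Fourier series in three variables\<close>

text \<open>Real integrals are written as contour integrals so that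
  \<open>contour_integral_swap\<close> can serve as Fubini's theorem.\<close>

lemma integral_eq_contour_integral: "integral {0..1} h = contour_integral (linepath 0 1) (\<lambda>w. h (Re w))"
  by (simp add: contour_integral_integral linepath_def scaleR_conv_of_real)

text \<open>Morera's theorem: the integral over a triangle may be taken under the integral sign,
  where it vanishes by Cauchy.\<close>

lemma holomorphic_integral_param:
  fixes g :: "complex \<Rightarrow> real \<Rightarrow> complex"
  assumes U: "open U" and c: "continuous_on (U \<times> {0..1}) (\<lambda>(z,x). g z x)"
    and h: "\<And>x. x \<in> {0..1} \<Longrightarrow> (\<lambda>z. g z x) holomorphic_on U"
  shows "(\<lambda>z. integral {0..1} (g z)) holomorphic_on U"
proof -
  have ab: "contour_integral (linepath a b) (\<lambda>z. integral {0..1} (g z))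
      = integral {0..1} (\<lambda>x. contour_integral (linepath a b) (\<lambda>z. g z x))"
    and int: "(\<lambda>x. contour_integral (linepath a b) (\<lambda>z. g z x)) integrable_on {0..1}"
    if ab: "closed_segment a b \<subseteq> U" for a b
  proof -
    have seg: "Re w \<in> {0..1}" if "w \<in> closed_segment 0 1" for w
      using that by (auto simp: closed_segment_def)
    have c': "continuous_on (closed_segment a b \<times> closed_segment 0 1) (\<lambda>p. g (fst p) (Re (snd p)))"
      by (rule continuous_on_compose2[OF c[unfolded case_prod_beta], of _ "\<lambda>p. (fst p, Re (snd p))", simplified])
         (use ab seg in \<open>auto intro!: continuous_intros\<close>)
    show "contour_integral (linepath a b) (\<lambda>z. integral {0..1} (g z))
      = integral {0..1} (\<lambda>x. contour_integral (linepath a b) (\<lambda>z. g z x))"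
      unfolding integral_eq_contour_integral
      by (rule contour_integral_swap) (use c' in \<open>auto simp: case_prod_beta\<close>)
    have lp: "(1 - u) *\<^sub>R a + u *\<^sub>R b \<in> U" if "0 \<le> u" "u \<le> 1" for u
      using linepath_in_path[of u a b] ab that by (auto simp: linepath_def)
    have "continuous_on ({0..1::real} \<times> {0..1::real}) (\<lambda>p. g (linepath a b (snd p)) (fst p) * (b - a))"
      by (intro continuous_intros continuous_on_compose2[OF c[unfolded case_prod_beta], of _ "\<lambda>p. (linepath a b (snd p), fst p)", simplified])
         (use lp in \<open>auto intro!: continuous_intros simp: linepath_def\<close>)
    then have "continuous_on {0..1::real} (\<lambda>x. integral (cbox 0 1) (\<lambda>u. g (linepath a b u) x * (b - a)))"
      by (intro integral_continuous_on_param) (simp add: case_prod_beta)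
    then show "(\<lambda>x. contour_integral (linepath a b) (\<lambda>z. g z x)) integrable_on {0..1}"
      unfolding contour_integral_integral by (intro integrable_continuous_real) simp
  qed
  have "(\<lambda>z. integral {0..1} (g z)) analytic_on U"
  proof (rule Morera_triangle[OF _ U], goal_cases)
    case 1
    show ?case using integral_continuous_on_param[of U "0::real" 1 g] c by simp
  next
    case (2 a b c)
    show ?case
    proof
      assume hull: "convex hull {a, b, c} \<subseteq> U"
      have sigma_exp: "closed_segment a b \<subseteq> U" "closed_segment b c \<subseteq> U" "closed_segment c a \<subseteq> U"
        by (rule subset_trans[OF closed_segment_subset[OF _ _ convex_convex_hull] hull]; simp add: hull_inc)+
      have "contour_integral (linepath a b) (\<lambda>z. g z x) + contour_integral (linepath b c) (\<lambda>z. g z x)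
          + contour_integral (linepath c a) (\<lambda>z. g z x) = 0" if x: "x \<in> {0..1}" for x
      proof -
        have "(\<lambda>z. g z x) holomorphic_on convex hull {a, b, c}" using h[OF x] hull holomorphic_on_subset by blast
        from Cauchy_theorem_triangle[OF this] show ?thesis
          using has_chain_integral_chain_integral3[of "\<lambda>z. g z x" 0 a b c a]
          by simp
      qed
      then have "integral {0..1} (\<lambda>x. contour_integral (linepath a b) (\<lambda>z. g z x) + contour_integral (linepath b c) (\<lambda>z. g z x)
          + contour_integral (linepath c a) (\<lambda>z. g z x)) = integral {0..1::real} (\<lambda>x. 0)"
        by (rule integral_cong)
      then show "contour_integral (linepath a b) (\<lambda>z. integral {0..1} (g z)) +
         contour_integral (linepath b c) (\<lambda>z. integral {0..1} (g z)) +
         contour_integral (linepath c a) (\<lambda>z. integral {0..1} (g z)) = 0"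
        unfolding ab[OF sigma_exp(1)] ab[OF sigma_exp(2)] ab[OF sigma_exp(3)]
        by (simp add: integral_add int sigma_exp integrable_add)
    qed
  qed
  then show ?thesis using analytic_imp_holomorphic by blast
qed

lemma line_coeff_bound:
  assumes "continuous_on {0..1} (\<lambda>x. g (Complex x y))" "\<And>x. x \<in> {0..1} \<Longrightarrow> norm (g (Complex x y)) \<le> B"
  shows "norm (line_coeff g n y) \<le> B * exp (2 * pi * (of_int n * y))"
proof -
  have "norm (integral {0..1} (\<lambda>x. g (Complex x y) * ee (- (of_int n * Complex x y))))
      \<le> (B * exp (2 * pi * (of_int n * y))) * (1 - 0)"
    by (rule integral_bound)
       (use assms in \<open>auto intro!: continuous_intros mult_mono order_trans[OF norm_ge_zero] simp: norm_mult norm_ee\<close>)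
  then show ?thesis by (simp add: line_coeff_def line_integral_def)
qed

text \<open>Separates one variable: \<open>'b\<close> collects the remaining indices, and
  \<open>unit\<close> gives the one-variable case. If \<open>C k\<close> were nonzero, a finite part
  of the series with tail at most |C k| / 2 would integrate against ee(- k x) to \<open>C k\<close>,
  although the total sum 0 bounds that part by the tail.\<close>

lemma fourier_unique_prod:
  fixes A :: "int \<Rightarrow> 'b \<Rightarrow> complex"
  assumes "\<And>x::real. ((\<lambda>(m,k). A m k * ee (of_int m * of_real x)) has_sum 0) UNIV"
  shows "(A m has_sum 0) UNIV"
proof -
  have sA: "(\<lambda>(m,k). A m k) summable_on UNIV"
    using assms[of 0] by (auto simp: summable_on_def)
  have sm: "A m summable_on UNIV" for m
    using summable_on_SigmaD1[of A UNIV "\<lambda>_. UNIV" m] sA by simp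
  define C where "C m = infsum (A m) UNIV" for m
  have C: "(A m has_sum C m) UNIV" for m unfolding C_def by (rule has_sum_infsum[OF sm])
  have hC: "((\<lambda>m. C m * ee (of_int m * of_real x)) has_sum 0) UNIV" for x :: real
  proof (rule has_sum_SigmaD[where f = "\<lambda>(m,k). A m k * ee (of_int m * of_real x)" and B = "\<lambda>_. UNIV"])
    show "((\<lambda>(m,k). A m k * ee (of_int m * of_real x)) has_sum 0) (UNIV \<times> UNIV)" using assms by simp
    show "((\<lambda>y. case (m, y) of (m,k) \<Rightarrow> A m k * ee (of_int m * of_real x)) has_sum C m * ee (of_int m * of_real x)) UNIV" for m
      using has_sum_cmult_left[OF C] by simp
  qed
  have absC: "(\<lambda>m. norm (C m)) summable_on UNIV"
    using hC[of 0] summable_on_iff_abs_summable_on_complex by (auto simp: summable_on_def)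
  have "C k = 0" for k
  proof (rule ccontr)
    assume nz: "C k \<noteq> 0"
    define e where "e = norm (C k) / 2"
    have e: "e > 0" using nz by (simp add: e_def)
    obtain F where F: "finite F" "dist (sum (\<lambda>m. norm (C m)) F) (infsum (\<lambda>m. norm (C m)) UNIV) \<le> e"
      using infsum_finite_approximation[OF absC e] by blast
    from F(2) have F2: "infsum (\<lambda>m. norm (C m)) UNIV - sum (\<lambda>m. norm (C m)) F \<le> e" by (simp add: dist_real_def)
    define F' where "F' = insert k F"
    have F': "finite F'" "k \<in> F'" using F by (auto simp: F'_def)
    have tail: "infsum (\<lambda>m. norm (C m)) (- F') \<le> e"
    proof -
      have s: "(\<lambda>m. norm (C m)) summable_on X" for X using absC summable_on_subset_banach by blast
      have "infsum (\<lambda>m. norm (C m)) UNIV = infsum (\<lambda>m. norm (C m)) F + infsum (\<lambda>m. norm (C m)) (- F)"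
        using infsum_Un_disjoint[OF s s, of F "- F"] by simp
      moreover have "infsum (\<lambda>m. norm (C m)) (- F') \<le> infsum (\<lambda>m. norm (C m)) (- F)"
        by (rule infsum_mono2) (auto simp: s F'_def)
      ultimately show ?thesis using F2 F(1) by simp
    qed
    have ptw: "norm (sum (\<lambda>m. C m * ee (of_int (m - k) * of_real x)) F') \<le> e" for x :: real
    proof -
      have h: "((\<lambda>m. C m * ee (of_int (m - k) * of_real x)) has_sum 0) UNIV"
        using has_sum_cmult_left[OF hC[of x], of "ee (- (of_int k * of_real x))"]
        by (simp add: mult.assoc ee_add[symmetric] left_diff_distrib)
      have "((\<lambda>m. C m * ee (of_int (m - k) * of_real x)) has_sum (0 - sum (\<lambda>m. C m * ee (of_int (m - k) * of_real x)) F')) (UNIV - F')"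
        by (rule has_sum_Diff[OF h]) (use F' in auto)
      moreover have "((\<lambda>m. norm (C m * ee (of_int (m - k) * of_real x))) has_sum infsum (\<lambda>m. norm (C m)) (- F')) (UNIV - F')"
        using has_sum_infsum[OF summable_on_subset_banach[OF absC, of "- F'"]]
        by (simp add: norm_mult norm_ee Compl_eq_Diff_UNIV)
      ultimately have "norm (0 - sum (\<lambda>m. C m * ee (of_int (m - k) * of_real x)) F') \<le> infsum (\<lambda>m. norm (C m)) (- F')"
        by (rule norm_has_sum_bound[rotated])
      then show ?thesis using tail by simp
    qed
    have i1: "integral {0..1} (\<lambda>x. C m * ee (of_int (m - k) * of_real x)) = (if m = k then C k else 0)" for m
    proof (cases "m = k")
      case False
      define j where "j = m - k"
      have j: "j \<noteq> 0" using False by (simp add: j_def)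
      have "((\<lambda>x. ee (of_int j * Complex x 0)) has_integral
        (ee (of_int j * Complex 1 0) / (2 * of_real pi * \<i> * of_int j) - ee (of_int j * Complex 0 0) / (2 * of_real pi * \<i> * of_int j))) {0..1}"
      proof (rule fundamental_theorem_of_calculus)
        fix x :: real
        show "((\<lambda>x. ee (of_int j * Complex x 0) / (2 * of_real pi * \<i> * of_int j)) has_vector_derivative
            ee (of_int j * Complex x 0)) (at x within {0..1})"
          unfolding ee_def using j
          by (intro has_vector_derivative_hline) (auto intro!: derivative_eq_intros simp: field_simps)
      qed simp
      moreover have "Complex x 0 = of_real x" for x by (simp add: complex_eq_iff)
      ultimately have "((\<lambda>x. ee (of_int j * of_real x)) has_integral 0) {0..1}" by simp
      from integral_unique[OF has_integral_mult_right[OF this, of "C m"]] show ?thesis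
        using False unfolding j_def by (simp del: integral_mult_right integral_mult_left of_int_diff)
    qed simp
    have "norm (integral {0..1} (\<lambda>x. sum (\<lambda>m. C m * ee (of_int (m - k) * of_real x)) F')) \<le> e * (1 - 0)"
      by (rule integral_bound) (auto intro!: continuous_intros ptw simp del: of_int_diff)
    also have "integral {0..1} (\<lambda>x. sum (\<lambda>m. C m * ee (of_int (m - k) * of_real x)) F')
        = (\<Sum>m\<in>F'. integral {0..1} (\<lambda>x. C m * ee (of_int (m - k) * of_real x)))"
      by (rule integral_sum) (auto intro!: integrable_continuous_real continuous_intros F' simp del: of_int_diff)
    also have "\<dots> = C k" unfolding i1 using F' by (simp add: sum.delta)
    finally show False using nz by (simp add: e_def)
  qed
  then show ?thesis using C by metis
qed

lemma fourier_unique3: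
  assumes "\<And>x u x'::real. ((\<lambda>(m,r,n). a m r n * ee (of_int m * (t + of_real x) + of_int r * (z + of_real u) + of_int n * (s + of_real x'))) has_sum 0) UNIV"
  shows "a m r n = 0"
proof -
  have 1: "((\<lambda>(r,n). a m r n * ee (of_int m * t + of_int r * (z + of_real u) + of_int n * (s + of_real x'))) has_sum 0) UNIV" for m and u x' :: real
  proof (rule fourier_unique_prod[of "\<lambda>m (r,n). a m r n * ee (of_int m * t + of_int r * (z + of_real u) + of_int n * (s + of_real x'))"])
    fix x :: real
    show "((\<lambda>(m,k). (case k of (r,n) \<Rightarrow> a m r n * ee (of_int m * t + of_int r * (z + of_real u) + of_int n * (s + of_real x'))) * ee (of_int m * of_real x)) has_sum 0) UNIV"
      by (rule back_subst[of "\<lambda>f. (f has_sum 0) UNIV", OF assms[of x u x']])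
         (auto simp: fun_eq_iff ring_distribs ee_add mult_ac)
  qed
  have 2: "((\<lambda>n. a m r n * ee (of_int m * t + of_int r * z + of_int n * (s + of_real x'))) has_sum 0) UNIV" for m r and x' :: real
  proof (rule fourier_unique_prod[of "\<lambda>r n. a m r n * ee (of_int m * t + of_int r * z + of_int n * (s + of_real x'))"])
    fix u :: real
    show "((\<lambda>(r,n). a m r n * ee (of_int m * t + of_int r * z + of_int n * (s + of_real x')) * ee (of_int r * of_real u)) has_sum 0) UNIV"
      by (rule back_subst[of "\<lambda>f. (f has_sum 0) UNIV", OF 1[of m u x']])
         (auto simp: fun_eq_iff ring_distribs ee_add mult_ac)
  qed
  have "((\<lambda>n::int. a m r n * ee (of_int m * t + of_int r * z + of_int n * s) * ee (of_int n * of_real x)) has_sum 0) UNIV" for x :: real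
    using 2[of m r x] by (simp add: ring_distribs ee_add mult_ac)
  then have "((\<lambda>(n::int, k::unit). a m r n * ee (of_int m * t + of_int r * z + of_int n * s) * ee (of_int n * of_real x)) has_sum 0) UNIV" for x :: real
    using has_sum_reindex_bij_betw[of "\<lambda>n. (n, ())" UNIV UNIV
        "\<lambda>(n::int, k::unit). a m r n * ee (of_int m * t + of_int r * z + of_int n * s) * ee (of_int n * of_real x)" 0]
    by (simp add: bij_betw_def inj_on_def surj_def)
  from fourier_unique_prod[of "\<lambda>n (k::unit). a m r n * ee (of_int m * t + of_int r * z + of_int n * s)", OF this, of n]
  show ?thesis by (auto simp: has_sum_finite_iff)
qed

section \<open>Iterated Fourier coefficients on the Siegel domain\<close>

definition siegel_domain :: "(complex \<times> complex \<times> complex) set" where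
  "siegel_domain = {(t,z,s). 0 < Im s \<and> 0 < Im t \<and> (Im z)\<^sup>2 < Im t * Im s}"

text \<open>For fixed z and s the section in t is a half plane, nonempty for every z. This is why z
  can range over the whole plane once t has been integrated out.\<close>

lemma siegel_domain_iff: "(t,z,s) \<in> siegel_domain \<longleftrightarrow> 0 < Im s \<and> (Im z)\<^sup>2 / Im s < Im t"
proof (cases "0 < Im s")
  case True
  have "0 < Im t" if "(Im z)\<^sup>2 < Im t * Im s"
    using order_le_less_trans[OF zero_le_power2 that] True by (simp add: zero_less_mult_iff)
  then show ?thesis using True by (auto simp: siegel_domain_def divide_less_eq)
qed (auto simp: siegel_domain_def)

locale siegel_fourier =
  fixes f :: "complex \<Rightarrow> complex \<Rightarrow> complex \<Rightarrow> complex"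
  assumes cont: "continuous_on siegel_domain (\<lambda>(t,z,s). f t z s)"
    and hol1: "\<And>z s. (\<lambda>t. f t z s) holomorphic_on {t. (t,z,s) \<in> siegel_domain}"
    and hol2: "\<And>t s. (\<lambda>z. f t z s) holomorphic_on {z. (t,z,s) \<in> siegel_domain}"
    and hol3: "\<And>t z. (\<lambda>s. f t z s) holomorphic_on {s. (t,z,s) \<in> siegel_domain}"
    and per1: "\<And>t z s. (t,z,s) \<in> siegel_domain \<Longrightarrow> f (t + 1) z s = f t z s"
    and per2: "\<And>t z s. (t,z,s) \<in> siegel_domain \<Longrightarrow> f t (z + 1) s = f t z s"
    and per3: "\<And>t z s. (t,z,s) \<in> siegel_domain \<Longrightarrow> f t z (s + 1) = f t z s"
begin

text \<open>The heights of the integration lines are arbitrary points of the domain. The indices of \<open>c3\<close> follow the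
  order of the variables, so \<open>c3 m r n\<close> belongs to the matrix \<open>half_int m n r\<close>.\<close>

definition "c1 m z s = line_coeff (\<lambda>t. f t z s) m ((Im z)\<^sup>2 / Im s + 1)"
definition "c2 m r s = line_coeff (\<lambda>z. c1 m z s) r 0"
definition "c3 m r n = line_coeff (\<lambda>s. c2 m r s) n 1"

lemma hol1': "0 < Im s \<Longrightarrow> (\<lambda>t. f t z s) holomorphic_on {t. (Im z)\<^sup>2 / Im s < Im t}"
  using hol1[of z s] by (simp add: siegel_domain_iff)

lemma c1_eq:
  assumes "0 < Im s" "(Im z)\<^sup>2 / Im s < y"
  shows "c1 m z s = line_coeff (\<lambda>t. f t z s) m y"
  unfolding c1_def
  by (rule line_coeff_const[OF line_domain_halfplane hol1'[OF assms(1)]]) (use assms in \<open>auto intro!: per1 simp: siegel_domain_iff\<close>)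

lemma c1_sum:
  assumes "(t,z,s) \<in> siegel_domain"
  shows "((\<lambda>m. c1 m z s * ee (of_int m * t)) has_sum f t z s) UNIV"
  unfolding c1_def
  by (rule fourier_has_sum[OF line_domain_halfplane hol1']) (use assms in \<open>auto intro!: per1 simp: siegel_domain_iff\<close>)

text \<open>The height of integration in \<open>c1\<close> varies with z and s. A height valid on a
  whole neighbourhood is required before holomorphy can be read off under the integral sign;
  \<open>c1_eq\<close> permits the change.\<close>

lemma c1_local:
  assumes "0 < Im sc"
  obtains y where "\<And>z s. z \<in> ball zc 1 \<Longrightarrow> s \<in> ball sc (Im sc / 2) \<Longrightarrow> 0 < Im s \<and> (Im z)\<^sup>2 / Im s < y"
proof -
  have "0 < Im s \<and> (Im z)\<^sup>2 / Im s < (\<bar>Im zc\<bar> + 1)\<^sup>2 / (Im sc / 2) + 1"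
    if "z \<in> ball zc 1" "s \<in> ball sc (Im sc / 2)" for z s
  proof -
    have "\<bar>Im sc - Im s\<bar> < Im sc / 2" using that(2) abs_Im_le_cmod[of "sc - s"] by (simp add: dist_norm)
    then have s: "Im sc / 2 < Im s" by arith
    have "\<bar>Im zc - Im z\<bar> < 1" using that(1) abs_Im_le_cmod[of "zc - z"] by (simp add: dist_norm)
    then have "\<bar>Im z\<bar> \<le> \<bar>\<bar>Im zc\<bar> + 1\<bar>" by arith
    then have "(Im z)\<^sup>2 \<le> (\<bar>Im zc\<bar> + 1)\<^sup>2" by (rule abs_le_square_iff[THEN iffD1])
    then have "(Im z)\<^sup>2 / Im s \<le> (\<bar>Im zc\<bar> + 1)\<^sup>2 / (Im sc / 2)"
      using s assms by (intro frac_le) auto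
    then show ?thesis using s assms by auto
  qed
  then show ?thesis using that by blast
qed

lemma c1_local_eq:
  assumes "0 < Im sc"
  obtains y where
    "\<And>m z s. z \<in> ball zc 1 \<Longrightarrow> s \<in> ball sc (Im sc / 2) \<Longrightarrow>
       c1 m z s = integral {0..1} (\<lambda>x. f (Complex x y) z s * ee (- (of_int m * Complex x y)))"
    "\<And>x z s. z \<in> ball zc 1 \<Longrightarrow> s \<in> ball sc (Im sc / 2) \<Longrightarrow> (Complex x y, z, s) \<in> siegel_domain"
proof -
  obtain y where y: "\<And>z s. z \<in> ball zc 1 \<Longrightarrow> s \<in> ball sc (Im sc / 2) \<Longrightarrow> 0 < Im s \<and> (Im z)\<^sup>2 / Im s < y"
    using c1_local[OF assms] by blast
  show ?thesis
  proof (rule that[of y])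
    fix m z s assume "z \<in> ball zc 1" "s \<in> ball sc (Im sc / 2)"
    from y[OF this] show "c1 m z s = integral {0..1} (\<lambda>x. f (Complex x y) z s * ee (- (of_int m * Complex x y)))"
      by (subst c1_eq[of s z y]) (auto simp: line_coeff_def line_integral_def)
  qed (use y in \<open>auto simp: siegel_domain_iff\<close>)
qed

lemma cont3:
  assumes "continuous_on A g1" "continuous_on A g2" "continuous_on A g3"
    "\<And>p. p \<in> A \<Longrightarrow> (g1 p, g2 p, g3 p) \<in> siegel_domain"
  shows "continuous_on A (\<lambda>p. f (g1 p) (g2 p) (g3 p))"
proof -
  have "continuous_on A (\<lambda>p. case (g1 p, g2 p, g3 p) of (t,z,s) \<Rightarrow> f t z s)"
    by (rule continuous_on_compose2[OF cont]) (use assms in \<open>auto intro!: continuous_intros\<close>)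
  then show ?thesis by simp
qed

lemma c1_cont: "continuous_on (UNIV \<times> {s. 0 < Im s}) (\<lambda>(z,s). c1 m z s)"
proof -
  have "isCont (\<lambda>(z,s). c1 m z s) (z0,s0)" if s0: "0 < Im s0" for z0 s0
  proof -
    obtain y where y: "\<And>m z s. z \<in> ball z0 1 \<Longrightarrow> s \<in> ball s0 (Im s0 / 2) \<Longrightarrow>
       c1 m z s = integral {0..1} (\<lambda>x. f (Complex x y) z s * ee (- (of_int m * Complex x y)))"
      "\<And>x z s. z \<in> ball z0 1 \<Longrightarrow> s \<in> ball s0 (Im s0 / 2) \<Longrightarrow> (Complex x y, z, s) \<in> siegel_domain"
      using c1_local_eq[OF s0, where zc = z0] by blast
    let ?U = "ball z0 1 \<times> ball s0 (Im s0 / 2)"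
    have "continuous_on ?U (\<lambda>p. integral (cbox 0 1) (\<lambda>x. f (Complex x y) (fst p) (snd p) * ee (- (of_int m * Complex x y))))"
      by (rule integral_continuous_on_param)
         (use y in \<open>auto simp: case_prod_beta Complex_eq intro!: continuous_intros cont3\<close>)
    then have "continuous_on ?U (\<lambda>(z,s). c1 m z s)"
      by (rule continuous_on_eq) (use y in auto)
    then show ?thesis using s0 by (auto simp: continuous_on_eq_continuous_at open_Times)
  qed
  then show ?thesis by (intro continuous_at_imp_continuous_on) auto
qed

lemma c1_hol_z:
  assumes s: "0 < Im s" shows "(\<lambda>z. c1 m z s) holomorphic_on UNIV"
proof (rule holomorphic_onI)
  fix z0 :: complex
  obtain y where y: "\<And>m z s'. z \<in> ball z0 1 \<Longrightarrow> s' \<in> ball s (Im s / 2) \<Longrightarrow>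
       c1 m z s' = integral {0..1} (\<lambda>x. f (Complex x y) z s' * ee (- (of_int m * Complex x y)))"
      "\<And>x z s'. z \<in> ball z0 1 \<Longrightarrow> s' \<in> ball s (Im s / 2) \<Longrightarrow> (Complex x y, z, s') \<in> siegel_domain"
    using c1_local_eq[OF s, where zc = z0] by blast
  have sigma: "s \<in> ball s (Im s / 2)" using s by simp
  have "(\<lambda>z. integral {0..1} (\<lambda>x. f (Complex x y) z s * ee (- (of_int m * Complex x y)))) holomorphic_on ball z0 1"
  proof (rule holomorphic_integral_param)
    show "continuous_on (ball z0 1 \<times> {0..1}) (\<lambda>(z,x). f (Complex x y) z s * ee (- (of_int m * Complex x y)))"
      using y(2)[OF _ sigma] by (auto simp: case_prod_beta Complex_eq intro!: continuous_intros cont3)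
    show "(\<lambda>z. f (Complex x y) z s * ee (- (of_int m * Complex x y))) holomorphic_on ball z0 1" for x
      using y(2)[OF _ sigma] by (intro holomorphic_intros holomorphic_on_subset[OF hol2]) auto
  qed simp
  then have "(\<lambda>z. c1 m z s) holomorphic_on ball z0 1"
    by (rule holomorphic_transform) (use y(1)[OF _ sigma] in auto)
  then show "(\<lambda>z. c1 m z s) field_differentiable at z0 within UNIV"
    by (auto intro: holomorphic_on_imp_differentiable_at)
qed

lemma c1_hol_s: "(\<lambda>s. c1 m z s) holomorphic_on {s. 0 < Im s}"
proof (rule holomorphic_onI)
  fix s0 :: complex assume "s0 \<in> {s. 0 < Im s}"
  then have s0: "0 < Im s0" by simp
  obtain y where y: "\<And>m z' s'. z' \<in> ball z 1 \<Longrightarrow> s' \<in> ball s0 (Im s0 / 2) \<Longrightarrow>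
       c1 m z' s' = integral {0..1} (\<lambda>x. f (Complex x y) z' s' * ee (- (of_int m * Complex x y)))"
      "\<And>x z' s'. z' \<in> ball z 1 \<Longrightarrow> s' \<in> ball s0 (Im s0 / 2) \<Longrightarrow> (Complex x y, z', s') \<in> siegel_domain"
    using c1_local_eq[OF s0, where zc = z] by blast
  have zz: "z \<in> ball z 1" by simp
  have "(\<lambda>s. integral {0..1} (\<lambda>x. f (Complex x y) z s * ee (- (of_int m * Complex x y)))) holomorphic_on ball s0 (Im s0 / 2)"
  proof (rule holomorphic_integral_param)
    show "continuous_on (ball s0 (Im s0 / 2) \<times> {0..1}) (\<lambda>(s,x). f (Complex x y) z s * ee (- (of_int m * Complex x y)))"
      using y(2)[OF zz] by (auto simp: case_prod_beta Complex_eq intro!: continuous_intros cont3)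
    show "(\<lambda>s. f (Complex x y) z s * ee (- (of_int m * Complex x y))) holomorphic_on ball s0 (Im s0 / 2)" for x
      using y(2)[OF zz] by (intro holomorphic_intros holomorphic_on_subset[OF hol3]) auto
  qed simp
  then have "(\<lambda>s. c1 m z s) holomorphic_on ball s0 (Im s0 / 2)"
    by (rule holomorphic_transform) (use y(1)[OF zz] in auto)
  then have "(\<lambda>s. c1 m z s) field_differentiable at s0"
    by (rule holomorphic_on_imp_differentiable_at) (use s0 in auto)
  then show "(\<lambda>s. c1 m z s) field_differentiable at s0 within {s. 0 < Im s}"
    by (rule field_differentiable_at_within)
qed

lemma c1_per_z: assumes "0 < Im s" shows "c1 m (z + 1) s = c1 m z s"
  unfolding c1_def line_coeff_def line_integral_def using assms by (intro integral_cong) (auto intro!: per2 simp: siegel_domain_iff)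

lemma c1_per_s: assumes "0 < Im s" shows "c1 m z (s + 1) = c1 m z s"
  unfolding c1_def line_coeff_def line_integral_def using assms by (intro integral_cong) (auto intro!: per3 simp: siegel_domain_iff)

lemma c2_eq: assumes "0 < Im s" shows "c2 m r s = line_coeff (\<lambda>z. c1 m z s) r v"
  unfolding c2_def by (rule line_coeff_const[OF line_domain_UNIV c1_hol_z]) (use assms in \<open>auto intro: c1_per_z\<close>)

lemma c2_sum:
  assumes "0 < Im s" shows "((\<lambda>r. c2 m r s * ee (of_int r * z)) has_sum c1 m z s) UNIV"
  unfolding c2_def by (rule fourier_has_sum[OF line_domain_UNIV c1_hol_z]) (use assms in \<open>auto intro: c1_per_z\<close>)

lemma c2_hol: "(\<lambda>s. c2 m r s) holomorphic_on {s. 0 < Im s}"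
  unfolding c2_def line_coeff_def line_integral_def
proof (rule holomorphic_integral_param)
  show "open {s. 0 < Im s}" by (rule open_halfspace_Im_gt)
  show "continuous_on ({s. 0 < Im s} \<times> {0..1}) (\<lambda>(s,x). c1 m (Complex x 0) s * ee (- (of_int r * Complex x 0)))"
    unfolding case_prod_beta
    by (intro continuous_intros continuous_on_compose2[OF c1_cont[unfolded case_prod_beta], of _ "\<lambda>p. (Complex (snd p) 0, fst p)", simplified])
       (auto simp: Complex_eq intro!: continuous_intros)
qed (intro holomorphic_intros c1_hol_s)

lemma c2_per: assumes "0 < Im s" shows "c2 m r (s + 1) = c2 m r s"
  unfolding c2_def line_coeff_def line_integral_def using assms by (simp add: c1_per_s)

lemma c3_eq: assumes "0 < w" shows "c3 m r n = line_coeff (\<lambda>s. c2 m r s) n w"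
  unfolding c3_def by (rule line_coeff_const[OF line_domain_halfplane c2_hol]) (use assms in \<open>auto intro: c2_per\<close>)

lemma c3_sum:
  assumes "0 < Im s" shows "((\<lambda>n. c3 m r n * ee (of_int n * s)) has_sum c2 m r s) UNIV"
  unfolding c3_def by (rule fourier_has_sum[OF line_domain_halfplane c2_hol]) (use assms in \<open>auto intro: c2_per\<close>)

text \<open>A Cauchy estimate with free heights (y, v, w): every admissible line computes the same
  coefficient, so the heights may be adapted to the index (m, r, n).\<close>

lemma c3_bound:
  assumes w: "0 < w" "v\<^sup>2 < y * w" "0 < y"
    and M: "\<And>x u x'. x \<in> {0..1} \<Longrightarrow> u \<in> {0..1} \<Longrightarrow> x' \<in> {0..1} \<Longrightarrow> norm (f (Complex x y) (Complex u v) (Complex x' w)) \<le> M"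
  shows "norm (c3 m r n) \<le> M * exp (2 * pi * (of_int m * y + of_int r * v + of_int n * w))"
proof -
  have DDi: "(Complex x y, Complex u v, Complex x' w) \<in> siegel_domain" for x u x' using w by (simp add: siegel_domain_def)
  have b1: "norm (c1 m (Complex u v) (Complex x' w)) \<le> M * exp (2 * pi * (of_int m * y))"
    if "u \<in> {0..1}" "x' \<in> {0..1}" for u x'
  proof -
    have "c1 m (Complex u v) (Complex x' w) = line_coeff (\<lambda>t. f t (Complex u v) (Complex x' w)) m y"
      by (rule c1_eq) (use w in \<open>auto simp: divide_less_eq\<close>)
    moreover have "continuous_on {0..1} (\<lambda>x. f (Complex x y) (Complex u v) (Complex x' w))"
      by (intro cont3 continuous_intros DDi)
    ultimately show ?thesis
      using line_coeff_bound[of "\<lambda>t. f t (Complex u v) (Complex x' w)" y M m] M that by auto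
  qed
  have b2: "norm (c2 m r (Complex x' w)) \<le> M * exp (2 * pi * (of_int m * y)) * exp (2 * pi * (of_int r * v))"
    if "x' \<in> {0..1}" for x'
  proof -
    have "c2 m r (Complex x' w) = line_coeff (\<lambda>z. c1 m z (Complex x' w)) r v" by (rule c2_eq) (use w in auto)
    moreover have "continuous_on {0..1} (\<lambda>x. c1 m (Complex x v) (Complex x' w))"
      by (rule continuous_on_hline[OF line_domain_UNIV _ holomorphic_on_imp_continuous_on[OF c1_hol_z]]) (use w in auto)
    ultimately show ?thesis using line_coeff_bound[of "\<lambda>z. c1 m z (Complex x' w)" v _ r] b1 that by auto
  qed
  have "c3 m r n = line_coeff (\<lambda>s. c2 m r s) n w" by (rule c3_eq[OF w(1)])
  moreover have "continuous_on {0..1} (\<lambda>x. c2 m r (Complex x w))"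
    by (rule continuous_on_hline[OF line_domain_halfplane _ holomorphic_on_imp_continuous_on[OF c2_hol]]) (use w in auto)
  ultimately have "norm (c3 m r n) \<le> M * exp (2 * pi * (of_int m * y)) * exp (2 * pi * (of_int r * v)) * exp (2 * pi * (of_int n * w))"
    using line_coeff_bound[of "\<lambda>s. c2 m r s" w _ n] b2 by auto
  then show ?thesis by (simp add: exp_add ring_distribs mult_ac)
qed

lemma summable_exp_int: 
  assumes "0 < (e::real)" shows "(\<lambda>m::int. exp (- (e * \<bar>of_int m\<bar>))) summable_on UNIV"
proof -
  have r: "0 \<le> exp (- e)" "exp (- e) < 1" using assms by auto
  have s: "summable (\<lambda>k. exp (- e) ^ k)" using r by (intro summable_geometric) auto
  have s1: "summable (\<lambda>k. exp (- e) ^ (k + 1))" using s by (rule summable_ignore_initial_segment)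
  have 1: "((\<lambda>k::nat. complex_of_real (exp (- (e * \<bar>of_int (int k)\<bar>)))) has_sum (of_real (suminf (\<lambda>k. exp (- e) ^ k)))) UNIV"
  proof (rule norm_summable_imp_has_sum)
    have *: "exp (- (e * \<bar>of_int (int k)\<bar>)) = exp (- e) ^ k" for k
      by (simp add: exp_of_nat_mult[symmetric] mult.commute)
    show "(\<lambda>k::nat. complex_of_real (exp (- (e * \<bar>of_int (int k)\<bar>)))) sums of_real (suminf (\<lambda>k. exp (- e) ^ k))"
      unfolding * sums_of_real_iff using s by (rule summable_sums)
    show "summable (\<lambda>k. norm (complex_of_real (exp (- (e * \<bar>of_int (int k)\<bar>)))))"
      unfolding * using s by (simp add: norm_of_real del: of_real_power)
  qed
  have 2: "((\<lambda>k::nat. complex_of_real (exp (- (e * \<bar>of_int (- int k - 1)\<bar>)))) has_sum (of_real (suminf (\<lambda>k. exp (- e) ^ (k + 1))))) UNIV"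
  proof (rule norm_summable_imp_has_sum)
    have *: "exp (- (e * \<bar>of_int (- int k - 1)\<bar>)) = exp (- e) ^ (k + 1)" for k
      by (simp add: exp_of_nat_mult[symmetric] mult.commute exp_add[symmetric] algebra_simps)
    show "(\<lambda>k::nat. complex_of_real (exp (- (e * \<bar>of_int (- int k - 1)\<bar>)))) sums of_real (suminf (\<lambda>k. exp (- e) ^ (k + 1)))"
      unfolding * sums_of_real_iff using s1 by (rule summable_sums)
    show "summable (\<lambda>k. norm (complex_of_real (exp (- (e * \<bar>of_int (- int k - 1)\<bar>)))))"
      unfolding * using s1 by (simp add: norm_of_real del: of_real_power power_Suc)
  qed
  show ?thesis
    using has_sum_bounded_linear[OF bounded_linear_Re has_sum_int_split[of "\<lambda>m. complex_of_real (exp (- (e * \<bar>of_int m\<bar>)))", OF 1 2]]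
    unfolding Re_complex_of_real summable_on_def by blast
qed

lemma summable_times_nonneg:
  fixes g :: "'a \<Rightarrow> real" and h :: "'b \<Rightarrow> real"
  assumes "g summable_on UNIV" "h summable_on UNIV" "\<And>x. 0 \<le> g x" "\<And>x. 0 \<le> h x"
  shows "(\<lambda>(x,y). g x * h y) summable_on UNIV"
proof -
  have "(\<lambda>(x,y). g x * h y) summable_on (UNIV \<times> UNIV)"
  proof (rule summable_on_SigmaI)
    show "((\<lambda>y. case (x, y) of (x, y) \<Rightarrow> g x * h y) has_sum g x * infsum h UNIV) UNIV" for x
      using has_sum_cmult_right[OF has_sum_infsum[OF assms(2)]] by simp
    show "(\<lambda>x. g x * infsum h UNIV) summable_on UNIV" by (rule summable_on_cmult_left[OF assms(1)])
  qed (use assms in auto)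
  then show ?thesis by simp
qed

lemma c3_abs_summable:
  assumes D: "(t,z,s) \<in> siegel_domain"
  shows "(\<lambda>(m,r,n). norm (c3 m r n * ee (of_int m * t + of_int r * z + of_int n * s))) summable_on UNIV"
proof -
  define y v w where "y = Im t" and "v = Im z" and "w = Im s"
  have pos: "0 < y" "0 < w" "v\<^sup>2 < y * w" using D by (auto simp: y_def v_def w_def siegel_domain_def)
  \<comment> \<open>Finds a box of radius e around the heights that stays in the domain; y - e, w -
    e and |v| + e form its worst corner.\<close>
  have "((\<lambda>e. (y - e) * (w - e) - (\<bar>v\<bar> + e)\<^sup>2) \<longlongrightarrow> (y - 0) * (w - 0) - (\<bar>v\<bar> + 0)\<^sup>2) (at_right 0)"
    by (intro tendsto_intros)
  then have "eventually (\<lambda>e. 0 < (y - e) * (w - e) - (\<bar>v\<bar> + e)\<^sup>2) (at_right 0)"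
    by (rule order_tendstoD) (use pos in auto)
  moreover have "eventually (\<lambda>e. e < min y w) (at_right 0)"
    by (rule order_tendstoD(2)[OF tendsto_ident_at]) (use pos in auto)
  moreover have "eventually (\<lambda>e::real. 0 < e) (at_right 0)" by (simp add: eventually_at_right_less)
  ultimately have "eventually (\<lambda>e. 0 < (y - e) * (w - e) - (\<bar>v\<bar> + e)\<^sup>2 \<and> e < min y w \<and> 0 < e) (at_right 0)"
    by eventually_elim auto
  then obtain e where e: "0 < (y - e) * (w - e) - (\<bar>v\<bar> + e)\<^sup>2" "e < min y w" "0 < e"
    using eventually_happens'[OF trivial_limit_at_right_real] by blast
  have box: "0 < y' \<and> 0 < w' \<and> v'\<^sup>2 < y' * w'"
    if "y' \<in> {y-e..y+e}" "v' \<in> {v-e..v+e}" "w' \<in> {w-e..w+e}" for y' v' w'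
  proof -
    have "\<bar>v'\<bar> \<le> \<bar>\<bar>v\<bar> + e\<bar>" using that by auto
    then have "v'\<^sup>2 \<le> (\<bar>v\<bar> + e)\<^sup>2" by (rule abs_le_square_iff[THEN iffD1])
    also have "\<dots> < (y - e) * (w - e)" using e by simp
    also have "\<dots> \<le> y' * w'" using that e by (intro mult_mono) auto
    finally show ?thesis using that e by auto
  qed
  let ?K = "{0..1::real} \<times> {0..1::real} \<times> {0..1::real} \<times> {y-e..y+e} \<times> {v-e..v+e} \<times> {w-e..w+e}"
  let ?F = "\<lambda>(x,u,x',y',v',w'). f (Complex x y') (Complex u v') (Complex x' w')"
  have "continuous_on ?K ?F"
    unfolding case_prod_beta Complex_eq
    by (intro cont3 continuous_intros) (use box in \<open>auto simp: siegel_domain_def\<close>)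
  then have "bounded (?F ` ?K)"
    by (intro compact_imp_bounded compact_continuous_image compact_Times) auto
  then obtain M where M: "\<And>p. p \<in> ?K \<Longrightarrow> norm (?F p) \<le> M" unfolding bounded_iff by blast
  define sigma_exp where "sigma_exp m = (if (m::int) \<ge> 0 then - e else e)" for m
  have sigma_exp: "of_int m * sigma_exp m = - (e * \<bar>of_int m\<bar>)" "sigma_exp m \<in> {-e..e}" for m using e by (auto simp: sigma_exp_def)
  define g where "g m = exp (- (2 * pi * e * \<bar>of_int m\<bar>))" for m :: int
  have bound: "norm (c3 m r n * ee (of_int m * t + of_int r * z + of_int n * s)) \<le> M * (g m * (g r * g n))" for m r n
  proof -
    have "norm (c3 m r n) \<le> M * exp (2 * pi * (of_int m * (y + sigma_exp m) + of_int r * (v + sigma_exp r) + of_int n * (w + sigma_exp n)))"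
    proof (rule c3_bound)
      have i: "y + sigma_exp m \<in> {y-e..y+e}" "v + sigma_exp r \<in> {v-e..v+e}" "w + sigma_exp n \<in> {w-e..w+e}" using sigma_exp(2) by auto
      show "0 < w + sigma_exp n" "(v + sigma_exp r)\<^sup>2 < (y + sigma_exp m) * (w + sigma_exp n)" "0 < y + sigma_exp m" using box[OF i] by auto
      fix x u x' :: real assume "x \<in> {0..1}" "u \<in> {0..1}" "x' \<in> {0..1}"
      then show "norm (f (Complex x (y + sigma_exp m)) (Complex u (v + sigma_exp r)) (Complex x' (w + sigma_exp n))) \<le> M"
        using M[of "(x,u,x',y + sigma_exp m, v + sigma_exp r, w + sigma_exp n)"] i by auto
    qed
    then have "norm (c3 m r n) * exp (- 2 * pi * (of_int m * y + of_int r * v + of_int n * w))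
       \<le> M * exp (2 * pi * (of_int m * (y + sigma_exp m) + of_int r * (v + sigma_exp r) + of_int n * (w + sigma_exp n)))
         * exp (- 2 * pi * (of_int m * y + of_int r * v + of_int n * w))"
      by (intro mult_right_mono) auto
    also have "\<dots> = M * (g m * (g r * g n))"
      unfolding g_def mult.assoc exp_add[symmetric] by (simp add: ring_distribs sigma_exp algebra_simps)
    also have "norm (c3 m r n) * exp (- 2 * pi * (of_int m * y + of_int r * v + of_int n * w))
      = norm (c3 m r n * ee (of_int m * t + of_int r * z + of_int n * s))"
      by (simp add: norm_mult norm_ee y_def v_def w_def)
    finally show ?thesis .
  qed
  have gs: "g summable_on UNIV" using summable_exp_int[of "2 * pi * e"] e by (simp add: g_def[abs_def])
  have g0: "0 \<le> g m" for m by (simp add: g_def)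
  have "(\<lambda>(m,rn). g m * (case rn of (r,n) \<Rightarrow> g r * g n)) summable_on UNIV"
    by (rule summable_times_nonneg[OF gs summable_times_nonneg[OF gs gs]]) (use g0 in auto)
  then have "(\<lambda>p. M * (case p of (m,rn) \<Rightarrow> g m * (case rn of (r,n) \<Rightarrow> g r * g n))) summable_on UNIV"
    by (rule summable_on_cmult_right)
  then show ?thesis
    by (rule summable_on_comparison_test) (use bound in auto)
qed

text \<open>Absolute summability upgrades the three nested one-variable expansions to one
  unconditional sum over triples.\<close>

theorem c3_has_sum:
  assumes D: "(t,z,s) \<in> siegel_domain"
  shows "((\<lambda>(m,r,n). c3 m r n * ee (of_int m * t + of_int r * z + of_int n * s)) has_sum f t z s) UNIV"
proof -
  let ?a = "\<lambda>m r n. c3 m r n * ee (of_int m * t + of_int r * z + of_int n * s)"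
  have s: "0 < Im s" using D by (simp add: siegel_domain_def)
  have "(\<lambda>(m,r,n). ?a m r n) summable_on UNIV"
    by (rule abs_summable_summable, rule summable_on_cong[THEN iffD1, OF _ c3_abs_summable[OF D]]) auto
  then have sum1: "(\<lambda>(m,p). case p of (r,n) \<Rightarrow> ?a m r n) summable_on UNIV \<times> UNIV" by simp
  have sum2: "(\<lambda>(r,n). ?a m r n) summable_on UNIV \<times> UNIV" for m
    using summable_on_SigmaD1[OF sum1, of m] by simp
  have "((\<lambda>(r,n). ?a m r n) has_sum c1 m z s * ee (of_int m * t)) (UNIV \<times> UNIV)" for m
  proof (rule has_sum_SigmaI)
    show "((\<lambda>n. case (r, n) of (r,n) \<Rightarrow> ?a m r n) has_sum (c2 m r s * ee (of_int r * z)) * ee (of_int m * t)) UNIV" for r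
      using has_sum_cmult_left[OF c3_sum[OF s, of m r], of "ee (of_int r * z) * ee (of_int m * t)"]
      by (simp add: ee_add mult_ac)
    show "((\<lambda>r. c2 m r s * ee (of_int r * z) * ee (of_int m * t)) has_sum c1 m z s * ee (of_int m * t)) UNIV"
      by (rule has_sum_cmult_left[OF c2_sum[OF s]])
  qed (use sum2 in auto)
  then have "((\<lambda>(m,p). case p of (r,n) \<Rightarrow> ?a m r n) has_sum f t z s) (UNIV \<times> UNIV)"
    by (intro has_sum_SigmaI[OF _ c1_sum[OF D]]) (use sum1 in auto)
  then show ?thesis by simp
qed

end

section \<open>Fourier coefficients of Siegel modular forms\<close>

no_notation fps_nth (infixl "$" 75)

definition sym_mat :: "complex \<Rightarrow> complex \<Rightarrow> complex \<Rightarrow> complex ^ 2 ^ 2" where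
  "sym_mat t z s = (\<chi> i j. if i = 1 then (if j = 1 then t else z) else (if j = 1 then z else s))"

lemma sym_mat_nth [simp]: "sym_mat t z s $ 1 $ 1 = t" "sym_mat t z s $ 1 $ 2 = z" "sym_mat t z s $ 2 $ 1 = z" "sym_mat t z s $ 2 $ 2 = s"
  by (simp_all add: sym_mat_def)

lemma mat2_eq_iff: "(A :: 'a ^ 2 ^ 2) = B \<longleftrightarrow> A $ 1 $ 1 = B $ 1 $ 1 \<and> A $ 1 $ 2 = B $ 1 $ 2 \<and> A $ 2 $ 1 = B $ 2 $ 1 \<and> A $ 2 $ 2 = B $ 2 $ 2"
proof -
  have "A = B \<longleftrightarrow> (\<forall>i j. A $ i $ j = B $ i $ j)" by (metis vec_eq_iff)
  then show ?thesis unfolding forall_2 by blast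
qed

lemma transpose_sym_iff: "transpose (A :: 'a ^ 2 ^ 2) = A \<longleftrightarrow> A $ 1 $ 2 = A $ 2 $ 1"
  by (auto simp: mat2_eq_iff transpose_def)

lemma quadratic_form_2:
  fixes A :: "real ^ 2 ^ 2"
  shows "x \<bullet> (A *v x) = A $ 1 $ 1 * (x $ 1)\<^sup>2 + (A $ 1 $ 2 + A $ 2 $ 1) * (x $ 1 * x $ 2) + A $ 2 $ 2 * (x $ 2)\<^sup>2"
  by (simp add: inner_vec_def matrix_vector_mult_def sum_2 power2_eq_square algebra_simps)

lemma positive_definite_2:
  fixes A :: "real ^ 2 ^ 2"
  shows "positive_definite A \<longleftrightarrow> A $ 1 $ 2 = A $ 2 $ 1 \<and> 0 < A $ 1 $ 1 \<and> 0 < A $ 2 $ 2 \<and> (A $ 1 $ 2)\<^sup>2 < A $ 1 $ 1 * A $ 2 $ 2"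
    (is "?L \<longleftrightarrow> ?R")
proof
  assume L: ?L
  then have s: "A $ 1 $ 2 = A $ 2 $ 1" by (simp add: positive_definite_def transpose_sym_iff)
  have pos: "0 < A $ 1 $ 1 * x\<^sup>2 + 2 * A $ 1 $ 2 * (x * y) + A $ 2 $ 2 * y\<^sup>2" if "(x,y) \<noteq> (0,0)" for x y
  proof -
    have "(vector [x,y] :: real ^ 2) \<noteq> 0" using that by (auto simp: vec_eq_iff forall_2)
    then have "0 < vector [x,y] \<bullet> (A *v vector [x,y])" using L unfolding positive_definite_def by blast
    then show ?thesis unfolding quadratic_form_2 using s by simp
  qed
  have a: "0 < A $ 1 $ 1" using pos[of 1 0] by simp
  have d: "0 < A $ 2 $ 2" using pos[of 0 1] by simp
  \<comment> \<open>At this vector the form equals \<open>A $ 2 $ 2\<close> times the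
    determinant.\<close>
  have "0 < A $ 2 $ 2 * (A $ 1 $ 1 * A $ 2 $ 2 - (A $ 1 $ 2)\<^sup>2)"
    using pos[of "A $ 2 $ 2" "- A $ 1 $ 2"] d by (simp add: power2_eq_square algebra_simps)
  then have "0 < A $ 1 $ 1 * A $ 2 $ 2 - (A $ 1 $ 2)\<^sup>2" using d by (simp add: zero_less_mult_iff)
  with a d s show ?R by simp
next
  assume R: ?R
  have "0 < x \<bullet> (A *v x)" if "x \<noteq> 0" for x
  proof -
    have xx: "x $ 1 \<noteq> 0 \<or> x $ 2 \<noteq> 0" using that by (auto simp: vec_eq_iff forall_2)
    have e: "A $ 1 $ 1 * (x \<bullet> (A *v x)) = (A $ 1 $ 1 * x $ 1 + A $ 1 $ 2 * x $ 2)\<^sup>2 + (A $ 1 $ 1 * A $ 2 $ 2 - (A $ 1 $ 2)\<^sup>2) * (x $ 2)\<^sup>2"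
      unfolding quadratic_form_2 using R by (simp add: power2_eq_square algebra_simps)
    have "0 < A $ 1 $ 1 * (x \<bullet> (A *v x))"
    proof (cases "x $ 2 = 0")
      case True then show ?thesis unfolding e using xx R by simp
    next
      case False
      then have "0 < (A $ 1 $ 1 * A $ 2 $ 2 - (A $ 1 $ 2)\<^sup>2) * (x $ 2)\<^sup>2" using R by (intro mult_pos_pos) auto
      then show ?thesis unfolding e by (simp add: add_nonneg_pos)
    qed
    then show ?thesis using R by (simp add: zero_less_mult_iff)
  qed
  then show ?L using R by (simp add: positive_definite_def transpose_sym_iff)
qed

lemma positive_semidefinite_2:
  fixes A :: "real ^ 2 ^ 2"
  shows "positive_semidefinite A \<longleftrightarrow> A $ 1 $ 2 = A $ 2 $ 1 \<and> 0 \<le> A $ 1 $ 1 \<and> 0 \<le> A $ 2 $ 2 \<and> (A $ 1 $ 2)\<^sup>2 \<le> A $ 1 $ 1 * A $ 2 $ 2"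
    (is "?L \<longleftrightarrow> ?R")
proof
  assume L: ?L
  then have s: "A $ 1 $ 2 = A $ 2 $ 1" by (simp add: positive_semidefinite_def transpose_sym_iff)
  have pos: "0 \<le> A $ 1 $ 1 * x\<^sup>2 + 2 * A $ 1 $ 2 * (x * y) + A $ 2 $ 2 * y\<^sup>2" for x y
  proof -
    have "0 \<le> vector [x,y] \<bullet> (A *v vector [x,y])" using L unfolding positive_semidefinite_def by blast
    then show ?thesis unfolding quadratic_form_2 using s by simp
  qed
  have a: "0 \<le> A $ 1 $ 1" using pos[of 1 0] by simp
  have d: "0 \<le> A $ 2 $ 2" using pos[of 0 1] by simp
  have "(A $ 1 $ 2)\<^sup>2 \<le> A $ 1 $ 1 * A $ 2 $ 2"
  proof (cases "A $ 2 $ 2 = 0")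
    case True
    then have "0 \<le> A $ 1 $ 1 + 2 * A $ 1 $ 2 * y" for y using pos[of 1 y] by simp
    \<comment> \<open>The witness at which the linear function of y would take the value -1.\<close>
    from this[of "- (A $ 1 $ 1 + 1) / (2 * A $ 1 $ 2)"] have "A $ 1 $ 2 = 0"
      by (cases "A $ 1 $ 2 = 0") auto
    then show ?thesis using True by simp
  next
    case False
    have "0 \<le> A $ 2 $ 2 * (A $ 1 $ 1 * A $ 2 $ 2 - (A $ 1 $ 2)\<^sup>2)"
      using pos[of "A $ 2 $ 2" "- A $ 1 $ 2"] by (simp add: power2_eq_square algebra_simps)
    then show ?thesis using d False by (simp add: zero_le_mult_iff)
  qed
  with a d s show ?R by simp
next
  assume R: ?R
  have "0 \<le> x \<bullet> (A *v x)" for x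
  proof (cases "A $ 1 $ 1 = 0")
    case True
    then have "A $ 1 $ 2 = 0" using R by simp
    then show ?thesis unfolding quadratic_form_2 using R True by simp
  next
    case False
    have e: "A $ 1 $ 1 * (x \<bullet> (A *v x)) = (A $ 1 $ 1 * x $ 1 + A $ 1 $ 2 * x $ 2)\<^sup>2 + (A $ 1 $ 1 * A $ 2 $ 2 - (A $ 1 $ 2)\<^sup>2) * (x $ 2)\<^sup>2"
      unfolding quadratic_form_2 using R by (simp add: power2_eq_square algebra_simps)
    have "0 \<le> A $ 1 $ 1 * (x \<bullet> (A *v x))" unfolding e
      by (intro add_nonneg_nonneg mult_nonneg_nonneg) (use R in auto)
    then show ?thesis using R False by (simp add: zero_le_mult_iff)
  qed
  then show ?L using R by (simp add: positive_semidefinite_def transpose_sym_iff)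
qed

lemma sym_mat_in_H2 [simp]: "sym_mat t z s \<in> siegel_H2 \<longleftrightarrow> (t,z,s) \<in> siegel_domain"
  by (auto simp: siegel_H2_def transpose_sym_iff positive_definite_2 map_matrix_def siegel_domain_def)

lemma siegel_H2_sym_mat: "Z \<in> siegel_H2 \<Longrightarrow> Z = sym_mat (Z $ 1 $ 1) (Z $ 1 $ 2) (Z $ 2 $ 2)"
  unfolding mat2_eq_iff[of Z] by (simp add: siegel_H2_def transpose_sym_iff)

lemma continuous_on_sym_mat [continuous_intros]:
  assumes "continuous_on S f" "continuous_on S g" "continuous_on S h"
  shows "continuous_on S (\<lambda>x. sym_mat (f x) (g x) (h x))"
  unfolding sym_mat_def using assms
  by (intro continuous_on_vec_lambda, rename_tac i j, case_tac "i = 1"; case_tac "j = 1"; simp)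

text \<open>On an affine complex line with direction \<open>E\<close> the complex linear derivative
  \<open>L\<close> becomes multiplication by \<open>L E\<close>.\<close>

lemma holomorphic_line:
  assumes F: "holomorphic_on_H2 F" and E: "\<And>c. Z c = Z0 + (\<chi> i j. c * E $ i $ j)"
  shows "(\<lambda>c. F (Z c)) holomorphic_on {c. Z c \<in> siegel_H2}"
proof (rule holomorphic_onI)
  fix c assume "c \<in> {c. Z c \<in> siegel_H2}"
  then obtain L where L: "(F has_derivative L) (at (Z c) within siegel_H2)"
     "\<And>c X. L (\<chi> i j. c * X $ i $ j) = c * L X"
    using F unfolding holomorphic_on_H2_def by blast
  have lin: "linear (\<lambda>c::complex. (\<chi> i j. c * E $ i $ j) :: complex ^ 2 ^ 2)"
    by (rule linearI) (auto simp: vec_eq_iff ring_distribs)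
  have "(Z has_derivative (\<lambda>c. \<chi> i j. c * E $ i $ j)) (at c within {c. Z c \<in> siegel_H2})"
    unfolding E[abs_def] using has_derivative_add_const[OF linear_imp_has_derivative[OF lin]]
    by (auto simp: add.commute intro!: derivative_eq_intros linear_imp_has_derivative lin)
  moreover have "(F has_derivative L) (at (Z c) within Z ` {c. Z c \<in> siegel_H2})"
    by (rule has_derivative_subset[OF L(1)]) auto
  ultimately have "((\<lambda>c. F (Z c)) has_derivative (\<lambda>c. L (\<chi> i j. c * E $ i $ j))) (at c within {c. Z c \<in> siegel_H2})"
    by (rule has_derivative_in_compose)
  then have "((\<lambda>c. F (Z c)) has_field_derivative L E) (at c within {c. Z c \<in> siegel_H2})"
    unfolding has_field_derivative_def L(2) by (simp add: mult_commute_abs)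
  then show "(\<lambda>c. F (Z c)) field_differentiable at c within {c. Z c \<in> siegel_H2}"
    unfolding field_differentiable_def by blast
qed

section \<open>Block matrices and transformation laws\<close>

definition block_mat :: "'a ^ 2 ^ 2 \<Rightarrow> 'a ^ 2 ^ 2 \<Rightarrow> 'a ^ 2 ^ 2 \<Rightarrow> 'a ^ 2 ^ 2 \<Rightarrow> 'a ^ (2 + 2) ^ (2 + 2)" where
  "block_mat A B C D = (\<chi> i j. case i of Inl a \<Rightarrow> (case j of Inl b \<Rightarrow> A $ a $ b | Inr b \<Rightarrow> B $ a $ b)
      | Inr a \<Rightarrow> (case j of Inl b \<Rightarrow> C $ a $ b | Inr b \<Rightarrow> D $ a $ b))"

lemma block_block_mat [simp]: "blockA (block_mat A B C D) = A" "blockB (block_mat A B C D) = B" "blockC (block_mat A B C D) = C" "blockD (block_mat A B C D) = D"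
  by (simp_all add: blockA_def blockB_def blockC_def blockD_def block_mat_def vec_eq_iff)

lemma sum_UNIV_sum: "(\<Sum>x\<in>UNIV. f x) = (\<Sum>x\<in>UNIV. f (Inl x :: 'a::finite + 'b::finite)) + (\<Sum>x\<in>UNIV. f (Inr x))"
proof -
  have "(\<Sum>x\<in>UNIV. f x) = (\<Sum>x\<in>range Inl. f x) + (\<Sum>x\<in>range Inr. f x)"
    unfolding UNIV_sum by (rule sum.union_disjoint) auto
  then show ?thesis by (simp add: sum.reindex)
qed

lemma block_mat_in_Gamma2:
  fixes A B C D :: "int ^ 2 ^ 2"
  assumes "A$1$1*C$1$2 + A$2$1*C$2$2 = C$1$1*A$1$2 + C$2$1*A$2$2"
    "B$1$1*D$1$2 + B$2$1*D$2$2 = D$1$1*B$1$2 + D$2$1*B$2$2"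
    "A$1$1*D$1$1 + A$2$1*D$2$1 - C$1$1*B$1$1 - C$2$1*B$2$1 = 1"
    "A$1$1*D$1$2 + A$2$1*D$2$2 - C$1$1*B$1$2 - C$2$1*B$2$2 = 0"
    "A$1$2*D$1$1 + A$2$2*D$2$1 - C$1$2*B$1$1 - C$2$2*B$2$1 = 0"
    "A$1$2*D$1$2 + A$2$2*D$2$2 - C$1$2*B$1$2 - C$2$2*B$2$2 = 1"
  shows "block_mat A B C D \<in> Gamma2"
  unfolding Gamma2_def mem_Collect_eq vec_eq_iff
  using assms
  by (simp add: matrix_matrix_mult_def transpose_def symplectic_J_def block_mat_def sum_UNIV_sum sum_2 forall_2 split_sum_all algebra_simps)

definition int_mat2 :: "int \<Rightarrow> int \<Rightarrow> int \<Rightarrow> int \<Rightarrow> int ^ 2 ^ 2" where "int_mat2 a b c d = vector [vector [a, b], vector [c, d]]"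

lemma int_mat2_nth [simp]: "int_mat2 a b c d $ 1 $ 1 = a" "int_mat2 a b c d $ 1 $ 2 = b" "int_mat2 a b c d $ 2 $ 1 = c" "int_mat2 a b c d $ 2 $ 2 = d"
  by (simp_all add: int_mat2_def)

text \<open>The inverse in \<open>siegel_action\<close> is never computed: the image W is recognised
  by W (C Z + D) = A Z + B, which can be checked entrywise.\<close>

lemma modular_transform:
  assumes F: "F \<in> siegel_modular_forms k" and M: "block_mat A B C D \<in> Gamma2" and Z: "Z \<in> siegel_H2"
    and J: "J = map_matrix of_int C ** Z + map_matrix of_int D" and nz: "det J \<noteq> 0"
    and W: "W ** J = map_matrix of_int A ** Z + map_matrix of_int B"
  shows "F W = det J ^ k * F Z"
proof -
  have aut: "automorphy_matrix (block_mat A B C D) Z = J" by (simp add: automorphy_matrix_def J)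
  have "invertible J" using nz by (simp add: invertible_det_nz)
  then have "\<exists>B. J ** B = mat 1 \<and> B ** J = mat 1" by (simp add: invertible_def)
  then have inv: "J ** matrix_inv J = mat 1" unfolding matrix_inv_def by (rule someI_ex[THEN conjunct1])
  have "siegel_action (block_mat A B C D) Z = W"
    unfolding siegel_action_def aut block_block_mat W[symmetric] by (simp add: matrix_mul_assoc[symmetric] inv)
  then show ?thesis using F M Z aut unfolding siegel_modular_forms_def by auto
qed

lemma minus_one_power_twice: "(- 1) ^ j * ((- 1) ^ j * (x :: complex)) = x"
  by (simp add: mult.assoc[symmetric] power_mult_distrib[symmetric])

lemma half_int_nth [simp]: "half_int m n r $ 1 $ 1 = of_int m" "half_int m n r $ 1 $ 2 = of_int r / 2"
  "half_int m n r $ 2 $ 1 = of_int r / 2" "half_int m n r $ 2 $ 2 = of_int n"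
  by (simp_all add: half_int_def)

lemma half_int_in_L2: "half_int m n r \<in> L2 \<longleftrightarrow> 0 \<le> m \<and> 0 \<le> n \<and> r\<^sup>2 \<le> 4 * m * n"
proof -
  have "(real_of_int r)\<^sup>2 \<le> 4 * (real_of_int m * real_of_int n) \<longleftrightarrow> r\<^sup>2 \<le> 4 * m * n"
    by (metis (no_types, opaque_lifting) mult.assoc of_int_le_iff of_int_mult of_int_numeral of_int_power)
  then show ?thesis
    by (auto simp: L2_def Lambda2_def transpose_sym_iff positive_semidefinite_2 forall_2 power_divide)
qed

lemma L2_half_int: assumes "T \<in> L2" obtains m n r where "T = half_int m n r"
proof -
  have "T $ 1 $ 1 \<in> \<int>" "T $ 2 $ 2 \<in> \<int>" "2 * T $ 1 $ 2 \<in> \<int>" "T $ 1 $ 2 = T $ 2 $ 1"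
    using assms by (auto simp: L2_def Lambda2_def transpose_sym_iff)
  then obtain m n r :: int where "T $ 1 $ 1 = of_int m" "T $ 2 $ 2 = of_int n" "2 * T $ 1 $ 2 = of_int r" "T $ 1 $ 2 = T $ 2 $ 1"
    unfolding Ints_def by blast
  then show ?thesis by (intro that[of m n r]) (auto simp: mat2_eq_iff)
qed

locale siegel_form =
  fixes k :: nat and F :: "complex ^ 2 ^ 2 \<Rightarrow> complex"
  assumes F: "F \<in> siegel_modular_forms k"
begin

definition "f t z s = F (sym_mat t z s)"

lemma law_translate:
  assumes "(t,z,s) \<in> siegel_domain"
  shows "f (t + of_int b1) (z + of_int b2) (s + of_int b3) = f t z s"
proof -
  have "F (sym_mat (t + of_int b1) (z + of_int b2) (s + of_int b3)) = det (sym_mat 1 0 1) ^ k * F (sym_mat t z s)"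
    by (rule modular_transform[OF F, of "int_mat2 1 0 0 1" "int_mat2 b1 b2 b2 b3" "int_mat2 0 0 0 0" "int_mat2 1 0 0 1"])
       (use assms in \<open>auto intro!: block_mat_in_Gamma2 simp: mat2_eq_iff matrix_matrix_mult_def sum_2 map_matrix_def det_2\<close>)
  then show ?thesis by (simp add: f_def det_2)
qed

text \<open>Comes from the diagonal blocks U and its inverse transpose, with U = (1 0; l 1), acting
  by Z -> U Z U^T.\<close>

lemma law_shear:
  assumes "(t,z,s) \<in> siegel_domain"
  shows "f t (z + of_int l * t) (s + 2 * of_int l * z + of_int l ^ 2 * t) = f t z s"
proof -
  define J :: "complex ^ 2 ^ 2" where "J = map_matrix of_int (int_mat2 0 0 0 0) ** sym_mat t z s + map_matrix of_int (int_mat2 1 (- l) 0 1)"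
  have d: "det J = 1" by (simp add: J_def det_2 matrix_matrix_mult_def sum_2 map_matrix_def)
  have "F (sym_mat t (z + of_int l * t) (s + 2 * of_int l * z + of_int l ^ 2 * t)) = det J ^ k * F (sym_mat t z s)"
    by (rule modular_transform[OF F _ _ J_def, where A = "int_mat2 1 0 l 1" and B = "int_mat2 0 0 0 0"])
       (simp_all add: block_mat_in_Gamma2 d assms, simp_all add: J_def mat2_eq_iff matrix_matrix_mult_def sum_2 map_matrix_def algebra_simps power2_eq_square)
  then show ?thesis by (simp add: f_def d)
qed

text \<open>A block U of determinant -1 has automorphy factor (-1)^k. In odd weight this law and
  \<open>law_neg\<close> are the source of the two antisymmetries.\<close>

lemma law_swap:
  assumes "(t,z,s) \<in> siegel_domain"
  shows "f s z t = (- 1) ^ k * f t z s"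
proof -
  define J :: "complex ^ 2 ^ 2" where "J = map_matrix of_int (int_mat2 0 0 0 0) ** sym_mat t z s + map_matrix of_int (int_mat2 0 1 1 0)"
  have d: "det J = - 1" by (simp add: J_def det_2 matrix_matrix_mult_def sum_2 map_matrix_def)
  have "F (sym_mat s z t) = det J ^ k * F (sym_mat t z s)"
    by (rule modular_transform[OF F _ _ J_def, where A = "int_mat2 0 1 1 0" and B = "int_mat2 0 0 0 0"])
       (simp_all add: block_mat_in_Gamma2 d assms, simp_all add: J_def mat2_eq_iff matrix_matrix_mult_def sum_2 map_matrix_def)
  then show ?thesis by (simp add: f_def d)
qed

lemma law_neg:
  assumes "(t,z,s) \<in> siegel_domain"
  shows "f t (- z) s = (- 1) ^ k * f t z s"
proof -
  define J :: "complex ^ 2 ^ 2" where "J = map_matrix of_int (int_mat2 0 0 0 0) ** sym_mat t z s + map_matrix of_int (int_mat2 1 0 0 (- 1))"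
  have d: "det J = - 1" by (simp add: J_def det_2 matrix_matrix_mult_def sum_2 map_matrix_def)
  have "F (sym_mat t (- z) s) = det J ^ k * F (sym_mat t z s)"
    by (rule modular_transform[OF F _ _ J_def, where A = "int_mat2 1 0 0 (- 1)" and B = "int_mat2 0 0 0 0"])
       (simp_all add: block_mat_in_Gamma2 d assms, simp_all add: J_def mat2_eq_iff matrix_matrix_mult_def sum_2 map_matrix_def)
  then show ?thesis by (simp add: f_def d)
qed

text \<open>The inversion of SL_2(Z) embedded in the first variable. It only translates s, so it
  acts on each Fourier-Jacobi coefficient separately.\<close>

lemma law_S:
  assumes D: "(t,z,s) \<in> siegel_domain"
  shows "f (- 1 / t) (z / t) (s - z\<^sup>2 / t) = t ^ k * f t z s"
proof -
  have t0: "t \<noteq> 0" using D by (auto simp: siegel_domain_def)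
  define J :: "complex ^ 2 ^ 2" where "J = map_matrix of_int (int_mat2 1 0 0 0) ** sym_mat t z s + map_matrix of_int (int_mat2 0 0 0 1)"
  have d: "det J = t" by (simp add: J_def det_2 matrix_matrix_mult_def sum_2 map_matrix_def)
  have "F (sym_mat (- 1 / t) (z / t) (s - z\<^sup>2 / t)) = det J ^ k * F (sym_mat t z s)"
    by (rule modular_transform[OF F _ _ J_def, where A = "int_mat2 0 0 0 1" and B = "int_mat2 (- 1) 0 0 0"])
       (simp_all add: block_mat_in_Gamma2 d assms t0, simp_all add: t0 J_def mat2_eq_iff matrix_matrix_mult_def sum_2 map_matrix_def power2_eq_square)
  then show ?thesis by (simp add: f_def d)
qed

lemma F_cont: "continuous_on siegel_H2 F"
  unfolding continuous_on_eq_continuous_within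
proof
  fix Z assume "Z \<in> siegel_H2"
  then obtain L where "(F has_derivative L) (at Z within siegel_H2)"
    using F unfolding siegel_modular_forms_def holomorphic_on_H2_def by blast
  then show "continuous (at Z within siegel_H2) F" by (rule has_derivative_continuous)
qed

sublocale siegel_fourier f
proof
  have h: "holomorphic_on_H2 F" using F by (auto simp: siegel_modular_forms_def)
  have "continuous_on siegel_domain (\<lambda>p. F (sym_mat (fst p) (fst (snd p)) (snd (snd p))))"
    by (rule continuous_on_compose2[OF F_cont]) (auto intro!: continuous_intros)
  then show "continuous_on siegel_domain (\<lambda>(t,z,s). f t z s)" by (simp add: f_def case_prod_beta)
  show "(\<lambda>t. f t z s) holomorphic_on {t. (t,z,s) \<in> siegel_domain}" for z s
    using holomorphic_line[OF h, of "\<lambda>t. sym_mat t z s" "sym_mat 0 z s" "sym_mat 1 0 0"] by (simp add: f_def mat2_eq_iff)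
  show "(\<lambda>z. f t z s) holomorphic_on {z. (t,z,s) \<in> siegel_domain}" for t s
    using holomorphic_line[OF h, of "\<lambda>z. sym_mat t z s" "sym_mat t 0 s" "sym_mat 0 1 0"] by (simp add: f_def mat2_eq_iff)
  show "(\<lambda>s. f t z s) holomorphic_on {s. (t,z,s) \<in> siegel_domain}" for t z
    using holomorphic_line[OF h, of "\<lambda>s. sym_mat t z s" "sym_mat t z 0" "sym_mat 0 0 1"] by (simp add: f_def mat2_eq_iff)
qed (use law_translate[of _ _ _ 1 0 0] law_translate[of _ _ _ 0 1 0] law_translate[of _ _ _ 0 0 1] in auto)

section \<open>Symmetries and support of the Fourier coefficients\<close>

lemma c3_unique:
  assumes "\<And>t z s. (t,z,s) \<in> siegel_domain \<Longrightarrow>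
    ((\<lambda>(m,r,n). b m r n * ee (of_int m * t + of_int r * z + of_int n * s)) has_sum f t z s) UNIV"
  shows "b m r n = c3 m r n"
proof -
  have "b m r n - c3 m r n = 0"
  proof (rule fourier_unique3[where t = \<i> and z = 0 and s = \<i>])
    fix x u x' :: real
    have D: "(\<i> + of_real x, 0 + of_real u, \<i> + of_real x') \<in> siegel_domain" by (simp add: siegel_domain_def)
    show "((\<lambda>(m,r,n). (b m r n - c3 m r n) * ee (of_int m * (\<i> + of_real x) + of_int r * (0 + of_real u) + of_int n * (\<i> + of_real x'))) has_sum 0) UNIV"
      by (rule back_subst[of "\<lambda>g. (g has_sum 0) UNIV", OF has_sum_add[OF assms[OF D] has_sum_cmult_right[OF c3_has_sum[OF D], of "- 1"], simplified]])
         (auto simp: fun_eq_iff left_diff_distrib)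
  qed
  then show ?thesis by simp
qed

text \<open>Substituting z + l t and s + 2 l z + l^2 t into m t + r z + n s permutes the indices and
  preserves r^2 - 4 m n.\<close>

lemma c3_shear: "c3 (m + r * l + n * l\<^sup>2) (r + 2 * l * n) n = c3 m r n"
proof -
  define b where "b m r n = c3 (m + r * (- l) + n * l\<^sup>2) (r - 2 * l * n) n" for m r n
  have "b m r n = c3 m r n" for m r n
  proof (rule c3_unique)
    fix t z s assume D: "(t,z,s) \<in> siegel_domain"
    have D': "(t, z + of_int l * t, s + 2 * of_int l * z + of_int l ^ 2 * t) \<in> siegel_domain"
    proof -
      have "(Im t) * (Im s + 2 * l * Im z + l\<^sup>2 * Im t) - (Im z + l * Im t)\<^sup>2 = Im t * Im s - (Im z)\<^sup>2"
        by (simp add: power2_eq_square algebra_simps)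
      then have 1: "(Im z + l * Im t)\<^sup>2 < (Im t) * (Im s + 2 * l * Im z + l\<^sup>2 * Im t)" using D by (simp add: siegel_domain_def)
      then have "0 < Im t * (Im s + 2 * l * Im z + l\<^sup>2 * Im t)" using zero_le_power2 order_le_less_trans by blast
      then have "0 < Im s + 2 * l * Im z + l\<^sup>2 * Im t" using D by (simp add: siegel_domain_def zero_less_mult_iff)
      then show ?thesis using 1 D by (simp add: siegel_domain_def power2_eq_square)
    qed
    have bij: "bij_betw (\<lambda>(m,r,n). (m + r * (- l) + n * l\<^sup>2, r - 2 * l * n, n)) UNIV UNIV"
      by (rule bij_betwI[where g = "\<lambda>(m,r,n). (m + r * l + n * l\<^sup>2, r + 2 * l * n, n)"])
         (auto simp: power2_eq_square algebra_simps)
    have "((\<lambda>p. case (case p of (m,r,n) \<Rightarrow> (m + r * (- l) + n * l\<^sup>2, r - 2 * l * n, n)) of (m,r,n) \<Rightarrow>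
        c3 m r n * ee (of_int m * t + of_int r * (z + of_int l * t) + of_int n * (s + 2 * of_int l * z + of_int l ^ 2 * t))) has_sum f t z s) UNIV"
      using c3_has_sum[OF D'] unfolding law_shear[OF D] by (subst has_sum_reindex_bij_betw[OF bij])
    then show "((\<lambda>(m,r,n). b m r n * ee (of_int m * t + of_int r * z + of_int n * s)) has_sum f t z s) UNIV"
      by (rule back_subst[of "\<lambda>g. (g has_sum f t z s) UNIV"])
         (auto simp: fun_eq_iff b_def power2_eq_square algebra_simps)
  qed
  from this[of "m + r * l + n * l\<^sup>2" "r + 2 * l * n" n] show ?thesis
    by (simp add: b_def power2_eq_square algebra_simps)
qed

lemma c3_swap: "c3 n r m = (- 1) ^ k * c3 m r n"
proof -
  define b where "b m r n = (- 1) ^ k * c3 n r m" for m r n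
  have "b m r n = c3 m r n" for m r n
  proof (rule c3_unique)
    fix t z s assume D: "(t,z,s) \<in> siegel_domain"
    then have D': "(s, z, t) \<in> siegel_domain" by (simp add: siegel_domain_def mult.commute)
    have bij: "bij_betw (\<lambda>(m,r,n). (n,r,m)) UNIV UNIV"
      by (rule bij_betwI[where g = "\<lambda>(m,r,n). (n,r,m)"]) auto
    have "((\<lambda>p. case (case p of (m,r,n) \<Rightarrow> (n,r,m)) of (m,r,n) \<Rightarrow>
        c3 m r n * ee (of_int m * s + of_int r * z + of_int n * t)) has_sum (- 1) ^ k * f t z s) UNIV"
      using c3_has_sum[OF D'] unfolding law_swap[OF D] by (subst has_sum_reindex_bij_betw[OF bij])
    from has_sum_cmult_right[OF this, of "(- 1) ^ k", unfolded minus_one_power_twice]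
    show "((\<lambda>(m,r,n). b m r n * ee (of_int m * t + of_int r * z + of_int n * s)) has_sum f t z s) UNIV"
      by (rule back_subst[of "\<lambda>g. (g has_sum f t z s) UNIV"])
         (auto simp: fun_eq_iff b_def algebra_simps)
  qed
  from this[of n r m] show ?thesis by (simp add: b_def)
qed

lemma c3_neg: "c3 m (- r) n = (- 1) ^ k * c3 m r n"
proof -
  define b where "b m r n = (- 1) ^ k * c3 m (- r) n" for m r n
  have "b m r n = c3 m r n" for m r n
  proof (rule c3_unique)
    fix t z s assume D: "(t,z,s) \<in> siegel_domain"
    then have D': "(t, - z, s) \<in> siegel_domain" by (simp add: siegel_domain_def)
    have bij: "bij_betw (\<lambda>(m::int, r::int, n::int). (m, - r, n)) UNIV UNIV"
      by (rule bij_betwI[where g = "\<lambda>(m,r,n). (m,- r,n)"]) auto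
    have "((\<lambda>p. case (case p of (m,r,n) \<Rightarrow> (m,- r,n)) of (m,r,n) \<Rightarrow>
        c3 m r n * ee (of_int m * t + of_int r * (- z) + of_int n * s)) has_sum (- 1) ^ k * f t z s) UNIV"
      using c3_has_sum[OF D'] unfolding law_neg[OF D] by (subst has_sum_reindex_bij_betw[OF bij])
    from has_sum_cmult_right[OF this, of "(- 1) ^ k", unfolded minus_one_power_twice]
    show "((\<lambda>(m,r,n). b m r n * ee (of_int m * t + of_int r * z + of_int n * s)) has_sum f t z s) UNIV"
      by (rule back_subst[of "\<lambda>g. (g has_sum f t z s) UNIV"])
         (auto simp: fun_eq_iff b_def algebra_simps)
  qed
  from this[of m "- r" n] show ?thesis by (simp add: b_def)
qed

text \<open>Koecher's principle: for \<open>n < 0\<close> the shears carry \<open>(m, r, n)\<close> to infinitely many indices with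
  the same coefficient and \<open>m\<close> tending to \<open>-\<infinity>\<close>, against convergence.\<close>

lemma c3_negative_n:
  assumes n: "n < 0" shows "c3 m r n = 0"
proof (rule ccontr)
  assume nz: "c3 m r n \<noteq> 0"
  have D: "(\<i>,0,\<i>) \<in> siegel_domain" by (simp add: siegel_domain_def)
  define \<pi> where "\<pi> = (\<lambda>l::nat. (m + r * int l + n * (int l)\<^sup>2, r + 2 * int l * n, n))"
  have inj: "inj \<pi>" using n by (auto simp: inj_on_def \<pi>_def)
  let ?g = "\<lambda>(m,r,n). norm (c3 m r n * ee (of_int m * \<i> + of_int r * 0 + of_int n * \<i>))"
  have "?g summable_on range \<pi>" by (rule summable_on_subset_banach[OF c3_abs_summable[OF D]]) auto
  then have "(?g \<circ> \<pi>) summable_on UNIV" using summable_on_reindex[OF inj] by blast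
  then have "summable (?g \<circ> \<pi>)" by (rule summable_on_imp_summable)
  then have lim: "(?g \<circ> \<pi>) \<longlonglongrightarrow> 0" by (rule summable_LIMSEQ_zero)
  have "norm (c3 m r n) \<le> (?g \<circ> \<pi>) l" if l: "l \<ge> nat (\<bar>m\<bar> + \<bar>r\<bar> + 1)" for l
  proof -
    have L: "int l \<ge> \<bar>m\<bar> + \<bar>r\<bar> + 1" using l by linarith
    have "(\<bar>m\<bar> + \<bar>r\<bar>) * int l \<le> int l * int l" by (rule mult_right_mono) (use L in auto)
    moreover have "\<bar>m\<bar> * 1 \<le> \<bar>m\<bar> * int l" by (rule mult_left_mono) (use L in auto)
    moreover have "r * int l \<le> \<bar>r\<bar> * int l" by (rule mult_right_mono) auto
    moreover have "n * (int l)\<^sup>2 \<le> (- 1) * (int l)\<^sup>2" by (rule mult_right_mono) (use n in auto)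
    ultimately have le: "m + r * int l + n * (int l)\<^sup>2 + n \<le> 0" using n by (simp add: power2_eq_square algebra_simps)
    have "(?g \<circ> \<pi>) l = norm (c3 m r n) * exp (- 2 * pi * of_int (m + r * int l + n * (int l)\<^sup>2 + n))"
      by (simp add: \<pi>_def c3_shear norm_mult norm_ee)
    moreover have "1 \<le> exp (- 2 * pi * of_int (m + r * int l + n * (int l)\<^sup>2 + n))"
    proof -
      have "real_of_int (m + r * int l + n * (int l)\<^sup>2 + n) \<le> 0" using le by linarith
      then have "0 \<le> - 2 * pi * real_of_int (m + r * int l + n * (int l)\<^sup>2 + n)"
        using mult_nonneg_nonpos[of "2 * pi"] by fastforce
      then show ?thesis by simp
    qed
    ultimately show ?thesis using mult_left_mono[of 1 _ "norm (c3 m r n)"] by fastforce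
  qed
  then have "norm (c3 m r n) \<le> 0"
    by (intro LIMSEQ_le_const[OF lim]) blast
  then show False using nz by simp
qed

lemma c3_negative_m: "m < 0 \<Longrightarrow> c3 m r n = 0"
  using c3_swap[of m r n] c3_negative_n by simp

text \<open>Descent on m + n among the indices with 4 m n < r^2, a condition kept by shear and swap.
  If n < |r| or m < |r|, one shear step lowers m + n; if |r| is at most both, then r^2 <= m n
  contradicts it. The boundary case m n = 0 is sheared to a negative index.\<close>

lemma c3_support:
  assumes "c3 m r n \<noteq> 0" shows "0 \<le> m \<and> 0 \<le> n \<and> r\<^sup>2 \<le> 4 * m * n"
proof -
  have nonneg: "0 \<le> m \<and> 0 \<le> n" if "c3 m r n \<noteq> 0" for m r n
    using that c3_negative_n c3_negative_m by (metis not_le)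
  have "c3 m r n = 0" if "4 * m * n < r\<^sup>2" for m r n
    using that
  proof (induction "nat (m + n)" arbitrary: m r n rule: less_induct)
    case less
    show ?case
    proof (rule ccontr)
      assume nz: "c3 m r n \<noteq> 0"
      have mn: "0 \<le> m" "0 \<le> n" using nonneg[OF nz] by auto
      have step: "\<not> (0 < n \<and> n < \<bar>r\<bar>)" if nz: "c3 m r n \<noteq> 0" and lt: "4 * m * n < r\<^sup>2"
         and IH: "\<And>m' r' n'. nat (m' + n') < nat (m + n) \<Longrightarrow> 4 * m' * n' < r'\<^sup>2 \<Longrightarrow> c3 m' r' n' = 0" for m r n
      proof
        assume n: "0 < n \<and> n < \<bar>r\<bar>"
        define l where "l = - sgn r"
        have l: "l\<^sup>2 = 1" "r * l = - \<bar>r\<bar>" using n by (auto simp: l_def sgn_if)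
        have e: "c3 (m - \<bar>r\<bar> + n) (r + 2 * l * n) n = c3 m r n" using c3_shear[of m r l n] l by simp
        have "0 \<le> m - \<bar>r\<bar> + n" using nonneg[of "m - \<bar>r\<bar> + n" "r + 2 * l * n" n] e nz by simp
        moreover have "4 * (m - \<bar>r\<bar> + n) * n < (r + 2 * l * n)\<^sup>2"
        proof -
          have "(r + 2 * l * n)\<^sup>2 = r\<^sup>2 + 4 * n * (r * l) + 4 * n\<^sup>2 * l\<^sup>2" by (simp add: power2_eq_square algebra_simps)
          also have "\<dots> = r\<^sup>2 - 4 * n * \<bar>r\<bar> + 4 * n\<^sup>2" by (simp add: l)
          finally show ?thesis using lt by (simp add: power2_eq_square algebra_simps)
        qed
        ultimately have "c3 (m - \<bar>r\<bar> + n) (r + 2 * l * n) n = 0" using n by (intro IH) auto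
        then show False using e nz by simp
      qed
      have n0: "n \<noteq> 0" if "c3 m r n \<noteq> 0" "4 * m * n < r\<^sup>2" for m r n
      proof
        assume "n = 0"
        with that have r: "r \<noteq> 0" by auto
        \<comment> \<open>For n = 0 the shear adds r l to m, and m - |r| (m + 1) is
          negative.\<close>
        define l where "l = - sgn r * (m + 1)"
        have "r * l = - (\<bar>r\<bar> * (m + 1))" by (simp add: l_def mult.assoc[symmetric] abs_sgn)
        moreover have "0 \<le> m" using nonneg[OF that(1)] by simp
        moreover have "m + 1 \<le> \<bar>r\<bar> * (m + 1)"
          using r \<open>0 \<le> m\<close> mult_right_mono[of 1 "\<bar>r\<bar>" "m + 1"] by simp
        ultimately have "m + r * l < 0" by linarith
        then have "c3 (m + r * l) r 0 = 0" by (rule c3_negative_m)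
        then show False using c3_shear[of m r l 0] that \<open>n = 0\<close> by simp
      qed
      have nz': "c3 n r m \<noteq> 0" using c3_swap[of n r m] nz by simp
      have lt': "4 * n * m < r\<^sup>2" using less.prems by (simp add: mult_ac)
      have "n \<noteq> 0" by (rule n0[OF nz less.prems])
      moreover have "m \<noteq> 0" by (rule n0[OF nz' lt'])
      ultimately have pos: "0 < m" "0 < n" using mn by auto
      have "\<bar>r\<bar> \<le> n" using step[OF nz less.prems less.hyps] pos by auto
      moreover have "\<bar>r\<bar> \<le> m" using step[OF nz' lt'] less.hyps pos by (auto simp: add.commute)
      ultimately have "\<bar>r\<bar> * \<bar>r\<bar> \<le> m * n" using pos by (intro mult_mono) auto
      moreover have "0 < m * n" using pos by simp
      ultimately show False using less.prems by (simp add: power2_eq_square)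
    qed
  qed
  then show ?thesis using assms nonneg by (meson not_le)
qed

section \<open>Identification with \<open>fourier_coeff\<close>\<close>

definition half_int_triple where "half_int_triple = (\<lambda>(m,r,n). half_int m n r)"
definition psd_triples :: "(int \<times> int \<times> int) set" where "psd_triples = {(m,r,n). 0 \<le> m \<and> 0 \<le> n \<and> r\<^sup>2 \<le> 4 * m * n}"

lemma inj_half_int_triple: "inj_on half_int_triple A"
  by (auto simp: inj_on_def half_int_triple_def mat2_eq_iff)

lemma half_int_triple_psd_triples: "half_int_triple ` psd_triples = L2"
proof
  show "half_int_triple ` psd_triples \<subseteq> L2" by (auto simp: half_int_triple_def psd_triples_def half_int_in_L2)
  show "L2 \<subseteq> half_int_triple ` psd_triples"
  proof
    fix T assume T: "T \<in> L2"
    then obtain m n r where e: "T = half_int m n r" by (rule L2_half_int)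
    with T have "(m,r,n) \<in> psd_triples" by (simp add: psd_triples_def half_int_in_L2)
    moreover have "T = half_int_triple (m,r,n)" by (simp add: e half_int_triple_def)
    ultimately show "T \<in> half_int_triple ` psd_triples" by blast
  qed
qed

lemma q_pow_half_int_triple: "q_pow (half_int m n r) (sym_mat t z s) = ee (of_int m * t + of_int r * z + of_int n * s)"
  by (simp add: q_pow_def ee_def trace_def matrix_matrix_mult_def sum_2 map_matrix_def algebra_simps)

lemma has_sum_L2_iff:
  "((\<lambda>T. a T * q_pow T (sym_mat t z s)) has_sum x) L2 \<longleftrightarrow>
   ((\<lambda>(m,r,n). (if (m,r,n) \<in> psd_triples then a (half_int m n r) else 0) * ee (of_int m * t + of_int r * z + of_int n * s)) has_sum x) UNIV"
proof -
  have "((\<lambda>T. a T * q_pow T (sym_mat t z s)) has_sum x) L2 \<longleftrightarrow> (((\<lambda>T. a T * q_pow T (sym_mat t z s)) \<circ> half_int_triple) has_sum x) psd_triples"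
    unfolding half_int_triple_psd_triples[symmetric] by (rule has_sum_reindex[OF inj_half_int_triple])
  also have "\<dots> \<longleftrightarrow> ((\<lambda>(m,r,n). (if (m,r,n) \<in> psd_triples then a (half_int m n r) else 0) * ee (of_int m * t + of_int r * z + of_int n * s)) has_sum x) UNIV"
    by (rule has_sum_cong_neutral) (auto simp: half_int_triple_def q_pow_half_int_triple)
  finally show ?thesis .
qed

text \<open>The description in \<open>fourier_coeff\<close> has exactly one solution: existence
  rests on \<open>c3_has_sum\<close> and \<open>c3_support\<close>, uniqueness on
  \<open>c3_unique\<close>.\<close>

lemma fourier_coeff_half_int: "fourier_coeff F (half_int m n r) = c3 m r n"
proof -
  define a0 where "a0 T = (if T \<in> L2 then (case inv_into psd_triples half_int_triple T of (m,r,n) \<Rightarrow> c3 m r n) else 0)" for T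
  have a0: "a0 (half_int m n r) = c3 m r n" for m r n
  proof (cases "(m,r,n) \<in> psd_triples")
    case True
    then have "inv_into psd_triples half_int_triple (half_int_triple (m,r,n)) = (m,r,n)" by (rule inv_into_f_f[OF inj_half_int_triple])
    moreover have "half_int m n r \<in> L2" using True by (simp add: half_int_in_L2 psd_triples_def)
    ultimately show ?thesis by (simp add: a0_def half_int_triple_def)
  next
    case False
    then have "half_int m n r \<notin> L2" by (simp add: half_int_in_L2 psd_triples_def)
    moreover have "c3 m r n = 0" using False c3_support by (auto simp: psd_triples_def)
    ultimately show ?thesis by (simp add: a0_def)
  qed
  have "fourier_coeff F = a0"
    unfolding fourier_coeff_def
  proof (rule the_equality)
    show "(\<forall>T. T \<notin> L2 \<longrightarrow> a0 T = 0) \<and> (\<forall>Z\<in>siegel_H2. ((\<lambda>T. a0 T * q_pow T Z) has_sum F Z) L2)"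
    proof (intro conjI ballI allI impI)
      fix Z assume Z: "Z \<in> siegel_H2"
      define t z s where "t = Z $ 1 $ 1" and "z = Z $ 1 $ 2" and "s = Z $ 2 $ 2"
      have subring_Z: "Z = sym_mat t z s" using siegel_H2_sym_mat[OF Z] by (simp add: t_def z_def s_def)
      then have D: "(t,z,s) \<in> siegel_domain" using Z by simp
      have "(\<lambda>(m,r,n). (if (m,r,n) \<in> psd_triples then a0 (half_int m n r) else 0) * ee (of_int m * t + of_int r * z + of_int n * s))
        = (\<lambda>(m,r,n). c3 m r n * ee (of_int m * t + of_int r * z + of_int n * s))"
        using c3_support by (auto simp: fun_eq_iff a0 psd_triples_def)
      then show "((\<lambda>T. a0 T * q_pow T Z) has_sum F Z) L2"
        unfolding subring_Z has_sum_L2_iff using c3_has_sum[OF D] by (simp add: f_def)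
    qed (simp add: a0_def)
  next
    fix a assume a: "(\<forall>T. T \<notin> L2 \<longrightarrow> a T = 0) \<and> (\<forall>Z\<in>siegel_H2. ((\<lambda>T. a T * q_pow T Z) has_sum F Z) L2)"
    have "(if (m,r,n) \<in> psd_triples then a (half_int m n r) else 0) = c3 m r n" for m r n
    proof (rule c3_unique)
      fix t z s assume "(t,z,s) \<in> siegel_domain"
      then have "((\<lambda>T. a T * q_pow T (sym_mat t z s)) has_sum F (sym_mat t z s)) L2" using a by simp
      then show "((\<lambda>(m,r,n). (if (m,r,n) \<in> psd_triples then a (half_int m n r) else 0) * ee (of_int m * t + of_int r * z + of_int n * s)) has_sum f t z s) UNIV"
        unfolding has_sum_L2_iff f_def .
    qed
    then have *: "a (half_int m n r) = a0 (half_int m n r)" if "(m,r,n) \<in> psd_triples" for m r n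
      using that by (metis a0)
    show "a = a0"
    proof
      fix T show "a T = a0 T"
      proof (cases "T \<in> L2")
        case True
        then obtain p where "p \<in> psd_triples" "T = half_int_triple p" unfolding half_int_triple_psd_triples[symmetric] by blast
        then show ?thesis using * by (cases p) (auto simp: half_int_triple_def)
      qed (use a in \<open>simp add: a0_def\<close>)
    qed
  qed
  then show ?thesis by (simp add: a0)
qed

end

section \<open>Power series with coefficients in a subring\<close>

no_notation vec_nth (infixl "$" 90)
notation fps_nth (infixl "$" 75)

text \<open>Subrings are sets of complex numbers rather than types, so that integral, p-integral and
  complex series share one type and can be compared and evaluated together.\<close>

definition is_subring :: "complex set \<Rightarrow> bool" where
  "is_subring R \<longleftrightarrow> 1 \<in> R \<and> (\<forall>x\<in>R. \<forall>y\<in>R. x - y \<in> R \<and> x * y \<in> R)"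

lemma subring_0: "is_subring R \<Longrightarrow> 0 \<in> R" by (metis is_subring_def cancel_comm_monoid_add_class.diff_cancel)
lemma subring_1: "is_subring R \<Longrightarrow> 1 \<in> R" by (simp add: is_subring_def)
lemma subring_diff: "is_subring R \<Longrightarrow> x \<in> R \<Longrightarrow> y \<in> R \<Longrightarrow> x - y \<in> R" by (simp add: is_subring_def)
lemma subring_mult: "is_subring R \<Longrightarrow> x \<in> R \<Longrightarrow> y \<in> R \<Longrightarrow> x * y \<in> R" by (simp add: is_subring_def)
lemma subring_uminus: "is_subring R \<Longrightarrow> x \<in> R \<Longrightarrow> - x \<in> R" using subring_diff[of R 0 x] subring_0 by simp
lemma subring_add: "is_subring R \<Longrightarrow> x \<in> R \<Longrightarrow> y \<in> R \<Longrightarrow> x + y \<in> R" using subring_diff[of R x "- y"] subring_uminus by simp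
lemma subring_sum: "is_subring R \<Longrightarrow> (\<And>i. i \<in> I \<Longrightarrow> f i \<in> R) \<Longrightarrow> sum f I \<in> R"
  by (induction I rule: infinite_finite_induct) (auto simp: subring_0 subring_add)
lemma subring_power: "is_subring R \<Longrightarrow> x \<in> R \<Longrightarrow> x ^ n \<in> R"
  by (induction n) (auto simp: subring_1 subring_mult)
lemma subring_of_nat: "is_subring R \<Longrightarrow> of_nat n \<in> R"
  by (induction n) (auto simp: subring_0 subring_1 subring_add)
lemma subring_of_int: "is_subring R \<Longrightarrow> of_int n \<in> R"
  by (cases n) (auto simp: subring_of_nat subring_uminus simp del: of_nat_Suc)
lemma Ints_subset_subring: "is_subring R \<Longrightarrow> \<int> \<subseteq> R"
  using subring_of_int by (auto simp: Ints_def)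
lemma is_subring_Ints: "is_subring \<int>" by (simp add: is_subring_def)
lemma is_subring_UNIV: "is_subring UNIV" by (simp add: is_subring_def)

definition coeffs_in :: "complex set \<Rightarrow> complex fps set" where "coeffs_in R = {c. \<forall>n. c $ n \<in> R}"

lemma coeffs_in_diff: "is_subring R \<Longrightarrow> c \<in> coeffs_in R \<Longrightarrow> d \<in> coeffs_in R \<Longrightarrow> c - d \<in> coeffs_in R"
  by (simp add: coeffs_in_def subring_diff)
lemma coeffs_in_add: "is_subring R \<Longrightarrow> c \<in> coeffs_in R \<Longrightarrow> d \<in> coeffs_in R \<Longrightarrow> c + d \<in> coeffs_in R"
  by (simp add: coeffs_in_def subring_add)
lemma coeffs_in_mult: "is_subring R \<Longrightarrow> c \<in> coeffs_in R \<Longrightarrow> d \<in> coeffs_in R \<Longrightarrow> c * d \<in> coeffs_in R"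
  by (auto simp: coeffs_in_def fps_mult_nth intro!: subring_sum subring_mult)
lemma coeffs_in_const: "is_subring R \<Longrightarrow> x \<in> R \<Longrightarrow> fps_const x \<in> coeffs_in R"
  by (auto simp: coeffs_in_def subring_0)
lemma coeffs_in_power: "is_subring R \<Longrightarrow> c \<in> coeffs_in R \<Longrightarrow> c ^ n \<in> coeffs_in R"
  by (induction n) (use coeffs_in_mult coeffs_in_const[of R 1] subring_1 in auto)
lemma coeffs_in_X: "is_subring R \<Longrightarrow> fps_X \<in> coeffs_in R"
  by (auto simp: coeffs_in_def subring_0 subring_1)
lemma coeffs_in_nth: "c \<in> coeffs_in R \<Longrightarrow> c $ n \<in> R" by (simp add: coeffs_in_def)

text \<open>The q-expansions of periodic functions that are holomorphic on the upper half plane and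
  at the cusp.\<close>

definition disc_series :: "complex set \<Rightarrow> complex fps set" where
  "disc_series R = {c. fps_conv_radius c \<ge> 1 \<and> (\<forall>n. c $ n \<in> R)}"

lemma disc_series_radius: "c \<in> disc_series R \<Longrightarrow> norm q < 1 \<Longrightarrow> ereal (norm q) < fps_conv_radius c"
  unfolding disc_series_def by (metis (mono_tags, lifting) ereal_less(3) less_le_trans mem_Collect_eq)
lemma disc_series_mono: "R \<subseteq> R' \<Longrightarrow> disc_series R \<subseteq> disc_series R'" by (auto simp: disc_series_def)
lemma disc_series_nth: "c \<in> disc_series R \<Longrightarrow> c $ n \<in> R" by (simp add: disc_series_def)

lemma disc_series_const: "is_subring R \<Longrightarrow> x \<in> R \<Longrightarrow> fps_const x \<in> disc_series R"
  by (auto simp: disc_series_def subring_0)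
lemma disc_series_0: "is_subring R \<Longrightarrow> 0 \<in> disc_series R" using disc_series_const[of R 0] subring_0 by simp
lemma disc_series_1: "is_subring R \<Longrightarrow> 1 \<in> disc_series R" using disc_series_const[of R 1] subring_1 by simp
lemma disc_series_X: "is_subring R \<Longrightarrow> fps_X \<in> disc_series R"
  by (auto simp: disc_series_def subring_0 subring_1)
lemma disc_series_add: "is_subring R \<Longrightarrow> c \<in> disc_series R \<Longrightarrow> d \<in> disc_series R \<Longrightarrow> c + d \<in> disc_series R"
  unfolding disc_series_def by (auto simp: subring_add intro: order_trans[OF _ fps_conv_radius_add])
lemma disc_series_diff: "is_subring R \<Longrightarrow> c \<in> disc_series R \<Longrightarrow> d \<in> disc_series R \<Longrightarrow> c - d \<in> disc_series R"
  unfolding disc_series_def by (auto simp: subring_diff intro: order_trans[OF _ fps_conv_radius_diff])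
lemma disc_series_mult: "is_subring R \<Longrightarrow> c \<in> disc_series R \<Longrightarrow> d \<in> disc_series R \<Longrightarrow> c * d \<in> disc_series R"
  using coeffs_in_mult[of R c d] unfolding disc_series_def coeffs_in_def by (auto intro: order_trans[OF _ fps_conv_radius_mult])
lemma disc_series_power: "is_subring R \<Longrightarrow> c \<in> disc_series R \<Longrightarrow> c ^ n \<in> disc_series R"
  by (induction n) (auto simp: disc_series_1 disc_series_mult)
lemma disc_series_sum: "is_subring R \<Longrightarrow> (\<And>i. i \<in> I \<Longrightarrow> f i \<in> disc_series R) \<Longrightarrow> sum f I \<in> disc_series R"
  by (induction I rule: infinite_finite_induct) (auto simp: disc_series_0 disc_series_add)
lemma disc_series_prod: "is_subring R \<Longrightarrow> (\<And>i. i \<in> I \<Longrightarrow> f i \<in> disc_series R) \<Longrightarrow> prod f I \<in> disc_series R"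
  by (induction I rule: infinite_finite_induct) (auto simp: disc_series_1 disc_series_mult)

lemma ev_add: "c \<in> disc_series R \<Longrightarrow> d \<in> disc_series R \<Longrightarrow> norm q < 1 \<Longrightarrow> eval_fps (c + d) q = eval_fps c q + eval_fps d q"
  by (simp add: eval_fps_add disc_series_radius)
lemma ev_diff: "c \<in> disc_series R \<Longrightarrow> d \<in> disc_series R \<Longrightarrow> norm q < 1 \<Longrightarrow> eval_fps (c - d) q = eval_fps c q - eval_fps d q"
  by (simp add: eval_fps_diff disc_series_radius)
lemma ev_mult: "c \<in> disc_series R \<Longrightarrow> d \<in> disc_series R \<Longrightarrow> norm q < 1 \<Longrightarrow> eval_fps (c * d) q = eval_fps c q * eval_fps d q"
  by (simp add: eval_fps_mult disc_series_radius)
lemma ev_power: "c \<in> disc_series R \<Longrightarrow> norm q < 1 \<Longrightarrow> eval_fps (c ^ n) q = eval_fps c q ^ n"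
  by (simp add: eval_fps_power disc_series_radius)
lemma ev_sum: "is_subring R \<Longrightarrow> (\<And>i. i \<in> I \<Longrightarrow> f i \<in> disc_series R) \<Longrightarrow> norm q < 1 \<Longrightarrow> eval_fps (sum f I) q = (\<Sum>i\<in>I. eval_fps (f i) q)"
  by (induction I rule: infinite_finite_induct) (auto simp: ev_add[of _ R] disc_series_sum)
lemma ev_prod: "is_subring R \<Longrightarrow> (\<And>i. i \<in> I \<Longrightarrow> f i \<in> disc_series R) \<Longrightarrow> norm q < 1 \<Longrightarrow> eval_fps (prod f I) q = (\<Prod>i\<in>I. eval_fps (f i) q)"
  by (induction I rule: infinite_finite_induct) (auto simp: ev_mult[of _ R] disc_series_prod)

lemma disc_series_holomorphic: "c \<in> disc_series R \<Longrightarrow> eval_fps c holomorphic_on ball 0 1"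
  by (rule holomorphic_on_eval_fps) (auto intro: disc_series_radius)

text \<open>The point q = 0 is exempt because it is not a value of \<open>ee\<close>.\<close>

lemma disc_series_eqI:
  assumes "c \<in> disc_series R" "d \<in> disc_series R'" "\<And>q. norm q < 1 \<Longrightarrow> q \<noteq> 0 \<Longrightarrow> eval_fps c q = eval_fps d q"
  shows "c = d"
proof -
  have r: "0 < fps_conv_radius c" "0 < fps_conv_radius d"
    using disc_series_radius[OF assms(1), of 0] disc_series_radius[OF assms(2), of 0] by (simp_all add: zero_ereal_def)
  have c: "isCont (eval_fps c) 0" "isCont (eval_fps d) 0"
    using r by (auto intro!: continuous_eval_fps simp: zero_ereal_def)
  have ev: "eventually (\<lambda>q. eval_fps c q = eval_fps d q) (at 0)"
    unfolding eventually_at by (rule exI[of _ 1]) (use assms(3) in \<open>auto simp: dist_norm\<close>)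
  have "eval_fps c 0 = eval_fps d 0"
    using tendsto_unique[OF _ c(1)[unfolded isCont_def] Lim_transform_eventually[OF c(2)[unfolded isCont_def]]]
      ev by (metis (mono_tags, lifting) eventually_mono trivial_limit_at)
  then have "eval_fps c q = eval_fps d q" if "norm q < 1" for q using assms(3)[OF that] by (cases "q = 0") auto
  then have "eventually (\<lambda>q. eval_fps c q = eval_fps d q) (nhds 0)"
    unfolding eventually_nhds_metric by (intro exI[of _ 1]) (auto simp: dist_norm)
  then show ?thesis using eval_fps_eqD r by blast
qed

lemma holomorphic_imp_disc_series_UNIV:
  assumes "g holomorphic_on ball 0 1"
  obtains c where "c \<in> disc_series UNIV" "\<And>q. norm q < 1 \<Longrightarrow> eval_fps c q = g q" "\<And>n. c $ n = (deriv ^^ n) g 0 / fact n"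
proof -
  have h: "g holomorphic_on eball 0 1" using assms by (simp add: one_ereal_def)
  show ?thesis
  proof (rule that[of "fps_expansion g 0"])
    show "fps_expansion g 0 \<in> disc_series UNIV" using conv_radius_fps_expansion[OF h] by (simp add: disc_series_def)
    show "eval_fps (fps_expansion g 0) q = g q" if "norm q < 1" for q
      using eval_fps_expansion'[OF h, of q] that by (simp add: one_ereal_def)
  qed (simp add: fps_expansion_def)
qed

text \<open>Integrality survives locally uniform limits because \<open>\<int>\<close> is closed in \<open>\<complex>\<close>.\<close>

lemma disc_series_Ints_limit:
  assumes C: "\<And>N. C N \<in> disc_series \<int>"
    and lim: "\<And>\<rho>. 0 < \<rho> \<Longrightarrow> \<rho> < 1 \<Longrightarrow> uniform_limit (cball 0 \<rho>) (\<lambda>N q. eval_fps (C N) q) g sequentially"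
  obtains c where "c \<in> disc_series \<int>" "\<And>q. norm q < 1 \<Longrightarrow> eval_fps c q = g q" "\<And>n. (\<lambda>N. C N $ n) \<longlonglongrightarrow> c $ n"
proof -
  have g: "g holomorphic_on ball 0 1"
  proof (rule holomorphic_uniform_sequence)
    show "eval_fps (C n) holomorphic_on ball 0 1" for n by (rule disc_series_holomorphic[OF C])
    fix x :: complex assume x: "x \<in> ball 0 1"
    define d where "d = (1 - norm x) / 2"
    have d: "0 < d" using x by (simp add: d_def)
    have x1: "0 \<le> norm x" "norm x < 1" using x by simp_all
    have r: "0 < norm x + d" using x1 d by linarith
    have r2: "norm x + d < 1" using x1 by (simp add: d_def field_simps)
    have sub: "cball x d \<subseteq> cball 0 (norm x + d)"
      by (auto simp: dist_norm) (metis norm_minus_commute norm_triangle_sub add.commute add_mono_thms_linordered_semiring(3) order_trans)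
    show "\<exists>d>0. cball x d \<subseteq> ball 0 1 \<and> uniform_limit (cball x d) (\<lambda>n. eval_fps (C n)) g sequentially"
      using d sub r2 uniform_limit_on_subset[OF lim[OF r r2] sub]
      by (intro exI[of _ d]) auto
  qed simp
  obtain c where c: "c \<in> disc_series UNIV" "\<And>q. norm q < 1 \<Longrightarrow> eval_fps c q = g q" "\<And>n. c $ n = (deriv ^^ n) g 0 / fact n"
    using holomorphic_imp_disc_series_UNIV[OF g] by blast
  have tend: "(\<lambda>N. C N $ n) \<longlonglongrightarrow> c $ n" for n
  proof -
    have "(\<lambda>N. (deriv ^^ n) (eval_fps (C N)) 0) \<longlonglongrightarrow> (deriv ^^ n) g 0"
    proof (rule higher_deriv_complex_uniform_limit)
      show "uniform_limit (ball 0 (1/2)) (\<lambda>N. eval_fps (C N)) g sequentially"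
        by (rule uniform_limit_on_subset[OF lim[of "1/2"]]) auto
      show "\<forall>\<^sub>F n in sequentially. eval_fps (C n) holomorphic_on ball 0 (1 / 2)"
        by (intro always_eventually allI holomorphic_on_subset[OF disc_series_holomorphic[OF C]]) auto
    qed auto
    then have "(\<lambda>N. (deriv ^^ n) (eval_fps (C N)) 0 / fact n) \<longlonglongrightarrow> (deriv ^^ n) g 0 / fact n"
      by (intro tendsto_intros) auto
    moreover have "(deriv ^^ n) (eval_fps (C N)) 0 / fact n = C N $ n" for N
      using disc_series_radius[OF C, of 0] by (subst fps_nth_conv_deriv) (auto simp: zero_ereal_def)
    ultimately show ?thesis by (simp add: c(3))
  qed
  have "c $ n \<in> \<int>" for n
    by (rule closed_sequentially[OF closed_Ints _ tend]) (use C in \<open>auto simp: disc_series_def\<close>)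
  then have "c \<in> disc_series \<int>" using c(1) by (simp add: disc_series_def)
  then show ?thesis using that c tend by blast
qed

text \<open>With constant term 1 the recursion for the inverse divides by nothing, so the
  coefficients stay in \<open>R\<close>; nonvanishing on the disc preserves the radius.\<close>

lemma disc_series_inverse:
  assumes R: "is_subring R" and c: "c \<in> disc_series R" "c $ 0 = 1" and nz: "\<And>q. norm q < 1 \<Longrightarrow> eval_fps c q \<noteq> 0"
  shows "inverse c \<in> disc_series R" "norm q < 1 \<Longrightarrow> eval_fps (inverse c) q = inverse (eval_fps c q)"
proof -
  have inv: "c * inverse c = 1" using c(2) by (simp add: inverse_mult_eq_1')
  have co: "inverse c $ n \<in> R" for n
  proof (induction n rule: less_induct)
    case (less n)
    show ?case
    proof (cases "n = 0")
      case True then show ?thesis using c(2) R by (simp add: subring_1)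
    next
      case False
      have "0 = (c * inverse c) $ n" using False inv by simp
      also have "\<dots> = inverse c $ n + (\<Sum>i\<in>{1..n}. c $ i * inverse c $ (n - i))"
        using False by (simp add: fps_mult_nth sum.atLeast_Suc_atMost c(2))
      finally have "inverse c $ n = - (\<Sum>i\<in>{1..n}. c $ i * inverse c $ (n - i))" by (simp add: eq_neg_iff_add_eq_0)
      moreover have "(\<Sum>i\<in>{1..n}. c $ i * inverse c $ (n - i)) \<in> R"
        using c(1) by (intro subring_sum[OF R] subring_mult[OF R] less.IH) (auto simp: disc_series_def)
      ultimately show ?thesis using R by (simp add: subring_uminus)
    qed
  qed
  have rad: "fps_conv_radius c \<ge> 1" using c by (simp add: disc_series_def)
  have nz': "eval_fps c z \<noteq> 0" if "z \<in> eball 0 1" for z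
    using nz[of z] that by (simp add: one_ereal_def)
  have "fps_conv_radius (inverse c) \<ge> min 1 (fps_conv_radius c)"
    by (rule fps_conv_radius_inverse) (use c(2) nz' in auto)
  then show "inverse c \<in> disc_series R" using rad co by (simp add: disc_series_def)
  show "eval_fps (inverse c) q = inverse (eval_fps c q)" if "norm q < 1"
    by (rule eval_fps_inverse[where r = 1]) (use rad that nz' disc_series_radius[OF c(1) that] in \<open>auto simp: one_ereal_def\<close>)
qed

section \<open>Infinite products\<close>

definition inf_prod :: "(nat \<Rightarrow> complex) \<Rightarrow> complex" where "inf_prod u = lim (\<lambda>N. \<Prod>n<N. 1 + u n)"

text \<open>The partial products satisfy P (N + 1) - P N = P N * u N and are bounded by exp of the
  sum of \<open>M\<close>, so the M-test applies to the telescoping series.\<close>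

lemma prod_uniform_limit:
  fixes u :: "nat \<Rightarrow> 'a \<Rightarrow> complex"
  assumes M: "\<And>n x. x \<in> A \<Longrightarrow> norm (u n x) \<le> M n" "summable M" and M0: "\<And>n. 0 \<le> M n"
  shows "uniform_limit A (\<lambda>N x. \<Prod>n<N. 1 + u n x) (\<lambda>x. inf_prod (\<lambda>n. u n x)) sequentially"
proof -
  define P where "P N x = (\<Prod>n<N. 1 + u n x)" for N x
  have bnd: "norm (P N x) \<le> exp (suminf M)" if "x \<in> A" for N x
  proof -
    have "norm (P N x) = (\<Prod>n<N. norm (1 + u n x))" by (simp add: P_def prod_norm)
    also have "\<dots> \<le> (\<Prod>n<N. exp (M n))"
    proof (rule prod_mono, safe)
      fix n
      have "norm (1 + u n x) \<le> 1 + M n" using norm_triangle_ineq[of 1 "u n x"] M(1)[OF that, of n] by simp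
      also have "\<dots> \<le> exp (M n)" by (rule exp_ge_add_one_self)
      finally show "norm (1 + u n x) \<le> exp (M n)" .
    qed auto
    also have "\<dots> = exp (\<Sum>n<N. M n)" by (simp add: exp_sum)
    also have "\<dots> \<le> exp (suminf M)" using sum_le_suminf[OF M(2)] M0 by simp
    finally show ?thesis .
  qed
  have "uniform_limit A (\<lambda>N x. \<Sum>n<N. P n x * u n x) (\<lambda>x. suminf (\<lambda>n. P n x * u n x)) sequentially"
  proof (rule Weierstrass_m_test)
    show "norm (P n x * u n x) \<le> exp (suminf M) * M n" if "x \<in> A" for n x
      unfolding norm_mult using bnd[OF that] M(1)[OF that] by (intro mult_mono) auto
    show "summable (\<lambda>n. exp (suminf M) * M n)" by (rule summable_mult[OF M(2)])
  qed
  moreover have "(\<Sum>n<N. P n x * u n x) = P N x - 1" for N x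
    by (induction N) (auto simp: P_def algebra_simps)
  ultimately have ul: "uniform_limit A (\<lambda>N x. P N x - 1) (\<lambda>x. suminf (\<lambda>n. P n x * u n x)) sequentially" by simp
  have "uniform_limit A (\<lambda>N x. (P N x - 1) + 1) (\<lambda>x. suminf (\<lambda>n. P n x * u n x) + 1) sequentially"
    by (intro uniform_limit_intros ul)
  then have ul: "uniform_limit A P (\<lambda>x. suminf (\<lambda>n. P n x * u n x) + 1) sequentially" by simp
  have "uniform_limit A P (\<lambda>x. inf_prod (\<lambda>n. u n x)) sequentially"
  proof (rule uniform_limit_cong'[THEN iffD1, OF _ _ ul])
    fix x assume "x \<in> A"
    from tendsto_uniform_limitI[OF ul this] show "suminf (\<lambda>n. P n x * u n x) + 1 = inf_prod (\<lambda>n. u n x)"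
      unfolding inf_prod_def P_def by (simp add: limI)
  qed simp
  then show ?thesis by (simp add: P_def[abs_def])
qed

lemma inf_prod_limit:
  assumes "summable (\<lambda>n. norm (u n))"
  shows "(\<lambda>N. \<Prod>n<N. 1 + u n) \<longlonglongrightarrow> inf_prod u"
  using tendsto_uniform_limitI[OF prod_uniform_limit[of UNIV "\<lambda>n (_::unit). u n" "\<lambda>n. norm (u n)"], of "()"] assms by simp

lemma inf_prod_nonzero:
  assumes s: "summable (\<lambda>n. norm (u n))" and nz: "\<And>n. 1 + u n \<noteq> 0"
  shows "inf_prod u \<noteq> 0"
proof
  assume "inf_prod u = 0"
  then have "(\<lambda>N. \<Prod>n<N. 1 + u n) \<longlonglongrightarrow> 0" using inf_prod_limit[OF s] by simp
  then have "(\<lambda>N. \<Prod>n<Suc N. 1 + u n) \<longlonglongrightarrow> 0" by (rule LIMSEQ_Suc)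
  then have "(\<lambda>N. \<Prod>n\<le>N. 1 + u n) \<longlonglongrightarrow> 0" by (simp add: lessThan_Suc_atMost)
  moreover have "convergent_prod (\<lambda>n. 1 + u n)"
    by (rule abs_convergent_prod_imp_convergent_prod) (use s in \<open>simp add: abs_convergent_prod_conv_summable\<close>)
  ultimately show False using nz convergent_prod_to_zero_iff by blast
qed

text \<open>An element of \<open>complex fps fps\<close> is a power series in the Jacobi variable with coefficients that are
  power series in \<open>q\<close>; \<open>eval_q q\<close> specialises \<open>q\<close>, and \<open>lift_fps\<close> embeds series that do not involve \<open>q\<close>.\<close>

definition disc_series2 :: "complex set \<Rightarrow> complex fps fps \<Rightarrow> bool" where
  "disc_series2 R C \<longleftrightarrow> (\<forall>j. C $ j \<in> disc_series R)"
definition eval_q :: "complex \<Rightarrow> complex fps fps \<Rightarrow> complex fps" where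
  "eval_q q C = Abs_fps (\<lambda>j. eval_fps (C $ j) q)"
definition lift_fps :: "complex fps \<Rightarrow> complex fps fps" where
  "lift_fps g = Abs_fps (\<lambda>j. fps_const (g $ j))"

lemma eval_q_nth [simp]: "eval_q q C $ j = eval_fps (C $ j) q" by (simp add: eval_q_def)
lemma lift_fps_nth [simp]: "lift_fps g $ j = fps_const (g $ j)" by (simp add: lift_fps_def)

lemma disc_series2_nth: "disc_series2 R C \<Longrightarrow> C $ j \<in> disc_series R" by (simp add: disc_series2_def)
lemma disc_series2_mono: "R \<subseteq> R' \<Longrightarrow> disc_series2 R C \<Longrightarrow> disc_series2 R' C" using subsetD[OF disc_series_mono[of R R']] by (auto simp: disc_series2_def)
lemma disc_series2_diff: "is_subring R \<Longrightarrow> disc_series2 R C \<Longrightarrow> disc_series2 R D \<Longrightarrow> disc_series2 R (C - D)" by (simp add: disc_series2_def disc_series_diff)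
lemma disc_series2_mult: "is_subring R \<Longrightarrow> disc_series2 R C \<Longrightarrow> disc_series2 R D \<Longrightarrow> disc_series2 R (C * D)"
  by (auto simp: disc_series2_def fps_mult_nth intro!: disc_series_sum disc_series_mult)
lemma disc_series2_const: "is_subring R \<Longrightarrow> c \<in> disc_series R \<Longrightarrow> disc_series2 R (fps_const c)" by (auto simp: disc_series2_def disc_series_0)
lemma disc_series2_1: "is_subring R \<Longrightarrow> disc_series2 R 1" using disc_series2_const[OF _ disc_series_1] by simp
lemma disc_series2_X: "is_subring R \<Longrightarrow> disc_series2 R fps_X" by (auto simp: disc_series2_def disc_series_0 disc_series_1)
lemma disc_series2_power: "is_subring R \<Longrightarrow> disc_series2 R C \<Longrightarrow> disc_series2 R (C ^ n)"
  by (induction n) (auto simp: disc_series2_mult disc_series2_1)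
lemma disc_series2_prod: "is_subring R \<Longrightarrow> (\<And>i. i \<in> I \<Longrightarrow> disc_series2 R (f i)) \<Longrightarrow> disc_series2 R (prod f I)"
  by (induction I rule: infinite_finite_induct) (auto simp: disc_series2_mult disc_series2_1)

lemma eval_q_diff: "disc_series2 R C \<Longrightarrow> disc_series2 R D \<Longrightarrow> norm q < 1 \<Longrightarrow> eval_q q (C - D) = eval_q q C - eval_q q D"
  by (simp add: fps_eq_iff disc_series2_def ev_diff[of _ R])
lemma eval_q_mult: "is_subring R \<Longrightarrow> disc_series2 R C \<Longrightarrow> disc_series2 R D \<Longrightarrow> norm q < 1 \<Longrightarrow> eval_q q (C * D) = eval_q q C * eval_q q D"
  by (simp add: fps_eq_iff disc_series2_def fps_mult_nth ev_sum[of R] disc_series_mult ev_mult[of _ R])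
lemma eval_q_const [simp]: "eval_q q (fps_const c) = fps_const (eval_fps c q)"
  by (simp add: fps_eq_iff)
lemma eval_q_1 [simp]: "eval_q q 1 = 1" by (simp add: fps_eq_iff)
lemma eval_q_X [simp]: "eval_q q fps_X = fps_X" by (simp add: fps_eq_iff fps_X_def)
lemma eval_q_power: "is_subring R \<Longrightarrow> disc_series2 R C \<Longrightarrow> norm q < 1 \<Longrightarrow> eval_q q (C ^ n) = eval_q q C ^ n"
  by (induction n) (auto simp: eval_q_mult[of R] disc_series2_power)
lemma eval_q_prod: "is_subring R \<Longrightarrow> (\<And>i. i \<in> I \<Longrightarrow> disc_series2 R (f i)) \<Longrightarrow> norm q < 1 \<Longrightarrow> eval_q q (prod f I) = (\<Prod>i\<in>I. eval_q q (f i))"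
  by (induction I rule: infinite_finite_induct) (auto simp: eval_q_mult[of R] disc_series2_prod)

lemma lift_fps_mult: "lift_fps (g * h) = lift_fps g * lift_fps h"
proof (rule fps_ext)
  fix n
  have "fps_const (sum f I) = (\<Sum>i\<in>I. fps_const (f i))" for f :: "nat \<Rightarrow> complex" and I
    by (induction I rule: infinite_finite_induct) (auto simp: fps_const_add[symmetric] simp del: fps_const_add)
  then show "lift_fps (g * h) $ n = (lift_fps g * lift_fps h) $ n" by (simp add: fps_mult_nth)
qed
lemma lift_fps_1 [simp]: "lift_fps 1 = 1" by (simp add: fps_eq_iff)
lemma lift_fps_power: "lift_fps (g ^ n) = lift_fps g ^ n" by (induction n) (auto simp: lift_fps_mult)

lemma disc_series2_compose_lift_fps:
  assumes R: "is_subring R" and C: "disc_series2 R C" and g: "g \<in> coeffs_in R"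
  shows "disc_series2 R (C oo lift_fps g)"
  unfolding disc_series2_def fps_compose_nth lift_fps_power[symmetric]
  using C g by (auto intro!: disc_series_sum[OF R] disc_series_mult[OF R] disc_series_const[OF R] coeffs_in_nth[OF coeffs_in_power[OF R]] simp: disc_series2_def)

lemma eval_q_compose_lift_fps:
  assumes R: "is_subring R" and C: "disc_series2 R C" and g: "g \<in> coeffs_in R" and q: "norm q < 1"
  shows "eval_q q (C oo lift_fps g) = eval_q q C oo g"
proof (rule fps_ext)
  fix n
  have "eval_fps (C $ i * fps_const (g ^ i $ n)) q = eval_fps (C $ i) q * g ^ i $ n" for i
    using disc_series2_nth[OF C] disc_series_const[OF R coeffs_in_nth[OF coeffs_in_power[OF R g]]] q by (simp add: ev_mult[of _ R])
  moreover have "C $ i * fps_const (g ^ i $ n) \<in> disc_series R" for i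
    using disc_series2_nth[OF C] disc_series_const[OF R coeffs_in_nth[OF coeffs_in_power[OF R g]]] R by (simp add: disc_series_mult)
  ultimately show "eval_q q (C oo lift_fps g) $ n = (eval_q q C oo g) $ n"
    by (simp add: fps_compose_nth lift_fps_power[symmetric] ev_sum[OF R _ q])
qed

section \<open>The square of the Jacobi theta function\<close>

text \<open>With \<open>s = \<zeta> - 2 + 1 / \<zeta>\<close> the product formula of \<open>\<theta>\<^sup>2\<close>, divided by its value at first order, is a
  power series in \<open>s\<close>, since \<open>(1 - \<zeta> q\<^sup>n) (1 - q\<^sup>n / \<zeta>) = (1 - q\<^sup>n)\<^sup>2 - s q\<^sup>n\<close>.\<close>

definition lambert_term :: "complex \<Rightarrow> nat \<Rightarrow> complex" where "lambert_term q n = q ^ (n + 1) / (1 - q ^ (n + 1))\<^sup>2"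
definition theta_factor :: "complex \<Rightarrow> complex \<Rightarrow> nat \<Rightarrow> complex" where "theta_factor q s n = (1 - s * lambert_term q n)\<^sup>2 - 1"
definition theta_prod :: "complex \<Rightarrow> complex \<Rightarrow> complex" where "theta_prod q s = s * inf_prod (theta_factor q s)"
definition theta_partial :: "nat \<Rightarrow> complex \<Rightarrow> complex \<Rightarrow> complex" where "theta_partial N q s = s * (\<Prod>n<N. 1 + theta_factor q s n)"

lemma one_minus_power_nz:
  assumes "norm (q::complex) < 1" shows "1 - q ^ Suc n \<noteq> 0"
proof
  assume "1 - q ^ Suc n = 0"
  then have "norm q ^ Suc n = 1" by (metis eq_iff_diff_eq_0 norm_one norm_power)
  moreover have "norm q ^ Suc n < 1" using assms by (simp add: power_less_one_iff del: power_Suc)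
  ultimately show False by simp
qed

lemma norm_lambert_term:
  assumes "norm q \<le> \<rho>" "\<rho> < 1"
  shows "norm (lambert_term q n) \<le> \<rho> ^ (n + 1) / (1 - \<rho>)\<^sup>2"
proof -
  have \<rho>: "0 \<le> \<rho>" using assms norm_ge_zero[of q] by linarith
  have "norm (q ^ (n + 1)) \<le> \<rho> ^ (n + 1)" unfolding norm_power by (rule power_mono) (use assms in auto)
  moreover have "\<rho> ^ (n + 1) \<le> \<rho>" using power_decreasing[of 1 "n + 1" \<rho>] \<rho> assms by simp
  ultimately have "1 - \<rho> \<le> norm (1 - q ^ (n + 1))"
    using norm_triangle_ineq2[of 1 "q ^ (n + 1)"] by simp
  then have "(1 - \<rho>)\<^sup>2 \<le> (norm (1 - q ^ (n + 1)))\<^sup>2" using assms by (intro power_mono) auto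
  then show ?thesis unfolding lambert_term_def norm_divide norm_power[of _ 2]
    using assms \<rho> by (intro frac_le) (auto simp: norm_power simp del: power_Suc intro: power_mono)
qed

lemma norm_theta_factor:
  assumes "norm q \<le> \<rho>" "\<rho> < 1" "norm s \<le> r"
  shows "norm (theta_factor q s n) \<le> (2 * r + r\<^sup>2 / (1 - \<rho>)\<^sup>2) / (1 - \<rho>)\<^sup>2 * \<rho> ^ (n + 1)"
proof -
  define X where "X = \<rho> ^ (n + 1) / (1 - \<rho>)\<^sup>2"
  have \<rho>: "0 \<le> \<rho>" using assms norm_ge_zero[of q] by linarith
  have r: "0 \<le> r" using assms(3) norm_ge_zero[of s] by linarith
  have X: "norm (lambert_term q n) \<le> X" "0 \<le> X" "X \<le> 1 / (1 - \<rho>)\<^sup>2"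
    using norm_lambert_term[OF assms(1,2)] \<rho> assms power_le_one[of \<rho> "n + 1"] by (auto simp: X_def divide_right_mono)
  have sX: "norm (s * lambert_term q n) \<le> r * X" unfolding norm_mult using assms X r by (intro mult_mono) auto
  have "theta_factor q s n = - 2 * (s * lambert_term q n) + (s * lambert_term q n)\<^sup>2" by (simp add: theta_factor_def power2_eq_square algebra_simps)
  then have "norm (theta_factor q s n) \<le> 2 * norm (s * lambert_term q n) + (norm (s * lambert_term q n))\<^sup>2"
    by (metis norm_triangle_ineq norm_mult norm_power norm_minus_cancel norm_numeral)
  also have "\<dots> \<le> 2 * (r * X) + (r * X)\<^sup>2" using sX by (intro add_mono mult_left_mono power_mono) auto
  also have "(r * X)\<^sup>2 \<le> r\<^sup>2 * (X * (1 / (1 - \<rho>)\<^sup>2))"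
    unfolding power_mult_distrib power2_eq_square[of X] using X by (intro mult_left_mono mult_mono) auto
  finally show ?thesis by (simp add: X_def algebra_simps add_divide_distrib power2_eq_square)
qed

lemma summable_bound: assumes "0 \<le> \<rho>" "\<rho> < (1::real)" shows "summable (\<lambda>n. c * \<rho> ^ (n + 1))"
  using assms by (intro summable_mult summable_ignore_initial_segment summable_geometric) auto

lemma summable_theta_factor: assumes "norm q < 1" shows "summable (\<lambda>n. norm (theta_factor q s n))"
  by (rule summable_comparison_test'[of "\<lambda>n. (2 * norm s + (norm s)\<^sup>2 / (1 - norm q)\<^sup>2) / (1 - norm q)\<^sup>2 * norm q ^ (n + 1)" 0])
     (use assms norm_theta_factor[of q "norm q" s "norm s"] summable_bound[of "norm q"] in auto)

lemma theta_partial_limit: assumes "norm q < 1" shows "(\<lambda>N. theta_partial N q s) \<longlonglongrightarrow> theta_prod q s"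
  unfolding theta_partial_def theta_prod_def by (intro tendsto_intros inf_prod_limit summable_theta_factor assms)

lemma theta_partial_uniform:
  assumes "0 \<le> \<rho>" "\<rho> < 1" "0 \<le> r"
  shows "uniform_limit (cball 0 \<rho> \<times> cball 0 r) (\<lambda>N (q,s). theta_partial N q s) (\<lambda>(q,s). theta_prod q s) sequentially"
proof -
  let ?A = "cball (0::complex) \<rho> \<times> cball (0::complex) r"
  have "uniform_limit ?A (\<lambda>N p. \<Prod>n<N. 1 + theta_factor (fst p) (snd p) n) (\<lambda>p. inf_prod (\<lambda>n. theta_factor (fst p) (snd p) n)) sequentially"
    by (rule prod_uniform_limit[where M = "\<lambda>n. (2 * r + r\<^sup>2 / (1 - \<rho>)\<^sup>2) / (1 - \<rho>)\<^sup>2 * \<rho> ^ (n + 1)"])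
       (use assms norm_theta_factor summable_bound in auto)
  then have ul: "uniform_limit ?A (\<lambda>N p. \<Prod>n<N. 1 + theta_factor (fst p) (snd p) n) (\<lambda>p. inf_prod (theta_factor (fst p) (snd p))) sequentially"
    by simp
  show ?thesis
  proof (rule uniform_limitI)
    fix e :: real assume e: "e > 0"
    then have "e / (r + 1) > 0" using assms by simp
    from uniform_limitD[OF ul this]
    show "\<forall>\<^sub>F N in sequentially. \<forall>p\<in>?A. dist (case p of (q,s) \<Rightarrow> theta_partial N q s) (case p of (q,s) \<Rightarrow> theta_prod q s) < e"
    proof eventually_elim
      case (elim N)
      show ?case
      proof (safe, goal_cases)
        case (1 q s)
        have "dist (theta_partial N q s) (theta_prod q s) = norm s * dist (\<Prod>n<N. 1 + theta_factor q s n) (inf_prod (theta_factor q s))"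
          by (simp add: theta_partial_def theta_prod_def dist_norm norm_mult[symmetric] right_diff_distrib)
        also have "\<dots> \<le> (r + 1) * dist (\<Prod>n<N. 1 + theta_factor q s n) (inf_prod (theta_factor q s))"
          using 1 by (intro mult_right_mono) auto
        also have "\<dots> < (r + 1) * (e / (r + 1))"
          using elim[rule_format, of "(q,s)"] 1 assms by (intro mult_strict_left_mono) auto
        finally show ?case using assms by simp
      qed
    qed
  qed
qed

section \<open>Integrality of the theta expansion\<close>

definition lambert_fps :: "nat \<Rightarrow> complex fps" where "lambert_fps n = fps_X ^ (n + 1) * (inverse (1 - fps_X ^ (n + 1)))\<^sup>2"

lemma disc_series_one_minus_X: "1 - fps_X ^ Suc n \<in> disc_series \<int>"
  by (intro disc_series_diff disc_series_1 disc_series_power disc_series_X is_subring_Ints)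

lemma ev_one_minus_X: "norm (q::complex) < 1 \<Longrightarrow> eval_fps (1 - fps_X ^ Suc n) q = 1 - q ^ Suc n"
  by (simp add: ev_diff[OF disc_series_1[OF is_subring_Ints] disc_series_power[OF is_subring_Ints disc_series_X[OF is_subring_Ints]]] del: power_Suc)

lemma disc_series_inverse_one_minus_X:
  shows "inverse (1 - fps_X ^ Suc n) \<in> disc_series \<int>"
    and "norm (q::complex) < 1 \<Longrightarrow> eval_fps (inverse (1 - fps_X ^ Suc n)) q = 1 / (1 - q ^ Suc n)"
proof -
  have 1: "(1 - fps_X ^ Suc n :: complex fps) $ 0 = 1" by simp
  have 2: "eval_fps (1 - fps_X ^ Suc n) q \<noteq> 0" if "norm q < 1" for q :: complex
    unfolding ev_one_minus_X[OF that] using that by (rule one_minus_power_nz)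
  show "inverse (1 - fps_X ^ Suc n) \<in> disc_series \<int>"
    by (rule disc_series_inverse(1)[OF is_subring_Ints disc_series_one_minus_X 1 2])
  show "eval_fps (inverse (1 - fps_X ^ Suc n)) q = 1 / (1 - q ^ Suc n)" if "norm q < 1"
    using disc_series_inverse(2)[OF is_subring_Ints disc_series_one_minus_X 1 2 that] ev_one_minus_X[OF that, of n]
    by (simp add: inverse_eq_divide)
qed

lemma lambert_fps: "lambert_fps n \<in> disc_series \<int>" "norm q < 1 \<Longrightarrow> eval_fps (lambert_fps n) q = lambert_term q n"
proof -
  have i: "inverse (1 - fps_X ^ (n + 1)) \<in> disc_series \<int>" using disc_series_inverse_one_minus_X(1)[of n] by simp
  have x: "fps_X ^ (n + 1) \<in> disc_series \<int>" by (intro disc_series_power disc_series_X is_subring_Ints)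
  show "lambert_fps n \<in> disc_series \<int>" unfolding lambert_fps_def by (intro disc_series_mult disc_series_power i x is_subring_Ints)
  show "eval_fps (lambert_fps n) q = lambert_term q n" if "norm q < 1"
    unfolding lambert_fps_def ev_mult[OF x disc_series_power[OF is_subring_Ints i] that] ev_power[OF i that]
    using disc_series_inverse_one_minus_X(2)[OF that, of n] by (simp add: lambert_term_def power_divide del: power_Suc)
qed

definition theta_partial_fps :: "nat \<Rightarrow> complex fps fps" where
  "theta_partial_fps N = fps_X * (\<Prod>n<N. (1 - fps_X * fps_const (lambert_fps n))\<^sup>2)"

lemma disc_series2_factor: "disc_series2 \<int> (1 - fps_X * fps_const (lambert_fps n))"
  by (intro disc_series2_diff disc_series2_mult disc_series2_1 disc_series2_X disc_series2_const is_subring_Ints lambert_fps)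

lemma disc_series2_theta_partial_fps: "disc_series2 \<int> (theta_partial_fps N)"
  unfolding theta_partial_fps_def by (intro disc_series2_mult disc_series2_prod disc_series2_power disc_series2_factor disc_series2_X is_subring_Ints)

lemma eval_q_theta_partial_fps:
  assumes q: "norm q < 1"
  shows "eval_q q (theta_partial_fps N) = fps_of_poly ([:0, 1:] * (\<Prod>n<N. [:1, - lambert_term q n:]\<^sup>2))"
proof -
  have "eval_q q (1 - fps_X * fps_const (lambert_fps n)) = fps_of_poly [:1, - lambert_term q n:]" for n
  proof -
    have "eval_q q (1 - fps_X * fps_const (lambert_fps n)) = 1 - fps_X * fps_const (lambert_term q n)"
      using q is_subring_Ints by (simp add: eval_q_diff[of \<int>] eval_q_mult[of \<int>] disc_series2_mult disc_series2_1 disc_series2_X disc_series2_const lambert_fps)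
    also have "\<dots> = fps_of_poly [:1, - lambert_term q n:]" by (simp add: fps_of_poly_pCons)
    finally show ?thesis .
  qed
  then show ?thesis unfolding theta_partial_fps_def
    using q is_subring_Ints disc_series2_factor
    by (simp add: eval_q_mult[of \<int>] eval_q_prod[of \<int>] eval_q_power[of \<int>] disc_series2_prod disc_series2_power disc_series2_X
        fps_of_poly_mult fps_of_poly_prod fps_of_poly_power fps_of_poly_pCons)
qed

lemma eval_theta_partial_fps:
  assumes q: "norm q < 1"
  shows "eval_fps (eval_q q (theta_partial_fps N)) s = theta_partial N q s" "fps_conv_radius (eval_q q (theta_partial_fps N)) = \<infinity>"
  unfolding eval_q_theta_partial_fps[OF q] eval_fps_of_poly
  by (simp_all add: theta_partial_def poly_prod theta_factor_def)

lemma theta_partial_holomorphic: assumes "norm q < 1" shows "theta_partial N q holomorphic_on UNIV"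
  unfolding eval_theta_partial_fps(1)[OF assms, symmetric, abs_def] eta_contract_eq
  by (rule holomorphic_on_eval_fps) (simp add: eval_theta_partial_fps(2)[OF assms])

lemma theta_prod_holomorphic: assumes q: "norm q < 1" shows "theta_prod q holomorphic_on UNIV"
proof (rule holomorphic_uniform_sequence)
  show "theta_partial n q holomorphic_on UNIV" for n by (rule theta_partial_holomorphic[OF q])
  fix x :: complex
  have u: "uniform_limit (cball 0 (norm q) \<times> cball 0 (norm x + 1)) (\<lambda>N (q,s). theta_partial N q s) (\<lambda>(q,s). theta_prod q s) sequentially"
    by (rule theta_partial_uniform) (use q in auto)
  have "uniform_limit (cball x 1) (\<lambda>n. theta_partial n q) (theta_prod q) sequentially"
  proof (rule uniform_limitI)
    fix e :: real assume "e > 0"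
    from uniform_limitD[OF u this] show "\<forall>\<^sub>F n in sequentially. \<forall>s\<in>cball x 1. dist (theta_partial n q s) (theta_prod q s) < e"
    proof eventually_elim
      case (elim n)
      show ?case
      proof
        fix s assume "s \<in> cball x 1"
        then have "norm s \<le> norm x + 1"
          using norm_triangle_ineq2[of s x] by (simp add: dist_norm norm_minus_commute)
        then show "dist (theta_partial n q s) (theta_prod q s) < e" using elim[rule_format, of "(q,s)"] by simp
      qed
    qed
  qed
  then show "\<exists>d>0. cball x d \<subseteq> UNIV \<and> uniform_limit (cball x d) (\<lambda>n. theta_partial n q) (theta_prod q) sequentially"
    by (intro exI[of _ 1]) auto
qed simp

text \<open>Cauchy's inequality on |s| = 1 passes uniform convergence from values in s to Taylor
  coefficients at s = 0, still uniformly in q. This is the input for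
  \<open>disc_series_Ints_limit\<close>.\<close>

lemma theta_partial_fps_coeff_uniform:
  assumes \<rho>: "0 \<le> \<rho>" "\<rho> < 1"
  shows "uniform_limit (cball 0 \<rho>) (\<lambda>N q. eval_fps (theta_partial_fps N $ j) q) (\<lambda>q. (deriv ^^ j) (theta_prod q) 0 / fact j) sequentially"
proof (rule uniform_limitI)
  fix e :: real assume e: "e > 0"
  have "uniform_limit (cball 0 \<rho> \<times> cball 0 1) (\<lambda>N (q,s). theta_partial N q s) (\<lambda>(q,s). theta_prod q s) sequentially"
    by (rule theta_partial_uniform) (use \<rho> in auto)
  from uniform_limitD[OF this, of "e / 2"] e
  have "\<forall>\<^sub>F N in sequentially. \<forall>p\<in>cball 0 \<rho> \<times> cball 0 1. dist (case p of (q,s) \<Rightarrow> theta_partial N q s) (case p of (q,s) \<Rightarrow> theta_prod q s) < e / 2" by simp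
  then show "\<forall>\<^sub>F N in sequentially. \<forall>q\<in>cball 0 \<rho>. dist (eval_fps (theta_partial_fps N $ j) q) ((deriv ^^ j) (theta_prod q) 0 / fact j) < e"
  proof (eventually_elim, safe)
    fix N and q :: complex
    assume H: "\<forall>p\<in>cball 0 \<rho> \<times> cball 0 1. dist (case p of (q,s) \<Rightarrow> theta_partial N q s) (case p of (q,s) \<Rightarrow> theta_prod q s) < e / 2"
      and q: "q \<in> cball 0 \<rho>"
    have q1: "norm q < 1" using q \<rho> by simp
    let ?D = "\<lambda>s. theta_partial N q s - theta_prod q s"
    have "norm ((deriv ^^ j) ?D 0) \<le> fact j * (e / 2) / 1 ^ j"
    proof (rule Cauchy_inequality)
      have h: "?D holomorphic_on UNIV" by (intro holomorphic_intros theta_partial_holomorphic theta_prod_holomorphic q1)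
      show "?D holomorphic_on ball 0 1" by (rule holomorphic_on_subset[OF h]) simp
      show "continuous_on (cball 0 1) ?D"
        by (rule holomorphic_on_imp_continuous_on, rule holomorphic_on_subset[OF h]) simp
      fix s :: complex assume "norm (0 - s) = 1"
      then show "norm (?D s) \<le> e / 2" using H[rule_format, of "(q,s)"] q by (simp add: dist_norm)
    qed simp
    moreover have "(deriv ^^ j) ?D 0 = (deriv ^^ j) (theta_partial N q) 0 - (deriv ^^ j) (theta_prod q) 0"
      by (rule higher_deriv_diff[OF theta_partial_holomorphic[OF q1] theta_prod_holomorphic[OF q1]]) auto
    moreover have "eval_fps (theta_partial_fps N $ j) q = (deriv ^^ j) (theta_partial N q) 0 / fact j"
    proof -
      have "eval_q q (theta_partial_fps N) $ j = (deriv ^^ j) (eval_fps (eval_q q (theta_partial_fps N))) 0 / fact j"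
        by (rule fps_nth_conv_deriv) (simp add: eval_theta_partial_fps(2)[OF q1])
      then show ?thesis by (simp add: eval_theta_partial_fps(1)[OF q1, abs_def])
    qed
    ultimately have "norm (fact j * (eval_fps (theta_partial_fps N $ j) q - (deriv ^^ j) (theta_prod q) 0 / fact j)) \<le> fact j * (e / 2)"
      by (simp add: right_diff_distrib)
    then have "dist (eval_fps (theta_partial_fps N $ j) q) ((deriv ^^ j) (theta_prod q) 0 / fact j) \<le> e / 2"
      by (simp add: norm_mult dist_norm)
    then show "dist (eval_fps (theta_partial_fps N $ j) q) ((deriv ^^ j) (theta_prod q) 0 / fact j) < e" using e by simp
  qed
qed

lemma theta_partial_fps_nth_0: "theta_partial_fps N $ 0 = 0" by (simp add: theta_partial_fps_def)
lemma theta_partial_fps_nth_1: "theta_partial_fps N $ 1 = 1"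
proof -
  have "(\<Prod>n<N. (1 - fps_X * fps_const (lambert_fps n))\<^sup>2) $ 0 = (1::complex fps)"
    by (induction N) (auto simp: power2_eq_square)
  then show ?thesis by (simp add: theta_partial_fps_def)
qed

lemma theta_fps_exists: "\<exists>A. disc_series2 \<int> A \<and> (\<forall>q j. norm q < 1 \<longrightarrow> eval_fps (A $ j) q = (deriv ^^ j) (theta_prod q) 0 / fact j) \<and> A $ 0 = 0 \<and> A $ 1 = 1"
proof -
  have "\<exists>c. c \<in> disc_series \<int> \<and> (\<forall>q. norm q < 1 \<longrightarrow> eval_fps c q = (deriv ^^ j) (theta_prod q) 0 / fact j) \<and> (\<forall>n. (\<lambda>N. theta_partial_fps N $ j $ n) \<longlonglongrightarrow> c $ n)" for j
    using disc_series_Ints_limit[of "\<lambda>N. theta_partial_fps N $ j" "\<lambda>q. (deriv ^^ j) (theta_prod q) 0 / fact j"] disc_series2_nth[OF disc_series2_theta_partial_fps] theta_partial_fps_coeff_uniform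
    by (metis less_imp_le)
  then obtain c where c: "\<And>j. c j \<in> disc_series \<int>" "\<And>j q. norm q < 1 \<Longrightarrow> eval_fps (c j) q = (deriv ^^ j) (theta_prod q) 0 / fact j"
      "\<And>j n. (\<lambda>N. theta_partial_fps N $ j $ n) \<longlonglongrightarrow> c j $ n"
    by metis
  have "c 0 $ n = 0" "c 1 $ n = (1 :: complex fps) $ n" for n
    using LIMSEQ_unique[OF c(3)[of 0 n]] LIMSEQ_unique[OF c(3)[of 1 n]] by (simp_all add: theta_partial_fps_nth_0 theta_partial_fps_nth_1[simplified])
  then have "c 0 = 0" "c 1 = 1" by (simp_all add: fps_eq_iff)
  then show ?thesis using c by (intro exI[of _ "Abs_fps c"]) (auto simp: disc_series2_def)
qed

definition theta_fps :: "complex fps fps" where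
  "theta_fps = (SOME A. disc_series2 \<int> A \<and> (\<forall>q j. norm q < 1 \<longrightarrow> eval_fps (A $ j) q = (deriv ^^ j) (theta_prod q) 0 / fact j) \<and> A $ 0 = 0 \<and> A $ 1 = 1)"

lemma theta_fps: "disc_series2 \<int> theta_fps" "norm q < 1 \<Longrightarrow> eval_fps (theta_fps $ j) q = (deriv ^^ j) (theta_prod q) 0 / fact j" "theta_fps $ 0 = 0" "theta_fps $ 1 = 1"
  using someI_ex[OF theta_fps_exists] unfolding theta_fps_def[symmetric] by blast+

lemma theta_prod_expansion: assumes q: "norm q < 1" shows "theta_prod q has_fps_expansion eval_q q theta_fps"
proof -
  have "theta_prod q has_fps_expansion fps_expansion (theta_prod q) 0"
    by (rule has_fps_expansion_fps_expansion[OF _ _ theta_prod_holomorphic[OF q]]) auto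
  moreover have "fps_expansion (theta_prod q) 0 = eval_q q theta_fps"
    by (simp add: fps_eq_iff fps_expansion_def theta_fps(2)[OF q])
  ultimately show ?thesis by simp
qed

section \<open>Elliptic law and nonvanishing of the theta square\<close>

definition sigma :: "complex \<Rightarrow> complex" where "sigma x = x - 2 + 1 / x"

lemma factor_sigma:
  assumes "norm q < 1" "x \<noteq> 0"
  shows "1 - sigma x * lambert_term q n = (1 - q ^ (n+1) * x) * (1 - q ^ (n+1) / x) / (1 - q ^ (n+1))\<^sup>2"
  using one_minus_power_nz[OF assms(1), of n] assms(2)
  by (simp add: sigma_def lambert_term_def divide_simps power2_eq_square del: power_Suc) (simp add: algebra_simps)

text \<open>At finite level the shift by q loses one factor at either end, and these boundary
  factors tend to 1. They stand on both sides as multipliers because they may vanish.\<close>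

lemma theta_partial_shift:
  assumes q: "norm q < 1" "q \<noteq> 0" and x: "x \<noteq> 0"
  shows "theta_partial N q (sigma (q * x)) * (q * x\<^sup>2) * (1 - q ^ N / x)\<^sup>2 = theta_partial N q (sigma x) * (1 - q ^ (N+1) * x)\<^sup>2"
proof (induction N)
  case 0
  have "sigma (q * x) * (q * x) = (1 - q * x)\<^sup>2" using q x by (simp add: sigma_def field_simps power2_eq_square)
  moreover have "x * (1 - 1 / x)\<^sup>2 = sigma x" using x by (simp add: sigma_def field_simps power2_eq_square)
  moreover have "sigma (q * x) * (q * x\<^sup>2) * (1 - 1 / x)\<^sup>2 = (sigma (q * x) * (q * x)) * (x * (1 - 1 / x)\<^sup>2)"
    by (simp add: power2_eq_square)
  ultimately show ?case by (simp add: theta_partial_def)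
next
  case (Suc N)
  define d where "d = ((1 - q ^ (N+1))\<^sup>2)\<^sup>2"
  have qx: "q * x \<noteq> 0" using q x by simp
  have f1: "1 + theta_factor q (sigma (q * x)) N = (1 - q ^ (N+2) * x)\<^sup>2 * (1 - q ^ N / x)\<^sup>2 / d"
  proof -
    have "q ^ (N+1) * (q * x) = q ^ (N+2) * x" "q ^ (N+1) / (q * x) = q ^ N / x" using q by simp_all
    from factor_sigma[OF q(1) qx, of N, unfolded this] show ?thesis
      by (simp add: theta_factor_def d_def power_divide power_mult_distrib del: power_Suc)
  qed
  have f2: "1 + theta_factor q (sigma x) N = (1 - q ^ (N+1) * x)\<^sup>2 * (1 - q ^ (N+1) / x)\<^sup>2 / d"
    using factor_sigma[OF q(1) x, of N] by (simp add: theta_factor_def d_def power_divide power_mult_distrib)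
  have "theta_partial (Suc N) q (sigma (q * x)) * (q * x\<^sup>2) * (1 - q ^ Suc N / x)\<^sup>2
     = (theta_partial N q (sigma (q * x)) * (q * x\<^sup>2) * (1 - q ^ N / x)\<^sup>2) * ((1 - q ^ (N+2) * x)\<^sup>2 * (1 - q ^ (N+1) / x)\<^sup>2 / d)"
    by (simp add: theta_partial_def f1 field_simps)
  also have "\<dots> = theta_partial N q (sigma x) * (1 - q ^ (N+1) * x)\<^sup>2 * ((1 - q ^ (N+2) * x)\<^sup>2 * (1 - q ^ (N+1) / x)\<^sup>2 / d)"
    by (simp only: Suc)
  also have "\<dots> = theta_partial (Suc N) q (sigma x) * (1 - q ^ (Suc N + 1) * x)\<^sup>2"
    by (simp add: theta_partial_def f2 field_simps)
  finally show ?case .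
qed

lemma theta_prod_shift:
  assumes q: "norm q < 1" "q \<noteq> 0" and x: "x \<noteq> 0"
  shows "theta_prod q (sigma (q * x)) * (q * x\<^sup>2) = theta_prod q (sigma x)"
proof -
  have p: "(\<lambda>N. q ^ N) \<longlonglongrightarrow> 0" using q by (intro LIMSEQ_power_zero) auto
  have p1: "(\<lambda>N. q ^ (N + 1)) \<longlonglongrightarrow> 0" using LIMSEQ_ignore_initial_segment[OF p, of 1] .
  have "(\<lambda>N. theta_partial N q (sigma (q * x)) * (q * x\<^sup>2) * (1 - q ^ N / x)\<^sup>2) \<longlonglongrightarrow> theta_prod q (sigma (q * x)) * (q * x\<^sup>2) * (1 - 0 / x)\<^sup>2"
    by (intro tendsto_intros theta_partial_limit q p x)
  moreover have "(\<lambda>N. theta_partial N q (sigma x) * (1 - q ^ (N+1) * x)\<^sup>2) \<longlonglongrightarrow> theta_prod q (sigma x) * (1 - 0 * x)\<^sup>2"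
    by (intro tendsto_intros theta_partial_limit q p1)
  ultimately show ?thesis using LIMSEQ_unique unfolding theta_partial_shift[OF assms] by fastforce
qed

lemma norm_ee_lt_1: "0 < Im t \<Longrightarrow> norm (ee t) < 1" by (simp add: norm_ee)

text \<open>Up to normalisation the square of the Jacobi theta function over eta^6, the weak Jacobi
  form of weight -2 and index 1.\<close>

definition theta_sq :: "complex \<Rightarrow> complex \<Rightarrow> complex" where "theta_sq t z = theta_prod (ee t) (sigma (ee z))"

lemma theta_sq_add_1: "theta_sq t (z + 1) = theta_sq t z" by (simp add: theta_sq_def)
lemma theta_sq_0 [simp]: "theta_sq t 0 = 0" by (simp add: theta_sq_def sigma_def theta_prod_def)
lemma theta_sq_add_t: assumes "0 < Im t" shows "theta_sq t (z + t) = ee (- t - 2 * z) * theta_sq t z"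
proof -
  have "ee (- t - 2 * z) * (ee t * (ee z)\<^sup>2) = 1"
    using ee_add[of "- t - 2 * z" "t + 2 * z"] ee_power(1)[of 2 z] by (simp add: ee_add)
  then show ?thesis
    using theta_prod_shift[OF norm_ee_lt_1[OF assms], of "ee z"]
    unfolding theta_sq_def ee_add mult.commute[of "ee z" "ee t"] by (metis ee_nonzero mult.commute mult.left_commute mult.right_neutral)
qed
lemma theta_sq_holomorphic: assumes "0 < Im t" shows "theta_sq t holomorphic_on UNIV"
proof -
  have h: "(\<lambda>z. sigma (ee z)) holomorphic_on UNIV" unfolding sigma_def by (intro holomorphic_intros) auto
  have "(theta_prod (ee t) \<circ> (\<lambda>z. sigma (ee z))) holomorphic_on UNIV"
    by (rule holomorphic_on_compose[OF h], rule holomorphic_on_subset[OF theta_prod_holomorphic[OF norm_ee_lt_1[OF assms]]]) simp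
  then show ?thesis by (simp add: theta_sq_def[abs_def] o_def)
qed

text \<open>At \<open>ee z\<close> = -1 every factor is a fourth power of (1 + q^n) / (1 - q^n). The
  value supplies both nonvanishing hypotheses of \<open>index_one_span\<close>.\<close>

lemma theta_sq_half_nonzero: assumes "0 < Im t" shows "theta_sq t (1 / 2) \<noteq> 0"
proof -
  have e: "ee (1 / 2) = - 1" by (simp add: ee_def)
  define q where "q = ee t"
  have q: "norm q < 1" using norm_ee_lt_1[OF assms] by (simp add: q_def)
  have "inf_prod (theta_factor q (- 4)) \<noteq> 0"
  proof (rule inf_prod_nonzero[OF summable_theta_factor[OF q]])
    fix n
    have "1 - sigma (- 1) * lambert_term q n = ((1 + q ^ (n+1)) / (1 - q ^ (n+1)))\<^sup>2"
      unfolding factor_sigma[OF q, of "- 1" n, simplified] by (simp add: power_divide power2_eq_square)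
    moreover have "1 + q ^ (n+1) \<noteq> 0"
    proof
      assume "1 + q ^ (n+1) = 0"
      then have "q ^ (n+1) = - 1" by (simp add: eq_neg_iff_add_eq_0 add.commute)
      then have "norm q ^ (n+1) = 1" by (metis norm_minus_cancel norm_one norm_power)
      moreover have "norm q ^ (n+1) < 1" using q by (simp add: power_less_one_iff del: power_Suc)
      ultimately show False by simp
    qed
    moreover have "1 - q ^ (n+1) \<noteq> 0" using one_minus_power_nz[OF q, of n] by simp
    ultimately show "1 + theta_factor q (- 4) n \<noteq> 0" by (simp add: theta_factor_def sigma_def)
  qed
  then show ?thesis by (simp add: theta_sq_def e sigma_def theta_prod_def q_def[symmetric])
qed

lemma fourier_unique1:
  assumes "\<And>x::real. ((\<lambda>n. a n * ee (of_int n * of_real x)) has_sum 0) UNIV"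
  shows "a n = 0"
proof -
  have "((\<lambda>(n::int, k::unit). a n * ee (of_int n * of_real x)) has_sum 0) UNIV" for x :: real
    using assms[of x] has_sum_reindex_bij_betw[of "\<lambda>n. (n, ())" UNIV UNIV
        "\<lambda>(n::int, k::unit). a n * ee (of_int n * of_real x)" 0]
    by (simp add: bij_betw_def inj_on_def surj_def)
  from fourier_unique_prod[of "\<lambda>n (k::unit). a n", OF this, of n]
  show ?thesis by (auto simp: has_sum_finite_iff)
qed

text \<open>The space \<open>index_one t\<close> is two-dimensional, spanned by the square of theta and its translate by
  \<open>1/2\<close>. The inversion formula follows because the transformed function lies in that space and
  vanishes to second order at \<open>0\<close>.\<close>

definition index_one :: "complex \<Rightarrow> (complex \<Rightarrow> complex) \<Rightarrow> bool" where
  "index_one t f \<longleftrightarrow> f holomorphic_on UNIV \<and> (\<forall>z. f (z + 1) = f z) \<and> (\<forall>z. f (z + t) = ee (- t - 2 * z) * f z)"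

lemma index_one_add: "index_one t f \<Longrightarrow> index_one t g \<Longrightarrow> index_one t (\<lambda>z. f z + g z)"
  by (auto simp: index_one_def ring_distribs intro!: holomorphic_intros)
lemma index_one_cmult: "index_one t f \<Longrightarrow> index_one t (\<lambda>z. c * f z)"
  by (auto simp: index_one_def intro!: holomorphic_intros)

lemma line_coeff_add: "continuous_on UNIV f \<Longrightarrow> continuous_on UNIV g \<Longrightarrow> line_coeff (\<lambda>z. f z + g z) r y = line_coeff f r y + line_coeff g r y"
  unfolding line_coeff_def line_integral_def ring_distribs
  by (rule integral_add)
     (auto intro!: integrable_continuous_real continuous_intros intro: continuous_on_hline[OF line_domain_UNIV])
lemma line_coeff_cmult: "line_coeff (\<lambda>z. c * f z) r y = c * line_coeff f r y"
  unfolding line_coeff_def line_integral_def by (simp add: mult.assoc)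

lemma index_one_fourier: assumes "index_one t f" shows "((\<lambda>r. line_coeff f r 0 * ee (of_int r * z)) has_sum f z) UNIV"
  by (rule fourier_has_sum[OF line_domain_UNIV]) (use assms in \<open>auto simp: index_one_def\<close>)

text \<open>Computing f(z + t) in two ways links Fourier coefficients of equal parity, so those at 0
  and 1 determine f.\<close>

lemma index_one_rec:
  assumes J: "index_one t f"
  shows "line_coeff f (r + 2) 0 = line_coeff f r 0 * ee ((of_int r + 1) * t)"
proof -
  have "line_coeff f r 0 * ee (of_int r * t) - line_coeff f (r + 2) 0 * ee (- t) = 0"
  proof (rule fourier_unique1[where a = "\<lambda>r. line_coeff f r 0 * ee (of_int r * t) - line_coeff f (r + 2) 0 * ee (- t)"])
    fix x :: real
    have 1: "((\<lambda>r. line_coeff f r 0 * ee (of_int r * t) * ee (of_int r * of_real x)) has_sum f (of_real x + t)) UNIV"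
      using index_one_fourier[OF J, of "of_real x + t"] by (simp add: ring_distribs ee_add mult_ac)
    have bij: "bij_betw (\<lambda>r::int. r + 2) UNIV UNIV" by (rule bij_betwI[where g = "\<lambda>r. r - 2"]) auto
    have "((\<lambda>r. line_coeff f (r + 2) 0 * ee (of_int (r + 2) * of_real x)) has_sum f (of_real x)) UNIV"
      using index_one_fourier[OF J, of "of_real x"] by (subst has_sum_reindex_bij_betw[OF bij])
    from has_sum_cmult_left[OF this, of "ee (- t - 2 * of_real x)"]
    have 2: "((\<lambda>r. line_coeff f (r + 2) 0 * ee (- t) * ee (of_int r * of_real x)) has_sum f (of_real x + t)) UNIV"
    proof (rule back_subst[of "\<lambda>g. (g has_sum _) UNIV", OF back_subst[of "\<lambda>v. (_ has_sum v) UNIV"]])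
      show "f (of_real x) * ee (- t - 2 * of_real x) = f (of_real x + t)" using J by (simp add: index_one_def)
      have "ee (of_int (r + 2) * of_real x) * ee (- t - 2 * of_real x) = ee (- t) * ee (of_int r * of_real x)" for r
        unfolding ee_add[symmetric] by (simp add: algebra_simps)
      then show "(\<lambda>r. line_coeff f (r + 2) 0 * ee (of_int (r + 2) * of_real x) * ee (- t - 2 * of_real x))
         = (\<lambda>r. line_coeff f (r + 2) 0 * ee (- t) * ee (of_int r * of_real x))" by (simp add: mult.assoc)
    qed
    show "((\<lambda>r. (line_coeff f r 0 * ee (of_int r * t) - line_coeff f (r + 2) 0 * ee (- t)) * ee (of_int r * of_real x)) has_sum 0) UNIV"
      using has_sum_add[OF 1 has_sum_cmult_right[OF 2, of "- 1"]] by (simp add: left_diff_distrib)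
  qed
  then have "line_coeff f r 0 * ee (of_int r * t) * ee t = line_coeff f (r + 2) 0 * (ee (- t) * ee t)" by simp
  moreover have "ee (- t) * ee t = 1" by (simp add: ee_minus)
  ultimately show ?thesis by (simp add: ring_distribs ee_add mult.assoc)
qed

lemma index_one_zero:
  assumes J: "index_one t f" and "line_coeff f 0 0 = 0" "line_coeff f 1 0 = 0"
  shows "f z = 0"
proof -
  have P: "line_coeff f r 0 = 0 \<and> line_coeff f (r + 1) 0 = 0" for r
  proof (induction r rule: int_induct[where k = 0])
    case base then show ?case using assms by simp
  next
    case (step1 i) then show ?case using index_one_rec[OF J, of i] by (simp add: algebra_simps)
  next
    case (step2 i) then show ?case using index_one_rec[OF J, of "i - 1"] by (simp add: algebra_simps)
  qed
  have "((\<lambda>r. line_coeff f r 0 * ee (of_int r * z)) has_sum f z) UNIV" by (rule index_one_fourier[OF J])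
  then have "((\<lambda>r::int. 0) has_sum f z) UNIV" using P by simp
  then show ?thesis by (rule has_sum_unique) (rule has_sum_0, simp)
qed

text \<open>Cramer's rule in the coordinates given by the Fourier coefficients 0 and 1.
  \<open>B\<close> and \<open>H\<close> are independent because only \<open>H\<close> is nonzero at
  0, and evaluating the relation between \<open>B\<close>, \<open>H\<close> and \<open>C\<close> at
  0 removes \<open>H\<close>.\<close>

lemma index_one_span:
  assumes B: "index_one t B" "B 0 = 0" and H: "index_one t H" "H 0 \<noteq> 0" and C: "index_one t C" "C 0 = 0" and nz: "B z0 \<noteq> 0"
  obtains c where "\<And>z. C z = c * B z"
proof -
  have cont: "continuous_on UNIV f" if "index_one t f" for f
    using that holomorphic_on_imp_continuous_on by (auto simp: index_one_def)
  define b0 b1 h0 h1 c0 c1 where "b0 = line_coeff B 0 0" and "b1 = line_coeff B 1 0" and "h0 = line_coeff H 0 0" and "h1 = line_coeff H 1 0"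
    and "c0 = line_coeff C 0 0" and "c1 = line_coeff C 1 0"
  have lin: "line_coeff (\<lambda>z. x * f z + y * g z) r 0 = x * line_coeff f r 0 + y * line_coeff g r 0" if "index_one t f" "index_one t g" for f g x y r
    by (simp add: line_coeff_add[OF cont[OF index_one_cmult[OF that(1)]] cont[OF index_one_cmult[OF that(2)]]] line_coeff_cmult)
  have J: "index_one t (\<lambda>z. x * f z + y * g z)" if "index_one t f" "index_one t g" for f g x y
    using that by (intro index_one_add index_one_cmult)
  define dt where "dt = b0 * h1 - b1 * h0"
  have dt: "dt \<noteq> 0"
  proof
    assume d: "dt = 0"
    have 1: "h1 * B z + (- b1) * H z = 0" for z
    proof (rule index_one_zero[OF J[OF B(1) H(1)]])
      show "line_coeff (\<lambda>z. h1 * B z + (- b1) * H z) 0 0 = 0" "line_coeff (\<lambda>z. h1 * B z + (- b1) * H z) 1 0 = 0"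
        unfolding lin[OF B(1) H(1)] b0_def[symmetric] b1_def[symmetric] h0_def[symmetric] h1_def[symmetric]
        using d by (simp_all add: dt_def algebra_simps)
    qed
    have 2: "h0 * B z + (- b0) * H z = 0" for z
    proof (rule index_one_zero[OF J[OF B(1) H(1)]])
      show "line_coeff (\<lambda>z. h0 * B z + (- b0) * H z) 0 0 = 0" "line_coeff (\<lambda>z. h0 * B z + (- b0) * H z) 1 0 = 0"
        unfolding lin[OF B(1) H(1)] b0_def[symmetric] b1_def[symmetric] h0_def[symmetric] h1_def[symmetric]
        using d by (simp_all add: dt_def algebra_simps)
    qed
    have "b1 = 0" "b0 = 0" using 1[of 0] 2[of 0] B(2) H(2) by auto
    then show False using index_one_zero[OF B(1), of z0] nz by (simp add: b0_def b1_def)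
  qed
  define \<beta> \<gamma> where "\<beta> = c0 * h1 - c1 * h0" and "\<gamma> = b0 * c1 - b1 * c0"
  have z: "1 * (dt * C z + (- \<beta>) * B z) + (- \<gamma>) * H z = 0" for z
  proof (rule index_one_zero[OF J[OF J[OF C(1) B(1)] H(1)]])
    show "line_coeff (\<lambda>z. 1 * (dt * C z + (- \<beta>) * B z) + (- \<gamma>) * H z) 0 0 = 0"
      unfolding lin[OF J[OF C(1) B(1)] H(1)] lin[OF C(1) B(1)] b0_def[symmetric] h0_def[symmetric] c0_def[symmetric] dt_def \<beta>_def \<gamma>_def
      by (simp add: algebra_simps)
    show "line_coeff (\<lambda>z. 1 * (dt * C z + (- \<beta>) * B z) + (- \<gamma>) * H z) 1 0 = 0"
      unfolding lin[OF J[OF C(1) B(1)] H(1)] lin[OF C(1) B(1)] b1_def[symmetric] h1_def[symmetric] c1_def[symmetric] dt_def \<beta>_def \<gamma>_def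
      by (simp add: algebra_simps)
  qed
  have "\<gamma> = 0" using z[of 0] B(2) C(2) H(2) by simp
  then have "C z = \<beta> / dt * B z" for z using z[of z] dt by (simp add: field_simps)
  then show ?thesis by (rule that)
qed

definition sigma_exp :: "complex fps" where "sigma_exp = fps_exp 1 - 2 + fps_exp (- 1)"

lemma theta_sq_expansion:
  assumes "0 < Im t"
  shows "(\<lambda>w. theta_sq t (w / (2 * of_real pi * \<i>))) has_fps_expansion (eval_q (ee t) theta_fps oo sigma_exp)"
proof -
  have e: "ee (w / (2 * of_real pi * \<i>)) = exp w" for w by (simp add: ee_def)
  have "(\<lambda>w. exp w - 2 + exp (- w)) has_fps_expansion sigma_exp"
    unfolding sigma_exp_def using has_fps_expansion_exp[of "1::complex"] has_fps_expansion_exp[of "-1::complex"]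
    by (intro fps_expansion_intros)
  from has_fps_expansion_compose[OF theta_prod_expansion[OF norm_ee_lt_1[OF assms]] this]
  have "(theta_prod (ee t) \<circ> (\<lambda>w. exp w - 2 + exp (- w))) has_fps_expansion (eval_q (ee t) theta_fps oo sigma_exp)"
    by (simp add: sigma_exp_def)
  moreover have "theta_prod (ee t) \<circ> (\<lambda>w. exp w - 2 + exp (- w)) = (\<lambda>w. theta_sq t (w / (2 * of_real pi * \<i>)))"
    by (simp add: fun_eq_iff theta_sq_def sigma_def e exp_minus inverse_eq_divide)
  ultimately show ?thesis by simp
qed

lemma sigma_exp_nth: "sigma_exp $ 0 = 0" "sigma_exp $ Suc 0 = 0" "sigma_exp $ 2 = 1" by (simp_all add: sigma_exp_def numeral_fps_const)

lemma theta_fps_sigma_exp_nth: 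
  assumes "norm q < 1"
  shows "(eval_q q theta_fps oo sigma_exp) $ 2 = 1"
proof -
  have "sigma_exp\<^sup>2 $ 2 = 0" by (simp add: power2_eq_square fps_mult_nth numeral_2_eq_2 sigma_exp_nth)
  moreover have "{0..2::nat} = {0, 1, 2}" by auto
  ultimately show ?thesis by (simp add: fps_compose_nth theta_fps(3) theta_fps(4)[simplified] sigma_exp_nth)
qed

theorem theta_sq_inversion:
  assumes t: "0 < Im t"
  shows "theta_sq (- 1 / t) (z / t) = ee (z\<^sup>2 / t) / t\<^sup>2 * theta_sq t z"
    and "(eval_q (ee (- 1 / t)) theta_fps oo sigma_exp) oo (fps_const (1 / t) * fps_X) =
      fps_const (1 / t\<^sup>2) * ((fps_exp (1 / (2 * of_real pi * \<i> * t)) oo fps_X\<^sup>2) * (eval_q (ee t) theta_fps oo sigma_exp))"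
proof -
  have t0: "t \<noteq> 0" using t by auto
  define t' where "t' = - 1 / t"
  have t': "0 < Im t'" using t unfolding t'_def Im_divide by (simp add: sum_power2_gt_zero_iff)
  \<comment> \<open>The transformed function with its exponential factor removed. Inversion
    exchanges the two periods: the law under z + 1 comes from \<open>theta_sq_add_t\<close> at -1/t,
    the law under z + t from periodicity.\<close>
  define C where "C z = theta_sq t' (z / t) * ee (- (z\<^sup>2 / t))" for z
  have hC: "C holomorphic_on UNIV"
  proof -
    have "(theta_sq t' \<circ> (\<lambda>z. z / t)) holomorphic_on UNIV"
      by (rule holomorphic_on_compose, intro holomorphic_intros, use t0 in simp, rule holomorphic_on_subset[OF theta_sq_holomorphic[OF t']]) auto
    then show ?thesis unfolding C_def[abs_def] o_def using t0 by (intro holomorphic_intros)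
  qed
  have J: "index_one t C" unfolding index_one_def
  proof (intro conjI allI hC)
    fix z
    have "theta_sq t' (z / t) = theta_sq t' (((z + 1) / t) + t')" using t0 by (simp add: t'_def field_simps)
    also have "\<dots> = ee (- t' - 2 * ((z + 1) / t)) * theta_sq t' ((z + 1) / t)" by (rule theta_sq_add_t[OF t'])
    finally have "C z = theta_sq t' ((z + 1) / t) * (ee (- t' - 2 * ((z + 1) / t)) * ee (- (z\<^sup>2 / t)))"
      by (simp add: C_def mult_ac)
    also have "ee (- t' - 2 * ((z + 1) / t)) * ee (- (z\<^sup>2 / t)) = ee (- ((z + 1)\<^sup>2 / t))"
    proof -
      have "(- t' - 2 * ((z + 1) / t)) + - (z\<^sup>2 / t) = - ((z + 1)\<^sup>2 / t)"
        using t0 by (simp add: t'_def power2_eq_square field_simps)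
      then show ?thesis unfolding ee_add[symmetric] by simp
    qed
    finally show "C (z + 1) = C z" by (simp add: C_def)
    have "theta_sq t' ((z + t) / t) = theta_sq t' (z / t)" using theta_sq_add_1[of t' "z / t"] t0 by (simp add: add_divide_distrib)
    moreover have "ee (- ((z + t)\<^sup>2 / t)) = ee (- t - 2 * z) * ee (- (z\<^sup>2 / t))"
    proof -
      have "- ((z + t)\<^sup>2 / t) = (- t - 2 * z) + - (z\<^sup>2 / t)"
        using t0 by (simp add: power2_eq_square field_simps)
      then show ?thesis unfolding ee_add[symmetric] by simp
    qed
    ultimately show "C (z + t) = ee (- t - 2 * z) * C z" by (simp add: C_def mult_ac)
  qed
  have JB: "index_one t (theta_sq t)" by (simp add: index_one_def theta_sq_holomorphic[OF t] theta_sq_add_1 theta_sq_add_t[OF t])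
  have JH: "index_one t (\<lambda>z. theta_sq t (z + 1 / 2))" unfolding index_one_def
  proof (intro conjI allI)
    have "(theta_sq t \<circ> (\<lambda>z. z + 1 / 2)) holomorphic_on UNIV"
      by (rule holomorphic_on_compose, intro holomorphic_intros, rule holomorphic_on_subset[OF theta_sq_holomorphic[OF t]]) auto
    then show "(\<lambda>z. theta_sq t (z + 1 / 2)) holomorphic_on UNIV" by (simp add: o_def)
    fix z
    show "theta_sq t (z + 1 + 1 / 2) = theta_sq t (z + 1 / 2)" using theta_sq_add_1[of t "z + 1/2"] by (simp add: algebra_simps)
    have "- t - 2 * (z + 1 / 2) = (- t - 2 * z) + of_int (- 1)" by simp
    then have "ee (- t - 2 * (z + 1 / 2)) = ee (- t - 2 * z)" by (simp only: ee_add_of_int)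
    then show "theta_sq t (z + t + 1 / 2) = ee (- t - 2 * z) * theta_sq t (z + 1 / 2)"
      using theta_sq_add_t[OF t, of "z + 1 / 2"] by (simp add: algebra_simps)
  qed
  obtain c where c: "\<And>z. C z = c * theta_sq t z"
    by (rule index_one_span[OF JB _ JH _ J]) (use theta_sq_half_nonzero[OF t] in \<open>auto simp: C_def\<close>)
  define \<kappa> where "\<kappa> = 1 / (2 * of_real pi * \<i> * t)"
  define P where "P = eval_q (ee t) theta_fps oo sigma_exp"
  define P' where "P' = eval_q (ee t') theta_fps oo sigma_exp"
  have l: "(\<lambda>w. 1 / t * w) has_fps_expansion (fps_const (1 / t) * fps_X)"
    by (intro fps_expansion_intros)
  have sq: "(\<lambda>w. w ^ 2) has_fps_expansion (fps_X ^ 2 :: complex fps)" by (rule has_fps_expansion_fps_X_power)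
  have E: "(\<lambda>w. exp (a * w\<^sup>2)) has_fps_expansion (fps_exp a oo fps_X\<^sup>2)" for a :: complex
    using has_fps_expansion_compose[OF has_fps_expansion_exp[of a] sq] by (simp add: o_def)
  have eC: "ee (- ((w / (2 * of_real pi * \<i>))\<^sup>2 / t)) = exp (- \<kappa> * w\<^sup>2)" for w
  proof -
    have "c * - ((w / c)\<^sup>2 / t) = - (1 / (c * t)) * w\<^sup>2" if "c \<noteq> 0" for c
      using that t0 by (simp add: power2_eq_square)
    from this[of "2 * of_real pi * \<i>"] show ?thesis by (simp only: ee_def \<kappa>_def) simp
  qed
  have "((\<lambda>w. theta_sq t' (w / (2 * of_real pi * \<i>))) \<circ> (\<lambda>w. 1 / t * w)) has_fps_expansion (P' oo (fps_const (1 / t) * fps_X))"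
    unfolding P'_def by (rule has_fps_expansion_compose[OF theta_sq_expansion[OF t'] l]) simp
  from has_fps_expansion_mult[OF this E[of "- \<kappa>"]]
  have x1: "(\<lambda>w. C (w / (2 * of_real pi * \<i>))) has_fps_expansion (P' oo (fps_const (1 / t) * fps_X)) * (fps_exp (- \<kappa>) oo fps_X\<^sup>2)"
    unfolding C_def eC o_def by (simp add: field_simps)
  have x2: "(\<lambda>w. C (w / (2 * of_real pi * \<i>))) has_fps_expansion fps_const c * P"
    unfolding c P_def by (intro has_fps_expansion_cmult_left theta_sq_expansion t)
  have id: "(P' oo (fps_const (1 / t) * fps_X)) * (fps_exp (- \<kappa>) oo fps_X\<^sup>2) = fps_const c * P"
    by (rule fps_expansion_unique_complex[OF x1 x2])
  have PP: "(fps_exp (- \<kappa>) oo fps_X\<^sup>2) * (fps_exp \<kappa> oo fps_X\<^sup>2) = 1"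
    by (simp add: fps_compose_mult_distrib[symmetric] fps_exp_add_mult[symmetric])
  have id2: "P' oo (fps_const (1 / t) * fps_X) = fps_const c * (P * (fps_exp \<kappa> oo fps_X\<^sup>2))"
    using arg_cong[OF id, of "\<lambda>x. x * (fps_exp \<kappa> oo fps_X\<^sup>2)"] PP by (simp add: mult.assoc)
  have q: "norm (ee t) < 1" "norm (ee t') < 1" using t t' by (auto intro: norm_ee_lt_1)
  have P0: "P $ 0 = 0" "P $ Suc 0 = 0" "P $ 2 = 1"
    using theta_fps_sigma_exp_nth[OF q(1)] by (simp_all add: P_def fps_compose_nth theta_fps(3) sigma_exp_nth)
  \<comment> \<open>Comparing the coefficients of w^2, which are 1 / t^2 and c, fixes the
    constant.\<close>
  have "(P' oo (fps_const (1 / t) * fps_X)) $ 2 = (1 / t)\<^sup>2"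
    using theta_fps_sigma_exp_nth[OF q(2)] by (simp add: fps_compose_linear P'_def)
  moreover have "(P * (fps_exp \<kappa> oo fps_X\<^sup>2)) $ 2 = 1"
    using P0 by (simp add: fps_mult_nth numeral_2_eq_2)
  ultimately have cc: "c = 1 / t\<^sup>2" using id2 by (simp add: power_divide)
  show "theta_sq (- 1 / t) (z / t) = ee (z\<^sup>2 / t) / t\<^sup>2 * theta_sq t z"
    using c[of z] cc by (simp add: C_def t'_def ee_minus field_simps)
  show "(eval_q (ee (- 1 / t)) theta_fps oo sigma_exp) oo (fps_const (1 / t) * fps_X) =
      fps_const (1 / t\<^sup>2) * ((fps_exp (1 / (2 * of_real pi * \<i> * t)) oo fps_X\<^sup>2) * (eval_q (ee t) theta_fps oo sigma_exp))"
    using id2 unfolding P_def P'_def t'_def cc \<kappa>_def by (simp add: mult_ac)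
qed

section \<open>Elliptic modular forms\<close>

text \<open>Level one forms given by their q-expansion: periodicity and holomorphy at the cusp are
  built in, so one equation remains. Weights are integers because those of the germs below can be
  negative.\<close>

definition modular_fps :: "complex set \<Rightarrow> int \<Rightarrow> complex fps \<Rightarrow> bool" where
  "modular_fps R K c \<longleftrightarrow> c \<in> disc_series R \<and> (\<forall>t. 0 < Im t \<longrightarrow> eval_fps c (ee (- 1 / t)) = t powi K * eval_fps c (ee t))"

lemma Im_inversion: "0 < Im t \<Longrightarrow> 0 < Im (- 1 / t)"
  unfolding Im_divide by (simp add: sum_power2_gt_zero_iff)

lemma ee_surj:
  assumes "norm q < 1" "q \<noteq> 0"
  obtains t where "0 < Im t" "ee t = q"
proof
  define t where "t = Ln q / (2 * of_real pi * \<i>)"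
  show e: "ee t = q" using assms by (simp add: t_def ee_def)
  have "exp (- 2 * pi * Im t) < exp 0" using assms(1) unfolding e[symmetric] norm_ee by simp
  then have "0 < 2 * pi * Im t" by simp
  then show "0 < Im t" by (simp add: zero_less_mult_iff)
qed

lemma modular_fps_mono: "R \<subseteq> R' \<Longrightarrow> modular_fps R K c \<Longrightarrow> modular_fps R' K c"
  using subsetD[OF disc_series_mono[of R R']] by (auto simp: modular_fps_def)

lemma modular_fps_disc_series: "modular_fps R K c \<Longrightarrow> c \<in> disc_series R" by (simp add: modular_fps_def)
lemma modular_fps_eq: "modular_fps R K c \<Longrightarrow> 0 < Im t \<Longrightarrow> eval_fps c (ee (- 1 / t)) = t powi K * eval_fps c (ee t)"
  by (simp only: modular_fps_def)

lemma modular_fps_diff: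
  assumes "is_subring R" "modular_fps R K c" "modular_fps R K d" shows "modular_fps R K (c - d)"
  unfolding modular_fps_def
proof (intro conjI allI impI)
  fix t assume t: "0 < Im t"
  show "eval_fps (c - d) (ee (- 1 / t)) = t powi K * eval_fps (c - d) (ee t)"
    unfolding ev_diff[OF assms(2,3)[THEN modular_fps_disc_series] norm_ee_lt_1[OF Im_inversion[OF t]]]
      ev_diff[OF assms(2,3)[THEN modular_fps_disc_series] norm_ee_lt_1[OF t]] modular_fps_eq[OF assms(2) t] modular_fps_eq[OF assms(3) t]
    by (simp add: right_diff_distrib)
qed (use assms in \<open>auto simp: modular_fps_disc_series disc_series_diff\<close>)

lemma modular_fps_mult:
  assumes "is_subring R" "modular_fps R K c" "modular_fps R L d" shows "modular_fps R (K + L) (c * d)"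
  unfolding modular_fps_def
proof (intro conjI allI impI)
  fix t assume t: "0 < Im t"
  then have "t \<noteq> 0" by auto
  then show "eval_fps (c * d) (ee (- 1 / t)) = t powi (K + L) * eval_fps (c * d) (ee t)"
    unfolding ev_mult[OF assms(2,3)[THEN modular_fps_disc_series] norm_ee_lt_1[OF Im_inversion[OF t]]]
      ev_mult[OF assms(2,3)[THEN modular_fps_disc_series] norm_ee_lt_1[OF t]] modular_fps_eq[OF assms(2) t] modular_fps_eq[OF assms(3) t]
    by (simp add: power_int_add)
qed (use assms in \<open>auto simp: modular_fps_disc_series disc_series_mult\<close>)

lemma modular_fps_const: "is_subring R \<Longrightarrow> x \<in> R \<Longrightarrow> modular_fps R 0 (fps_const x)"
  by (simp add: modular_fps_def disc_series_const)

lemma modular_fps_power: "is_subring R \<Longrightarrow> modular_fps R K c \<Longrightarrow> modular_fps R (K * int n) (c ^ n)"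
proof (induction n)
  case 0 then show ?case using modular_fps_const[of R 1] subring_1 by simp
next
  case (Suc n) then show ?case using modular_fps_mult[of R K c "K * int n" "c ^ n"] by (simp add: ring_distribs)
qed

lemma disc_series_zeroI:
  assumes "c \<in> disc_series R" "\<And>t. 0 < Im t \<Longrightarrow> eval_fps c (ee t) = 0" shows "c = 0"
proof (rule disc_series_eqI[OF assms(1) disc_series_0[OF is_subring_UNIV]])
  fix q :: complex assume "norm q < 1" "q \<noteq> 0"
  then obtain t where "0 < Im t" "ee t = q" using ee_surj by blast
  then show "eval_fps c q = eval_fps 0 q" using assms(2) by auto
qed

text \<open>Applying t -> -1/t twice returns to t with the factor (-1)^K.\<close>

lemma modular_fps_odd:
  assumes M: "modular_fps R K c" and K: "odd K" shows "c = 0"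
proof (rule disc_series_zeroI)
  show "c \<in> disc_series R" using M by (simp add: modular_fps_def)
  fix t assume t: "0 < Im t"
  then have t0: "t \<noteq> 0" by auto
  have "- 1 / (- 1 / t) = t" by simp
  with modular_fps_eq[OF M Im_inversion[OF t]] have "eval_fps c (ee t) = (- 1 / t) powi K * eval_fps c (ee (- 1 / t))" by simp
  also have "\<dots> = ((- 1 / t) * t) powi K * eval_fps c (ee t)"
    unfolding modular_fps_eq[OF M t] by (simp only: power_int_mult_distrib mult.assoc)
  also have "(- 1 / t) * t = - 1" using t0 by simp
  also have "(- 1 :: complex) powi K = - 1" using K by (simp add: power_int_minus_left)
  finally show "eval_fps c (ee t) = 0" by simp
qed

text \<open>Alternating the two generators at least doubles the imaginary part as long as it is below \<open>1/2\<close>.\<close>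

lemma fundamental_reduction:
  assumes S: "\<And>t. 0 < Im t \<Longrightarrow> g (ee (- 1 / t)) = g (ee t)" and t: "0 < Im t"
  obtains t' where "1 / 2 \<le> Im t'" "g (ee t') = g (ee t)"
proof -
  have "\<exists>t'. 1 / 2 \<le> Im t' \<and> g (ee t') = g (ee t)" if "0 < Im t" "1 / 2 \<le> 2 ^ j * Im t" for j t
    using that
  proof (induction j arbitrary: t)
    case 0 then show ?case by auto
  next
    case (Suc j)
    show ?case
    proof (cases "1 / 2 \<le> Im t")
      case False
      define t0 where "t0 = t + of_int (- round (Re t))"
      have e: "ee t0 = ee t" unfolding t0_def by (rule ee_add_of_int)
      have im: "Im t0 = Im t" by (simp add: t0_def)
      have "\<bar>Re t0\<bar> \<le> 1 / 2" using of_int_round_abs_le[of "Re t"] by (simp add: t0_def abs_minus_commute)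
      then have "(Re t0)\<^sup>2 \<le> (1 / 2)\<^sup>2" by (metis abs_ge_zero power2_abs power_mono)
      moreover have "(Im t0)\<^sup>2 \<le> (1 / 2)\<^sup>2" unfolding im using False Suc.prems by (intro power_mono) auto
      ultimately have n: "(Re t0)\<^sup>2 + (Im t0)\<^sup>2 \<le> 1 / 2" by (simp add: power2_eq_square)
      have n0: "0 < (Re t0)\<^sup>2 + (Im t0)\<^sup>2" using Suc.prems im by (simp add: sum_power2_gt_zero_iff)
      have "Im (- 1 / t0) = Im t / ((Re t0)\<^sup>2 + (Im t0)\<^sup>2)" unfolding Im_divide by (simp add: im)
      also have "\<dots> \<ge> Im t / (1 / 2)" using n n0 Suc.prems by (intro divide_left_mono) auto
      finally have i2: "2 * Im t \<le> Im (- 1 / t0)" by simp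
      have "1 / 2 \<le> 2 ^ j * (2 * Im t)" using Suc.prems by (simp add: mult_ac)
      also have "\<dots> \<le> 2 ^ j * Im (- 1 / t0)" using i2 by (intro mult_left_mono) auto
      finally obtain t' where "1 / 2 \<le> Im t'" "g (ee t') = g (ee (- 1 / t0))"
        using Suc.IH[of "- 1 / t0"] i2 Suc.prems by force
      moreover have "g (ee (- 1 / t0)) = g (ee t)" using S[of t0] im e Suc.prems by simp
      ultimately show ?thesis by auto
    qed (use Suc.prems in auto)
  qed
  moreover obtain j where "1 / 2 / Im t \<le> 2 ^ j" using real_arch_pow[of 2 "1 / 2 / Im t"] by (auto intro: less_imp_le)
  moreover from this have "1 / 2 \<le> 2 ^ j * Im t" using t by (simp add: field_simps)
  ultimately show ?thesis using that t by blast
qed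

text \<open>By \<open>fundamental_reduction\<close> all values on the punctured disc already occur
  for Im t >= 1/2, that is on |q| <= exp(- pi). The maximum over this compact disc is therefore an
  interior maximum over the whole disc.\<close>

lemma modular_fps_weight_0:
  assumes M: "modular_fps R 0 c" shows "c = fps_const (c $ 0)"
proof -
  have c: "c \<in> disc_series R" using M by (simp add: modular_fps_def)
  have h: "eval_fps c holomorphic_on ball 0 1" by (rule disc_series_holomorphic[OF c])
  define r where "r = exp (- pi)"
  have r: "0 < r" "r < 1" by (simp_all add: r_def)
  have "continuous_on (cball 0 r) (\<lambda>q. norm (eval_fps c q))"
    by (intro continuous_on_norm holomorphic_on_imp_continuous_on holomorphic_on_subset[OF h]) (use r in auto)
  then obtain \<xi> where \<xi>: "\<xi> \<in> cball 0 r" "\<And>q. q \<in> cball 0 r \<Longrightarrow> norm (eval_fps c q) \<le> norm (eval_fps c \<xi>)"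
    using continuous_attains_sup[of "cball (0::complex) r"] r by (metis compact_cball cball_eq_empty not_less less_imp_le)
  have mx: "norm (eval_fps c q) \<le> norm (eval_fps c \<xi>)" if q: "q \<in> ball 0 1" for q
  proof (cases "q = 0")
    case True then show ?thesis using \<xi>(2) r by simp
  next
    case False
    then obtain t where t: "0 < Im t" "ee t = q" using ee_surj[of q] q by auto
    obtain t' where t': "1 / 2 \<le> Im t'" "eval_fps c (ee t') = eval_fps c (ee t)"
      using fundamental_reduction[of "eval_fps c" t] M t by (auto simp: modular_fps_def)
    have "norm (ee t') \<le> r" unfolding norm_ee r_def using t'(1) by simp
    then show ?thesis using \<xi>(2)[of "ee t'"] t' t by simp
  qed
  have "eval_fps c constant_on ball 0 1"
    by (rule maximum_modulus_principle[OF h, where U = "ball 0 1", OF _ _ _ _ _ mx]) (use \<xi>(1) r in auto)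
  then have k: "eval_fps c q = eval_fps c 0" if "norm q < 1" for q
    using that unfolding constant_on_def by (metis dist_0_norm mem_ball norm_zero zero_less_one)
  have 0: "eval_fps c 0 = c $ 0" by (rule eval_fps_at_0)
  show ?thesis
    by (rule disc_series_eqI[OF c disc_series_const[OF is_subring_UNIV, of "c $ 0"]]) (use k 0 in auto)
qed

section \<open>The discriminant and an Eisenstein series from division values\<close>

definition zprod :: "(nat \<Rightarrow> complex fps) \<Rightarrow> complex fps" where
  "zprod f = (SOME c. c \<in> disc_series \<int> \<and> (\<forall>q. norm q < 1 \<longrightarrow> (\<lambda>N. \<Prod>n<N. eval_fps (f n) q) \<longlonglongrightarrow> eval_fps c q)
     \<and> (\<forall>n. (\<lambda>N. (\<Prod>i<N. f i) $ n) \<longlonglongrightarrow> c $ n))"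

lemma zprod:
  assumes f: "\<And>n. f n \<in> disc_series \<int>"
    and b: "\<And>n q \<rho>. 0 \<le> \<rho> \<Longrightarrow> \<rho> < 1 \<Longrightarrow> norm q \<le> \<rho> \<Longrightarrow> norm (eval_fps (f n) q - 1) \<le> B \<rho> * \<rho> ^ n"
    and B: "\<And>\<rho>. 0 \<le> \<rho> \<Longrightarrow> \<rho> < 1 \<Longrightarrow> 0 \<le> B \<rho>"
  shows "zprod f \<in> disc_series \<int>" "norm q < 1 \<Longrightarrow> (\<lambda>N. \<Prod>n<N. eval_fps (f n) q) \<longlonglongrightarrow> eval_fps (zprod f) q"
    "(\<lambda>N. (\<Prod>i<N. f i) $ n) \<longlonglongrightarrow> zprod f $ n"
proof -
  have ul: "uniform_limit (cball 0 \<rho>) (\<lambda>N q. eval_fps (\<Prod>n<N. f n) q) (\<lambda>q. inf_prod (\<lambda>n. eval_fps (f n) q - 1)) sequentially"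
    if \<rho>: "0 < \<rho>" "\<rho> < 1" for \<rho>
  proof -
    have "uniform_limit (cball 0 \<rho>) (\<lambda>N q. \<Prod>n<N. 1 + (eval_fps (f n) q - 1)) (\<lambda>q. inf_prod (\<lambda>n. eval_fps (f n) q - 1)) sequentially"
      by (rule prod_uniform_limit[where M = "\<lambda>n. B \<rho> * \<rho> ^ n"])
         (use b[of \<rho>] B[of \<rho>] \<rho> in \<open>auto intro!: summable_mult summable_geometric\<close>)
    then show ?thesis
      by (rule uniform_limit_cong'[THEN iffD1, rotated 2]) (use \<rho> in \<open>auto simp: ev_prod[OF is_subring_Ints f]\<close>)
  qed
  have "\<exists>c. c \<in> disc_series \<int> \<and> (\<forall>q. norm q < 1 \<longrightarrow> (\<lambda>N. \<Prod>n<N. eval_fps (f n) q) \<longlonglongrightarrow> eval_fps c q)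
     \<and> (\<forall>n. (\<lambda>N. (\<Prod>i<N. f i) $ n) \<longlonglongrightarrow> c $ n)"
  proof -
    obtain c where c: "c \<in> disc_series \<int>" "\<And>q. norm q < 1 \<Longrightarrow> eval_fps c q = inf_prod (\<lambda>n. eval_fps (f n) q - 1)" "\<And>n. (\<lambda>N. (\<Prod>i<N. f i) $ n) \<longlonglongrightarrow> c $ n"
      by (rule disc_series_Ints_limit[OF disc_series_prod[OF is_subring_Ints f] ul]) (assumption+ | rule that)+
    have "(\<lambda>N. \<Prod>n<N. eval_fps (f n) q) \<longlonglongrightarrow> eval_fps c q" if q: "norm q < 1" for q
    proof -
      have "(\<lambda>N. eval_fps (\<Prod>n<N. f n) q) \<longlonglongrightarrow> inf_prod (\<lambda>n. eval_fps (f n) q - 1)"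
        by (rule tendsto_uniform_limitI[OF ul[of "(1 + norm q) / 2"]]) (use q in \<open>auto simp: field_simps add_pos_nonneg\<close>)
      then show ?thesis using q c(2) by (simp add: ev_prod[OF is_subring_Ints f])
    qed
    then show ?thesis using c by blast
  qed
  from someI_ex[OF this, folded zprod_def]
  show "zprod f \<in> disc_series \<int>" "norm q < 1 \<Longrightarrow> (\<lambda>N. \<Prod>n<N. eval_fps (f n) q) \<longlonglongrightarrow> eval_fps (zprod f) q"
    "(\<lambda>N. (\<Prod>i<N. f i) $ n) \<longlonglongrightarrow> zprod f $ n" by blast+
qed

lemma zprod_nth_0:
  assumes "\<And>n. f n $ 0 = (1::complex)" "(\<lambda>N. (\<Prod>i<N. f i) $ 0) \<longlonglongrightarrow> zprod f $ 0"
  shows "zprod f $ 0 = 1"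
proof -
  have "(\<Prod>i<N. f i) $ 0 = 1" for N by (induction N) (auto simp: assms)
  then show ?thesis using LIMSEQ_unique[OF assms(2)] by simp
qed

lemma norm_one_minus_power_ge:
  assumes "norm (q::complex) \<le> \<rho>" "\<rho> < 1" shows "1 - \<rho> \<le> norm (1 - q ^ Suc n)"
proof -
  have \<rho>: "0 \<le> \<rho>" using assms norm_ge_zero[of q] by linarith
  have "norm (q ^ Suc n) \<le> \<rho> ^ Suc n" unfolding norm_power by (rule power_mono) (use assms in auto)
  moreover have "\<rho> ^ Suc n \<le> \<rho>" using power_decreasing[of 1 "Suc n" \<rho>] \<rho> assms by simp
  ultimately show ?thesis using norm_triangle_ineq2[of 1 "q ^ Suc n"] by simp
qed

lemma norm_power_le_power:
  assumes "norm (q::complex) \<le> \<rho>" "\<rho> < 1" "n \<le> j" shows "norm (q ^ j) \<le> \<rho> ^ n"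
proof -
  have \<rho>: "0 \<le> \<rho>" using assms norm_ge_zero[of q] by linarith
  have "norm (q ^ j) \<le> \<rho> ^ j" unfolding norm_power by (rule power_mono) (use assms in auto)
  also have "\<rho> ^ j \<le> \<rho> ^ n" using assms \<rho> by (intro power_decreasing) auto
  finally show ?thesis .
qed

definition euler_factor :: "nat \<Rightarrow> complex fps" where "euler_factor n = 1 - fps_X ^ Suc n"
text \<open>The product of these factors is the reciprocal of Gauss's series of (-1)^n q^(n^2) over
  all integers n; the product of \<open>triangle_factor\<close> is the reciprocal of the series of
  q^(n(n+1)/2) over n >= 0.\<close>

definition gauss_factor :: "nat \<Rightarrow> complex fps" where "gauss_factor n = (1 + fps_X ^ Suc n) * inverse (1 - fps_X ^ Suc n)"
definition triangle_factor :: "nat \<Rightarrow> complex fps" where "triangle_factor n = (1 - fps_X ^ Suc (2 * n)) * inverse (1 - fps_X ^ Suc (2 * n + 1))"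

lemmas subring_Z = is_subring_Ints

lemma euler_factor: "euler_factor n \<in> disc_series \<int>" "norm q < 1 \<Longrightarrow> eval_fps (euler_factor n) q = 1 - q ^ Suc n" "euler_factor n $ 0 = 1"
  using disc_series_one_minus_X ev_one_minus_X by (simp_all add: euler_factor_def)

lemma one_plus_X: "(1 + fps_X ^ Suc n :: complex fps) \<in> disc_series \<int>" "norm (q::complex) < 1 \<Longrightarrow> eval_fps (1 + fps_X ^ Suc n) q = 1 + q ^ Suc n"
proof -
  show "(1 + fps_X ^ Suc n :: complex fps) \<in> disc_series \<int>" by (intro disc_series_add disc_series_1 disc_series_power disc_series_X subring_Z)
  show "eval_fps (1 + fps_X ^ Suc n) q = 1 + q ^ Suc n" if "norm q < 1"
    unfolding ev_add[OF disc_series_1[OF subring_Z] disc_series_power[OF subring_Z disc_series_X[OF subring_Z]] that] eval_fps_X_power eval_fps_1 ..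
qed

lemma gauss_factor: "gauss_factor n \<in> disc_series \<int>" "norm q < 1 \<Longrightarrow> eval_fps (gauss_factor n) q = (1 + q ^ Suc n) / (1 - q ^ Suc n)" "gauss_factor n $ 0 = 1"
  using ev_mult[OF one_plus_X(1) disc_series_inverse_one_minus_X(1)] disc_series_mult[OF subring_Z one_plus_X(1) disc_series_inverse_one_minus_X(1)]
    disc_series_inverse_one_minus_X(2)[of q n] one_plus_X(2)[of q n]
  by (simp_all add: gauss_factor_def del: power_Suc)

lemma triangle_factor: "triangle_factor n \<in> disc_series \<int>" "norm q < 1 \<Longrightarrow> eval_fps (triangle_factor n) q = (1 - q ^ Suc (2 * n)) / (1 - q ^ Suc (2 * n + 1))" "triangle_factor n $ 0 = 1"
  using ev_mult[OF disc_series_one_minus_X disc_series_inverse_one_minus_X(1)] disc_series_mult[OF subring_Z disc_series_one_minus_X disc_series_inverse_one_minus_X(1)]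
    disc_series_inverse_one_minus_X(2)[of q "2 * n + 1"] ev_one_minus_X[of q "2 * n"]
  by (simp_all add: triangle_factor_def del: power_Suc)

lemma euler_factor_bound: assumes "norm q \<le> \<rho>" "\<rho> < 1" shows "norm (eval_fps (euler_factor n) q - 1) \<le> 1 * \<rho> ^ n"
  using norm_power_le_power[OF assms, of n "Suc n"] assms by (simp add: euler_factor del: power_Suc)

lemma frac_bound:
  assumes q: "norm (q::complex) \<le> \<rho>" "\<rho> < 1" and x: "norm x \<le> 2 * \<rho> ^ n" and e: "e - 1 = x / (1 - q ^ Suc j)"
  shows "norm (e - 1) \<le> 2 / (1 - \<rho>) * \<rho> ^ n"
proof -
  have "norm x / norm (1 - q ^ Suc j) \<le> (2 * \<rho> ^ n) / (1 - \<rho>)"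
    using norm_one_minus_power_ge[OF q, of j] x q order_trans[OF norm_ge_zero x] by (intro frac_le) auto
  then show ?thesis unfolding e norm_divide by simp
qed

lemma gauss_factor_bound: assumes q: "norm q \<le> \<rho>" "\<rho> < 1" shows "norm (eval_fps (gauss_factor n) q - 1) \<le> 2 / (1 - \<rho>) * \<rho> ^ n"
proof (rule frac_bound[OF q, of "2 * q ^ Suc n" _ _ n])
  have q1: "norm q < 1" using q by simp
  show "eval_fps (gauss_factor n) q - 1 = 2 * q ^ Suc n / (1 - q ^ Suc n)"
    using one_minus_power_nz[OF q1, of n] by (simp add: gauss_factor(2)[OF q1] field_simps del: power_Suc)
  show "norm (2 * q ^ Suc n) \<le> 2 * \<rho> ^ n"
    using norm_power_le_power[OF q, of n "Suc n"] by (simp add: norm_mult del: power_Suc)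
qed

lemma triangle_factor_bound: assumes q: "norm q \<le> \<rho>" "\<rho> < 1" shows "norm (eval_fps (triangle_factor n) q - 1) \<le> 2 / (1 - \<rho>) * \<rho> ^ n"
proof (rule frac_bound[OF q, of "q ^ Suc (2 * n + 1) - q ^ Suc (2 * n)" _ _ "2 * n + 1"])
  have q1: "norm q < 1" using q by simp
  show "eval_fps (triangle_factor n) q - 1 = (q ^ Suc (2 * n + 1) - q ^ Suc (2 * n)) / (1 - q ^ Suc (2 * n + 1))"
    using one_minus_power_nz[OF q1, of "2 * n + 1"] by (simp add: triangle_factor(2)[OF q1] field_simps del: power_Suc)
  show "norm (q ^ Suc (2 * n + 1) - q ^ Suc (2 * n)) \<le> 2 * \<rho> ^ n"
    using norm_triangle_ineq4[of "q ^ Suc (2 * n + 1)" "q ^ Suc (2 * n)"]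
      norm_power_le_power[OF q, of n "Suc (2 * n + 1)"] norm_power_le_power[OF q, of n "Suc (2 * n)"] by linarith
qed

definition "euler_fps = zprod euler_factor"
definition "gauss_fps = zprod gauss_factor"
definition "triangle_fps = zprod triangle_factor"

lemma euler_fps: "euler_fps \<in> disc_series \<int>" "norm q < 1 \<Longrightarrow> (\<lambda>N. \<Prod>n<N. 1 - q ^ Suc n) \<longlonglongrightarrow> eval_fps euler_fps q" "euler_fps $ 0 = 1"
proof -
  note z = zprod[of euler_factor "\<lambda>_. 1", OF euler_factor(1) euler_factor_bound, folded euler_fps_def]
  show "euler_fps \<in> disc_series \<int>" by (rule z(1)) auto
  show "(\<lambda>N. \<Prod>n<N. 1 - q ^ Suc n) \<longlonglongrightarrow> eval_fps euler_fps q" if "norm q < 1"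
    using z(2)[of q] that by (simp add: euler_factor(2) del: power_Suc)
  show "euler_fps $ 0 = 1" unfolding euler_fps_def by (rule zprod_nth_0[OF euler_factor(3)]) (use z(3)[of 0] in \<open>simp add: euler_fps_def\<close>)
qed

lemma gauss_fps: "gauss_fps \<in> disc_series \<int>" "norm q < 1 \<Longrightarrow> (\<lambda>N. \<Prod>n<N. (1 + q ^ Suc n) / (1 - q ^ Suc n)) \<longlonglongrightarrow> eval_fps gauss_fps q"
proof -
  note z = zprod[of gauss_factor "\<lambda>\<rho>. 2 / (1 - \<rho>)", OF gauss_factor(1) gauss_factor_bound, folded gauss_fps_def]
  show "gauss_fps \<in> disc_series \<int>" by (rule z(1)) auto
  show "(\<lambda>N. \<Prod>n<N. (1 + q ^ Suc n) / (1 - q ^ Suc n)) \<longlonglongrightarrow> eval_fps gauss_fps q" if "norm q < 1"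
    using z(2)[of q] that by (simp add: gauss_factor(2) del: power_Suc)
qed

lemma triangle_fps: "triangle_fps \<in> disc_series \<int>" "norm q < 1 \<Longrightarrow> (\<lambda>N. \<Prod>n<N. (1 - q ^ Suc (2 * n)) / (1 - q ^ Suc (2 * n + 1))) \<longlonglongrightarrow> eval_fps triangle_fps q" "triangle_fps $ 0 = 1"
proof -
  note z = zprod[of triangle_factor "\<lambda>\<rho>. 2 / (1 - \<rho>)", OF triangle_factor(1) triangle_factor_bound, folded triangle_fps_def]
  show "triangle_fps \<in> disc_series \<int>" by (rule z(1)) auto
  show "(\<lambda>N. \<Prod>n<N. (1 - q ^ Suc (2 * n)) / (1 - q ^ Suc (2 * n + 1))) \<longlonglongrightarrow> eval_fps triangle_fps q" if "norm q < 1"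
    using z(2)[of q] that by (simp add: triangle_factor(2) del: power_Suc)
  show "triangle_fps $ 0 = 1" unfolding triangle_fps_def by (rule zprod_nth_0[OF triangle_factor(3)]) (use z(3)[of 0] in \<open>simp add: triangle_fps_def\<close>)
qed

lemma euler_fps_nonzero:
  assumes q: "norm q < 1" shows "eval_fps euler_fps q \<noteq> 0"
proof -
  have s: "summable (\<lambda>n. norm (- (q ^ Suc n)))"
    using summable_bound[of "norm q" 1] q by (simp add: norm_power norm_mult)
  have "inf_prod (\<lambda>n. - (q ^ Suc n)) \<noteq> 0"
    by (rule inf_prod_nonzero[OF s]) (use one_minus_power_nz[OF q] in \<open>simp del: power_Suc\<close>)
  moreover have "inf_prod (\<lambda>n. - (q ^ Suc n)) = eval_fps euler_fps q"
    using LIMSEQ_unique[OF inf_prod_limit[OF s] ] euler_fps(2)[OF q] by (simp del: power_Suc)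
  ultimately show ?thesis by simp
qed

text \<open>The argument -4 is \<open>sigma (- 1)\<close>, so this is the value at the division
  point 1/2.\<close>

lemma theta_prod_minus_4: assumes q: "norm q < 1" shows "theta_prod q (- 4) = - 4 * eval_fps gauss_fps q ^ 4"
proof -
  have "theta_partial N q (- 4) = - 4 * (\<Prod>n<N. (1 + q ^ Suc n) / (1 - q ^ Suc n)) ^ 4" for N
  proof -
    have "1 + theta_factor q (- 4) n = ((1 + q ^ Suc n) / (1 - q ^ Suc n)) ^ 4" for n
    proof -
      have "1 - sigma (- 1) * lambert_term q n = ((1 + q ^ Suc n) / (1 - q ^ Suc n))\<^sup>2"
        unfolding factor_sigma[OF q, of "- 1" n, simplified] by (simp add: power_divide power2_eq_square)
      then have "(1 - sigma (- 1) * lambert_term q n)\<^sup>2 = ((1 + q ^ Suc n) / (1 - q ^ Suc n)) ^ 4"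
        by (simp add: power_mult[symmetric] del: power_Suc)
      then show ?thesis by (simp add: theta_factor_def sigma_def)
    qed
    then show ?thesis by (simp add: theta_partial_def prod_power_distrib del: power_Suc)
  qed
  then have "(\<lambda>N. theta_partial N q (- 4)) \<longlonglongrightarrow> - 4 * eval_fps gauss_fps q ^ 4"
    by (simp only:) (intro tendsto_intros gauss_fps(2) q)
  then show ?thesis using LIMSEQ_unique[OF theta_partial_limit[OF q]] by simp
qed

text \<open>As u is a square root of q, this is the value at the division point t/2, and with - u at
  (t + 1)/2. Numerators of consecutive factors overlap, which leaves (1 - u^(2N+1))^2 at finite
  level.\<close>

lemma theta_prod_sqrt:
  assumes u: "norm u < 1" "u \<noteq> 0" shows "theta_prod (u\<^sup>2) (sigma u) = eval_fps triangle_fps u ^ 4 / u"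
proof -
  have q: "norm (u\<^sup>2) < 1" using u by (simp add: norm_power power_less_one_iff)
  have fac: "1 - sigma u * lambert_term (u\<^sup>2) n = (1 - u ^ Suc (2 * Suc n)) * (1 - u ^ Suc (2 * n)) / (1 - u ^ Suc (2 * n + 1))\<^sup>2" for n
  proof -
    have e: "(u\<^sup>2) ^ (n+1) = u ^ Suc (2 * n + 1)" unfolding power_mult[symmetric] by (rule arg_cong) simp
    have "(u\<^sup>2) ^ (n+1) * u = u ^ Suc (2 * Suc n)" unfolding e by (simp add: mult_ac)
    moreover have "(u\<^sup>2) ^ (n+1) / u = u ^ Suc (2 * n)" unfolding e using u by simp
    ultimately show ?thesis using factor_sigma[OF q u(2), of n] unfolding e by (simp del: power_Suc)
  qed
  have id: "theta_partial N (u\<^sup>2) (sigma u) = (\<Prod>n<N. (1 - u ^ Suc (2 * n)) / (1 - u ^ Suc (2 * n + 1))) ^ 4 / u * (1 - u ^ Suc (2 * N))\<^sup>2" for N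
  proof (induction N)
    case 0 then show ?case using u by (simp add: theta_partial_def sigma_def power2_eq_square field_simps)
  next
    case (Suc N)
    have "theta_partial (Suc N) (u\<^sup>2) (sigma u) = theta_partial N (u\<^sup>2) (sigma u) * (1 - sigma u * lambert_term (u\<^sup>2) N)\<^sup>2"
      by (simp add: theta_partial_def theta_factor_def)
    moreover have "p ^ 4 / u * b\<^sup>2 * (a * b / c\<^sup>2)\<^sup>2 = (p * (b / c)) ^ 4 / u * a\<^sup>2" for p a b c :: complex
      by (simp add: power_divide power_mult_distrib eval_nat_numeral mult_ac)
    ultimately show ?case unfolding Suc fac prod.lessThan_Suc by simp
  qed
  have p: "(\<lambda>N. u ^ Suc (2 * N)) \<longlonglongrightarrow> 0"
    by (rule LIMSEQ_subseq_LIMSEQ[OF LIMSEQ_power_zero[OF u(1)], unfolded o_def]) (simp add: strict_mono_def)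
  have "(\<lambda>N. theta_partial N (u\<^sup>2) (sigma u)) \<longlonglongrightarrow> eval_fps triangle_fps u ^ 4 / u * (1 - 0)\<^sup>2"
    unfolding id by (intro tendsto_intros triangle_fps(2) u p)
  then show ?thesis using LIMSEQ_unique[OF theta_partial_limit[OF q]] by fastforce
qed

text \<open>The first three factors have N-th partial product \<open>E (2 * N) / E N ^ 4\<close>,
  and \<open>E\<close> tends to Euler's product along both N and 2 N.\<close>

lemma triple_product_value:
  assumes u: "norm u < 1"
  shows "eval_fps gauss_fps (u\<^sup>2) * (eval_fps triangle_fps u * eval_fps triangle_fps (- u)) * eval_fps euler_fps (u\<^sup>2) ^ 3 = 1"
proof -
  define q where "q = u\<^sup>2"
  have q: "norm q < 1" using u by (simp add: q_def norm_power power_less_one_iff)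
  have u': "norm (- u) < 1" using u by simp
  define E where "E N = (\<Prod>n<N. 1 - q ^ Suc n)" for N
  have E0: "E N \<noteq> 0" for N unfolding E_def using one_minus_power_nz[OF q] by (simp del: power_Suc)
  have lE: "E \<longlonglongrightarrow> eval_fps euler_fps q" unfolding E_def by (rule euler_fps(2)[OF q])
  have nz4: "eval_fps euler_fps q ^ 4 \<noteq> 0" using euler_fps_nonzero[OF q] by simp
  have l2: "(\<lambda>N. E (2 * N)) \<longlonglongrightarrow> eval_fps euler_fps q"
    by (rule LIMSEQ_subseq_LIMSEQ[OF lE, unfolded o_def]) (simp add: strict_mono_def)
  have l1: "(\<lambda>N. E (2 * N) / E N ^ 4 * E N ^ 3) \<longlonglongrightarrow> eval_fps euler_fps q / eval_fps euler_fps q ^ 4 * eval_fps euler_fps q ^ 3"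
    by (intro tendsto_intros lE l2 nz4)
  have id: "(\<Prod>n<N. (1 + q ^ Suc n) / (1 - q ^ Suc n)) * ((\<Prod>n<N. (1 - u ^ Suc (2 * n)) / (1 - u ^ Suc (2 * n + 1))) *
      (\<Prod>n<N. (1 - (- u) ^ Suc (2 * n)) / (1 - (- u) ^ Suc (2 * n + 1)))) = E (2 * N) / E N ^ 4" for N
  proof (induction N)
    case (Suc N)
    define b where "b = u ^ Suc (2 * N)"
    define a where "a = q ^ Suc N"
    have e: "u ^ Suc (2 * N + 1) = a" "(- u) ^ Suc (2 * N + 1) = a" "(- u) ^ Suc (2 * N) = - b"
      by (simp_all add: a_def b_def q_def power_mult[symmetric] power_mult power2_eq_square)
    have moment: "b * b = q ^ Suc (2 * N)" by (simp add: b_def q_def power_mult[symmetric] power_add[symmetric] mult_2)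
    have theta_prod: "a * a = q ^ Suc (2 * N + 1)" by (simp add: a_def power_add[symmetric] mult_2)
    have a1: "1 - a \<noteq> 0" using one_minus_power_nz[OF q, of N] by (simp add: a_def)
    have m1: "E (2 * Suc N) = E (2 * N) * ((1 - b * b) * (1 - a * a))" by (simp add: E_def moment theta_prod)
    have m2: "E (Suc N) = E N * (1 - a)" by (simp add: E_def a_def)
    have m3: "(1 + a) / (1 - a) * ((1 - b) / (1 - a) * ((1 - - b) / (1 - a))) = ((1 - b * b) * (1 - a * a)) / (1 - a) ^ 4"
    proof -
      have "(1 + a) / c * ((1 - b) / c * ((1 - - b) / c)) = ((1 - b * b) * ((1 + a) * c)) / c ^ 4" if "c \<noteq> 0" for c
        using that by (simp add: field_simps eval_nat_numeral)
      moreover have "(1 + a) * (1 - a) = 1 - a * a" by (simp add: algebra_simps)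
      ultimately show ?thesis using a1 by metis
    qed
    have g: "p1 * x * (p2 * y * (p3 * z)) = (p1 * (p2 * p3)) * (x * (y * z))" for p1 p2 p3 x y z :: complex
      by (simp add: mult_ac)
    show ?case unfolding prod.lessThan_Suc e a_def[symmetric] b_def[symmetric] g Suc m3 m1 m2
      by (simp add: power_mult_distrib)
  qed (simp add: E_def)
  have "(\<lambda>N. (\<Prod>n<N. (1 + q ^ Suc n) / (1 - q ^ Suc n)) * ((\<Prod>n<N. (1 - u ^ Suc (2 * n)) / (1 - u ^ Suc (2 * n + 1))) *
      (\<Prod>n<N. (1 - (- u) ^ Suc (2 * n)) / (1 - (- u) ^ Suc (2 * n + 1)))) * E N ^ 3)
      \<longlonglongrightarrow> eval_fps gauss_fps q * (eval_fps triangle_fps u * eval_fps triangle_fps (- u)) * eval_fps euler_fps q ^ 3"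
    by (intro tendsto_intros gauss_fps(2) triangle_fps(2) lE q u u')
  then have "(\<lambda>N. E (2 * N) / E N ^ 4 * E N ^ 3) \<longlonglongrightarrow> eval_fps gauss_fps q * (eval_fps triangle_fps u * eval_fps triangle_fps (- u)) * eval_fps euler_fps q ^ 3"
    unfolding id .
  from LIMSEQ_unique[OF this l1] show ?thesis using euler_fps_nonzero[OF q] by (simp add: q_def eval_nat_numeral)
qed

text \<open>The three division values have weight \<open>-2\<close> and are permuted up to sign by the modular group, so
  \<open>16 / (X1 X2 X3)\<^sup>2\<close> has weight 12 and \<open>X1\<^sup>4 + X2\<^sup>4 + X3\<^sup>4\<close> has weight \<open>-8\<close>. The former is \<open>Delta\<close>, and
  \<open>E4\<close> below is half the product of \<open>Delta\<close> with the latter.\<close>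

definition "X1 t = theta_sq t (1 / 2)"
definition "X2 t = ee (t / 4) * theta_sq t (t / 2)"
definition "X3 t = ee (t / 4) * theta_sq t ((t + 1) / 2)"

text \<open>The exponential ee(z^2 / t) at z = t/2 is \<open>ee (t / 4)\<close>, which is why this
  factor belongs to the division value. At z = (t - 1)/2 an additional ee(-1/2) = -1 appears, the
  sign of \<open>X3\<close>.\<close>

lemma X_inversion:
  assumes t: "0 < Im t"
  shows "X1 (- 1 / t) = X2 t / t\<^sup>2" "X2 (- 1 / t) = X1 t / t\<^sup>2" "X3 (- 1 / t) = - X3 t / t\<^sup>2"
proof -
  have a: "X1 (- 1 / t) = X2 t / t\<^sup>2" if t: "0 < Im t" for t
  proof -
    have t0: "t \<noteq> 0" using t by auto
    have h: "(t / 2) / t = 1 / 2" "(t / 2)\<^sup>2 / t = t / 4" using t0 by (simp_all add: power2_eq_square)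
    show ?thesis using theta_sq_inversion(1)[OF t, of "t / 2", unfolded h] by (simp add: X1_def X2_def)
  qed
  show "X1 (- 1 / t) = X2 t / t\<^sup>2" by (rule a[OF t])
  have t0: "t \<noteq> 0" using t by auto
  have "- 1 / (- 1 / t) = t" by simp
  with a[OF Im_inversion[OF t]] have "X1 t = X2 (- 1 / t) / (- 1 / t)\<^sup>2" by simp
  then show "X2 (- 1 / t) = X1 t / t\<^sup>2" using t0 by (simp add: power_divide)
  \<comment> \<open>(t - 1)/2 stands in for (t + 1)/2, since division by t turns it into (t' + 1)/2
    for t' = -1/t.\<close>
  have h: "((t - 1) / 2) / t = (- 1 / t + 1) / 2" "theta_sq t ((t - 1) / 2) = theta_sq t ((t + 1) / 2)"
    using t0 theta_sq_add_1[of t "(t - 1) / 2"] by (simp_all add: field_simps)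
  have 1: "theta_sq (- 1 / t) ((- 1 / t + 1) / 2) = ee (((t - 1) / 2)\<^sup>2 / t) / t\<^sup>2 * theta_sq t ((t + 1) / 2)"
    using theta_sq_inversion(1)[OF t, of "(t - 1) / 2"] unfolding h .
  have "(- 1 / t) / 4 + ((t - 1) / 2)\<^sup>2 / t = t / 4 + - 1 / 2" using t0 by (simp add: field_simps power2_eq_square)
  then have "ee ((- 1 / t) / 4) * ee (((t - 1) / 2)\<^sup>2 / t) = ee (t / 4) * ee (- 1 / 2)" unfolding ee_add[symmetric] by simp
  also have "ee (- 1 / 2) = - 1" by (simp add: ee_def exp_minus)
  finally have 2: "ee ((- 1 / t) / 4) * ee (((t - 1) / 2)\<^sup>2 / t) = - ee (t / 4)" by simp
  have "X3 (- 1 / t) = (ee ((- 1 / t) / 4) * ee (((t - 1) / 2)\<^sup>2 / t)) / t\<^sup>2 * theta_sq t ((t + 1) / 2)"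
    unfolding X3_def 1 by simp
  then show "X3 (- 1 / t) = - X3 t / t\<^sup>2" unfolding 2 by (simp add: X3_def)
qed

text \<open>\<open>X2\<close> and \<open>X3\<close> carry the power q^(-1/4); the recorded
  combinations turn it into 1/q.\<close>

lemma X_values:
  assumes t: "0 < Im t"
  defines "u \<equiv> ee (t / 2)"
  shows "X1 t = - 4 * eval_fps gauss_fps (ee t) ^ 4"
    "X2 t ^ 4 = eval_fps triangle_fps u ^ 16 / ee t" "X3 t ^ 4 = eval_fps triangle_fps (- u) ^ 16 / ee t"
    "(X2 t * X3 t)\<^sup>2 = (eval_fps triangle_fps u * eval_fps triangle_fps (- u)) ^ 8 / ee t" 
    "u\<^sup>2 = ee t" "norm u < 1" "norm (- u) < 1" "u \<noteq> 0"
proof -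
  have e2: "ee (1 / 2) = - 1" by (simp add: ee_def)
  show u2: "u\<^sup>2 = ee t" unfolding u_def ee_power(1)[symmetric] by simp
  show u: "norm u < 1" using t unfolding u_def by (intro norm_ee_lt_1) simp
  then show u': "norm (- u) < 1" by simp
  show u0: "u \<noteq> 0" by (simp add: u_def)
  show "X1 t = - 4 * eval_fps gauss_fps (ee t) ^ 4"
    unfolding X1_def theta_sq_def e2 using theta_prod_minus_4[OF norm_ee_lt_1[OF t]] by (simp add: sigma_def)
  have h: "ee (t / 4) ^ 2 = u" unfolding u_def ee_power(1)[symmetric] by simp
  then have h4: "ee (t / 4) ^ 4 = ee t" unfolding u2[symmetric] h[symmetric] by (simp flip: power_mult)
  have x2: "X2 t = ee (t / 4) * (eval_fps triangle_fps u ^ 4 / u)"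
    unfolding X2_def theta_sq_def u_def[symmetric] using theta_prod_sqrt[OF u u0] by (simp add: u2)
  have "ee ((t + 1) / 2) = - u" by (simp add: add_divide_distrib ee_add e2 u_def)
  then have x3: "X3 t = ee (t / 4) * (eval_fps triangle_fps (- u) ^ 4 / - u)"
    unfolding X3_def theta_sq_def using theta_prod_sqrt[OF u'] u0 by (simp add: u2)
  have u4: "u ^ 4 = ee t * ee t" unfolding u2[symmetric] by (simp add: power_add[symmetric])
  show "X2 t ^ 4 = eval_fps triangle_fps u ^ 16 / ee t"
    unfolding x2 power_mult_distrib power_divide h4 u4 power_mult[symmetric] by simp
  show "X3 t ^ 4 = eval_fps triangle_fps (- u) ^ 16 / ee t"
    unfolding x3 power_mult_distrib power_divide h4 power_mult[symmetric] by (simp add: u4)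
  have "X2 t * X3 t = - (ee (t / 4) ^ 2 / u ^ 2) * (eval_fps triangle_fps u * eval_fps triangle_fps (- u)) ^ 4"
    unfolding x2 x3 by (simp add: power_mult_distrib power2_eq_square)
  also have "ee (t / 4) ^ 2 / u ^ 2 = 1 / u" using h u0 by (simp add: power2_eq_square)
  finally show "(X2 t * X3 t)\<^sup>2 = (eval_fps triangle_fps u * eval_fps triangle_fps (- u)) ^ 8 / ee t"
    by (simp add: power_mult_distrib power_divide u2 power_mult[symmetric])
qed

section \<open>The discriminant and the form of weight 4\<close>

definition Delta :: "complex fps" where "Delta = fps_X * euler_fps ^ 24"

lemma Delta_disc_series: "Delta \<in> disc_series \<int>"
  unfolding Delta_def by (intro disc_series_mult disc_series_X disc_series_power euler_fps subring_Z)

lemma eval_Delta: "norm q < 1 \<Longrightarrow> eval_fps Delta q = q * eval_fps euler_fps q ^ 24"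
  unfolding Delta_def by (simp add: ev_mult[OF disc_series_X[OF subring_Z] disc_series_power[OF subring_Z euler_fps(1)]] ev_power[OF euler_fps(1)])

text \<open>The eighth power of \<open>triple_product_value\<close>; 16 is the square of the
  constant -4 in \<open>X1\<close>.\<close>

lemma Delta_X: assumes t: "0 < Im t" shows "eval_fps Delta (ee t) * (X1 t * (X2 t * X3 t))\<^sup>2 = 16"
proof -
  define u where "u = ee (t / 2)"
  note X = X_values[OF t, folded u_def]
  define g where "g = eval_fps gauss_fps (ee t)"
  define v where "v = eval_fps triangle_fps u * eval_fps triangle_fps (- u)"
  define e where "e = eval_fps euler_fps (ee t)"
  have id: "g * v * e ^ 3 = 1" using triple_product_value[OF X(6)] unfolding X(5) by (simp add: g_def v_def e_def)
  have "(X1 t * (X2 t * X3 t))\<^sup>2 = (X1 t)\<^sup>2 * (X2 t * X3 t)\<^sup>2" by (rule power_mult_distrib)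
  also have "\<dots> = 16 * g ^ 8 * (v ^ 8 / ee t)"
    unfolding X(4) X(1) by (simp add: power_mult_distrib power_mult[symmetric] g_def v_def)
  finally have "eval_fps Delta (ee t) * (X1 t * (X2 t * X3 t))\<^sup>2 = 16 * (g * v * e ^ 3) ^ 8"
    unfolding eval_Delta[OF norm_ee_lt_1[OF t]] by (simp add: power_mult_distrib power_mult[symmetric] e_def)
  then show ?thesis by (simp add: id)
qed

lemma Delta_modular_fps: "modular_fps \<int> 12 Delta"
  unfolding modular_fps_def
proof (intro conjI allI impI Delta_disc_series)
  fix t assume t: "0 < Im t"
  then have t0: "t \<noteq> 0" by auto
  let ?P = "\<lambda>t. (X1 t * (X2 t * X3 t))\<^sup>2"
  have P: "?P (- 1 / t) = ?P t / t ^ 12"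
    unfolding X_inversion[OF t] by (simp add: power_mult_distrib power_divide power_mult[symmetric] power_add[symmetric])
  have "?P t \<noteq> 0" using Delta_X[OF t] by auto
  moreover have "eval_fps Delta (ee (- 1 / t)) * (?P t / t ^ 12) = eval_fps Delta (ee t) * ?P t"
    using Delta_X[OF Im_inversion[OF t]] Delta_X[OF t] unfolding P by simp
  ultimately have "eval_fps Delta (ee (- 1 / t)) = t ^ 12 * eval_fps Delta (ee t)"
    using t0 by (simp add: field_simps)
  then show "eval_fps Delta (ee (- 1 / t)) = t powi 12 * eval_fps Delta (ee t)" by simp
qed

text \<open>Half of q (X2^4 + X3^4) as a series in q: in the sum the odd powers of ee(t/2) cancel
  and the even ones double, so halving keeps the coefficients integral.\<close>

definition even_part_fps :: "complex fps" where "even_part_fps = Abs_fps (\<lambda>n. (triangle_fps ^ 16) $ (2 * n))"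

lemma even_part_fps: "even_part_fps \<in> disc_series \<int>" "norm u < 1 \<Longrightarrow> 2 * eval_fps even_part_fps (u\<^sup>2) = eval_fps triangle_fps u ^ 16 + eval_fps triangle_fps (- u) ^ 16" "even_part_fps $ 0 = 1"
proof -
  have V: "triangle_fps ^ 16 \<in> disc_series \<int>" by (rule disc_series_power[OF subring_Z triangle_fps(1)])
  have s: "(\<lambda>n. 2 * (even_part_fps $ n * (u\<^sup>2) ^ n)) sums (eval_fps (triangle_fps ^ 16) u + eval_fps (triangle_fps ^ 16) (- u))" if u: "norm u < 1" for u
  proof -
    have u': "norm (- u) < 1" using u by simp
    have h1: "(\<lambda>k. triangle_fps ^ 16 $ k * u ^ k + triangle_fps ^ 16 $ k * (- u) ^ k) sums (eval_fps (triangle_fps ^ 16) u + eval_fps (triangle_fps ^ 16) (- u))"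
      by (intro sums_add sums_eval_fps disc_series_radius[OF V] u u')
    have h2: "triangle_fps ^ 16 $ k * u ^ k + triangle_fps ^ 16 $ k * (- u) ^ k = 0" if "k \<notin> range (\<lambda>n. 2 * n)" for k
    proof -
      have "odd k" using that by (auto elim!: evenE)
      then show ?thesis by (simp add: power_minus_odd)
    qed
    have sm: "strict_mono (\<lambda>n::nat. 2 * n)" by (simp add: strict_mono_def)
    have "(\<lambda>n. triangle_fps ^ 16 $ (2 * n) * u ^ (2 * n) + triangle_fps ^ 16 $ (2 * n) * (- u) ^ (2 * n)) sums (eval_fps (triangle_fps ^ 16) u + eval_fps (triangle_fps ^ 16) (- u))"
      using sums_mono_reindex[where f = "\<lambda>k. triangle_fps ^ 16 $ k * u ^ k + triangle_fps ^ 16 $ k * (- u) ^ k", OF sm h2] h1 by blast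
    moreover have "triangle_fps ^ 16 $ (2 * n) * u ^ (2 * n) + triangle_fps ^ 16 $ (2 * n) * (- u) ^ (2 * n) = 2 * (even_part_fps $ n * (u\<^sup>2) ^ n)" for n
    proof -
      have "(- u) ^ (2 * n) = u ^ (2 * n)" by (simp add: power_minus_even)
      then show ?thesis unfolding even_part_fps_def fps_nth_Abs_fps power_mult[symmetric] by (simp only: mult_2)
    qed
    ultimately show ?thesis by (simp only:)
  qed
  have rad: "fps_conv_radius even_part_fps \<ge> 1" unfolding fps_conv_radius_def
  proof (rule conv_radius_geI_ex)
    fix r :: real assume r: "0 < r" "ereal r < 1"
    define u where "u = complex_of_real (sqrt r)"
    have u: "norm u < 1" "u\<^sup>2 = of_real r" using r by (simp_all add: u_def one_ereal_def power2_eq_square flip: of_real_mult)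
    have "summable (\<lambda>n. even_part_fps $ n * (of_real r) ^ n)"
      using sums_summable[OF s[OF u(1)]] unfolding u(2) by (simp add: summable_cmult_iff)
    then show "\<exists>z::complex. norm z = r \<and> summable (\<lambda>n. even_part_fps $ n * z ^ n)"
      using r by (intro exI[of _ "of_real r"]) auto
  qed
  show H: "even_part_fps \<in> disc_series \<int>" unfolding disc_series_def using rad disc_series_nth[OF V] by (simp add: even_part_fps_def)
  show "2 * eval_fps even_part_fps (u\<^sup>2) = eval_fps triangle_fps u ^ 16 + eval_fps triangle_fps (- u) ^ 16" if u: "norm u < 1"
  proof -
    have u': "norm (- u) < 1" and u2: "norm (u\<^sup>2) < 1" using u by (simp_all add: norm_power power_less_one_iff)
    have "(\<lambda>n. 2 * (even_part_fps $ n * (u\<^sup>2) ^ n)) sums (2 * eval_fps even_part_fps (u\<^sup>2))"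
      by (intro sums_mult sums_eval_fps disc_series_radius[OF H u2])
    from sums_unique2[OF this s[OF u]] show ?thesis by (simp add: ev_power[OF triangle_fps(1)] u u')
  qed
  show "even_part_fps $ 0 = 1" by (simp add: even_part_fps_def triangle_fps(3) fps_nth_power_0)
qed

text \<open>128 is half of 4^4, the constant in \<open>X1 t ^ 4\<close>. What counts later is weight
  4, integrality and constant term 1.\<close>

definition E4 :: "complex fps" where "E4 = (fps_const 128 * fps_X * gauss_fps ^ 16 + even_part_fps) * euler_fps ^ 24"

lemma E4_nth_0: "E4 $ 0 = 1" by (simp add: E4_def even_part_fps(3) euler_fps(3) fps_nth_power_0)

lemma E4_modular_fps: "modular_fps \<int> 4 E4"
proof -
  have i: "fps_const 128 * fps_X \<in> disc_series \<int>" "fps_const 128 * fps_X * gauss_fps ^ 16 \<in> disc_series \<int>" "fps_const (128::complex) \<in> disc_series \<int>"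
    by (auto intro!: disc_series_mult disc_series_const disc_series_X disc_series_power gauss_fps subring_Z)
  have e1: "euler_fps ^ 24 \<in> disc_series \<int>" "gauss_fps ^ 16 \<in> disc_series \<int>" by (auto intro!: disc_series_power gauss_fps euler_fps subring_Z)
  have ev: "2 * eval_fps E4 (ee t) = (X1 t ^ 4 + X2 t ^ 4 + X3 t ^ 4) * eval_fps Delta (ee t)" if t: "0 < Im t" for t
  proof -
    define u where "u = ee (t / 2)"
    note X = X_values[OF t, folded u_def]
    have q: "norm (ee t) < 1" by (rule norm_ee_lt_1[OF t])
    have "eval_fps E4 (ee t) = (128 * ee t * eval_fps gauss_fps (ee t) ^ 16 + eval_fps even_part_fps (ee t)) * eval_fps euler_fps (ee t) ^ 24"
      unfolding E4_def ev_mult[OF disc_series_add[OF subring_Z i(2) even_part_fps(1)] e1(1) q] ev_add[OF i(2) even_part_fps(1) q] ev_mult[OF i(1) e1(2) q]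
        ev_mult[OF i(3) disc_series_X[OF subring_Z] q] ev_power[OF euler_fps(1) q] ev_power[OF gauss_fps(1) q] by simp
    then have "2 * eval_fps E4 (ee t) = (256 * ee t * eval_fps gauss_fps (ee t) ^ 16 + 2 * eval_fps even_part_fps (ee t)) * eval_fps euler_fps (ee t) ^ 24"
      by (simp add: algebra_simps)
    then have "2 * eval_fps E4 (ee t) = (256 * ee t * eval_fps gauss_fps (ee t) ^ 16 + (eval_fps triangle_fps u ^ 16 + eval_fps triangle_fps (- u) ^ 16)) * eval_fps euler_fps (ee t) ^ 24"
      unfolding even_part_fps(2)[OF X(6), unfolded X(5)] .
    also have "\<dots> = (X1 t ^ 4 + X2 t ^ 4 + X3 t ^ 4) * eval_fps Delta (ee t)"
      unfolding X(1) X(2) X(3) eval_Delta[OF q] by (simp add: power_mult_distrib power_mult[symmetric] field_simps)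
    finally show ?thesis .
  qed
  show ?thesis unfolding modular_fps_def
  proof (intro conjI allI impI)
    show "E4 \<in> disc_series \<int>" unfolding E4_def by (intro disc_series_mult disc_series_add i even_part_fps e1 subring_Z)
    fix t assume t: "0 < Im t"
    then have t0: "t \<noteq> 0" by auto
    have "X1 (- 1 / t) ^ 4 + X2 (- 1 / t) ^ 4 + X3 (- 1 / t) ^ 4 = (X1 t ^ 4 + X2 t ^ 4 + X3 t ^ 4) / t ^ 8"
      unfolding X_inversion[OF t] by (simp add: power_divide power_mult[symmetric] add_divide_distrib)
    moreover have "eval_fps Delta (ee (- 1 / t)) = t ^ 12 * eval_fps Delta (ee t)"
      using Delta_modular_fps t by (simp add: modular_fps_def)
    ultimately have "2 * eval_fps E4 (ee (- 1 / t)) = (t ^ 12 / t ^ 8) * (2 * eval_fps E4 (ee t))"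
      unfolding ev[OF Im_inversion[OF t]] ev[OF t] by simp
    also have "t ^ 12 / t ^ 8 = t ^ 4" using t0 by (simp add: field_simps power_add[symmetric])
    finally show "eval_fps E4 (ee (- 1 / t)) = t powi 4 * eval_fps E4 (ee t)" by simp
  qed
qed

section \<open>Sturm's bound modulo a prime ideal\<close>

text \<open>The ring is arbitrary because the lemma serves an ideal of complex numbers, an ideal of
  power series in q and, with the zero ideal, exact orders of vanishing.\<close>

lemma ideal_mult_nth:
  fixes a b :: "'a::comm_ring_1 fps"
  assumes I0: "0 \<in> I" and Iadd: "\<And>x y. x \<in> I \<Longrightarrow> y \<in> I \<Longrightarrow> x + y \<in> I"
    and Imult: "\<And>r x. r \<in> R \<Longrightarrow> x \<in> I \<Longrightarrow> r * x \<in> I"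
    and a: "\<And>n. a $ n \<in> R" "\<And>i. i < \<alpha> \<Longrightarrow> a $ i \<in> I"
    and b: "\<And>n. b $ n \<in> R" "\<And>i. i < \<beta> \<Longrightarrow> b $ i \<in> I"
  shows "i < \<alpha> + \<beta> \<Longrightarrow> (a * b) $ i \<in> I"
    and "(a * b) $ (\<alpha> + \<beta>) - a $ \<alpha> * b $ \<beta> \<in> I"
proof -
  have sum: "sum f J \<in> I" if "\<And>j. j \<in> J \<Longrightarrow> f j \<in> I" for f and J :: "nat set"
    using that by (induction J rule: infinite_finite_induct) (auto simp: I0 Iadd)
  have trm: "a $ j * b $ (i - j) \<in> I" if "j < \<alpha> \<or> i - j < \<beta>" for i j
    using that
  proof
    assume "j < \<alpha>"
    then show ?thesis using Imult[OF b(1) a(2)] by (simp add: mult.commute)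
  qed (rule Imult[OF a(1) b(2)])
  show "(a * b) $ i \<in> I" if "i < \<alpha> + \<beta>"
    unfolding fps_mult_nth by (rule sum, rule trm) (use that in auto)
  have "(a * b) $ (\<alpha> + \<beta>) = a $ \<alpha> * b $ \<beta> + (\<Sum>j\<in>{0..\<alpha> + \<beta>} - {\<alpha>}. a $ j * b $ (\<alpha> + \<beta> - j))"
    unfolding fps_mult_nth by (subst sum.remove[of _ \<alpha>]) auto
  moreover have "(\<Sum>j\<in>{0..\<alpha> + \<beta>} - {\<alpha>}. a $ j * b $ (\<alpha> + \<beta> - j)) \<in> I"
    by (rule sum, rule trm) auto
  ultimately show "(a * b) $ (\<alpha> + \<beta>) - a $ \<alpha> * b $ \<beta> \<in> I" by simp
qed

lemma ideal_power_nth: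
  fixes a :: "'a::comm_ring_1 fps"
  assumes I0: "0 \<in> I" and Iadd: "\<And>x y. x \<in> I \<Longrightarrow> y \<in> I \<Longrightarrow> x + y \<in> I"
    and Imult: "\<And>r x. r \<in> R \<Longrightarrow> x \<in> I \<Longrightarrow> r * x \<in> I"
    and R: "1 \<in> R" "0 \<in> R" "\<And>x y. x \<in> R \<Longrightarrow> y \<in> R \<Longrightarrow> x + y \<in> R" "\<And>x y. x \<in> R \<Longrightarrow> y \<in> R \<Longrightarrow> x * y \<in> R"
    and a: "\<And>n. a $ n \<in> R" "\<And>i. i < \<alpha> \<Longrightarrow> a $ i \<in> I"
  shows "(\<forall>i < j * \<alpha>. (a ^ j) $ i \<in> I) \<and> (a ^ j) $ (j * \<alpha>) - (a $ \<alpha>) ^ j \<in> I \<and> (\<forall>i. (a ^ j) $ i \<in> R)"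
proof (induction j)
  case 0 then show ?case using I0 R by simp
next
  case (Suc j)
  have sumR: "sum f J \<in> R" if "\<And>j. j \<in> J \<Longrightarrow> f j \<in> R" for f and J :: "nat set"
    using that by (induction J rule: infinite_finite_induct) (auto simp: R)
  have m1: "i < \<alpha> + j * \<alpha> \<Longrightarrow> (a * a ^ j) $ i \<in> I" for i
    by (rule ideal_mult_nth(1)[OF I0 Iadd Imult a]) (use Suc in auto)
  have m2: "(a * a ^ j) $ (\<alpha> + j * \<alpha>) - a $ \<alpha> * (a ^ j) $ (j * \<alpha>) \<in> I"
    by (rule ideal_mult_nth(2)[OF I0 Iadd Imult a]) (use Suc in auto)
  have "a $ \<alpha> * ((a ^ j) $ (j * \<alpha>) - (a $ \<alpha>) ^ j) \<in> I" using Imult[OF a(1)] Suc by blast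
  from Iadd[OF m2 this] have "(a * a ^ j) $ (\<alpha> + j * \<alpha>) - (a $ \<alpha>) ^ Suc j \<in> I" by (simp add: algebra_simps)
  moreover have "(a * a ^ j) $ i \<in> R" for i unfolding fps_mult_nth using Suc by (auto intro!: sumR R a)
  ultimately show ?case using m1 by simp
qed

locale prime_ideal =
  fixes R I :: "complex set"
  assumes R: "is_subring R" and IR: "I \<subseteq> R" and I0: "0 \<in> I" and I1: "1 \<notin> I"
    and Iadd: "\<And>x y. x \<in> I \<Longrightarrow> y \<in> I \<Longrightarrow> x + y \<in> I"
    and Imult: "\<And>r x. r \<in> R \<Longrightarrow> x \<in> I \<Longrightarrow> r * x \<in> I"
    and Iprime: "\<And>x y. x \<in> R \<Longrightarrow> y \<in> R \<Longrightarrow> x * y \<in> I \<Longrightarrow> x \<in> I \<or> y \<in> I"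
begin

lemma Iuminus: "x \<in> I \<Longrightarrow> - x \<in> I"
  using Imult[of "- 1" x] subring_uminus[OF R subring_1[OF R]] by simp
lemma Idiff: "x \<in> I \<Longrightarrow> y \<in> I \<Longrightarrow> x - y \<in> I"
  using Iadd[of x "- y"] Iuminus by simp
lemma Isum: "(\<And>j. j \<in> J \<Longrightarrow> f j \<in> I) \<Longrightarrow> sum f J \<in> I"
  by (induction J rule: infinite_finite_induct) (auto simp: I0 Iadd)

lemma power_nth:
  assumes "\<And>n. a $ n \<in> R" "\<And>i. i < \<alpha> \<Longrightarrow> a $ i \<in> I"
  shows "(\<forall>i < j * \<alpha>. (a ^ j) $ i \<in> I) \<and> (a ^ j) $ (j * \<alpha>) - (a $ \<alpha>) ^ j \<in> I"
  using ideal_power_nth[of I R a \<alpha> j] I0 Iadd Imult subring_1[OF R] subring_0[OF R] subring_add[OF R] subring_mult[OF R] assms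
  by blast

lemma mult_nth:
  assumes "\<And>n. a $ n \<in> R" "\<And>n. b $ n \<in> R" "\<And>i. i \<le> n \<Longrightarrow> a $ i \<in> I"
  shows "(a * b) $ n \<in> I"
  unfolding fps_mult_nth using assms by (intro Isum) (simp add: mult.commute[of "a $ _"] Imult)

lemma Ipower: "x \<in> R \<Longrightarrow> x ^ n \<in> I \<Longrightarrow> x \<in> I"
  by (induction n) (use I1 Iprime subring_power[OF R] in auto)

text \<open>Gauss's lemma: by primality, the first coefficient outside the ideal yields a
  coefficient of the power outside the ideal.\<close>

lemma fps_power_ideal:
  assumes a: "\<And>n. a $ n \<in> R" and p: "\<And>n. (a ^ j) $ n \<in> I"
  shows "a $ n \<in> I"
proof (rule ccontr)
  assume "a $ n \<notin> I"
  define m where "m = (LEAST n. a $ n \<notin> I)"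
  have m: "a $ m \<notin> I" unfolding m_def by (rule LeastI) (rule \<open>a $ n \<notin> I\<close>)
  have below: "a $ i \<in> I" if "i < m" for i using not_less_Least[of i] that by (auto simp: m_def)
  have "(a ^ j) $ (j * m) - (a $ m) ^ j \<in> I" using power_nth[of a m j] a below by blast
  then have "(a $ m) ^ j \<in> I" using Idiff[OF p[of "j * m"]] by fastforce
  then show False using Ipower a m by blast
qed

text \<open>Subtract a multiple of \<open>E4\<close> to a power to kill the constant term, then divide by \<open>Delta\<close>.\<close>

lemma sturm_12:
  assumes "modular_fps R (12 * int L) c" "\<And>n. n \<le> L \<Longrightarrow> c $ n \<in> I"
  shows "c $ n \<in> I"
  using assms
proof (induction L arbitrary: c n)
  case 0
  have "c = fps_const (c $ 0)" using modular_fps_weight_0[of R c] 0 by simp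
  then have "c $ n = fps_const (c $ 0) $ n" by (rule arg_cong)
  then show ?case using 0 I0 by (cases n) auto
next
  case (Suc L)
  have ZR: "\<int> \<subseteq> R" by (rule Ints_subset_subring[OF R])
  have cR: "c \<in> disc_series R" using Suc.prems by (simp add: modular_fps_disc_series)
  \<comment> \<open>\<open>E4 ^ 3\<close> has weight 12 and constant term 1, so its powers cover all
    weights divisible by 12.\<close>
  define P where "P = E4 ^ (3 * Suc L)"
  have P: "modular_fps R (12 * int (Suc L)) P"
    using modular_fps_power[OF R modular_fps_mono[OF ZR E4_modular_fps], of "3 * Suc L"] by (simp add: P_def algebra_simps)
  have P0: "P $ 0 = 1" by (simp add: P_def E4_nth_0 fps_nth_power_0)
  define d where "d = c - fps_const (c $ 0) * P"
  have d: "modular_fps R (12 * int (Suc L)) d"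
  proof -
    have "modular_fps R (0 + 12 * int (Suc L)) (fps_const (c $ 0) * P)"
      by (rule modular_fps_mult[OF R modular_fps_const[OF R disc_series_nth[OF cR]] P])
    then have "modular_fps R (12 * int (Suc L)) (fps_const (c $ 0) * P)" by simp
    then show ?thesis unfolding d_def by (rule modular_fps_diff[OF R Suc.prems(1)])
  qed
  have d0: "d $ 0 = 0" by (simp add: d_def P0)
  have dI: "d $ n - c $ n \<in> I" for n
    using Imult[OF disc_series_nth[OF modular_fps_disc_series[OF P]], of "c $ 0" n] Suc.prems(2)[of 0] Iuminus by (simp add: d_def mult.commute)
  define d' where "d' = fps_shift 1 d"
  have dd': "d = fps_X * d'" using d0 by (simp add: d'_def fps_eq_iff)
  have d'R: "d' \<in> disc_series R" using modular_fps_disc_series[OF d] unfolding disc_series_def d'_def by simp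
  \<comment> \<open>\<open>Delta\<close> is q times a series that is invertible over the integers,
    so dividing by it creates no denominators.\<close>
  define E where "E = euler_fps ^ 24"
  have E: "E \<in> disc_series \<int>" "E $ 0 = 1" by (auto simp: E_def euler_fps fps_nth_power_0 intro!: disc_series_power subring_Z)
  have Enz: "eval_fps E q \<noteq> 0" if "norm q < 1" for q
    using euler_fps_nonzero[OF that] by (simp add: E_def ev_power[OF euler_fps(1) that])
  note iE = disc_series_inverse[OF subring_Z E Enz]
  have iER: "inverse E \<in> disc_series R" using subsetD[OF disc_series_mono[OF ZR] iE(1)] by simp
  have ER: "E \<in> disc_series R" using subsetD[OF disc_series_mono[OF ZR] E(1)] .
  define g where "g = d' * inverse E"
  have gR: "g \<in> disc_series R" unfolding g_def by (rule disc_series_mult[OF R d'R iER])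
  have EE1: "E * inverse E = 1" by (rule inverse_mult_eq_1') (simp add: E(2))
  have "fps_X * E * (d' * inverse E) = fps_X * d' * (E * inverse E)" by (simp add: mult_ac)
  then have dg: "d = Delta * g" unfolding EE1 by (simp add: dd' g_def Delta_def E_def[symmetric])
  have gM: "modular_fps R (12 * int L) g" unfolding modular_fps_def
  proof (intro conjI allI impI gR)
    fix t assume t: "0 < Im t"
    then have t0: "t \<noteq> 0" by auto
    have e: "eval_fps d (ee t) = eval_fps Delta (ee t) * eval_fps g (ee t)" if "0 < Im t" for t
      unfolding dg by (rule ev_mult[OF subsetD[OF disc_series_mono[OF ZR] Delta_disc_series] gR norm_ee_lt_1[OF that]])
    have nz: "eval_fps Delta (ee t) \<noteq> 0" using Delta_X[OF t] by auto
    have "t powi 12 * eval_fps Delta (ee t) * eval_fps g (ee (- 1 / t)) = t powi (12 * int (Suc L)) * (eval_fps Delta (ee t) * eval_fps g (ee t))"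
      using modular_fps_eq[OF d t] unfolding e[OF t] e[OF Im_inversion[OF t]] modular_fps_eq[OF Delta_modular_fps t] .
    also have "12 * int (Suc L) = 12 + 12 * int L" by simp
    also have "t powi (12 + 12 * int L) = t powi 12 * t powi (12 * int L)" using t0 by (simp add: power_int_add)
    finally show "eval_fps g (ee (- 1 / t)) = t powi (12 * int L) * eval_fps g (ee t)"
      using nz t0 by simp
  qed
  have "g $ n \<in> I" for n
  proof (rule Suc.IH[OF gM])
    fix n assume n: "n \<le> L"
    have "d' $ i \<in> I" if "i < Suc n" for i
      using Iadd[OF dI[of "i + 1"] Suc.prems(2)[of "i + 1"]] that n by (simp add: d'_def)
    then have "(d' * inverse E) $ n \<in> I"
      using mult_nth[of d' "inverse E" n] disc_series_nth[OF d'R] disc_series_nth[OF iER] by simp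
    then show "g $ n \<in> I" by (simp add: g_def)
  qed
  then have "(g * Delta) $ n \<in> I" for n
    using mult_nth[of g Delta n] disc_series_nth[OF gR] disc_series_nth[OF subsetD[OF disc_series_mono[OF ZR] Delta_disc_series]] by simp
  then have "d $ n \<in> I" by (simp add: dg mult.commute)
  then show ?case using Idiff[OF _ dI[of n], of "d $ n"] by simp
qed

text \<open>The twelfth power has weight 12 K, divisible by 12, and its coefficients below 12 N > K
  lie in \<open>I\<close>, which is the hypothesis of \<open>sturm_12\<close> for L = K. Primality
  then returns to c.\<close>

theorem sturm_bound:
  assumes M: "modular_fps R (int K) c" and N: "K < 12 * N" and c: "\<And>n. n < N \<Longrightarrow> c $ n \<in> I"
  shows "c $ n \<in> I"
proof (rule fps_power_ideal)
  show cR: "c $ n \<in> R" for n using disc_series_nth[OF modular_fps_disc_series[OF M]] .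
  have M12: "modular_fps R (12 * int K) (c ^ 12)" using modular_fps_power[OF R M, of 12] by (simp add: mult.commute)
  show "(c ^ 12) $ n \<in> I" for n
    by (rule sturm_12[OF M12]) (use power_nth[of c N 12] cR c N in auto)
qed

end

section \<open>Jacobi germs\<close>

text \<open>A Jacobi germ of weight \<open>k\<close> and index \<open>m\<close> is recorded by its expansion in \<open>q\<close> and \<open>\<zeta> - 1\<close>; the
  transformation law is stated for its Taylor series in \<open>w = 2 \<pi> i z\<close>, where \<open>\<zeta> = exp w\<close>. No elliptic
  transformation law is imposed.\<close>

definition expm1_fps :: "complex fps" where "expm1_fps = fps_exp 1 - 1"
text \<open>With z = w / (2 pi i) the exponent 2 pi i m z^2 / t becomes m w^2 times
  \<open>kappa t\<close>.\<close>

definition kappa :: "complex \<Rightarrow> complex" where "kappa t = 1 / (2 * of_real pi * \<i> * t)"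
definition jacobi_germ :: "complex set \<Rightarrow> int \<Rightarrow> nat \<Rightarrow> complex fps fps \<Rightarrow> bool" where
  "jacobi_germ R k m C \<longleftrightarrow> disc_series2 R C \<and> (\<forall>t. 0 < Im t \<longrightarrow>
     (eval_q (ee (- 1 / t)) C oo expm1_fps) oo (fps_const (1 / t) * fps_X) =
     fps_const (t powi k) * ((fps_exp (of_nat m * kappa t) oo fps_X\<^sup>2) * (eval_q (ee t) C oo expm1_fps)))"

lemma expm1_fps_nth: "expm1_fps $ 0 = 0" "expm1_fps $ Suc 0 = 1" by (simp_all add: expm1_fps_def)

lemma jacobi_germ_disc_series2: "jacobi_germ R k m C \<Longrightarrow> disc_series2 R C" by (simp add: jacobi_germ_def)
lemma jacobi_germ_eq: "jacobi_germ R k m C \<Longrightarrow> 0 < Im t \<Longrightarrow> (eval_q (ee (- 1 / t)) C oo expm1_fps) oo (fps_const (1 / t) * fps_X) =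
     fps_const (t powi k) * ((fps_exp (of_nat m * kappa t) oo fps_X\<^sup>2) * (eval_q (ee t) C oo expm1_fps))"
  by (simp only: jacobi_germ_def)
lemma jacobi_germ_mono: "R \<subseteq> R' \<Longrightarrow> jacobi_germ R k m C \<Longrightarrow> jacobi_germ R' k m C"
  using disc_series2_mono unfolding jacobi_germ_def by blast

lemma jacobi_germ_mult:
  assumes "is_subring R" "jacobi_germ R k m C" "jacobi_germ R l n D" shows "jacobi_germ R (k + l) (m + n) (C * D)"
  unfolding jacobi_germ_def
proof (intro conjI allI impI)
  show "disc_series2 R (C * D)" by (intro disc_series2_mult assms jacobi_germ_disc_series2[OF assms(2)] jacobi_germ_disc_series2[OF assms(3)])
  fix t assume t: "0 < Im t"
  then have t0: "t \<noteq> 0" by auto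
  have exp: "fps_exp (of_nat (m + n) * kappa t) oo fps_X\<^sup>2 = (fps_exp (of_nat m * kappa t) oo fps_X\<^sup>2) * (fps_exp (of_nat n * kappa t) oo fps_X\<^sup>2)"
    by (subst fps_compose_mult_distrib[symmetric]) (simp_all add: fps_exp_add_mult[symmetric] ring_distribs)
  have pw: "fps_const (t powi (k + l)) = fps_const (t powi k) * fps_const (t powi l)"
    using t0 by (simp add: power_int_add)
  have sp: "eval_q (ee t) (C * D) oo expm1_fps = (eval_q (ee t) C oo expm1_fps) * (eval_q (ee t) D oo expm1_fps)" if "0 < Im t" for t
    unfolding eval_q_mult[OF assms(1) jacobi_germ_disc_series2[OF assms(2)] jacobi_germ_disc_series2[OF assms(3)] norm_ee_lt_1[OF that]]
    by (rule fps_compose_mult_distrib[OF expm1_fps_nth(1)])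
  have "(eval_q (ee (- 1 / t)) (C * D) oo expm1_fps) oo (fps_const (1 / t) * fps_X)
      = ((eval_q (ee (- 1 / t)) C oo expm1_fps) oo (fps_const (1 / t) * fps_X)) * ((eval_q (ee (- 1 / t)) D oo expm1_fps) oo (fps_const (1 / t) * fps_X))"
    unfolding sp[OF Im_inversion[OF t]] by (rule fps_compose_mult_distrib) simp
  also have "\<dots> = fps_const (t powi (k + l)) * ((fps_exp (of_nat (m + n) * kappa t) oo fps_X\<^sup>2) * (eval_q (ee t) (C * D) oo expm1_fps))"
    unfolding jacobi_germ_eq[OF assms(2) t] jacobi_germ_eq[OF assms(3) t] sp[OF t] exp pw by (simp only: mult_ac)
  finally show "(eval_q (ee (- 1 / t)) (C * D) oo expm1_fps) oo (fps_const (1 / t) * fps_X)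
    = fps_const (t powi (k + l)) * ((fps_exp (of_nat (m + n) * kappa t) oo fps_X\<^sup>2) * (eval_q (ee t) (C * D) oo expm1_fps))" .
qed

lemma jacobi_germ_diff:
  assumes "is_subring R" "jacobi_germ R k m C" "jacobi_germ R k m D" shows "jacobi_germ R k m (C - D)"
  unfolding jacobi_germ_def
proof (intro conjI allI impI)
  show "disc_series2 R (C - D)" by (intro disc_series2_diff assms jacobi_germ_disc_series2[OF assms(2)] jacobi_germ_disc_series2[OF assms(3)])
  fix t assume t: "0 < Im t"
  have sp: "eval_q (ee t) (C - D) oo expm1_fps = (eval_q (ee t) C oo expm1_fps) - (eval_q (ee t) D oo expm1_fps)" if "0 < Im t" for t
    unfolding eval_q_diff[OF jacobi_germ_disc_series2[OF assms(2)] jacobi_germ_disc_series2[OF assms(3)] norm_ee_lt_1[OF that]]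
    by (rule fps_compose_sub_distrib)
  show "(eval_q (ee (- 1 / t)) (C - D) oo expm1_fps) oo (fps_const (1 / t) * fps_X)
    = fps_const (t powi k) * ((fps_exp (of_nat m * kappa t) oo fps_X\<^sup>2) * (eval_q (ee t) (C - D) oo expm1_fps))"
    unfolding sp[OF Im_inversion[OF t]] fps_compose_sub_distrib jacobi_germ_eq[OF assms(2) t] jacobi_germ_eq[OF assms(3) t] sp[OF t]
    by (simp only: right_diff_distrib)
qed

lemma jacobi_germ_const:
  assumes "is_subring R" "modular_fps R K c" shows "jacobi_germ R K 0 (fps_const c)"
  unfolding jacobi_germ_def
proof (intro conjI allI impI)
  show "disc_series2 R (fps_const c)" by (intro disc_series2_const assms modular_fps_disc_series[OF assms(2)])
  fix t assume t: "0 < Im t"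
  show "(eval_q (ee (- 1 / t)) (fps_const c) oo expm1_fps) oo (fps_const (1 / t) * fps_X)
    = fps_const (t powi K) * ((fps_exp (of_nat 0 * kappa t) oo fps_X\<^sup>2) * (eval_q (ee t) (fps_const c) oo expm1_fps))"
    unfolding eval_q_const fps_const_compose modular_fps_eq[OF assms(2) t] by simp
qed

lemma jacobi_germ_power:
  assumes "is_subring R" "jacobi_germ R k m C" shows "jacobi_germ R (int n * k) (n * m) (C ^ n)"
proof (induction n)
  case 0 then show ?case using jacobi_germ_const[OF assms(1) modular_fps_const[OF assms(1) subring_1[OF assms(1)]]] by simp
next
  case (Suc n) then show ?case using jacobi_germ_mult[OF assms Suc] by (simp add: ring_distribs)
qed

lemma compose_expm1_fps_nth:
  assumes "\<And>j. j < i \<Longrightarrow> P $ j = 0"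
  shows "(P oo expm1_fps) $ i = P $ i" "j < i \<Longrightarrow> (P oo expm1_fps) $ j = 0"
proof -
  have z: "(expm1_fps ^ l) $ n = 0" if "n < l" for n l
    using startsby_zero_power_prefix[OF expm1_fps_nth(1), of l] that by auto
  have "(P oo expm1_fps) $ i = (\<Sum>l\<in>{0..i}. if l = i then P $ i else 0)"
    unfolding fps_compose_nth
    by (rule sum.cong) (use assms startsby_zero_power_nth_same[OF expm1_fps_nth(1), of i] in \<open>auto simp: expm1_fps_nth\<close>)
  then show "(P oo expm1_fps) $ i = P $ i" by simp
  show "(P oo expm1_fps) $ j = 0" if "j < i" using assms that by (simp add: fps_compose_nth)
qed

text \<open>The exponential factor starts with 1 and the substitution exp w - 1 starts with w, so
  neither affects the first coefficient after exact zeros; scaling w by 1/t contributes the weight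
  i.\<close>

lemma jacobi_germ_leading:
  assumes J: "jacobi_germ R k m C" and z: "\<And>j. j < i \<Longrightarrow> C $ j = 0"
  shows "modular_fps R (k + int i) (C $ i)"
  unfolding modular_fps_def
proof (intro conjI allI impI)
  show "C $ i \<in> disc_series R" using jacobi_germ_disc_series2[OF J] by (simp add: disc_series2_def)
  fix t assume t: "0 < Im t"
  then have t0: "t \<noteq> 0" by auto
  have z': "eval_q q C $ j = 0" if "j < i" for q j using z[OF that] by simp
  have c: "(eval_q q C oo expm1_fps) $ i = eval_fps (C $ i) q" "j < i \<Longrightarrow> (eval_q q C oo expm1_fps) $ j = 0" for q j
    using compose_expm1_fps_nth(1)[of i "eval_q q C"] compose_expm1_fps_nth(2)[of i "eval_q q C" j] z' by simp_all
  let ?E = "fps_exp (of_nat m * kappa t) oo fps_X\<^sup>2"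
  have E0: "?E $ 0 = 1" by simp
  have "(?E * (eval_q (ee t) C oo expm1_fps)) $ i = (\<Sum>j\<in>{0..i}. if j = 0 then eval_fps (C $ i) (ee t) else 0)"
    unfolding fps_mult_nth by (rule sum.cong) (auto simp: c E0)
  then have r: "(?E * (eval_q (ee t) C oo expm1_fps)) $ i = eval_fps (C $ i) (ee t)" by simp
  have "((eval_q (ee (- 1 / t)) C oo expm1_fps) oo (fps_const (1 / t) * fps_X)) $ i = (1 / t) ^ i * eval_fps (C $ i) (ee (- 1 / t))"
    unfolding fps_compose_linear fps_nth_Abs_fps c(1) ..
  then have "(1 / t) ^ i * eval_fps (C $ i) (ee (- 1 / t)) = t powi k * eval_fps (C $ i) (ee t)"
    unfolding jacobi_germ_eq[OF J t] fps_mult_left_const_nth r by simp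
  then have "t ^ i * (1 / t) ^ i * eval_fps (C $ i) (ee (- 1 / t)) = t ^ i * t powi k * eval_fps (C $ i) (ee t)"
    by (simp only: mult.assoc)
  moreover have "t ^ i * (1 / t) ^ i = 1" using t0 by (simp add: power_mult_distrib[symmetric])
  moreover have "t powi (k + int i) = t ^ i * t powi k" using t0 by (simp add: power_int_add)
  ultimately show "eval_fps (C $ i) (ee (- 1 / t)) = t powi (k + int i) * eval_fps (C $ i) (ee t)"
    by (simp only: mult_1)
qed

section \<open>Theta germs at N z\<close>

definition sigma_fps :: "complex fps" where "sigma_fps = fps_X\<^sup>2 * Abs_fps (\<lambda>n. (- 1) ^ n)"
definition dilate_fps :: "nat \<Rightarrow> complex fps" where "dilate_fps N = (1 + fps_X) ^ N - 1"
text \<open>The theta square at N z. In X = zeta - 1, \<open>sigma_fps\<close> is X^2 / (1 + X) =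
  zeta - 2 + 1/zeta, and \<open>dilate_fps N\<close> is zeta^N - 1. Using zeta - 1 instead of w
  keeps all coefficients integral.\<close>

definition theta_germ :: "nat \<Rightarrow> complex fps fps" where "theta_germ N = theta_fps oo lift_fps (sigma_fps oo dilate_fps N)"

lemma coeffs_in_compose: "is_subring R \<Longrightarrow> c \<in> coeffs_in R \<Longrightarrow> d \<in> coeffs_in R \<Longrightarrow> c oo d \<in> coeffs_in R"
  by (auto simp: coeffs_in_def fps_compose_nth intro!: subring_sum subring_mult coeffs_in_nth[OF coeffs_in_power])

lemma sigma_fps_coeffs_in: "sigma_fps \<in> coeffs_in \<int>"
proof -
  have "Abs_fps (\<lambda>n. (- 1) ^ n) \<in> coeffs_in \<int>" by (simp add: coeffs_in_def)
  then show ?thesis unfolding sigma_fps_def by (intro coeffs_in_mult coeffs_in_power coeffs_in_X is_subring_Ints)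
qed

lemma dilate_fps_coeffs_in: "dilate_fps N \<in> coeffs_in \<int>"
proof -
  have 1: "1 \<in> coeffs_in \<int>" using coeffs_in_const[OF is_subring_Ints, of 1] by simp
  show ?thesis unfolding dilate_fps_def by (intro coeffs_in_diff coeffs_in_add coeffs_in_power coeffs_in_X 1 is_subring_Ints)
qed

lemma sigma_fps_dilate_fps_coeffs_in: "sigma_fps oo dilate_fps N \<in> coeffs_in \<int>" by (intro coeffs_in_compose sigma_fps_coeffs_in dilate_fps_coeffs_in is_subring_Ints)

lemma sigma_fps_eq: "sigma_fps * (1 + fps_X) = fps_X\<^sup>2"
proof -
  have "Abs_fps (\<lambda>n. (- 1) ^ n) * (1 + fps_X) = (1 :: complex fps)"
  proof (rule fps_ext)
    fix n show "(Abs_fps (\<lambda>n. (- 1) ^ n) * (1 + fps_X)) $ n = (1 :: complex fps) $ n"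
      by (cases n) (simp_all add: distrib_left)
  qed
  then show ?thesis by (simp add: sigma_fps_def mult.assoc)
qed

lemma dilate_fps_nth: "dilate_fps N $ 0 = 0" "dilate_fps N $ Suc 0 = of_nat N"
  by (simp_all add: dilate_fps_def fps_binomial_of_nat[symmetric] fps_nth_power_0)

lemma dilate_fps_expm1_fps: "dilate_fps N oo expm1_fps = fps_exp (of_nat N) - 1"
proof -
  have "(1 + fps_X) oo expm1_fps = fps_exp 1" by (simp add: fps_compose_add_distrib expm1_fps_def)
  then show ?thesis
    by (simp add: dilate_fps_def fps_compose_sub_distrib fps_compose_power[OF expm1_fps_nth(1), symmetric] fps_exp_power_mult)
qed

lemma sigma_fps_compose_exp: "sigma_fps oo (fps_exp a - 1) = fps_exp a - 2 + fps_exp (- a)"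
proof -
  let ?y = "fps_exp a - 1 :: complex fps"
  have y0: "?y $ 0 = 0" by simp
  have "(sigma_fps * (1 + fps_X)) oo ?y = (sigma_fps oo ?y) * fps_exp a"
    unfolding fps_compose_mult_distrib[OF y0] by (simp add: fps_compose_add_distrib)
  then have "(sigma_fps oo ?y) * fps_exp a = ?y\<^sup>2"
    unfolding sigma_fps_eq by (simp add: fps_compose_power[OF y0, symmetric])
  then have "(sigma_fps oo ?y) * (fps_exp a * fps_exp (- a)) = ?y\<^sup>2 * fps_exp (- a)" by (simp add: mult.assoc[symmetric])
  moreover have inv: "fps_exp a * fps_exp (- a) = 1" by (simp add: fps_exp_add_mult[symmetric])
  ultimately have "sigma_fps oo ?y = ?y\<^sup>2 * fps_exp (- a)" by simp
  also have "\<dots> = fps_exp a * (fps_exp a * fps_exp (- a)) - 2 * (fps_exp a * fps_exp (- a)) + fps_exp (- a)"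
    by (simp add: power2_eq_square algebra_simps)
  finally show ?thesis unfolding inv by simp
qed

lemma eval_q_theta_germ:
  assumes q: "norm q < 1"
  shows "eval_q q (theta_germ N) oo expm1_fps = (eval_q q theta_fps oo sigma_exp) oo (fps_const (of_nat N) * fps_X)"
proof -
  have g0: "(sigma_fps oo dilate_fps N) $ 0 = 0" by (simp add: sigma_fps_def power2_eq_square)
  have "eval_q q (theta_germ N) oo expm1_fps = eval_q q theta_fps oo (sigma_fps oo dilate_fps N) oo expm1_fps"
    unfolding theta_germ_def eval_q_compose_lift_fps[OF is_subring_Ints theta_fps(1) sigma_fps_dilate_fps_coeffs_in q] ..
  also have "\<dots> = eval_q q theta_fps oo (sigma_fps oo dilate_fps N oo expm1_fps)"
    by (rule fps_compose_assoc[OF expm1_fps_nth(1) g0, symmetric])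
  also have "sigma_fps oo dilate_fps N oo expm1_fps = sigma_fps oo (dilate_fps N oo expm1_fps)"
    by (rule fps_compose_assoc[OF expm1_fps_nth(1) dilate_fps_nth(1), symmetric])
  also have "\<dots> = fps_exp (of_nat N) - 2 + fps_exp (- of_nat N)" unfolding dilate_fps_expm1_fps by (rule sigma_fps_compose_exp)
  also have "\<dots> = sigma_exp oo (fps_const (of_nat N) * fps_X)"
  proof -
    have "(2 :: complex fps) oo f = 2" for f by (metis fps_const_compose numeral_fps_const)
    then show ?thesis by (simp add: sigma_exp_def fps_compose_add_distrib fps_compose_sub_distrib)
  qed
  also have "eval_q q theta_fps oo (sigma_exp oo (fps_const (of_nat N) * fps_X)) = eval_q q theta_fps oo sigma_exp oo (fps_const (of_nat N) * fps_X)"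
    by (rule fps_compose_assoc) (simp_all add: sigma_exp_nth)
  finally show ?thesis .
qed

text \<open>Replacing z by N z multiplies z^2 / t, hence the index, by N^2 and leaves the weight
  alone.\<close>

lemma theta_germ_jacobi_germ: "jacobi_germ \<int> (- 2) (N\<^sup>2) (theta_germ N)"
  unfolding jacobi_germ_def
proof (intro conjI allI impI)
  show "disc_series2 \<int> (theta_germ N)" unfolding theta_germ_def by (rule disc_series2_compose_lift_fps[OF is_subring_Ints theta_fps(1) sigma_fps_dilate_fps_coeffs_in])
  fix t assume t: "0 < Im t"
  let ?n = "fps_const (of_nat N) * fps_X :: complex fps"
  let ?t = "fps_const (1 / t) * fps_X :: complex fps"
  let ?P = "\<lambda>t. eval_q (ee t) theta_fps oo sigma_exp"
  have com: "F oo ?n oo ?t = F oo ?t oo ?n" for F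
    by (simp add: fps_compose_linear fps_eq_iff)
  have ex: "fps_exp (kappa t) oo fps_X\<^sup>2 oo ?n = fps_exp (of_nat (N\<^sup>2) * kappa t) oo fps_X\<^sup>2"
  proof -
    have "fps_exp (kappa t) oo fps_X\<^sup>2 oo ?n = fps_exp (kappa t) oo (fps_X\<^sup>2 oo ?n)"
      by (rule fps_compose_assoc[symmetric]) (simp_all add: power2_eq_square)
    also have "fps_X\<^sup>2 oo ?n = (fps_const (of_nat (N\<^sup>2)) * fps_X) oo fps_X\<^sup>2"
      by (subst fps_compose_power[symmetric]) (simp_all add: fps_compose_mult_distrib power_mult_distrib power2_eq_square fps_const_mult[symmetric] del: fps_const_mult)
    also have "fps_exp (kappa t) oo \<dots> = fps_exp (kappa t) oo (fps_const (of_nat (N\<^sup>2)) * fps_X) oo fps_X\<^sup>2"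
      by (rule fps_compose_assoc) (simp_all add: power2_eq_square)
    finally show ?thesis by simp
  qed
  have "(eval_q (ee (- 1 / t)) (theta_germ N) oo expm1_fps) oo ?t = ?P (- 1 / t) oo ?t oo ?n"
    unfolding eval_q_theta_germ[OF norm_ee_lt_1[OF Im_inversion[OF t]]] com ..
  also have "\<dots> = (fps_const (1 / t\<^sup>2) * ((fps_exp (kappa t) oo fps_X\<^sup>2) * ?P t)) oo ?n"
    unfolding theta_sq_inversion(2)[OF t] kappa_def ..
  also have "\<dots> = fps_const (1 / t\<^sup>2) * ((fps_exp (kappa t) oo fps_X\<^sup>2 oo ?n) * (?P t oo ?n))"
    by (simp add: fps_compose_mult_distrib)
  also have "\<dots> = fps_const (t powi (- 2)) * ((fps_exp (of_nat (N\<^sup>2) * kappa t) oo fps_X\<^sup>2) * (eval_q (ee t) (theta_germ N) oo expm1_fps))"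
    unfolding ex eval_q_theta_germ[OF norm_ee_lt_1[OF t]] by (simp add: power_int_minus inverse_eq_divide)
  finally show "(eval_q (ee (- 1 / t)) (theta_germ N) oo expm1_fps) oo ?t =
     fps_const (t powi (- 2)) * ((fps_exp (of_nat (N\<^sup>2) * kappa t) oo fps_X\<^sup>2) * (eval_q (ee t) (theta_germ N) oo expm1_fps))" .
qed

lemma theta_germ_nth: "i < 2 \<Longrightarrow> theta_germ N $ i = 0" "theta_germ N $ 2 = fps_const (of_nat (N\<^sup>2))"
proof -
  define g where "g = sigma_fps oo dilate_fps N"
  have i2: "{0..2::nat} = {0,1,2}" "{0..Suc 0} = {0,1}" by auto
  have S: "sigma_fps $ 0 = 0" "sigma_fps $ Suc 0 = 0" "sigma_fps $ 2 = 1"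
    by (simp_all add: sigma_fps_def power2_eq_square fps_mult_nth i2 mult.assoc numeral_2_eq_2)
  have y2: "(dilate_fps N)\<^sup>2 $ 2 = of_nat (N\<^sup>2)"
    by (simp add: power2_eq_square fps_mult_nth i2 dilate_fps_nth[unfolded One_nat_def])
  have g: "g $ 0 = 0" "g $ Suc 0 = 0" "g $ 2 = of_nat (N\<^sup>2)"
    using S y2 by (simp_all add: g_def fps_compose_nth i2)
  have gg: "(lift_fps g)\<^sup>2 $ 2 = 0" "(lift_fps g)\<^sup>2 $ Suc 0 = 0"
    using g by (simp_all add: power2_eq_square fps_mult_nth i2)
  show "theta_germ N $ 2 = fps_const (of_nat (N\<^sup>2))"
    unfolding theta_germ_def g_def[symmetric] using g gg theta_fps(3,4) by (simp add: fps_compose_nth i2)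
  show "theta_germ N $ i = 0" if "i < 2"
    using that unfolding theta_germ_def g_def[symmetric] less_2_cases_iff using g gg theta_fps(3,4)
    by (auto simp: fps_compose_nth i2)
qed

lemma zero_mult_nth:
  fixes a b :: "'a::comm_ring_1 fps"
  assumes "\<forall>i<\<alpha>. a $ i = 0" "\<forall>i<\<beta>. b $ i = 0"
  shows "\<forall>i<\<alpha>+\<beta>. (a * b) $ i = 0" "(a * b) $ (\<alpha> + \<beta>) = a $ \<alpha> * b $ \<beta>"
  using ideal_mult_nth[of "{0}" UNIV a \<alpha> b \<beta>] assms by auto

lemma zero_power_nth:
  fixes a :: "'a::comm_ring_1 fps"
  assumes "\<forall>i<\<alpha>. a $ i = 0"
  shows "\<forall>i<j*\<alpha>. (a ^ j) $ i = 0" "(a ^ j) $ (j * \<alpha>) = (a $ \<alpha>) ^ j"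
  using ideal_power_nth[of "{0}" UNIV a \<alpha> j] assms by auto

lemma theta_germ_zero: "\<forall>i<2. theta_germ N $ i = 0" using theta_germ_nth(1) by blast

text \<open>Weight and index do not depend on \<open>j\<close> once \<open>pivot_germ M j\<close> is multiplied by a modular form of weight \<open>2 * j\<close>, while
  its order in \<open>\<zeta> - 1\<close> is \<open>6 * M + 2 * j\<close> with a leading coefficient that is a unit once
  6 is inverted.\<close>

definition pivot_germ :: "nat \<Rightarrow> nat \<Rightarrow> complex fps fps" where
  "pivot_germ M j = theta_germ 1 ^ (3 * j) * (theta_germ 2 ^ (3 * (M - j)) * theta_germ 3 ^ j)"

lemma pivot_germ_jacobi_germ:
  assumes "j \<le> M" shows "jacobi_germ \<int> (- 6 * int M - 2 * int j) (12 * M) (pivot_germ M j)"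
proof -
  have "jacobi_germ \<int> (int (3 * j) * - 2 + (int (3 * (M - j)) * - 2 + int j * - 2)) ((3 * j) * 1\<^sup>2 + ((3 * (M - j)) * 2\<^sup>2 + j * 3\<^sup>2)) (pivot_germ M j)"
    unfolding pivot_germ_def by (intro jacobi_germ_mult jacobi_germ_power theta_germ_jacobi_germ is_subring_Ints)
  moreover have e1: "int (3 * j) * - 2 + (int (3 * (M - j)) * - 2 + int j * - 2) = - 6 * int M - 2 * int j"
    using assms by (simp add: of_nat_diff)
  \<comment> \<open>3 j + 12 (M - j) + 9 j = 12 M, so the index does not see j.\<close>
  moreover have e2: "(3 * j) * 1\<^sup>2 + ((3 * (M - j)) * 2\<^sup>2 + j * 3\<^sup>2) = 12 * M" using assms by simp
  ultimately show ?thesis by (simp only:)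
qed

lemma pivot_germ_nth:
  assumes "j \<le> M"
  shows "i < 6 * M + 2 * j \<Longrightarrow> pivot_germ M j $ i = 0" "pivot_germ M j $ (6 * M + 2 * j) = fps_const (4 ^ (3 * (M - j)) * 9 ^ j)"
proof -
  have p: "\<forall>i<n*2. (theta_germ N ^ n) $ i = 0" "(theta_germ N ^ n) $ (n * 2) = fps_const (of_nat (N\<^sup>2) ^ n)" for n N
    using zero_power_nth[OF theta_germ_zero] by (simp_all add: theta_germ_nth(2) fps_const_power)
  note q = zero_mult_nth[OF p(1)[of "3 * (M - j)" 2] p(1)[of j 3]]
  note r = zero_mult_nth[OF p(1)[of "3 * j" 1] q(1)]
  have e: "(3 * j) * 2 + ((3 * (M - j)) * 2 + j * 2) = 6 * M + 2 * j" using assms by simp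
  show "pivot_germ M j $ i = 0" if "i < 6 * M + 2 * j" using r(1) that unfolding e pivot_germ_def by blast
  show "pivot_germ M j $ (6 * M + 2 * j) = fps_const (4 ^ (3 * (M - j)) * 9 ^ j)"
    using r(2) unfolding e q(2) p(2) pivot_germ_def by simp
qed

section \<open>Clearing lower Taylor coefficients modulo a prime ideal\<close>

context prime_ideal
begin

definition ideal_series :: "complex fps set" where "ideal_series = {c \<in> disc_series R. \<forall>n. c $ n \<in> I}"

lemma ideal_series_0: "0 \<in> ideal_series" by (simp add: ideal_series_def I0 disc_series_0[OF R])
lemma ideal_series_add: "c \<in> ideal_series \<Longrightarrow> d \<in> ideal_series \<Longrightarrow> c + d \<in> ideal_series" by (simp add: ideal_series_def disc_series_add[OF R] Iadd)
lemma ideal_series_diff: "c \<in> ideal_series \<Longrightarrow> d \<in> ideal_series \<Longrightarrow> c - d \<in> ideal_series" by (simp add: ideal_series_def disc_series_diff[OF R] Idiff)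
lemma ideal_series_mult: "r \<in> disc_series R \<Longrightarrow> c \<in> ideal_series \<Longrightarrow> r * c \<in> ideal_series"
  by (auto simp: ideal_series_def disc_series_mult[OF R] fps_mult_nth disc_series_nth intro!: Isum Imult)

text \<open>Multiplication by \<open>D\<close> brings \<open>\<Phi>\<close> to the common index M +
  11 M = 12 M of the pivots and makes it vanish exactly below 6 M, the lowest pivot order. The next
  2 v coefficients lie in the ideal and are cleared one by one by multiples of pivots, which
  themselves have coefficients in the ideal. The one at 6 M + 2 v is then exactly leading. Pivots
  exist for j <= M, whence v <= M.\<close>

theorem germ_leading_coefficient:
  assumes J: "jacobi_germ R k M \<Phi>" and k: "even k" and v: "v \<le> M" and low: "\<And>i. i < 2 * v \<Longrightarrow> \<Phi> $ i \<in> ideal_series"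
    and u4: "1 / 4 \<in> R" and u9: "1 / 9 \<in> R"
  obtains c where "modular_fps R (k + 2 * int v) c" "c - fps_const (9 ^ M) * \<Phi> $ (2 * v) \<in> ideal_series"
proof -
  have ZR: "\<int> \<subseteq> R" by (rule Ints_subset_subring[OF R])
  define D where "D = (theta_germ 1 ^ 2 * theta_germ 3) ^ M"
  have DJ: "jacobi_germ R (int M * (int 2 * - 2 + - 2)) (M * (2 * 1\<^sup>2 + 3\<^sup>2)) D"
    unfolding D_def by (intro jacobi_germ_power jacobi_germ_mult jacobi_germ_mono[OF ZR theta_germ_jacobi_germ] R)
  have Dn: "i < 6 * M \<Longrightarrow> D $ i = 0" "D $ (6 * M) = fps_const (9 ^ M)" for i
  proof -
    note p = zero_power_nth[OF theta_germ_zero[of 1], of 2]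
    note q = zero_mult_nth[OF p(1) theta_germ_zero[of 3]]
    note r = zero_power_nth[OF q(1), of M]
    have e: "M * (2 * 2 + 2) = 6 * M" by simp
    show "i < 6 * M \<Longrightarrow> D $ i = 0" using r(1) unfolding e D_def by blast
    show "D $ (6 * M) = fps_const (9 ^ M)"
      using r(2) unfolding e q(2) p(2) theta_germ_nth(2) D_def by (simp add: fps_const_power)
  qed
  define C0 where "C0 = \<Phi> * D"
  have C0J: "jacobi_germ R (k - 6 * int M) (12 * M) C0"
    using jacobi_germ_mult[OF R J DJ] by (simp add: C0_def algebra_simps)
  have Phi: "\<Phi> $ n \<in> disc_series R" for n using jacobi_germ_disc_series2[OF J] by (simp add: disc_series2_def)
  have DR: "D $ n \<in> disc_series R" for n using jacobi_germ_disc_series2[OF DJ] by (simp add: disc_series2_def)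
  have C0z: "C0 $ i = 0" if "i < 6 * M" for i
    using zero_mult_nth(1)[of 0 \<Phi> "6 * M" D] Dn(1) that by (simp add: C0_def)
  have C0I: "C0 $ i \<in> ideal_series" if "i < 6 * M + 2 * v" for i
    unfolding C0_def
    by (rule ideal_mult_nth(1)[where I = ideal_series and R = "disc_series R" and \<alpha> = "2 * v" and \<beta> = "6 * M"])
       (use Dn(1) ideal_series_0 ideal_series_add ideal_series_mult Phi DR low that in auto)
  have "C0 $ (2 * v + 6 * M) - \<Phi> $ (2 * v) * D $ (6 * M) \<in> ideal_series"
    unfolding C0_def
    by (rule ideal_mult_nth(2)[where I = ideal_series and R = "disc_series R"])
       (use Dn(1) ideal_series_0 ideal_series_add ideal_series_mult Phi DR low in auto)
  then have C0l: "C0 $ (6 * M + 2 * v) - fps_const (9 ^ M) * \<Phi> $ (2 * v) \<in> ideal_series"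
    unfolding Dn(2) by (simp only: add.commute[of "2 * v"] mult.commute[of "\<Phi> $ (2 * v)"])
  have "\<exists>C. jacobi_germ R (k - 6 * int M) (12 * M) C \<and> (\<forall>l < 6 * M + i. C $ l = 0) \<and> (\<forall>l. C $ l - C0 $ l \<in> ideal_series)"
    if "i \<le> 2 * v" for i
    using that
  proof (induction i)
    case 0 then show ?case using C0J C0z ideal_series_0 by (intro exI[of _ C0]) auto
  next
    case (Suc i)
    then obtain C where C: "jacobi_germ R (k - 6 * int M) (12 * M) C" "\<And>l. l < 6 * M + i \<Longrightarrow> C $ l = 0" "\<And>l. C $ l - C0 $ l \<in> ideal_series"
      by auto
    define H where "H = C $ (6 * M + i)"
    have "modular_fps R (k - 6 * int M + int (6 * M + i)) H" unfolding H_def by (rule jacobi_germ_leading[OF C(1,2)])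
    then have HM: "modular_fps R (k + int i) H" by (simp add: algebra_simps)
    have HI: "H \<in> ideal_series" using ideal_series_add[OF C(3)[of "6 * M + i"] C0I[of "6 * M + i"]] Suc.prems by (simp add: H_def)
    show ?case
    proof (cases "even i")
      case False
      \<comment> \<open>Odd positions clear themselves, since a leading coefficient there would have
        odd weight.\<close>
      then have "H = 0" using modular_fps_odd[OF HM] k by simp
      then have "\<forall>l < 6 * M + Suc i. C $ l = 0" using C(2) by (auto simp: less_Suc_eq H_def)
      then show ?thesis using C by blast
    next
      case True
      then obtain j where j: "i = 2 * j" by (auto elim: evenE)
      have jM: "j \<le> M" using j Suc.prems v by simp
      define u :: complex where "u = 4 ^ (3 * (M - j)) * 9 ^ j"
      have u0: "u \<noteq> 0" by (simp add: u_def)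
      have uR: "1 / u \<in> R"
      proof -
        have "1 / u = (1 / 4) ^ (3 * (M - j)) * (1 / 9) ^ j" by (simp add: u_def power_one_over)
        then show ?thesis using u4 u9 by (simp add: subring_mult[OF R] subring_power[OF R])
      qed
      \<comment> \<open>\<open>H\<close> has weight k + 2 j and the pivot has weight - 6 M - 2 j, so
        \<open>T\<close> has the weight of \<open>C\<close>.\<close>
      define T where "T = fps_const (fps_const (1 / u) * H) * pivot_germ M j"
      have "modular_fps R (0 + (k + int i)) (fps_const (1 / u) * H)" by (rule modular_fps_mult[OF R modular_fps_const[OF R uR] HM])
      from jacobi_germ_mult[OF R jacobi_germ_const[OF R this] jacobi_germ_mono[OF ZR pivot_germ_jacobi_germ[OF jM]]]
      have TJ: "jacobi_germ R (k - 6 * int M) (12 * M) T" by (simp add: T_def j algebra_simps)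
      have Tn: "T $ l = (fps_const (1 / u) * H) * pivot_germ M j $ l" for l by (simp add: T_def)
      have TI: "T $ l \<in> ideal_series" for l
      proof -
        have "pivot_germ M j $ l \<in> disc_series R" using jacobi_germ_disc_series2[OF jacobi_germ_mono[OF ZR pivot_germ_jacobi_germ[OF jM]]] by (simp add: disc_series2_def)
        then have "(pivot_germ M j $ l * fps_const (1 / u)) * H \<in> ideal_series"
          by (intro ideal_series_mult HI disc_series_mult[OF R] disc_series_const[OF R uR])
        then show ?thesis by (simp add: Tn mult_ac)
      qed
      have "(C - T) $ l = 0" if "l < 6 * M + Suc i" for l
      proof (cases "l = 6 * M + i")
        case True
        have "fps_const (1 / u) * fps_const u = 1" using u0 by simp
        then have "fps_const (1 / u) * H * fps_const u = H" by (metis mult.assoc mult.commute mult_1)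
        then have "T $ l = H" using pivot_germ_nth(2)[OF jM] True by (simp add: Tn j u_def)
        then show ?thesis using True by (simp add: H_def)
      next
        case False
        then show ?thesis using that C(2) pivot_germ_nth(1)[OF jM, of l] by (simp add: Tn j)
      qed
      moreover have "(C - T) $ l - C0 $ l \<in> ideal_series" for l
        using ideal_series_diff[OF C(3) TI, of l l] by (simp add: algebra_simps)
      ultimately show ?thesis using jacobi_germ_diff[OF R C(1) TJ] by blast
    qed
  qed
  from this[OF order_refl] obtain C where C: "jacobi_germ R (k - 6 * int M) (12 * M) C"
    "\<And>l. l < 6 * M + 2 * v \<Longrightarrow> C $ l = 0" "\<And>l. C $ l - C0 $ l \<in> ideal_series" by auto
  show ?thesis
  proof (rule that)
    have "modular_fps R (k - 6 * int M + int (6 * M + 2 * v)) (C $ (6 * M + 2 * v))" by (rule jacobi_germ_leading[OF C(1,2)])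
    then show "modular_fps R (k + 2 * int v) (C $ (6 * M + 2 * v))" by (simp add: algebra_simps)
    show "C $ (6 * M + 2 * v) - fps_const (9 ^ M) * \<Phi> $ (2 * v) \<in> ideal_series"
      using ideal_series_add[OF C(3)[of "6 * M + 2 * v"] C0l] by simp
  qed
qed

end

section \<open>Fourier-Jacobi coefficients\<close>

lemma power_div_fact_le_exp: assumes "0 \<le> (x::real)" shows "x ^ j / fact j \<le> exp x"
proof -
  have s: "(\<lambda>n. x ^ n / fact n) sums exp x"
    using exp_converges[of x] by (simp add: divide_inverse mult.commute)
  have "(\<Sum>n\<in>{j}. x ^ n / fact n) \<le> exp x"
    using sum_le_suminf[OF sums_summable[OF s], of "{j}"] sums_unique[OF s] assms by simp
  then show ?thesis by simp
qed

text \<open>Crude, but exponential in |r| for fixed j, which \<open>fourier_jacobi_summable\<close>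
  absorbs.\<close>

lemma norm_gbinomial_le: "norm ((of_int r :: complex) gchoose j) \<le> exp (\<bar>of_int r\<bar> + of_nat j)"
proof -
  have "norm ((of_int r :: complex) gchoose j) = (\<Prod>i = 0..<j. norm (of_int r - of_nat i :: complex)) / fact j"
    by (simp add: gbinomial_prod_rev norm_divide prod_norm)
  also have "\<dots> \<le> (\<Prod>i = 0..<j. \<bar>of_int r\<bar> + of_nat j) / fact j"
  proof (intro divide_right_mono prod_mono conjI)
    fix i assume i: "i \<in> {0..<j}"
    have "norm (of_int r - of_nat i :: complex) \<le> norm (of_int r :: complex) + norm (of_nat i :: complex)"
      by (rule norm_triangle_ineq4)
    then show "norm (of_int r - of_nat i :: complex) \<le> \<bar>of_int r\<bar> + of_nat j" using i by simp
  qed auto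
  also have "\<dots> = (\<bar>of_int r\<bar> + of_nat j) ^ j / fact j" by simp
  also have "\<dots> \<le> exp (\<bar>of_int r\<bar> + of_nat j)" by (rule power_div_fact_le_exp) simp
  finally show ?thesis .
qed

lemma exp_has_sum:
  fixes x :: "'a::{banach,real_normed_field}"
  shows "((\<lambda>i. x ^ i / fact i) has_sum exp x) UNIV"
proof (rule norm_summable_imp_has_sum)
  show "(\<lambda>i. x ^ i / fact i) sums exp x"
    using exp_converges[of x] by (simp add: scaleR_conv_of_real divide_inverse mult.commute)
  show "summable (\<lambda>i. norm (x ^ i / fact i))"
    using summable_norm_exp[of x] by (simp add: norm_mult norm_inverse norm_divide norm_power divide_inverse mult.commute)
qed

lemma finite_sum_has_sum:
  fixes h :: "'i \<Rightarrow> 'a \<Rightarrow> complex"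
  assumes "\<And>j. j \<in> J \<Longrightarrow> (h j has_sum S j) A"
  shows "((\<lambda>x. \<Sum>j\<in>J. h j x) has_sum (\<Sum>j\<in>J. S j)) A"
  using assms by (induction J rule: infinite_finite_induct) (auto intro: has_sum_add has_sum_0)

lemma subring_gbinomial:
  assumes R: "is_subring R"
  shows "(of_int r :: complex) gchoose j \<in> R"
proof (cases "0 \<le> r")
  case True
  then have "(of_int r :: complex) gchoose j = of_nat (nat r choose j)" by (simp add: binomial_gbinomial)
  then show ?thesis using subring_of_nat R by metis
next
  case False
  have "(of_int r :: complex) gchoose j = (- 1) ^ j * ((of_nat (nat (- r) + j - 1)) gchoose j)"
    using gbinomial_minus[of "of_int (- r) :: complex" j] False by (simp add: of_nat_diff)
  also have "\<dots> = (- 1) ^ j * of_nat ((nat (- r) + j - 1) choose j)" by (simp add: binomial_gbinomial)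
  finally show ?thesis using R subring_mult[OF R subring_power[OF R subring_uminus[OF R subring_1[OF R]]] subring_of_nat[OF R]] by metis
qed

lemma fps_binomial_expm1_fps: "fps_binomial (of_int r) oo expm1_fps = fps_exp (of_int r)"
proof -
  have n: "fps_binomial (of_nat k) oo expm1_fps = fps_exp (of_nat k)" for k
  proof -
    have "(1 + fps_X) oo expm1_fps = fps_exp 1" by (simp add: fps_compose_add_distrib expm1_fps_def)
    then show ?thesis unfolding fps_binomial_of_nat by (simp add: fps_compose_power[OF expm1_fps_nth(1), symmetric] fps_exp_power_mult)
  qed
  show ?thesis
  proof (cases "0 \<le> r")
    case True then show ?thesis using n[of "nat r"] by simp
  next
    case False
    define k where "k = nat (- r)"
    have r: "(of_int r :: complex) = - of_nat k" using False by (simp add: k_def)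
    have "fps_binomial (- of_nat k :: complex) * fps_binomial (of_nat k) = 1"
      by (simp add: fps_binomial_add_mult[symmetric])
    then have "(fps_binomial (- of_nat k :: complex) oo expm1_fps) * fps_exp (of_nat k) = 1"
      using fps_compose_mult_distrib[OF expm1_fps_nth(1), of "fps_binomial (- of_nat k)" "fps_binomial (of_nat k)"] n by simp
    then have "(fps_binomial (- of_nat k :: complex) oo expm1_fps) * (fps_exp (of_nat k) * fps_exp (- of_nat k)) = fps_exp (- of_nat k)"
      by (simp add: mult.assoc[symmetric])
    moreover have "fps_exp (of_nat k) * fps_exp (- of_nat k :: complex) = 1" by (simp add: fps_exp_add_mult[symmetric])
    ultimately show ?thesis by (simp add: r)
  qed
qed

context siegel_form
begin

lemma c3_range: "c3 (int m) r (int n) \<noteq> 0 \<Longrightarrow> \<bar>r\<bar> \<le> 4 * int m * int n"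
proof -
  assume "c3 (int m) r (int n) \<noteq> 0"
  then have "r\<^sup>2 \<le> 4 * int m * int n" using c3_support by blast
  moreover have "\<bar>r\<bar> \<le> r\<^sup>2"
  proof (cases "r = 0")
    case False
    then have "1 * \<bar>r\<bar> \<le> \<bar>r\<bar> * \<bar>r\<bar>" by (intro mult_right_mono) auto
    then show ?thesis by (simp add: power2_eq_square)
  qed simp
  ultimately show ?thesis by simp
qed

text \<open>The coefficient of (zeta - 1)^v in the sum over r of \<open>c3 m r n\<close> zeta^r. The
  range contains the support because r^2 <= 4 m n implies |r| <= 4 m n.\<close>

definition moment :: "nat \<Rightarrow> nat \<Rightarrow> nat \<Rightarrow> complex" where
  "moment v m n = (\<Sum>r\<in>{- (4 * int m * int n)..4 * int m * int n}. c3 (int m) r (int n) * (of_int r gchoose v))"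

lemma moment_has_sum: "((\<lambda>r. c3 (int m) r (int n) * (of_int r gchoose v)) has_sum moment v m n) UNIV"
  unfolding moment_def
proof (rule has_sum_finite_neutralI)
  fix r assume "r \<in> UNIV - {- (4 * int m * int n)..4 * int m * int n}"
  then have "\<not> \<bar>r\<bar> \<le> 4 * int m * int n" by auto
  then show "c3 (int m) r (int n) * (of_int r gchoose v) = 0" using c3_range by force
qed auto

definition moment_fps :: "nat \<Rightarrow> complex fps fps" where "moment_fps n = Abs_fps (\<lambda>j. Abs_fps (\<lambda>m. moment j m n))"

lemma moment_fps_nth [simp]: "moment_fps n $ j $ m = moment j m n" by (simp add: moment_fps_def)

text \<open>At fixed t any exponential growth in |r| is harmless: compare with the absolutely
  convergent expansions at z = i a / (2 pi) and at - z, with s high enough to stay in the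
  domain.\<close>

lemma fourier_jacobi_summable:
  assumes t: "0 < Im t"
  shows "(\<lambda>(m,r). norm (c3 m r n * ee (of_int m * t)) * exp (a * \<bar>of_int r\<bar>)) summable_on UNIV"
proof -
  define z where "z = \<i> * of_real (a / (2 * pi))"
  define s where "s = \<i> * of_real ((a / (2 * pi))\<^sup>2 / Im t + 1)"
  have D: "(t, z, s) \<in> siegel_domain" "(t, - z, s) \<in> siegel_domain"
    using t by (simp_all add: siegel_domain_def z_def s_def distrib_left add_nonneg_pos)
  let ?g = "\<lambda>z (m,r,n). norm (c3 m r n * ee (of_int m * t + of_int r * z + of_int n * s))"
  have inj: "inj (\<lambda>(m,r). (m, r, n))" by (auto simp: inj_on_def)
  have S: "(?g z' \<circ> (\<lambda>(m,r). (m, r, n))) summable_on UNIV" if "(t, z', s) \<in> siegel_domain" for z'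
    by (rule summable_on_reindex[OF inj, THEN iffD1], rule summable_on_subset_banach[OF c3_abs_summable[OF that]]) simp
  define K where "K = inverse (norm (ee (of_int n * s)))"
  have "(\<lambda>p. K * ((?g z \<circ> (\<lambda>(m,r). (m, r, n))) p + (?g (- z) \<circ> (\<lambda>(m,r). (m, r, n))) p)) summable_on UNIV"
    by (intro summable_on_cmult_right summable_on_add S D)
  then show ?thesis
  proof (rule summable_on_comparison_test)
    fix p :: "int \<times> int" assume "p \<in> UNIV"
    obtain m r where p: "p = (m,r)" by (cases p)
    have e: "norm (ee (of_int r * z)) = exp (- a * of_int r)" "norm (ee (of_int r * - z)) = exp (a * of_int r)"
      by (simp_all add: norm_ee z_def)
    have "exp (a * \<bar>of_int r\<bar>) \<le> exp (- a * of_int r) + exp (a * of_int r)"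
      by (cases "r \<ge> 0") (auto simp: abs_if)
    then have "norm (c3 m r n * ee (of_int m * t)) * exp (a * \<bar>of_int r\<bar>)
       \<le> norm (c3 m r n * ee (of_int m * t)) * (norm (ee (of_int r * z)) + norm (ee (of_int r * - z)))"
      unfolding e by (intro mult_left_mono) auto
    also have "\<dots> = K * ((?g z \<circ> (\<lambda>(m,r). (m, r, n))) p + (?g (- z) \<circ> (\<lambda>(m,r). (m, r, n))) p)"
      unfolding p o_def prod.case ee_add norm_mult by (simp add: K_def norm_ee field_simps)
    finally show "(case p of (m,r) \<Rightarrow> norm (c3 m r n * ee (of_int m * t)) * exp (a * \<bar>of_int r\<bar>))
       \<le> K * ((?g z \<circ> (\<lambda>(m,r). (m, r, n))) p + (?g (- z) \<circ> (\<lambda>(m,r). (m, r, n))) p)"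
      by (simp add: p)
  qed auto
qed

lemma moment_fps_has_sum:
  assumes t: "0 < Im t"
  shows "((\<lambda>(m,r). c3 m r (int n) * ee (of_int m * t) * (of_int r gchoose j)) has_sum eval_fps (moment_fps n $ j) (ee t)) UNIV"
    and "summable (\<lambda>m. moment j m n * ee t ^ m)"
proof -
  let ?h = "\<lambda>(m,r). c3 m r (int n) * ee (of_int m * t) * (of_int r gchoose j)"
  have "(\<lambda>p. exp (of_nat j) * (case p of (m,r) \<Rightarrow> norm (c3 m r (int n) * ee (of_int m * t)) * exp (1 * \<bar>of_int r\<bar>))) summable_on UNIV"
    by (rule summable_on_cmult_right[OF fourier_jacobi_summable[OF t]])
  then have "(\<lambda>p. norm (?h p)) summable_on UNIV"
  proof (rule summable_on_comparison_test)
    fix p :: "int \<times> int"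
    obtain m r where p: "p = (m,r)" by (cases p)
    show "norm (?h p) \<le> exp (of_nat j) * (case p of (m,r) \<Rightarrow> norm (c3 m r (int n) * ee (of_int m * t)) * exp (1 * \<bar>of_int r\<bar>))"
      using mult_left_mono[OF norm_gbinomial_le[of r j], of "norm (c3 m r (int n) * ee (of_int m * t))"]
      by (simp add: p norm_mult exp_add mult_ac)
  qed auto
  then have "?h summable_on UNIV" by (rule abs_summable_summable)
  then obtain S where S: "(?h has_sum S) (UNIV \<times> UNIV)" by (auto simp: summable_on_def)
  have "((\<lambda>m. if m < 0 then 0 else moment j (nat m) n * ee (of_int m * t)) has_sum S) UNIV"
  proof (rule has_sum_SigmaD[OF S])
    fix m :: int
    show "((\<lambda>y. ?h (m, y)) has_sum (if m < 0 then 0 else moment j (nat m) n * ee (of_int m * t))) UNIV"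
    proof (cases "m < 0")
      case True then show ?thesis by (simp add: c3_negative_m)
    next
      case False
      then show ?thesis using has_sum_cmult_left[OF moment_has_sum[of "nat m" n j], of "ee (of_int m * t)"] by (simp add: mult_ac)
    qed
  qed
  then have "((\<lambda>m. if m < 0 then 0 else moment j (nat m) n * ee (of_int m * t)) has_sum S) (range int)"
    by (rule has_sum_cong_neutral[THEN iffD1, rotated -1]) (auto simp: image_iff, metis nonneg_int_cases not_le)
  then have "((\<lambda>m::nat. moment j m n * ee t ^ m) has_sum S) UNIV"
    by (subst (asm) has_sum_reindex) (auto simp: o_def inj_on_def ee_power)
  then have s: "(\<lambda>m::nat. moment j m n * ee t ^ m) sums S" by (rule has_sum_imp_sums)
  then show "summable (\<lambda>m. moment j m n * ee t ^ m)" by (rule sums_summable)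
  have "eval_fps (moment_fps n $ j) (ee t) = S" using s by (simp add: eval_fps_def sums_iff)
  then show "(?h has_sum eval_fps (moment_fps n $ j) (ee t)) UNIV" using S by simp
qed

lemma moment_fps_disc_series2:
  assumes "\<And>m r. c3 m r (int n) \<in> R" "is_subring R"
  shows "disc_series2 R (moment_fps n)"
  unfolding disc_series2_def disc_series_def
proof (intro allI CollectI conjI)
  fix j
  show "1 \<le> fps_conv_radius (moment_fps n $ j)" unfolding fps_conv_radius_def
  proof (rule conv_radius_geI_ex)
    fix \<rho> :: real assume \<rho>: "0 < \<rho>" "ereal \<rho> < 1"
    then obtain t where t: "0 < Im t" "ee t = of_real \<rho>" using ee_surj[of "of_real \<rho>"] by (auto simp: one_ereal_def)
    then show "\<exists>z. norm z = \<rho> \<and> summable (\<lambda>m. moment_fps n $ j $ m * z ^ m)"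
      using moment_fps_has_sum(2)[OF t(1), of j n] \<rho> by (intro exI[of _ "of_real \<rho>"]) auto
  qed
  fix m
  show "moment_fps n $ j $ m \<in> R" unfolding moment_fps_nth moment_def
    using assms by (intro subring_sum subring_mult subring_gbinomial) auto
qed

definition fj_coeff :: "int \<Rightarrow> complex \<Rightarrow> complex \<Rightarrow> complex" where
  "fj_coeff n t z = infsum (\<lambda>(m,r). c3 m r n * ee (of_int m * t + of_int r * z)) UNIV"

lemma fj_coeff_has_sum:
  assumes t: "0 < Im t"
  shows "((\<lambda>(m,r). c3 m r n * ee (of_int m * t + of_int r * z)) has_sum fj_coeff n t z) UNIV"
  unfolding fj_coeff_def
proof (rule has_sum_infsum, rule abs_summable_summable, rule summable_on_comparison_test[OF fourier_jacobi_summable[OF t, of n "2 * pi * \<bar>Im z\<bar>"]])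
  fix p :: "int \<times> int"
  obtain m r where p: "p = (m,r)" by (cases p)
  have "- (of_int r * Im z) \<le> \<bar>Im z\<bar> * \<bar>of_int r\<bar>"
    using abs_ge_minus_self[of "of_int r * Im z"] by (simp add: abs_mult mult.commute)
  then have "2 * pi * - (of_int r * Im z) \<le> 2 * pi * (\<bar>Im z\<bar> * \<bar>of_int r\<bar>)" by (intro mult_left_mono) auto
  then have "norm (ee (of_int r * z)) \<le> exp (2 * pi * \<bar>Im z\<bar> * \<bar>of_int r\<bar>)"
    unfolding norm_ee by (simp add: mult_ac)
  then show "norm (case p of (m,r) \<Rightarrow> c3 m r n * ee (of_int m * t + of_int r * z))
     \<le> (case p of (m,r) \<Rightarrow> norm (c3 m r n * ee (of_int m * t)) * exp (2 * pi * \<bar>Im z\<bar> * \<bar>of_int r\<bar>))"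
    using mult_left_mono[of "norm (ee (of_int r * z))" _ "norm (c3 m r n * ee (of_int m * t))"]
    by (simp add: p ee_add norm_mult mult.assoc[symmetric])
qed auto

lemma fourier_jacobi_expansion:
  assumes D: "(t,z,s) \<in> siegel_domain"
  shows "((\<lambda>n. fj_coeff n t z * ee (of_int n * s)) has_sum f t z s) UNIV"
proof -
  have t: "0 < Im t" using D by (simp add: siegel_domain_def)
  have bij: "bij_betw (\<lambda>(n,m,r). (m,r,n)) UNIV (UNIV :: (int \<times> int \<times> int) set)"
    by (rule bij_betwI[where g = "\<lambda>(m,r,n). (n,m,r)"]) auto
  have "((\<lambda>p. case (case p of (n,m,r) \<Rightarrow> (m,r,n)) of (m,r,n) \<Rightarrow> c3 m r n * ee (of_int m * t + of_int r * z + of_int n * s)) has_sum f t z s) UNIV"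
    using c3_has_sum[OF D] by (subst has_sum_reindex_bij_betw[OF bij])
  then have S: "((\<lambda>(n,m,r). c3 m r n * ee (of_int m * t + of_int r * z + of_int n * s)) has_sum f t z s) (UNIV \<times> UNIV)"
    by (rule back_subst[of "\<lambda>g. (g has_sum f t z s) _", THEN back_subst[of "\<lambda>A. (_ has_sum f t z s) A"]]) auto
  show ?thesis
  proof (rule has_sum_SigmaD[OF S])
    fix n
    show "((\<lambda>y. case (n, y) of (n,m,r) \<Rightarrow> c3 m r n * ee (of_int m * t + of_int r * z + of_int n * s)) has_sum fj_coeff n t z * ee (of_int n * s)) UNIV"
      by (rule back_subst[of "\<lambda>g. (g has_sum fj_coeff n t z * ee (of_int n * s)) UNIV", OF has_sum_cmult_left[OF fj_coeff_has_sum[OF t]]])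
         (auto simp: fun_eq_iff ee_add mult_ac)
  qed
qed

text \<open>Both sides of \<open>law_S\<close> are expanded in s. As s moves only by the constant
  z^2 / t, coefficients can be compared along real translates of s.\<close>

lemma fj_coeff_inversion:
  assumes t: "0 < Im t"
  shows "fj_coeff n (- 1 / t) (z / t) = t ^ k * ee (of_int n * (z\<^sup>2 / t)) * fj_coeff n t z"
proof -
  define t' where "t' = - 1 / t"
  have t': "0 < Im t'" unfolding t'_def by (rule Im_inversion[OF t])
  \<comment> \<open>High enough for the original and the transformed point to lie in the domain,
    whatever the real shift x.\<close>
  define S where "S = \<bar>(Im z)\<^sup>2 / Im t\<bar> + \<bar>(Im (z / t))\<^sup>2 / Im t'\<bar> + \<bar>Im (z\<^sup>2 / t)\<bar> + 1"
  define s where "s = \<i> * of_real S"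
  have DDI: "(u, w, s') \<in> siegel_domain" if "0 < Im u" "0 < Im s'" "(Im w)\<^sup>2 / Im u < Im s'" for u w s'
    using that by (simp add: siegel_domain_def divide_less_eq mult.commute)
  have D: "(t, z, s + of_real x) \<in> siegel_domain" "(t', z / t, s - z\<^sup>2 / t + of_real x) \<in> siegel_domain" for x
  proof -
    define A B C where "A = (Im z)\<^sup>2 / Im t" and "B = (Im (z / t))\<^sup>2 / Im t'" and "C = Im (z\<^sup>2 / t)"
    have AB: "0 \<le> A" "0 \<le> B" using t t' by (simp_all add: A_def B_def)
    have s: "Im (s + of_real x) = \<bar>A\<bar> + \<bar>B\<bar> + \<bar>C\<bar> + 1" by (simp add: s_def S_def A_def B_def C_def)
    then have s': "Im (s - z\<^sup>2 / t + of_real x) = \<bar>A\<bar> + \<bar>B\<bar> + \<bar>C\<bar> + 1 - C" by (simp add: C_def)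
    show "(t, z, s + of_real x) \<in> siegel_domain" by (rule DDI[OF t]) (use AB s in \<open>unfold A_def[symmetric] s, linarith+\<close>)
    show "(t', z / t, s - z\<^sup>2 / t + of_real x) \<in> siegel_domain" by (rule DDI[OF t']) (use AB s' in \<open>unfold B_def[symmetric] s', linarith+\<close>)
  qed
  have "fj_coeff n t' (z / t) * ee (of_int n * (s - z\<^sup>2 / t)) - t ^ k * (fj_coeff n t z * ee (of_int n * s)) = 0"
  proof (rule fourier_unique1[where a = "\<lambda>n. fj_coeff n t' (z / t) * ee (of_int n * (s - z\<^sup>2 / t)) - t ^ k * (fj_coeff n t z * ee (of_int n * s))"])
    fix x :: real
    have law: "f t' (z / t) (s - z\<^sup>2 / t + of_real x) = t ^ k * f t z (s + of_real x)"
      using law_S[OF D(1)[of x]] by (simp add: t'_def algebra_simps)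
    have 1: "((\<lambda>n. fj_coeff n t' (z / t) * ee (of_int n * (s - z\<^sup>2 / t)) * ee (of_int n * of_real x)) has_sum t ^ k * f t z (s + of_real x)) UNIV"
      using fourier_jacobi_expansion[OF D(2)[of x]] unfolding law by (simp add: distrib_left ee_add mult.assoc)
    have 2: "((\<lambda>n. t ^ k * (fj_coeff n t z * ee (of_int n * s)) * ee (of_int n * of_real x)) has_sum t ^ k * f t z (s + of_real x)) UNIV"
      using has_sum_cmult_right[OF fourier_jacobi_expansion[OF D(1)[of x]], of "t ^ k"] by (simp add: distrib_left ee_add mult.assoc)
    show "((\<lambda>n. (fj_coeff n t' (z / t) * ee (of_int n * (s - z\<^sup>2 / t)) - t ^ k * (fj_coeff n t z * ee (of_int n * s))) * ee (of_int n * of_real x)) has_sum 0) UNIV"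
      using has_sum_add[OF 1 has_sum_cmult_right[OF 2, of "- 1"]] by (simp add: left_diff_distrib)
  qed
  then have "fj_coeff n t' (z / t) * ee (of_int n * (s - z\<^sup>2 / t)) = t ^ k * fj_coeff n t z * ee (of_int n * s)" by simp
  moreover have "ee (of_int n * s) = ee (of_int n * (z\<^sup>2 / t)) * ee (of_int n * (s - z\<^sup>2 / t))"
    unfolding ee_add[symmetric] by (simp add: algebra_simps)
  moreover have "ee (of_int n * (s - z\<^sup>2 / t)) \<noteq> 0" by (simp add: ee_def)
  ultimately have "fj_coeff n t' (z / t) = t ^ k * fj_coeff n t z * ee (of_int n * (z\<^sup>2 / t))" by simp
  then show ?thesis by (simp only: t'_def mult_ac)
qed

lemma moment_fps_compose_has_sum:
  assumes t: "0 < Im t"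
  shows "((\<lambda>(m,r). c3 m r (int n) * ee (of_int m * t) * (of_int r ^ i / fact i)) has_sum (eval_q (ee t) (moment_fps n) oo expm1_fps) $ i) UNIV"
proof -
  have "((\<lambda>p. \<Sum>j\<in>{0..i}. (case p of (m,r) \<Rightarrow> c3 m r (int n) * ee (of_int m * t) * (of_int r gchoose j)) * (expm1_fps ^ j $ i))
      has_sum (\<Sum>j\<in>{0..i}. eval_fps (moment_fps n $ j) (ee t) * (expm1_fps ^ j $ i))) UNIV"
    by (intro finite_sum_has_sum has_sum_cmult_left moment_fps_has_sum(1)[OF t])
  then have "((\<lambda>p. \<Sum>j\<in>{0..i}. (case p of (m,r) \<Rightarrow> c3 m r (int n) * ee (of_int m * t) * (of_int r gchoose j)) * (expm1_fps ^ j $ i))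
      has_sum (eval_q (ee t) (moment_fps n) oo expm1_fps) $ i) UNIV"
    by (simp add: fps_compose_nth)
  moreover have "(\<Sum>j\<in>{0..i}. (c3 m r (int n) * ee (of_int m * t) * (of_int r gchoose j)) * (expm1_fps ^ j $ i))
     = c3 m r (int n) * ee (of_int m * t) * (of_int r ^ i / fact i)" for m r
  proof -
    have "(\<Sum>j\<in>{0..i}. (of_int r gchoose j) * (expm1_fps ^ j $ i)) = (fps_binomial (of_int r) oo expm1_fps) $ i"
      by (simp add: fps_compose_nth)
    also have "\<dots> = of_int r ^ i / fact i" unfolding fps_binomial_expm1_fps by simp
    finally show ?thesis by (simp add: sum_distrib_left[symmetric] mult.assoc)
  qed
  ultimately show ?thesis by (simp add: case_prod_unfold)
qed

text \<open>The exponential series in w is exchanged with the sum over (m, r); the majorant exp(|u|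
  |r|) is covered by \<open>fourier_jacobi_summable\<close>.\<close>

lemma fj_coeff_expansion:
  assumes t: "0 < Im t"
  shows "(\<lambda>w. fj_coeff (int n) t (w / (2 * of_real pi * \<i>))) has_fps_expansion (eval_q (ee t) (moment_fps n) oo expm1_fps)"
proof (rule has_fps_expansionI, rule always_eventually, rule allI)
  fix u :: complex
  let ?P = "eval_q (ee t) (moment_fps n) oo expm1_fps"
  let ?c = "\<lambda>m r. c3 m r (int n) * ee (of_int m * t)"
  let ?g = "\<lambda>(p,i). (case p of (m,r) \<Rightarrow> ?c m r * (of_int r ^ i / fact i)) * u ^ i"
  have inner: "((\<lambda>i. ?g ((m,r),i)) has_sum ?c m r * exp (of_int r * u)) UNIV" for m r
    using has_sum_cmult_right[OF exp_has_sum[of "of_int r * u"], of "?c m r"] by (simp add: power_mult_distrib mult.assoc)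
  have "(\<lambda>q. norm (?g q)) summable_on (UNIV \<times> UNIV)"
  proof (rule summable_on_SigmaI)
    fix p :: "int \<times> int"
    obtain m r where p: "p = (m,r)" by (cases p)
    have "((\<lambda>i. (\<bar>of_int r\<bar> * norm u) ^ i / fact i) has_sum exp (\<bar>of_int r\<bar> * norm u)) UNIV" by (rule exp_has_sum)
    from has_sum_cmult_right[OF this, of "norm (?c m r)"]
    show "((\<lambda>i. norm (?g (p,i))) has_sum (case p of (m,r) \<Rightarrow> norm (?c m r) * exp (norm u * \<bar>of_int r\<bar>))) UNIV"
      by (simp add: p norm_mult norm_divide norm_power power_mult_distrib mult_ac)
  next
    show "(\<lambda>p. case p of (m,r) \<Rightarrow> norm (?c m r) * exp (norm u * \<bar>of_int r\<bar>)) summable_on UNIV"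
      by (rule fourier_jacobi_summable[OF t])
  qed auto
  then have "?g summable_on (UNIV \<times> UNIV)" by (rule abs_summable_summable)
  then obtain S where S: "(?g has_sum S) (UNIV \<times> UNIV)" by (auto simp: summable_on_def)
  have eu: "ee (of_int r * (u / (2 * of_real pi * \<i>))) = exp (of_int r * u)" for r
    by (simp add: ee_def)
  have "((\<lambda>p. case p of (m,r) \<Rightarrow> ?c m r * exp (of_int r * u)) has_sum S) UNIV"
    by (rule has_sum_SigmaD[OF S]) (use inner in auto)
  moreover have "((\<lambda>p. case p of (m,r) \<Rightarrow> ?c m r * exp (of_int r * u)) has_sum fj_coeff (int n) t (u / (2 * of_real pi * \<i>))) UNIV"
    using fj_coeff_has_sum[OF t, of "int n" "u / (2 * of_real pi * \<i>)"] unfolding ee_add eu by (simp only: mult.assoc)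
  ultimately have SS: "S = fj_coeff (int n) t (u / (2 * of_real pi * \<i>))" by (rule has_sum_unique)
  have "((\<lambda>(i,p). ?g (p,i)) has_sum S) (UNIV \<times> UNIV)" using S by (subst (asm) has_sum_swap)
  then have "((\<lambda>i. ?P $ i * u ^ i) has_sum S) UNIV"
  proof (rule has_sum_SigmaD)
    fix i :: nat
    show "((\<lambda>p. case (i, p) of (i, p) \<Rightarrow> ?g (p, i)) has_sum ?P $ i * u ^ i) UNIV"
      using has_sum_cmult_left[OF moment_fps_compose_has_sum[OF t, of n i], of "u ^ i"] by simp
  qed
  then show "(\<lambda>i. ?P $ i * u ^ i) sums fj_coeff (int n) t (u / (2 * of_real pi * \<i>))"
    using has_sum_imp_sums SS by blast
qed

theorem moment_fps_jacobi_germ: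
  assumes R: "is_subring R" "\<And>m r. c3 m r (int n) \<in> R"
  shows "jacobi_germ R (int k) n (moment_fps n)"
  unfolding jacobi_germ_def
proof (intro conjI allI impI)
  show "disc_series2 R (moment_fps n)" using moment_fps_disc_series2[of n R] R by blast
  fix t assume t: "0 < Im t"
  then have t0: "t \<noteq> 0" by auto
  have l: "(\<lambda>w. 1 / t * w) has_fps_expansion (fps_const (1 / t) * fps_X)"
    by (intro fps_expansion_intros)
  have sq: "(\<lambda>w. w ^ 2) has_fps_expansion (fps_X ^ 2 :: complex fps)" by (rule has_fps_expansion_fps_X_power)
  have E: "(\<lambda>w. exp (a * w\<^sup>2)) has_fps_expansion (fps_exp a oo fps_X\<^sup>2)" for a :: complex
    using has_fps_expansion_compose[OF has_fps_expansion_exp[of a] sq] by (simp add: o_def)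
  have eC: "ee (of_int (int n) * ((w / (2 * of_real pi * \<i>))\<^sup>2 / t)) = exp (of_nat n * kappa t * w\<^sup>2)" for w
  proof -
    have "c * (of_int (int n) * ((w / c)\<^sup>2 / t)) = of_nat n * (1 / (c * t)) * w\<^sup>2" if "c \<noteq> 0" for c
      using that t0 by (simp add: power2_eq_square)
    from this[of "2 * of_real pi * \<i>"] have "2 * of_real pi * \<i> * (of_int (int n) * ((w / (2 * of_real pi * \<i>))\<^sup>2 / t)) = of_nat n * (1 / (2 * of_real pi * \<i> * t)) * w\<^sup>2" by fastforce
    then show ?thesis unfolding ee_def kappa_def by (rule arg_cong)
  qed
  have "((\<lambda>w. fj_coeff (int n) (- 1 / t) (w / (2 * of_real pi * \<i>))) \<circ> (\<lambda>w. 1 / t * w)) has_fps_expansion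
      (eval_q (ee (- 1 / t)) (moment_fps n) oo expm1_fps oo (fps_const (1 / t) * fps_X))"
    by (rule has_fps_expansion_compose[OF fj_coeff_expansion[OF Im_inversion[OF t]] l]) simp
  moreover have "(\<lambda>w. fj_coeff (int n) (- 1 / t) (w / (2 * of_real pi * \<i>))) \<circ> (\<lambda>w. 1 / t * w) =
     (\<lambda>w. t ^ k * (exp (of_nat n * kappa t * w\<^sup>2) * fj_coeff (int n) t (w / (2 * of_real pi * \<i>))))"
  proof
    fix w
    have "fj_coeff (int n) (- 1 / t) ((w / (2 * of_real pi * \<i>)) / t) = t ^ k * exp (of_nat n * kappa t * w\<^sup>2) * fj_coeff (int n) t (w / (2 * of_real pi * \<i>))"
      unfolding fj_coeff_inversion[OF t] eC ..
    moreover have "(1 / t * w) / (2 * of_real pi * \<i>) = (w / (2 * of_real pi * \<i>)) / t" by simp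
    ultimately show "((\<lambda>w. fj_coeff (int n) (- 1 / t) (w / (2 * of_real pi * \<i>))) \<circ> (\<lambda>w. 1 / t * w)) w =
      t ^ k * (exp (of_nat n * kappa t * w\<^sup>2) * fj_coeff (int n) t (w / (2 * of_real pi * \<i>)))"
      unfolding o_def by (simp only: mult.assoc)
  qed
  ultimately have x1: "(\<lambda>w. t ^ k * (exp (of_nat n * kappa t * w\<^sup>2) * fj_coeff (int n) t (w / (2 * of_real pi * \<i>)))) has_fps_expansion
      (eval_q (ee (- 1 / t)) (moment_fps n) oo expm1_fps oo (fps_const (1 / t) * fps_X))" by simp
  have x2: "(\<lambda>w. t ^ k * (exp (of_nat n * kappa t * w\<^sup>2) * fj_coeff (int n) t (w / (2 * of_real pi * \<i>)))) has_fps_expansion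
      (fps_const (t ^ k) * ((fps_exp (of_nat n * kappa t) oo fps_X\<^sup>2) * (eval_q (ee t) (moment_fps n) oo expm1_fps)))"
    by (intro has_fps_expansion_cmult_left has_fps_expansion_mult E fj_coeff_expansion t)
  from fps_expansion_unique_complex[OF x1 x2]
  show "eval_q (ee (- 1 / t)) (moment_fps n) oo expm1_fps oo (fps_const (1 / t) * fps_X) =
     fps_const (t powi int k) * ((fps_exp (of_nat n * kappa t) oo fps_X\<^sup>2) * (eval_q (ee t) (moment_fps n) oo expm1_fps))"
    by simp
qed

end

section \<open>Odd weight\<close>

context prime_ideal
begin

text \<open>The matrix of the (i choose v) is unitriangular, so descending induction on i needs no
  division.\<close>

lemma binomial_sums_ideal:
  assumes y: "\<And>i. i \<le> L \<Longrightarrow> y i \<in> R" and s: "\<And>v. v \<le> L \<Longrightarrow> (\<Sum>i\<le>L. y i * of_nat (i choose v)) \<in> I"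
  shows "i \<le> L \<Longrightarrow> y i \<in> I"
proof (induction "L - i" arbitrary: i rule: less_induct)
  case less
  have "(\<Sum>j\<in>{..L} - {i}. y j * of_nat (j choose i)) \<in> I"
  proof (rule Isum)
    fix j assume j: "j \<in> {..L} - {i}"
    show "y j * of_nat (j choose i) \<in> I"
    proof (cases "j < i")
      case True then show ?thesis by (simp add: binomial_eq_0 I0)
    next
      case False
      then have "y j \<in> I" using less j by auto
      then show ?thesis using Imult[OF subring_of_nat[OF R]] by (simp add: mult.commute)
    qed
  qed
  moreover have "(\<Sum>j\<le>L. y j * of_nat (j choose i)) = y i + (\<Sum>j\<in>{..L} - {i}. y j * of_nat (j choose i))"
    using less.prems by (subst sum.remove[of _ i]) auto
  ultimately show ?case using Idiff[OF s[OF less.prems]] by fastforce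
qed

text \<open>Vandermonde's convolution writes (i choose v) through the (i - b choose j) with integer
  coefficients independent of i, which reduces to the unshifted case.\<close>

lemma shifted_binomial_sums_ideal:
  fixes b :: nat
  assumes y: "\<And>i. i \<le> L \<Longrightarrow> y i \<in> R" and s: "\<And>v. v \<le> L \<Longrightarrow> (\<Sum>i\<le>L. y i * (of_int (int i - int b) gchoose v)) \<in> I"
  shows "i \<le> L \<Longrightarrow> y i \<in> I"
proof (rule binomial_sums_ideal[of L y])
  fix v assume v: "v \<le> L"
  have V: "of_nat (i choose v) = (\<Sum>j=0..v. ((of_int (int i - int b) :: complex) gchoose j) * of_nat (b choose (v - j)))" for i
  proof -
    have "fps_binomial (of_nat i :: complex) $ v = (fps_binomial (of_int (int i - int b)) * fps_binomial (of_nat b)) $ v"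
      unfolding fps_binomial_add_mult[symmetric] by simp
    then show ?thesis by (simp add: fps_mult_nth binomial_gbinomial)
  qed
  have "(\<Sum>i\<le>L. y i * of_nat (i choose v)) = (\<Sum>j=0..v. of_nat (b choose (v - j)) * (\<Sum>i\<le>L. y i * (of_int (int i - int b) gchoose j)))"
    unfolding V sum_distrib_left by (subst sum.swap) (simp add: mult_ac)
  also have "\<dots> \<in> I" by (intro Isum Imult subring_of_nat R s) (use v in auto)
  finally show "(\<Sum>i\<le>L. y i * of_nat (i choose v)) \<in> I" .
qed (use y in auto)

end

text \<open>The condition p >= 5 enters through 1/4 and 1/9, which make the leading coefficients of
  the pivots invertible.\<close>

locale odd_siegel_form = siegel_form k F + prime_ideal R I
  for k F R I +
  assumes odd_k: "odd k" and c3R: "c3 m r n \<in> R" and quarter: "1 / 4 \<in> R" and ninth: "1 / 9 \<in> R"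
begin

lemma c3_anti: "c3 n r m = - c3 m r n" using c3_swap[of n r m] odd_k by simp
lemma c3_anti_r: "c3 m (- r) n = - c3 m r n" using c3_neg[of m r n] odd_k by simp
lemma c3_middle_0: "c3 m 0 n = 0" using c3_anti_r[of m 0 n] by simp
lemma c3_diag: "c3 m r m = 0" using c3_anti[of m r m] by simp

lemma moment_anti: "moment v n m = - moment v m n"
proof -
  have r: "4 * int n * int m = 4 * int m * int n" by simp
  show ?thesis unfolding moment_def r sum_negf[symmetric] by (intro sum.cong refl) (simp add: c3_anti[of "int n"])
qed

lemma moment_diag: "moment v m m = 0" unfolding moment_def by (simp add: c3_diag)

lemma moment_ideal: "(\<And>r. c3 (int m) r (int n) \<in> I) \<Longrightarrow> moment v m n \<in> I"
  unfolding moment_def by (intro Isum) (simp add: mult.commute[of "c3 _ _ _"] Imult subring_gbinomial[OF R])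

text \<open>Squaring makes the weight and the order of vanishing even, as \<open>germ_leading_coefficient\<close> needs.\<close>

lemma row_sturm:
  assumes low: "\<And>i m. i < v \<Longrightarrow> moment i m n \<in> I" and v: "v \<le> 2 * n"
    and N: "k + v < 12 * N" and z: "\<And>m. m < N \<Longrightarrow> moment v m n \<in> I"
  shows "moment v m n \<in> I"
proof -
  let ?G = "moment_fps n"
  define a where "a = ?G $ v"
  have GR: "?G $ j \<in> disc_series R" for j using moment_fps_disc_series2[OF c3R R] by (simp add: disc_series2_def)
  have aR: "a $ i \<in> R" for i using disc_series_nth[OF GR] by (simp add: a_def)
  have Gl: "?G $ i \<in> ideal_series" if "i < v" for i using GR low[OF that] by (simp add: ideal_series_def)
  have J: "jacobi_germ R (int k + int k) (n + n) (?G * ?G)" by (intro jacobi_germ_mult moment_fps_jacobi_germ R c3R)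
  have l: "(?G * ?G) $ i \<in> ideal_series" if "i < 2 * v" for i
    by (rule ideal_mult_nth(1)[where I = ideal_series and R = "disc_series R" and \<alpha> = v and \<beta> = v])
       (use ideal_series_0 ideal_series_add ideal_series_mult GR Gl that in auto)
  have "(?G * ?G) $ (v + v) - ?G $ v * ?G $ v \<in> ideal_series"
    by (rule ideal_mult_nth(2)[where I = ideal_series and R = "disc_series R"]) (use ideal_series_0 ideal_series_add ideal_series_mult GR Gl in auto)
  then have l2: "(?G * ?G) $ (2 * v) - a * a \<in> ideal_series" by (simp add: a_def mult_2)
  \<comment> \<open>The square has index n + n, which explains the hypothesis v <= 2 n.\<close>
  have "even (int k + int k)" "v \<le> n + n" using v by auto
  from germ_leading_coefficient[OF J this l quarter ninth]
  obtain c where c: "modular_fps R (int k + int k + 2 * int v) c" "c - fps_const (9 ^ (n + n)) * (?G * ?G) $ (2 * v) \<in> ideal_series"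
    by blast
  define e where "e = (9 :: complex) ^ (n + n)"
  have eR: "e \<in> R" using subring_power[OF R subring_of_nat[OF R, of 9], of "n + n"] by (simp add: e_def)
  have ieR: "inverse e \<in> R" using subring_power[OF R ninth, of "n + n"] by (simp add: e_def power_one_over inverse_eq_divide)
  have "c - fps_const e * (a * a) \<in> ideal_series"
    using ideal_series_add[OF c(2) ideal_series_mult[OF disc_series_const[OF R eR] l2]] by (simp add: e_def algebra_simps)
  then have d: "c $ i - e * (a * a) $ i \<in> I" for i by (simp add: ideal_series_def)
  have theta_prod: "(a * a) $ i \<in> I" if "i < N + N" for i
    by (rule ideal_mult_nth(1)[where I = I and R = R and \<alpha> = N and \<beta> = N])
       (use I0 Iadd Imult aR z that in \<open>auto simp: a_def\<close>)
  have cI: "c $ i \<in> I" for i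
  \<comment> \<open>Squaring doubles both the weight k + v and the known order N, so the inequality
    for the square is the hypothesis k + v < 12 N doubled.\<close>
  proof (rule sturm_bound[of "2 * k + 2 * v" c "2 * N"])
    show "modular_fps R (int (2 * k + 2 * v)) c" using c(1) by simp
    show "2 * k + 2 * v < 12 * (2 * N)" using N by simp
    show "c $ i \<in> I" if "i < 2 * N" for i using Iadd[OF d[of i] Imult[OF eR theta_prod[of i]]] that by simp
  qed
  have "(a ^ 2) $ i \<in> I" for i
  proof -
    have "e * (a * a) $ i \<in> I" using Idiff[OF cI[of i] d[of i]] by simp
    moreover have "e \<noteq> 0" by (simp add: e_def)
    ultimately show ?thesis using Imult[OF ieR, of "e * (a * a) $ i"] by (simp add: power2_eq_square mult.assoc[symmetric])
  qed
  from fps_power_ideal[OF aR this] show ?thesis by (simp add: a_def)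
qed

lemma row_vanishes:
  assumes z: "\<And>i m. i + 1 < 2 * n \<Longrightarrow> moment i m n \<in> I"
  shows "c3 m r (int n) \<in> I"
proof -
  have "\<forall>r. c3 (int m) r (int n) \<in> I" for m
  proof (cases "n = 0")
    case True
    have "c3 (int m) r 0 = 0" for r
      using c3_support[of "int m" r 0] c3_middle_0[of "int m" 0] by (cases "r = 0") auto
    then show ?thesis using True I0 by simp
  next
    case False
    show ?thesis
    proof (induction m rule: less_induct)
      case (less m)
      have sh: "c3 (int m) r (int n) \<in> I" if "int m + r * l + int n * l\<^sup>2 < int m" for r l
      proof (cases "int m + r * l + int n * l\<^sup>2 < 0")
        case True then show ?thesis using c3_shear[of "int m" r l "int n"] c3_negative_m I0 by simp
      next
        case False
        then obtain m' where m': "int m + r * l + int n * l\<^sup>2 = int m'" by (metis nonneg_int_cases not_less)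
        then have "c3 (int m') (r + 2 * l * int n) (int n) \<in> I" using less.IH[of m'] that by simp
        then show ?thesis using c3_shear[of "int m" r l "int n"] m' by simp
      qed
      have out: "c3 (int m) r (int n) \<in> I" if r: "\<bar>r\<bar> \<ge> int n" for r
      proof -
        consider "r > int n" | "r < - int n" | "r = int n" | "r = - int n" using r by linarith
        then show ?thesis
        proof cases
          \<comment> \<open>The shear by -1 changes m by n - r < 0, so the induction hypothesis
            applies.\<close>
          case 1 then show ?thesis by (intro sh[of r "- 1"]) simp
        next
          case 2 then show ?thesis by (intro sh[of r 1]) simp
        next
          \<comment> \<open>A unit shear turns r = n into - n at the same m, so antisymmetry in r
            makes the coefficient its own negative.\<close>
          case 3
          then have "c3 (int m) r (int n) = 0"
            using c3_shear[of "int m" r "- 1" "int n"] c3_anti_r[of "int m" "int n" "int n"] by simp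
          then show ?thesis using I0 by simp
        next
          case 4
          then have "c3 (int m) r (int n) = 0"
            using c3_shear[of "int m" r "1" "int n"] c3_anti_r[of "int m" "int n" "int n"] by simp
          then show ?thesis using I0 by simp
        qed
      qed
      \<comment> \<open>The indices |r| < n are renumbered 0..L by adding n - 1; their number L + 1
        = 2 n - 1 is that of the moments assumed to vanish.\<close>
      define L where "L = 2 * (n - 1)"
      define y where "y i = c3 (int m) (int i - int (n - 1)) (int n)" for i
      have y: "y i \<in> I" if "i \<le> L" for i
      proof (rule shifted_binomial_sums_ideal[of L y "n - 1"])
        fix v assume v: "v \<le> L"
        define J where "J = {- int (n - 1)..int (n - 1)}"
        define U where "U = {- (4 * int m * int n)..4 * int m * int n} \<union> J"
        let ?t = "\<lambda>r. c3 (int m) r (int n) * (of_int r gchoose v)"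
        have "moment v m n = sum ?t U" unfolding moment_def
        proof (rule sum.mono_neutral_left)
          show "\<forall>r\<in>U - {- (4 * int m * int n)..4 * int m * int n}. ?t r = 0"
          proof
            fix r assume "r \<in> U - {- (4 * int m * int n)..4 * int m * int n}"
            then have "\<not> \<bar>r\<bar> \<le> 4 * int m * int n" by auto
            then show "?t r = 0" using c3_range by force
          qed
        qed (auto simp: U_def J_def)
        also have "\<dots> = sum ?t J + sum ?t (U - J)"
          using sum.subset_diff[of J U ?t] by (simp add: U_def J_def add.commute)
        finally have e: "sum ?t J = moment v m n - sum ?t (U - J)" by simp
        have "sum ?t (U - J) \<in> I"
        proof (rule Isum)
          fix r assume "r \<in> U - J"
          then have "\<bar>r\<bar> \<ge> int n" using False by (auto simp: J_def)
          then show "?t r \<in> I" using Imult[OF subring_gbinomial[OF R] out] by (simp add: mult.commute)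
        qed
        moreover have "moment v m n \<in> I" using v False by (intro z) (simp add: L_def)
        ultimately have "sum ?t J \<in> I" unfolding e by (intro Idiff)
        moreover have "sum ?t J = (\<Sum>i\<le>L. y i * (of_int (int i - int (n - 1)) gchoose v))"
          unfolding y_def
          by (rule sum.reindex_bij_witness[of _ "\<lambda>i. int i - int (n - 1)" "\<lambda>r. nat (r + int (n - 1))"])
             (auto simp: J_def L_def)
        ultimately show "(\<Sum>i\<le>L. y i * (of_int (int i - int (n - 1)) gchoose v)) \<in> I" by simp
      qed (use that c3R in \<open>auto simp: y_def\<close>)
      show ?case
      proof
        fix r
        show "c3 (int m) r (int n) \<in> I"
        proof (cases "\<bar>r\<bar> \<ge> int n")
          case True then show ?thesis by (rule out)
        next
          case False
          then have "int (nat (r + int (n - 1))) - int (n - 1) = r" "nat (r + int (n - 1)) \<le> L" using \<open>n \<noteq> 0\<close> by (auto simp: L_def)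
          then show ?thesis using y[of "nat (r + int (n - 1))"] by (simp add: y_def)
        qed
      qed
    qed
  qed
  then show ?thesis using I0 c3_negative_m[of m r "int n"] by (metis nonneg_int_cases not_less)
qed

text \<open>At stage v two squares of known entries are at hand: one of side c + 4 from the
  hypothesis, and one of side w + 2 with w = (v + 1) div 2. In the latter the rows and columns up to
  w are settled by \<open>row_vanishes\<close> and antisymmetry, and the corner (w + 1, w + 1) is
  diagonal. Sturm's bound asks for k + v < 12 times the side, and one of the squares always meets
  it.\<close>

theorem all_in_ideal:
  fixes c :: nat
  assumes kc: "k \<le> 10 * c + 43"
    and small: "\<And>m n r. m \<le> c + 3 \<Longrightarrow> n \<le> c + 3 \<Longrightarrow> c3 (int m) r (int n) \<in> I"
  shows "c3 m r n \<in> I"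
proof -
  have "\<forall>m n. moment v m n \<in> I" for v
  proof (induction v rule: less_induct)
    case (less v)
    have big: "moment v m n \<in> I" if "2 * n \<le> v + 1" for m n
      by (rule moment_ideal, rule row_vanishes) (use less that in auto)
    have anti: "moment v m n \<in> I" if "moment v n m \<in> I" for m n using Iuminus[OF that] moment_anti[of v m n] by simp
    have st: "moment v m n \<in> I" if "k + v < 12 * N" "\<And>m. m < N \<Longrightarrow> moment v m n \<in> I" for N m n
    proof (cases "v \<le> 2 * n")
      case True show ?thesis by (rule row_sturm[OF _ True that]) (use less in auto)
    next
      case False then show ?thesis by (intro big) simp
    qed
    \<comment> \<open>From a square of side N: Sturm along its rows, then antisymmetry, then Sturm
      along every row.\<close>
    have all: "moment v m n \<in> I" if N: "k + v < 12 * N" and r: "\<And>n m. n < N \<Longrightarrow> m < N \<Longrightarrow> moment v m n \<in> I" for N m n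
      by (rule st[OF N], rule anti, rule st[OF N]) (use r in auto)
    show ?case
    proof (cases "k + v < 12 * (c + 4)")
      case True
      have "moment v m n \<in> I" if "n < c + 4" "m < c + 4" for m n using that by (intro moment_ideal small) auto
      then show ?thesis using all[OF True] by blast
    next
      case False
      define w where "w = (v + 1) div 2"
      have w: "2 * w \<le> v + 1" unfolding w_def by simp
      have "v \<le> 2 * w" unfolding w_def by presburger
      \<comment> \<open>The failed inequality gives v >= 2 c + 5, hence w >= c + 3 and k + v <= 10 c
        + 43 + 2 w < 12 w + 24.\<close>
      then have "k + v < 12 * (w + 2)" using False kc by simp
      moreover have "moment v m n \<in> I" if mn: "n < w + 2" "m < w + 2" for m n
      proof -
        consider "n \<le> w" | "m \<le> w" | "m = n" using mn by linarith
        then show ?thesis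
        proof cases
          case 1 then show ?thesis using w by (intro big) simp
        next
          case 2 then show ?thesis using w by - (rule anti, rule big, simp)
        next
          case 3 then show ?thesis by (simp add: moment_diag I0)
        qed
      qed
      ultimately show ?thesis using all by blast
    qed
  qed
  then have "c3 m r (int n) \<in> I" for n by (intro row_vanishes) auto
  then show ?thesis using I0 c3_negative_n[of n m r] by (metis nonneg_int_cases not_less)
qed

end

section \<open>The \<open>p\<close>-integral rational numbers\<close>

lemma prime_ideal_p_integral:
  assumes p: "prime p"
  shows "prime_ideal (p_integral p) (p_ideal p)"
proof -
  have pp: "prime (int p)" using p by simp
  have prod: "\<not> int p dvd b * d" if "\<not> int p dvd b" "\<not> int p dvd d" for b d
    using that pp prime_dvd_mult_iff by blast
  have nz: "(of_int b :: complex) \<noteq> 0" if "\<not> int p dvd b" for b using that by auto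
  have p0: "(of_nat p :: complex) \<noteq> 0" using p by (simp add: prime_gt_0_nat)
  have p1: "\<not> int p dvd 1" using pp by (meson not_prime_unit)
  have int: "(of_int a :: complex) \<in> p_integral p" for a
    unfolding p_integral_def using p1 by (intro CollectI exI[of _ a] exI[of _ 1]) simp
  have sub: "is_subring (p_integral p)" unfolding is_subring_def
  proof (intro conjI ballI)
    show "1 \<in> p_integral p" using int[of 1] by simp
    fix x y assume "x \<in> p_integral p" "y \<in> p_integral p"
    then obtain a b c d where x: "x = of_int a / of_int b" "\<not> int p dvd b" and y: "y = of_int c / of_int d" "\<not> int p dvd d"
      by (auto simp: p_integral_def)
    have "x - y = of_int (a * d - c * b) / of_int (b * d)" unfolding x y using nz[OF x(2)] nz[OF y(2)] by (simp add: field_simps)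
    then show "x - y \<in> p_integral p" unfolding p_integral_def using prod[OF x(2) y(2)] by blast
    have "x * y = of_int (a * c) / of_int (b * d)" using x y by simp
    then show "x * y \<in> p_integral p" unfolding p_integral_def using prod[OF x(2) y(2)] by blast
  qed
  show ?thesis
  proof (unfold_locales)
    show "is_subring (p_integral p)" by (rule sub)
    show "p_ideal p \<subseteq> p_integral p" using subring_mult[OF sub subring_of_nat[OF sub]] by (auto simp: p_ideal_def)
    show "0 \<in> p_ideal p" unfolding p_ideal_def using subring_0[OF sub] by force
    show "1 \<notin> p_ideal p"
    proof
      assume "1 \<in> p_ideal p"
      then obtain a b where ab: "(1 :: complex) = of_nat p * (of_int a / of_int b)" "\<not> int p dvd b"
        by (auto simp: p_ideal_def p_integral_def)
      then have "(of_int b :: complex) = of_int (int p * a)" using nz[OF ab(2)] by (simp add: field_simps)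
      then have "b = int p * a" by (simp only: of_int_eq_iff)
      then show False using ab(2) by simp
    qed
    show "x + y \<in> p_ideal p" if "x \<in> p_ideal p" "y \<in> p_ideal p" for x y
      using that subring_add[OF sub] unfolding p_ideal_def by (auto simp flip: distrib_left)
    show "r * x \<in> p_ideal p" if "r \<in> p_integral p" "x \<in> p_ideal p" for r x
      using that subring_mult[OF sub] unfolding p_ideal_def by (auto simp: mult.left_commute[of r])
    fix x y assume xy: "x \<in> p_integral p" "y \<in> p_integral p" "x * y \<in> p_ideal p"
    then obtain a b c d e g where x: "x = of_int a / of_int b" "\<not> int p dvd b" and y: "y = of_int c / of_int d" "\<not> int p dvd d"
      and z: "x * y = of_nat p * (of_int e / of_int g)" "\<not> int p dvd g" by (auto simp: p_integral_def p_ideal_def)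
    have "(of_int (a * c * g) :: complex) = of_int (int p * (e * b * d))"
      using z(1) nz[OF x(2)] nz[OF y(2)] nz[OF z(2)] unfolding x(1) y(1) by (simp add: field_simps)
    then have "a * c * g = int p * (e * b * d)" by (simp only: of_int_eq_iff)
    then have "int p dvd a * c * g" by simp
    then have "int p dvd a \<or> int p dvd c" using z(2) pp by (auto simp: prime_dvd_mult_iff)
    moreover have "of_int h / of_int b \<in> p_ideal p" if h: "int p dvd h" and b: "\<not> int p dvd b" for h b
    proof -
      obtain j where "h = int p * j" using h by blast
      then have "of_int h / of_int b = (of_nat p :: complex) * (of_int j / of_int b)" by simp
      then show ?thesis unfolding p_ideal_def p_integral_def using b by blast
    qed
    ultimately show "x \<in> p_ideal p \<or> y \<in> p_ideal p" using x y by blast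
  qed
qed

lemma inverse_p_integral: "\<not> int p dvd b \<Longrightarrow> 1 / of_int b \<in> p_integral p"
  unfolding p_integral_def by (intro CollectI exI[of _ 1] exI[of _ b]) simp

section \<open>The \<open>p\<close>-minimum matrix\<close>

lemma mat_succ_half_int:
  "mat_succ (half_int m n r) (half_int m' n' r') \<longleftrightarrow>
     m + n > m' + n' \<or> m + n = m' + n' \<and> (m > m' \<or> m = m' \<and> r > r')"
proof -
  have t: "trace (half_int m n r) = of_int (m + n)" for m n r
    by (simp add: trace_def sum_2)
  show ?thesis unfolding mat_succ_def t half_int_nth of_int_less_iff of_int_eq_iff by auto
qed

text \<open>The order is well founded on \<open>L2\<close>: trace and m are natural numbers there,
  and r^2 <= 4 m n <= (m + n)^2 allows r to be shifted by the trace into the natural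
  numbers.\<close>

lemma min_matrix_exists:
  assumes "\<not> zero_mod p F"
  obtains T where "T \<in> L2" "min_matrix p F = Fin T"
    "\<And>T'. T' \<in> L2 \<Longrightarrow> fourier_coeff F T' \<notin> p_ideal p \<Longrightarrow> T' = T \<or> mat_succ T' T"
proof -
  define P where "P T \<longleftrightarrow> T \<in> L2 \<and> fourier_coeff F T \<notin> p_ideal p" for T
  define g where "g = (\<lambda>(m, n, r). (nat (m + n), nat m, nat (r + m + n)))"
  define S where "S = {(m, n, r). P (half_int m n r)}"
  obtain T0 where "P T0" using assms unfolding zero_mod_def P_def by blast
  moreover from this have "T0 \<in> L2" by (simp add: P_def)
  then obtain m0 n0 r0 where "T0 = half_int m0 n0 r0" by (rule L2_half_int)
  ultimately have "(m0, n0, r0) \<in> S" by (simp add: S_def)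
  then have "\<exists>x. x \<in> S" by blast
  moreover have "wf (inv_image (less_than <*lex*> (less_than <*lex*> less_than)) g)" by (intro wf_inv_image wf_lex_prod wf_less_than)
  ultimately obtain x where x: "x \<in> S"
    "\<And>y. (y, x) \<in> inv_image (less_than <*lex*> (less_than <*lex*> less_than)) g \<Longrightarrow> y \<notin> S"
    unfolding wf_eq_minimal by meson
  obtain m n r where mnr: "x = (m, n, r)" by (cases x)
  define T where "T = half_int m n r"
  have bound: "0 \<le> m' \<and> 0 \<le> n' \<and> 0 \<le> r' + m' + n'" if "P (half_int m' n' r')" for m' n' r'
  proof -
    have h: "0 \<le> m'" "0 \<le> n'" "r'\<^sup>2 \<le> 4 * m' * n'" using that by (auto simp: P_def half_int_in_L2)
    have "4 * m' * n' \<le> (m' + n')\<^sup>2" using zero_le_power2[of "m' - n'"] by (simp add: power2_eq_square algebra_simps)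
    then have "\<bar>r'\<bar> \<le> \<bar>m' + n'\<bar>" unfolding abs_le_square_iff using h(3) by linarith
    then show ?thesis using h by linarith
  qed
  have PT: "P T" using x(1) by (simp add: mnr S_def T_def)
  have min: "T' = T \<or> mat_succ T' T" if "P T'" for T'
  proof -
    have "T' \<in> L2" using that by (simp add: P_def)
    then obtain m' n' r' where T': "T' = half_int m' n' r'" by (rule L2_half_int)
    have "(m', n', r') \<in> S" using that by (simp add: S_def T')
    then have "((m', n', r'), x) \<notin> inv_image (less_than <*lex*> (less_than <*lex*> less_than)) g" using x(2) by blast
    moreover have "0 \<le> m' \<and> 0 \<le> n' \<and> 0 \<le> r' + m' + n'" "0 \<le> m \<and> 0 \<le> n \<and> 0 \<le> r + m + n"
      using bound that PT by (auto simp: T' T_def)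
    ultimately have "(m', n', r') = (m, n, r) \<or> mat_succ T' T"
      unfolding T' T_def mat_succ_half_int mnr g_def by auto
    then show ?thesis by (auto simp: T' T_def)
  qed
  have "min_matrix p F = Fin T"
  proof -
    have "(THE T. T \<in> L2 \<and> fourier_coeff F T \<notin> p_ideal p \<and>
        (\<forall>T' \<in> L2. fourier_coeff F T' \<notin> p_ideal p \<longrightarrow> T' = T \<or> mat_succ T' T)) = T"
    proof (rule the_equality)
      fix T1 assume T1: "T1 \<in> L2 \<and> fourier_coeff F T1 \<notin> p_ideal p \<and>
        (\<forall>T' \<in> L2. fourier_coeff F T' \<notin> p_ideal p \<longrightarrow> T' = T1 \<or> mat_succ T' T1)"
      then have "T = T1 \<or> mat_succ T T1" "T1 = T \<or> mat_succ T1 T" using PT min by (auto simp: P_def)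
      then show "T1 = T" by (auto simp: mat_succ_def)
    qed (use PT min in \<open>auto simp: P_def\<close>)
    then show ?thesis using assms by (simp add: min_matrix_def)
  qed
  then show ?thesis using that[of T] PT min unfolding P_def by blast
qed

text \<open>Among the pairs m, n <= c + 3 with m and n distinct, only (c + 2, c + 3) and its swap
  reach trace 2 c + 5. All smaller traces are covered by the hypothesis, and at trace 2 c + 5 the
  negative r at (c + 2, c + 3) suffice by antisymmetry.\<close>

theorem proposition2p6:
  fixes p k :: nat and F :: "complex ^ 2 ^ 2 \<Rightarrow> complex" and c r0 :: int
  assumes "prime p" and "p \<ge> 5" and "odd k"
    and "F \<in> siegel_modular_forms_over k (p_integral p)"
    and "c = \<lfloor>(real k - 35) / 10\<rfloor>"
    and "half_int c c r0 \<in> L2" and "\<And>r. half_int c c r \<in> L2 \<Longrightarrow> r \<le> r0"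
    and "ext_succ (min_matrix p F) (Fin (half_int (c + 2) (c + 3) (r0 - 1)))"
  shows "min_matrix p F = Infty \<and> zero_mod p F"
proof -
  have Fk: "F \<in> siegel_modular_forms k" and coef: "\<And>T. T \<in> L2 \<Longrightarrow> fourier_coeff F T \<in> p_integral p"
    using assms(4) by (auto simp: siegel_modular_forms_over_def)
  interpret S: siegel_form k F by unfold_locales (rule Fk)
  interpret P: prime_ideal "p_integral p" "p_ideal p" by (rule prime_ideal_p_integral[OF assms(1)])
  have pp: "prime (int p)" using assms(1) by simp
  interpret odd_siegel_form k F "p_integral p" "p_ideal p"
  proof unfold_locales
    show "odd k" by (rule assms(3))
    fix m r n
    show "S.c3 m r n \<in> p_integral p"
    proof (cases "half_int m n r \<in> L2")
      case True then show ?thesis using coef[OF True] by (simp add: S.fourier_coeff_half_int)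
    next
      case False
      then have "S.c3 m r n = 0" using S.c3_support[of m r n] by (auto simp: half_int_in_L2)
      then show ?thesis using subring_0[OF P.R] by simp
    qed
  next
    have "\<not> int p dvd 4" using assms(2) by (auto dest: zdvd_imp_le)
    then show "1 / 4 \<in> p_integral p" using inverse_p_integral[of p 4] by simp
    have "\<not> int p dvd 3" using assms(2) by (auto dest: zdvd_imp_le)
    then have "\<not> int p dvd 9" using prime_dvd_mult_iff[OF pp, of 3 3] by simp
    then show "1 / 9 \<in> p_integral p" using inverse_p_integral[of p 9] by simp
  qed
  have "zero_mod p F"
  proof (rule ccontr)
    assume nz: "\<not> zero_mod p F"
    then obtain T where T: "T \<in> L2" "min_matrix p F = Fin T"
      "\<And>T'. T' \<in> L2 \<Longrightarrow> fourier_coeff F T' \<notin> p_ideal p \<Longrightarrow> T' = T \<or> mat_succ T' T"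
      by (rule min_matrix_exists) blast
    \<comment> \<open>Membership of \<open>half_int c c r0\<close> in \<open>L2\<close> forces c >=
      0, so weights below 35 do not occur.\<close>
    have c0: "0 \<le> c" using assms(6) by (simp add: half_int_in_L2)
    have r0: "0 \<le> r0" using assms(7)[of 0] c0 by (simp add: half_int_in_L2)
    \<comment> \<open>Of r > r0 - 1 only r >= 0 is kept; applied to r and to - r it will force r =
      0.\<close>
    have ge: "m + n > 2 * c + 5 \<or> m + n = 2 * c + 5 \<and> (m > c + 2 \<or> m = c + 2 \<and> r \<ge> 0)"
      if "S.c3 m r n \<notin> p_ideal p" for m r n
    proof -
      have "S.c3 m r n \<noteq> 0" using that P.I0 by metis
      then have "half_int m n r \<in> L2" using S.c3_support[of m r n] by (simp add: half_int_in_L2)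
      then have "half_int m n r = T \<or> mat_succ (half_int m n r) T" using T(3) that by (simp add: S.fourier_coeff_half_int)
      moreover have "mat_succ T (half_int (c + 2) (c + 3) (r0 - 1))" using assms(8) by (simp add: T(2))
      ultimately have "mat_succ (half_int m n r) (half_int (c + 2) (c + 3) (r0 - 1))" by (auto simp: mat_succ_def)
      then show ?thesis using r0 unfolding mat_succ_half_int by linarith
    qed
    have small: "S.c3 (int m) r (int n) \<in> p_ideal p" if mn: "m \<le> nat c + 3" "n \<le> nat c + 3" for m n r
    proof (rule ccontr)
      assume a1: "S.c3 (int m) r (int n) \<notin> p_ideal p"
      then have a2: "S.c3 (int m) (- r) (int n) \<notin> p_ideal p" "S.c3 (int n) r (int m) \<notin> p_ideal p" "S.c3 (int n) (- r) (int m) \<notin> p_ideal p"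
        using P.Iuminus unfolding c3_anti_r c3_anti[of "int n"] by force+
      have "int m \<noteq> int n" "r \<noteq> 0" using a1 P.I0 by (auto simp: c3_diag c3_middle_0)
      moreover have "int m \<le> c + 3" "int n \<le> c + 3" "2 * c + 5 \<le> int m + int n" using mn c0 ge[OF a1] by auto
      ultimately consider "int m = c + 2" "int n = c + 3" | "int m = c + 3" "int n = c + 2"
        by linarith
      then show False
      proof cases
        case 1 then show False using ge[OF a1] ge[OF a2(1)] \<open>r \<noteq> 0\<close> by simp
      next
        case 2 then show False using ge[OF a2(2)] ge[OF a2(3)] \<open>r \<noteq> 0\<close> by simp
      qed
    qed
    have "k \<le> 10 * nat c + 43"
    proof -
      have "(real k - 35) / 10 < of_int c + 1" unfolding assms(5) by linarith
      then have "real k < real_of_int (10 * c + 45)" by simp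
      then have "int k < 10 * c + 45" by linarith
      \<comment> \<open>The floor gives k <= 10 c + 44, and parity improves this to 43.\<close>
      then show ?thesis using assms(3) c0 by presburger
    qed
    from all_in_ideal[OF this small] have "S.c3 m r n \<in> p_ideal p" for m r n by blast
    then have "fourier_coeff F T' \<in> p_ideal p" if "T' \<in> L2" for T'
      using L2_half_int[OF that] S.fourier_coeff_half_int by metis
    then show False using nz by (simp add: zero_mod_def)
  qed
  then show ?thesis by (simp add: min_matrix_def)
qed

end
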